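(* Let $G$ be either $\mathrm{SU}(2)\times\mathrm{U}(1)^4$ or $\mathrm{SU}(2)\times\mathrm{SU}(2)\times\mathrm{U}(1)$, with left-invariant coframe $(e^1,\dots,e^7)$ satisfying $$de^4=e^{56},\quad de^5=-e^{46},\quad de^6=e^{45},\quad de^7=0,$$ and $de^1=de^2=de^3=0$ if $G=\mathrm{SU}(2)\times\mathrm{U}(1)^4$, respectively $de^1=e^{23}$, $de^2=-e^{13}$, $de^3=e^{12}$ if $G=\mathrm{SU}(2)\times\mathrm{SU}(2)\times\mathrm{U}(1)$. Fix the orientation $e^{1234567}$ and let $$\psi_0=e^{4567}+e^{2345}+e^{2367}-e^{1346}+e^{1357}-e^{1247}-e^{1256}.$$ Then the left-invariant solution to the Laplacian coflow $\frac{\partial}{\partial t}\psi(t)=\Delta_{\psi(t)}\psi(t)$, $\psi(0)=\psi_0$, is $$\psi(t)=e^{4567}+a(t)\left(e^{2345}+e^{2367}-e^{1346}+e^{1357}-e^{1247}-e^{1256}\right),$$ where $a(t)=\exp(t)$, $t\in\mathbb{R}$, if $G=\mathrm{SU}(2)\times\mathrm{U}(1)^4$, and $a(t)=2\exp(t)-1$, $t>-\log2$, if $G=\mathrm{SU}(2)\times\mathrm{SU}(2)\times\mathrm{U}(1)$. In particular the solution exists for all positive times. For every such $t$, $\psi(t)$ defines a strong $\mathrm{G}_2T$-structure $\varphi(t)=\star_t\psi(t)$, and $G$ splits as a Riemannian product $Y^3\times X^4$ with respect to the induced metric, where $Y^3$ (tangent to the directions dual to $e^1,e^2,e^3$) is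 the $3$-torus $\mathrm{U}(1)^3$ in the first case and the $3$-sphere $\mathrm{SU}(2)$ in the second case, and $X^4=\mathrm{SU}(2)\times\mathrm{U}(1)$ (tangent to the directions dual to $e^4,\dots,e^7$). Moreover, $Y^3$ is calibrated by $\varphi(t)$ (it is associative) and its volume increases along the flow, while $X^4$ is calibrated by $\psi(t)$ (it is coassociative) and its volume is constant along the flow.
   Context: Write $e^{ij\cdots}=e^i\wedge e^j\wedge\cdots$. A $\mathrm{G}_2$-structure on a $7$-manifold is a definite $3$-form $\varphi$: at each point there is a coframe $(f^1,\dots,f^7)$ with $\varphi=f^{123}+f^1\wedge(f^{45}+f^{67})+f^2\wedge(f^{46}-f^{57})-f^3\wedge(f^{47}+f^{56})$. It induces the metric $g_\varphi$ for which this coframe is orthonormal, an orientation $f^{1234567}$, and a Hodge operator $\star$. The $4$-forms $\star\varphi$ arising this way are called definite; a definite $4$-form $\psi$ together with a fixed orientation determines a metric $g_\psi$, a Hodge operator, and the $\mathrm{G}_2$-structure $\varphi=\star\psi$ with $\star\varphi=\psi$. $\Delta_\psi=d\delta+\delta d$ is the Hodge Laplacian of $g_\psi$, so $\Delta_{\psi}\psi=d\star d\star\psi-\star d\star d\psi$; $\star_t$ is the Hodge operator of $g_{\psi(t)}$ and the fixed orientation. $\varphi$ is a $\mathrm{G}_2T$-structure if $d\star\varphi=\theta\wedge\star\varphi$ for a $1$-form $\theta$. Its torsion $3$-form is $T=\frac16\star(d\varphi\wedge\varphi)\varphi-\star d\varphi+\star(\theta\wedge\varphi)$, and $\varphi$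 is strong if $dT=0$. An oriented submanifold is calibrated by a form $\alpha$ if $\alpha$ restricts to its Riemannian volume form.
   Formalization: The splitting, calibration and volume claims assume the factors Y and X of G are tangent to the directions dual to e^1,e^2,e^3 and to e^4,...,e^7; for U(1)^4 a coframe with irrational directions satisfies the structure equations but has no tangent 3-torus. *)

theory Defs
  imports "HOL-Analysis.Analysis" "HOL-Algebra.Group"
begin

section \<open>Alternating forms on a vector space\<close>

text \<open>A \<open>k\<close>-form on a subspace \<open>V\<close> is a function on lists of vectors; only its values on
  \<open>tuples V k\<close> are meaningful.\<close>

type_synonym 'a aform = "'a list \<Rightarrow> real"

definition tuples :: "'a set \<Rightarrow> nat \<Rightarrow> 'a list set" where
  "tuples V k = {vs. set vs \<subseteq> V \<and> length vs = k}"

definition alternating_on :: "'a::real_vector set \<Rightarrow> nat \<Rightarrow> 'a aform \<Rightarrow> bool" where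
  "alternating_on V k \<omega> \<longleftrightarrow>
     (\<forall>vs\<in>tuples V k. \<forall>i<k. \<forall>u\<in>V. \<forall>w\<in>V. \<forall>a b.
        \<omega> (vs[i := a *\<^sub>R u + b *\<^sub>R w]) = a * \<omega> (vs[i := u]) + b * \<omega> (vs[i := w])) \<and>
     (\<forall>vs\<in>tuples V k. \<forall>i<k. \<forall>j<k. i \<noteq> j \<and> vs ! i = vs ! j \<longrightarrow> \<omega> vs = 0)"

text \<open>The wedge product of a \<open>k\<close>-form with another form, as a sum over shuffles; thus
  \<open>(\<alpha> \<and> \<beta>)(u, v) = \<alpha>(u) \<beta>(v) - \<alpha>(v) \<beta>(u)\<close> for \<open>1\<close>-forms.\<close>

definition wedge :: "nat \<Rightarrow> 'a aform \<Rightarrow> 'a aform \<Rightarrow> 'a aform" where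
  "wedge k \<alpha> \<beta> vs =
     (\<Sum>I | I \<subseteq> {..<length vs} \<and> card I = k.
        (-1) ^ card {(i, j). i \<in> I \<and> j \<in> {..<length vs} - I \<and> j < i} *
        \<alpha> (nths vs I) * \<beta> (nths vs (- I)))"

text \<open>\<open>coframe_wedge f [i, j, \<dots>]\<close> is \<open>f\<^sup>i \<and> f\<^sup>j \<and> \<dots>\<close>.\<close>

fun coframe_wedge :: "(nat \<Rightarrow> 'a aform) \<Rightarrow> nat list \<Rightarrow> 'a aform" where
  "coframe_wedge f [] = (\<lambda>vs. 1)"
| "coframe_wedge f (i # is) = wedge 1 (f i) (coframe_wedge f is)"

text \<open>Coframes \<open>(f\<^sup>1, \<dots>, f\<^sup>7)\<close>: bases of the dual space of \<open>V\<close>.\<close>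

definition coframe :: "'a::real_vector set \<Rightarrow> (nat \<Rightarrow> 'a aform) \<Rightarrow> bool" where
  "coframe V f \<longleftrightarrow>
     (\<forall>i\<in>{1..7}. alternating_on V 1 (f i)) \<and>
     (\<forall>c. \<exists>!v. v \<in> V \<and> (\<forall>i\<in>{1..7}. f i [v] = c i))"

definition dual_frame :: "'a::real_vector set \<Rightarrow> (nat \<Rightarrow> 'a aform) \<Rightarrow> nat \<Rightarrow> 'a" where
  "dual_frame V f j = (THE v. v \<in> V \<and> (\<forall>i\<in>{1..7}. f i [v] = (if i = j then 1 else 0)))"

definition coframe_metric :: "(nat \<Rightarrow> 'a aform) \<Rightarrow> 'a \<Rightarrow> 'a \<Rightarrow> real" where
  "coframe_metric f v w = (\<Sum>i\<in>{1..7}. f i [v] * f i [w])"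

text \<open>The Hodge operator on \<open>k\<close>-forms of the metric and orientation for which \<open>f\<close> is an oriented
  orthonormal coframe, normalised by \<open>\<alpha> \<and> \<star>\<beta> = g(\<alpha>, \<beta>) f\<^sup>1\<^sup>2\<^sup>3\<^sup>4\<^sup>5\<^sup>6\<^sup>7\<close>.\<close>

definition coframe_hodge ::
    "'a::real_vector set \<Rightarrow> (nat \<Rightarrow> 'a aform) \<Rightarrow> nat \<Rightarrow> 'a aform \<Rightarrow> 'a aform" where
  "coframe_hodge V f k \<omega> vs =
     (\<Sum>I | I \<subseteq> {1..7} \<and> card I = k.
        let b = map (dual_frame V f) (sorted_list_of_set I)
        in \<omega> b * coframe_wedge f [1,2,3,4,5,6,7] (b @ vs))"

section \<open>Definite forms\<close>

definition standard_phi :: "(nat \<Rightarrow> 'a aform) \<Rightarrow> 'a aform" where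
  "standard_phi f vs =
     coframe_wedge f [1,2,3] vs + coframe_wedge f [1,4,5] vs + coframe_wedge f [1,6,7] vs
     + coframe_wedge f [2,4,6] vs - coframe_wedge f [2,5,7] vs
     - coframe_wedge f [3,4,7] vs - coframe_wedge f [3,5,6] vs"

definition adapted_phi :: "'a::real_vector set \<Rightarrow> 'a aform \<Rightarrow> (nat \<Rightarrow> 'a aform) \<Rightarrow> bool" where
  "adapted_phi V \<phi> f \<longleftrightarrow> coframe V f \<and> (\<forall>vs\<in>tuples V 3. \<phi> vs = standard_phi f vs)"

text \<open>For \<open>4\<close>-forms the orientation is given by a volume form \<open>vol\<close>. Asking \<open>f\<close> to be positively
  oriented is no restriction on \<open>\<psi>\<close>, since \<open>-f\<close> gives the same \<open>4\<close>-form and the opposite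
  orientation.\<close>

definition adapted_psi ::
    "'a::real_vector set \<Rightarrow> 'a aform \<Rightarrow> 'a aform \<Rightarrow> (nat \<Rightarrow> 'a aform) \<Rightarrow> bool" where
  "adapted_psi V vol \<psi> f \<longleftrightarrow>
     coframe V f \<and> vol (map (dual_frame V f) [1,2,3,4,5,6,7]) > 0 \<and>
     (\<forall>vs\<in>tuples V 4. \<psi> vs = coframe_hodge V f 3 (standard_phi f) vs)"

text \<open>Metric and Hodge operator do not depend on the adapted coframe that is chosen, because two
  such coframes differ by an element of \<open>G\<^sub>2 \<subseteq> SO(7)\<close>.\<close>

definition phi_hodge :: "'a::real_vector set \<Rightarrow> 'a aform \<Rightarrow> nat \<Rightarrow> 'a aform \<Rightarrow> 'a aform" where
  "phi_hodge V \<phi> = coframe_hodge V (SOME f. adapted_phi V \<phi> f)"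

definition psi_hodge ::
    "'a::real_vector set \<Rightarrow> 'a aform \<Rightarrow> 'a aform \<Rightarrow> nat \<Rightarrow> 'a aform \<Rightarrow> 'a aform" where
  "psi_hodge V vol \<psi> = coframe_hodge V (SOME f. adapted_psi V vol \<psi> f)"

definition psi_metric ::
    "'a::real_vector set \<Rightarrow> 'a aform \<Rightarrow> 'a aform \<Rightarrow> 'a \<Rightarrow> 'a \<Rightarrow> real" where
  "psi_metric V vol \<psi> = coframe_metric (SOME f. adapted_psi V vol \<psi> f)"

section \<open>Submanifolds\<close>

definition tangent_space :: "'a::real_normed_vector set \<Rightarrow> 'a \<Rightarrow> 'a set" where
  "tangent_space S p =
     {v. \<exists>c::real \<Rightarrow> 'a. (\<forall>s. c s \<in> S) \<and> c 0 = p \<and> (c has_vector_derivative v) (at 0)}"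

definition directional_derivative ::
    "'a::real_normed_vector set \<Rightarrow> ('a \<Rightarrow> real) \<Rightarrow> 'a \<Rightarrow> 'a \<Rightarrow> real" where
  "directional_derivative S h p v =
     (THE D. \<forall>c::real \<Rightarrow> 'a.
        (\<forall>s. c s \<in> S) \<and> c 0 = p \<and> (c has_vector_derivative v) (at 0) \<longrightarrow>
        ((\<lambda>s. h (c s)) has_real_derivative D) (at 0))"

type_synonym 'a form = "'a \<Rightarrow> 'a aform"

definition is_form :: "'a::real_normed_vector set \<Rightarrow> nat \<Rightarrow> 'a form \<Rightarrow> bool" where
  "is_form S k \<omega> \<longleftrightarrow> (\<forall>p\<in>S. alternating_on (tangent_space S p) k (\<omega> p))"

definition form_eq :: "'a::real_normed_vector set \<Rightarrow> nat \<Rightarrow> 'a form \<Rightarrow> 'a form \<Rightarrow> bool" where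
  "form_eq S k \<alpha> \<beta> \<longleftrightarrow> (\<forall>p\<in>S. \<forall>vs\<in>tuples (tangent_space S p) k. \<alpha> p vs = \<beta> p vs)"

definition orthonormal_list :: "('a \<Rightarrow> 'a \<Rightarrow> real) \<Rightarrow> 'a list \<Rightarrow> bool" where
  "orthonormal_list h vs \<longleftrightarrow>
     (\<forall>i<length vs. \<forall>j<length vs. h (vs ! i) (vs ! j) = (if i = j then 1 else 0))"

text \<open>\<open>\<alpha>\<close> restricts on the \<open>k\<close>-dimensional submanifold \<open>S\<close>, oriented by the \<open>k\<close>-form \<open>vol\<close>, to
  the volume form of the metric \<open>g\<close>, i.e. to the \<open>k\<close>-form with value \<open>1\<close> on positively oriented
  orthonormal bases.\<close>

definition calibrated ::
    "nat \<Rightarrow> 'a::real_normed_vector set \<Rightarrow> 'a form \<Rightarrow> ('a \<Rightarrow> 'a \<Rightarrow> 'a \<Rightarrow> real) \<Rightarrow> 'a form \<Rightarrow> bool" where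
  "calibrated k S vol g \<alpha> \<longleftrightarrow>
     is_form S k \<alpha> \<and>
     (\<forall>p\<in>S. dim (tangent_space S p) = k \<and>
        (\<forall>vs\<in>tuples (tangent_space S p) k. orthonormal_list (g p) vs \<longrightarrow>
           vol p vs \<noteq> 0 \<and> \<alpha> p vs = sgn (vol p vs)))"

text \<open>\<open>V\<close> is the \<open>CARD('k)\<close>-dimensional Riemannian volume of \<open>S\<close>, computed in a \<open>C\<^sup>1\<close>
  parametrisation \<open>F : U \<rightarrow> S\<close> that is onto and injective off a null set (\<open>V\<close> is independent of
  \<open>F\<close> by the area formula).\<close>

definition has_riemannian_volume ::
    "'k::finite itself \<Rightarrow> 'a::real_normed_vector set \<Rightarrow> ('a \<Rightarrow> 'a \<Rightarrow> 'a \<Rightarrow> real) \<Rightarrow> real \<Rightarrow> bool" where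
  "has_riemannian_volume k S g V \<longleftrightarrow>
     (\<exists>(F::real^'k \<Rightarrow> 'a) F' W U N.
        open W \<and> U \<subseteq> W \<and> U \<in> sets lebesgue \<and>
        (\<forall>u\<in>W. (F has_derivative F' u) (at u)) \<and> (\<forall>h. continuous_on W (\<lambda>u. F' u h)) \<and>
        F ` U = S \<and> negligible N \<and> inj_on F (U - N) \<and>
        ((\<lambda>u. sqrt (det (\<chi> i j. g (F u) (F' u (axis i 1)) (F' u (axis j 1)))))
           has_integral V) U)"

section \<open>Forms on linear Lie groups\<close>

text \<open>A linear Lie group is a group whose carrier is a submanifold of an algebra \<open>'a\<close> and whose
  multiplication is the restriction of the (bilinear) multiplication of \<open>'a\<close>. Left translation by
  \<open>p\<close> then has differential \<open>v \<mapsto> p \<otimes> v\<close>, and the bracket of the left-invariant fields with values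
  \<open>x\<close>, \<open>y\<close> at the identity is \<open>x \<otimes> y - y \<otimes> x\<close>.\<close>

abbreviation tangent :: "'a::real_normed_vector monoid \<Rightarrow> 'a \<Rightarrow> 'a set" where
  "tangent G p \<equiv> tangent_space (carrier G) p"

definition bracket :: "'a::real_normed_vector monoid \<Rightarrow> 'a \<Rightarrow> 'a \<Rightarrow> 'a" where
  "bracket G x y = x \<otimes>\<^bsub>G\<^esub> y - y \<otimes>\<^bsub>G\<^esub> x"

text \<open>The invariant formula for the exterior derivative of a \<open>k\<close>-form, evaluated on the
  left-invariant extensions of the tangent vectors \<open>vs\<close>.\<close>

definition ext_deriv :: "'a::real_normed_vector monoid \<Rightarrow> nat \<Rightarrow> 'a form \<Rightarrow> 'a form" where
  "ext_deriv G k \<omega> p vs =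
     (let xs = map (\<lambda>v. inv\<^bsub>G\<^esub> p \<otimes>\<^bsub>G\<^esub> v) vs in
       (\<Sum>i<Suc k. (-1) ^ i *
          directional_derivative (carrier G)
            (\<lambda>q. \<omega> q (map (\<lambda>x. q \<otimes>\<^bsub>G\<^esub> x) (nths xs (- {i})))) p (vs ! i)) +
       (\<Sum>(i, j) | i < j \<and> j < Suc k. (-1) ^ (i + j) *
          \<omega> p (map (\<lambda>x. p \<otimes>\<^bsub>G\<^esub> x) (bracket G (xs ! i) (xs ! j) # nths xs (- {i, j})))))"

definition left_invariant_form :: "'a::real_normed_vector monoid \<Rightarrow> nat \<Rightarrow> 'a form \<Rightarrow> bool" where
  "left_invariant_form G k \<omega> \<longleftrightarrow>
     is_form (carrier G) k \<omega> \<and>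
     (\<forall>p\<in>carrier G. \<forall>q\<in>carrier G. \<forall>vs\<in>tuples (tangent G q) k.
        \<omega> (p \<otimes>\<^bsub>G\<^esub> q) (map (\<lambda>v. p \<otimes>\<^bsub>G\<^esub> v) vs) = \<omega> q vs)"

definition left_invariant_coframe ::
    "'a::real_normed_vector monoid \<Rightarrow> (nat \<Rightarrow> 'a form) \<Rightarrow> bool" where
  "left_invariant_coframe G e \<longleftrightarrow>
     (\<forall>i\<in>{1..7}. left_invariant_form G 1 (e i)) \<and>
     (\<forall>p\<in>carrier G. coframe (tangent G p) (\<lambda>i. e i p))"

text \<open>\<open>ew e [i, j, \<dots>]\<close> is \<open>e\<^sup>i \<and> e\<^sup>j \<and> \<dots>\<close> for a field of coframes \<open>e\<close>.\<close>

definition ew :: "(nat \<Rightarrow> 'a form) \<Rightarrow> nat list \<Rightarrow> 'a form" where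
  "ew e is p = coframe_wedge (\<lambda>i. e i p) is"

section \<open>The Laplacian coflow\<close>

definition star_psi ::
    "'a::real_normed_vector monoid \<Rightarrow> 'a form \<Rightarrow> 'a form \<Rightarrow> nat \<Rightarrow> 'a form \<Rightarrow> 'a form" where
  "star_psi G vol \<psi> k \<omega> p = psi_hodge (tangent G p) (vol p) (\<psi> p) k (\<omega> p)"

definition metric_psi ::
    "'a::real_normed_vector monoid \<Rightarrow> 'a form \<Rightarrow> 'a form \<Rightarrow> 'a \<Rightarrow> 'a \<Rightarrow> 'a \<Rightarrow> real" where
  "metric_psi G vol \<psi> p = psi_metric (tangent G p) (vol p) (\<psi> p)"

definition definite_4form :: "'a::real_normed_vector monoid \<Rightarrow> 'a form \<Rightarrow> 'a form \<Rightarrow> bool" where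
  "definite_4form G vol \<psi> \<longleftrightarrow>
     is_form (carrier G) 4 \<psi> \<and>
     (\<forall>p\<in>carrier G. \<exists>f. adapted_psi (tangent G p) (vol p) (\<psi> p) f)"

text \<open>On a \<open>7\<close>-manifold \<open>\<delta> = (-1)\<^sup>k \<star> d \<star>\<close> on \<open>k\<close>-forms; the degrees of the intermediate forms have to
  be supplied.\<close>

definition codiff ::
    "'a::real_normed_vector monoid \<Rightarrow> 'a form \<Rightarrow> 'a form \<Rightarrow> nat \<Rightarrow> 'a form \<Rightarrow> 'a form" where
  "codiff G vol \<psi> k \<omega> p vs =
     (-1) ^ k *
     star_psi G vol \<psi> (8 - k) (ext_deriv G (7 - k) (star_psi G vol \<psi> k \<omega>)) p vs"

definition hodge_laplacian ::
    "'a::real_normed_vector monoid \<Rightarrow> 'a form \<Rightarrow> 'a form \<Rightarrow> nat \<Rightarrow> 'a form \<Rightarrow> 'a form" where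
  "hodge_laplacian G vol \<psi> k \<omega> p vs =
     ext_deriv G (k - 1) (codiff G vol \<psi> k \<omega>) p vs +
     codiff G vol \<psi> (k + 1) (ext_deriv G k \<omega>) p vs"

definition left_invariant_laplacian_coflow ::
    "'a::real_normed_vector monoid \<Rightarrow> 'a form \<Rightarrow> real set \<Rightarrow> (real \<Rightarrow> 'a form) \<Rightarrow> bool" where
  "left_invariant_laplacian_coflow G vol J \<psi> \<longleftrightarrow>
     (\<forall>t\<in>J. left_invariant_form G 4 (\<psi> t) \<and> definite_4form G vol (\<psi> t) \<and>
        (\<forall>p\<in>carrier G. \<forall>vs\<in>tuples (tangent G p) 4.
           ((\<lambda>s. \<psi> s p vs) has_real_derivative hodge_laplacian G vol (\<psi> t) 4 (\<psi> t) p vs)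
             (at t within J)))"

section \<open>Strong \<open>G\<^sub>2\<close>-structures with torsion\<close>

definition star_phi ::
    "'a::real_normed_vector monoid \<Rightarrow> 'a form \<Rightarrow> nat \<Rightarrow> 'a form \<Rightarrow> 'a form" where
  "star_phi G \<phi> k \<omega> p = phi_hodge (tangent G p) (\<phi> p) k (\<omega> p)"

definition G2_structure :: "'a::real_normed_vector monoid \<Rightarrow> 'a form \<Rightarrow> bool" where
  "G2_structure G \<phi> \<longleftrightarrow>
     is_form (carrier G) 3 \<phi> \<and> (\<forall>p\<in>carrier G. \<exists>f. adapted_phi (tangent G p) (\<phi> p) f)"

definition G2T_with_Lee_form :: "'a::real_normed_vector monoid \<Rightarrow> 'a form \<Rightarrow> 'a form \<Rightarrow> bool" where
  "G2T_with_Lee_form G \<phi> \<theta> \<longleftrightarrow>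
     G2_structure G \<phi> \<and> is_form (carrier G) 1 \<theta> \<and>
     form_eq (carrier G) 5 (ext_deriv G 4 (star_phi G \<phi> 3 \<phi>))
       (\<lambda>p. wedge 1 (\<theta> p) (star_phi G \<phi> 3 \<phi> p))"

definition torsion_form :: "'a::real_normed_vector monoid \<Rightarrow> 'a form \<Rightarrow> 'a form \<Rightarrow> 'a form" where
  "torsion_form G \<phi> \<theta> p vs =
     1 / 6 * star_phi G \<phi> 7 (\<lambda>q. wedge 4 (ext_deriv G 3 \<phi> q) (\<phi> q)) p [] * \<phi> p vs
     - star_phi G \<phi> 4 (ext_deriv G 3 \<phi>) p vs
     + star_phi G \<phi> 4 (\<lambda>q. wedge 1 (\<theta> q) (\<phi> q)) p vs"

definition strong_G2T :: "'a::real_normed_vector monoid \<Rightarrow> 'a form \<Rightarrow> bool" where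
  "strong_G2T G \<phi> \<longleftrightarrow>
     (\<exists>\<theta>. G2T_with_Lee_form G \<phi> \<theta> \<and>
        form_eq (carrier G) 4 (ext_deriv G 3 (torsion_form G \<phi> \<theta>)) (\<lambda>p vs. 0))"

section \<open>The groups and their product structure\<close>

definition U1 :: "complex monoid" where
  "U1 = \<lparr>carrier = {z. norm z = 1}, mult = (*), one = 1\<rparr>"

definition SU2 :: "(complex^2^2) monoid" where
  "SU2 = \<lparr>carrier = {A. (\<chi> i j. cnj (A $ j $ i)) ** A = mat 1 \<and> det A = 1},
          mult = (**), one = mat 1\<rparr>"

text \<open>At every point the factor \<open>Y\<close> is tangent to the directions dual to \<open>e\<^sup>1, e\<^sup>2, e\<^sup>3\<close>, and \<open>X\<close> to
  those dual to \<open>e\<^sup>4, \<dots>, e\<^sup>7\<close>.\<close>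

definition adapted_to_product ::
    "'y::real_normed_vector monoid \<Rightarrow> 'x::real_normed_vector monoid \<Rightarrow> (nat \<Rightarrow> ('y \<times> 'x) form) \<Rightarrow> bool"
  where
  "adapted_to_product Y X e \<longleftrightarrow>
     (\<forall>y\<in>carrier Y. \<forall>x\<in>carrier X.
        tangent_space (carrier Y \<times> {x}) (y, x) =
          {v \<in> tangent (Y \<times>\<times> X) (y, x). \<forall>i\<in>{4..7}. e i (y, x) [v] = 0} \<and>
        tangent_space ({y} \<times> carrier X) (y, x) =
          {v \<in> tangent (Y \<times>\<times> X) (y, x). \<forall>i\<in>{1..3}. e i (y, x) [v] = 0})"

text \<open>The metric \<open>g\<close> on \<open>Y \<times> X\<close> is the product of its restrictions to the two factors through the
  identity.\<close>

definition riemannian_product ::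
    "'y::real_normed_vector monoid \<Rightarrow> 'x::real_normed_vector monoid \<Rightarrow>
     ('y \<times> 'x \<Rightarrow> 'y \<times> 'x \<Rightarrow> 'y \<times> 'x \<Rightarrow> real) \<Rightarrow> bool" where
  "riemannian_product Y X g \<longleftrightarrow>
     (\<forall>y\<in>carrier Y. \<forall>x\<in>carrier X.
        \<forall>v\<in>tangent Y y. \<forall>v'\<in>tangent Y y. \<forall>w\<in>tangent X x. \<forall>w'\<in>tangent X x.
          g (y, x) (v, w) (v', w') =
            g (y, \<one>\<^bsub>X\<^esub>) (v, 0) (v', 0) + g (\<one>\<^bsub>Y\<^esub>, x) (0, w) (0, w'))"

end

theory Submission
  imports Defs "HOL-Combinatorics.Multiset_Permutations"
begin

text \<open>Metric and Hodge operator of a definite form may be computed in any adapted coframe, because two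
  such coframes differ by an orthogonal map. The coframe \<open>\<surd>s e\<^sup>1, \<surd>s e\<^sup>2, \<surd>s e\<^sup>3, e\<^sup>4, \<dots>, e\<^sup>7\<close> is adapted to
  the ansatz with \<open>a = s\<close>, and its structure equations are those of \<open>e\<close> with the constant \<open>k\<close> of the
  first factor (\<open>0\<close> for the torus, \<open>1\<close> for \<open>SU(2)\<close>) replaced by \<open>k / \<surd>s\<close>. Hence a single computation of
  the components of left-invariant forms gives the Laplacian \<open>(1 + k\<^sup>2 / s)\<close> times the part of degree
  \<open>2\<close> in \<open>e\<^sup>1, e\<^sup>2, e\<^sup>3\<close>, so that the flow becomes \<open>a' = a + k\<^sup>2\<close>. In components the Laplacian is a locally
  Lipschitz function of a definite form, which yields uniqueness; a solution cannot reach \<open>-log 2\<close>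
  because the ansatz tends there to the degenerate form \<open>e\<^sup>4\<^sup>5\<^sup>6\<^sup>7\<close>.\<close>

section \<open>Sums over tuples of indices\<close>

text \<open>Metric and Hodge operator are defined through an arbitrarily chosen adapted coframe, and
  uniqueness of the flow has to cover every left-invariant definite form, not only the ansatz. One
  explicit formula meets both obstacles. Contracting two copies of the dual of \<psi> with \<psi>
  gives \<open>bryant_psi\<close>, a dual version of Bryant's identity: in any frame it equals 13824
  c^2 times the inverse metric, where c is the volume factor of an adapted coframe (13824 = 24^3,
  with 4! from each of the two unnormalised duals and 24 from the contraction of the model forms).
  Contracting two copies of \<psi> by this matrix gives \<open>psi_norm\<close>, a positive constant
  times c^8, and the orientation makes c the positive eighth root. So volume factor, inverse metric
  and Hodge operator are functions of the components of \<psi>. This gives the independence of the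
  coframe, and it makes the Laplacian Lipschitz wherever \<open>psi_norm\<close> stays away from 0.
  The same number detects degeneracy: it is positive on definite forms and zero on e^4567.\<close>

lemma tuples_0 [simp]: "tuples V 0 = {[]}"
  by (auto simp: tuples_def)

lemma tuples_Suc: "tuples V (Suc k) = (\<lambda>(x, xs). x # xs) ` (V \<times> tuples V k)"
proof -
  have "vs \<in> (\<lambda>(x, xs). x # xs) ` (V \<times> tuples V k)" if "vs \<in> tuples V (Suc k)" for vs
    using that by (cases vs) (auto simp: tuples_def image_iff)
  then show ?thesis
    by (auto simp: tuples_def)
qed

lemma Nil_tuples [simp]: "[] \<in> tuples V k \<longleftrightarrow> k = 0"
  by (auto simp: tuples_def)

lemma Cons_tuples: "x # xs \<in> tuples V k \<longleftrightarrow> (\<exists>l. k = Suc l \<and> x \<in> V \<and> xs \<in> tuples V l)"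
  by (auto simp: tuples_def)

lemma Cons_tuples_Suc [simp]: "x # xs \<in> tuples V (Suc k) \<longleftrightarrow> x \<in> V \<and> xs \<in> tuples V k"
  by (auto simp: tuples_def)

lemma append_tuples: "xs \<in> tuples V k \<Longrightarrow> ys \<in> tuples V l \<Longrightarrow> xs @ ys \<in> tuples V (k + l)"
  by (auto simp: tuples_def)

lemma map_tuples: "xs \<in> tuples A k \<Longrightarrow> (\<And>x. x \<in> A \<Longrightarrow> h x \<in> V) \<Longrightarrow> map h xs \<in> tuples V k"
  by (auto simp: tuples_def)

lemma length_tuples: "xs \<in> tuples V k \<Longrightarrow> length xs = k"
  by (auto simp: tuples_def)

lemma set_tuples: "xs \<in> tuples V k \<Longrightarrow> set xs \<subseteq> V"
  by (auto simp: tuples_def)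

lemma finite_tuples [simp]: "finite I \<Longrightarrow> finite (tuples I k)"
  by (induction k) (auto simp: tuples_Suc)

lemma sum_tuples_Suc:
  "(\<Sum>xs\<in>tuples I (Suc k). h xs) = (\<Sum>x\<in>I. \<Sum>xs\<in>tuples I k. h (x # xs))"
proof -
  have "inj_on (\<lambda>(x, xs). x # xs) (I \<times> tuples I k)"
    by (auto simp: inj_on_def)
  then show ?thesis
    by (simp add: tuples_Suc sum.reindex sum.cartesian_product case_prod_unfold)
qed

lemma sum_tuples_add:
  "(\<Sum>xs\<in>tuples I (k + l). h xs) = (\<Sum>xs\<in>tuples I k. \<Sum>ys\<in>tuples I l. h (xs @ ys))"
  by (induction k arbitrary: h) (simp_all add: sum_tuples_Suc)

lemma sum_tuples_delta:
  assumes "finite I" "xs \<in> tuples I k"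
  shows "(\<Sum>ys\<in>tuples I k. (if xs = ys then 1 else 0) * h ys) = (h xs :: real)"
    and "(\<Sum>ys\<in>tuples I k. (if ys = xs then 1 else 0) * h ys) = (h xs :: real)"
proof -
  have *: "(\<Sum>ys\<in>tuples I k. (if xs = ys then 1 else 0) * h ys)
        = (\<Sum>ys\<in>tuples I k. if xs = ys then h ys else 0)"
    by (intro sum.cong) auto
  then show 1: "(\<Sum>ys\<in>tuples I k. (if xs = ys then 1 else 0) * h ys) = h xs"
    using assms by (simp add: sum.delta)
  show "(\<Sum>ys\<in>tuples I k. (if ys = xs then 1 else 0) * h ys) = h xs"
    unfolding 1[symmetric] by (intro sum.cong) auto
qed

text \<open>\<open>pr A\<close> is a tensor power of the matrix \<open>A\<close>.\<close>

definition pr :: "('a \<Rightarrow> 'b \<Rightarrow> real) \<Rightarrow> 'a list \<Rightarrow> 'b list \<Rightarrow> real" where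
  "pr A xs ys = prod_list (map2 A xs ys)"

lemma pr_simps [simp]:
  "pr A [] ys = 1" "pr A xs [] = 1" "pr A (x # xs) (y # ys) = A x y * pr A xs ys"
  by (auto simp: pr_def)

lemma pr_append:
  "length xs = length ys \<Longrightarrow> pr A (xs @ xs') (ys @ ys') = pr A xs ys * pr A xs' ys'"
  by (induction xs ys rule: list_induct2) auto

lemma pr_transpose: "pr (\<lambda>x y. A y x) xs ys = pr A ys xs"
  by (induction xs ys rule: list_induct2') auto

lemma pr_cong:
  assumes "\<And>x y. x \<in> set xs \<Longrightarrow> y \<in> set ys \<Longrightarrow> A x y = B x y"
  shows "pr A xs ys = pr B xs ys"
  using assms by (induction xs ys rule: list_induct2') auto

text \<open>The sum over lists factors into one sum per slot, which is why tensor powers respect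
  matrix products.\<close>

lemma pr_comp:
  assumes "length xs = k" "length zs = k"
  shows "(\<Sum>ys\<in>tuples I k. pr A xs ys * pr B ys zs) = pr (\<lambda>x z. \<Sum>y\<in>I. A x y * B y z) xs zs"
proof -
  have "length xs = length zs" using assms by simp
  then show ?thesis using assms
  proof (induction xs zs arbitrary: k rule: list_induct2)
    case Nil
    then show ?case by simp
  next
    case (Cons x xs z zs)
    from Cons.prems obtain l where l: "k = Suc l" "length xs = l" "length zs = l" by auto
    have "(\<Sum>ys\<in>tuples I k. pr A (x # xs) ys * pr B ys (z # zs))
        = (\<Sum>y\<in>I. \<Sum>ys\<in>tuples I l. (A x y * B y z) * (pr A xs ys * pr B ys zs))"
      by (simp add: l sum_tuples_Suc mult_ac)
    also have "\<dots> = (\<Sum>y\<in>I. A x y * B y z) * (\<Sum>ys\<in>tuples I l. pr A xs ys * pr B ys zs)"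
      by (simp only: sum_product)
    finally show ?case using Cons.IH[of l] l by simp
  qed
qed

lemma pr_delta:
  assumes "\<And>x y. x \<in> I \<Longrightarrow> y \<in> I \<Longrightarrow> D x y = (if x = y then 1 else 0)"
    and "xs \<in> tuples I k" "ys \<in> tuples I k"
  shows "pr D xs ys = (if xs = ys then 1 else 0)"
proof -
  have "length xs = length ys" using assms by (auto simp: tuples_def)
  then show ?thesis using assms(2,3)
  proof (induction xs ys arbitrary: k rule: list_induct2)
    case (Cons x xs y ys)
    then show ?case using assms(1) by (auto simp: Cons_tuples)
  qed simp
qed

lemma pr_scale: "length xs = length ys \<Longrightarrow> pr (\<lambda>x y. a * A x y) xs ys = a ^ length xs * pr A xs ys"
  by (induction xs ys rule: list_induct2) auto

lemma pr_inverse: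
  assumes "\<And>x z. x \<in> I \<Longrightarrow> z \<in> I \<Longrightarrow> (\<Sum>y\<in>I. A x y * B y z) = (if x = z then 1 else 0)"
    and "xs \<in> tuples I k" "zs \<in> tuples I k"
  shows "(\<Sum>ys\<in>tuples I k. pr A xs ys * pr B ys zs) = (if xs = zs then 1 else 0)"
  using assms by (subst pr_comp) (simp_all add: length_tuples pr_delta[OF assms(1)])

text \<open>Tensor powers of inverse matrices are inverse to each other; this moves a change of
  frame from one side of an identity to the other, for all slots at once.\<close>

lemma pr_cancel:
  assumes "finite I"
    and "\<And>x z. x \<in> I \<Longrightarrow> z \<in> I \<Longrightarrow> (\<Sum>y\<in>I. A x y * B y z) = (if x = z then 1 else 0)"
    and "xs \<in> tuples I k"
  shows "(\<Sum>ys\<in>tuples I k. pr A xs ys * (\<Sum>zs\<in>tuples I k. pr B ys zs * h zs)) = h xs"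
proof -
  have "(\<Sum>ys\<in>tuples I k. pr A xs ys * (\<Sum>zs\<in>tuples I k. pr B ys zs * h zs))
      = (\<Sum>zs\<in>tuples I k. (\<Sum>ys\<in>tuples I k. pr A xs ys * pr B ys zs) * h zs)"
    by (simp add: sum_distrib_left sum_distrib_right mult.assoc) (rule sum.swap)
  also have "\<dots> = (\<Sum>zs\<in>tuples I k. (if xs = zs then 1 else 0) * h zs)"
    using assms by (intro sum.cong refl) (simp add: pr_inverse)
  also have "\<dots> = h xs" using assms by (simp add: sum_tuples_delta)
  finally show ?thesis .
qed

section \<open>Antisymmetric functions on lists\<close>

text \<open>Antisymmetry is stated for adjacent entries only and uses no linear structure, so the
  same notion serves forms on vectors and component functions on index lists, and inductions over a
  prefix are easy.\<close>

definition skew_on :: "'a set \<Rightarrow> nat \<Rightarrow> ('a list \<Rightarrow> real) \<Rightarrow> bool" where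
  "skew_on S k h \<longleftrightarrow>
     (\<forall>xs a b ys. xs @ a # b # ys \<in> tuples S k \<longrightarrow> h (xs @ a # b # ys) = - h (xs @ b # a # ys))"

lemma skew_onI:
  assumes "\<And>xs a b ys. set xs \<subseteq> S \<Longrightarrow> a \<in> S \<Longrightarrow> b \<in> S \<Longrightarrow> set ys \<subseteq> S \<Longrightarrow>
    length xs + length ys + 2 = k \<Longrightarrow> h (xs @ a # b # ys) = - h (xs @ b # a # ys)"
  shows "skew_on S k h"
  unfolding skew_on_def
proof (intro allI impI)
  fix xs a b ys assume "xs @ a # b # ys \<in> tuples S k"
  then show "h (xs @ a # b # ys) = - h (xs @ b # a # ys)"
    by (intro assms) (simp_all add: tuples_def)
qed

lemma skew_onD:
  assumes "skew_on S k h" "xs @ a # b # ys \<in> tuples S k"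
  shows "h (xs @ a # b # ys) = - h (xs @ b # a # ys)"
  using assms unfolding skew_on_def by blast

lemma skew_on_move:
  assumes "skew_on S k h" "xs @ us @ a # ys \<in> tuples S k"
  shows "h (xs @ us @ a # ys) = (- 1) ^ length us * h (xs @ a # us @ ys)"
  using assms(2)
proof (induction us arbitrary: xs)
  case (Cons u us)
  have "h (xs @ (u # us) @ a # ys) = (- 1) ^ length us * h ((xs @ [u]) @ a # us @ ys)"
    using Cons.IH[of "xs @ [u]"] Cons.prems by simp
  also have "h ((xs @ [u]) @ a # us @ ys) = - h (xs @ a # u # us @ ys)"
    using skew_onD[OF assms(1), of xs u a "us @ ys"] Cons.prems by (simp add: tuples_def)
  finally show ?case by simp
qed simp

text \<open>Absolute values avoid naming the sign of the permutation. The prefix \<open>ps\<close>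
  collects the entries already matched in the induction.\<close>

lemma skew_on_mset:
  assumes "skew_on S k h" "mset xs = mset ys" "ps @ xs \<in> tuples S k"
  shows "\<bar>h (ps @ xs)\<bar> = \<bar>h (ps @ ys)\<bar>"
  using assms(2,3)
proof (induction xs arbitrary: ps ys)
  case (Cons x xs)
  have "x \<in> set ys" using Cons.prems(1) by (metis list.set_intros(1) set_mset_mset)
  then obtain us vs where ys: "ys = us @ x # vs" by (meson split_list)
  have m: "mset xs = mset (us @ vs)" using Cons.prems(1) by (simp add: ys)
  then have s: "set xs = set (us @ vs)" "length xs = length (us @ vs)"
    by (metis set_mset_mset) (metis m size_mset)
  have t: "ps @ us @ x # vs \<in> tuples S k"
    using Cons.prems(2) s by (auto simp: tuples_def)
  have "\<bar>h (ps @ ys)\<bar> = \<bar>h ((ps @ [x]) @ us @ vs)\<bar>"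
    using skew_on_move[OF assms(1) t] by (simp add: ys abs_mult)
  also have "\<dots> = \<bar>h ((ps @ [x]) @ xs)\<bar>"
    using Cons.IH[of "us @ vs" "ps @ [x]"] Cons.prems(2) m by simp
  finally show ?case by simp
qed simp

text \<open>Up to sign the equal entries can be moved to the front, where exchanging them shows that
  the value is its own negative.\<close>

lemma skew_on_not_distinct:
  assumes "skew_on S k h" "xs \<in> tuples S k" "\<not> distinct xs"
  shows "h xs = 0"
proof -
  obtain us a vs ws where xs: "xs = us @ [a] @ vs @ [a] @ ws"
    using assms(3) not_distinct_decomp by metis
  have "\<bar>h ([] @ xs)\<bar> = \<bar>h ([] @ (a # a # us @ vs @ ws))\<bar>"
    using assms xs by (intro skew_on_mset) auto
  moreover have "h (a # a # us @ vs @ ws) = 0"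
    using skew_onD[OF assms(1), of "[]" a a "us @ vs @ ws"] assms(2) xs by (simp add: tuples_def)
  ultimately show ?thesis by simp
qed

lemma skew_on_diff:
  assumes "skew_on S k h" "skew_on S k h'"
  shows "skew_on S k (\<lambda>xs. c * h xs - d * h' xs)"
proof (rule skew_onI)
  fix xs a b ys assume "set xs \<subseteq> S" "a \<in> S" "b \<in> S" "set ys \<subseteq> S" "length xs + length ys + 2 = k"
  then have "xs @ a # b # ys \<in> tuples S k" by (simp add: tuples_def)
  then show "c * h (xs @ a # b # ys) - d * h' (xs @ a # b # ys)
      = - (c * h (xs @ b # a # ys) - d * h' (xs @ b # a # ys))"
    using skew_onD[OF assms(1)] skew_onD[OF assms(2)] by simp
qed

lemma skew_on_sum:
  assumes "\<And>i. i \<in> A \<Longrightarrow> skew_on S k (h i)"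
  shows "skew_on S k (\<lambda>xs. \<Sum>i\<in>A. c i * h i xs)"
proof (rule skew_onI)
  fix xs a b ys assume "set xs \<subseteq> S" "a \<in> S" "b \<in> S" "set ys \<subseteq> S" "length xs + length ys + 2 = k"
  then have "xs @ a # b # ys \<in> tuples S k" by (simp add: tuples_def)
  then have "\<And>i. i \<in> A \<Longrightarrow> h i (xs @ a # b # ys) = - h i (xs @ b # a # ys)"
    using skew_onD[OF assms] by blast
  then show "(\<Sum>i\<in>A. c i * h i (xs @ a # b # ys)) = - (\<Sum>i\<in>A. c i * h i (xs @ b # a # ys))"
    by (simp add: sum_negf[symmetric])
qed

lemma skew_on_prefix:
  assumes "skew_on S (k + l) h" "us \<in> tuples S k"
  shows "skew_on S l (\<lambda>xs. h (us @ xs))"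
proof (rule skew_onI)
  fix xs a b ys assume "set xs \<subseteq> S" "a \<in> S" "b \<in> S" "set ys \<subseteq> S" "length xs + length ys + 2 = l"
  then have "(us @ xs) @ a # b # ys \<in> tuples S (k + l)" using assms(2) by (simp add: tuples_def)
  from skew_onD[OF assms(1) this] show "h (us @ xs @ a # b # ys) = - h (us @ xs @ b # a # ys)"
    by simp
qed

text \<open>The Levi-Civita symbol as the product of the signs of all pairs. It makes sense for
  lists of any length with any entries, in particular for concatenations
  \<open>us @ xs\<close>.\<close>

primrec eps :: "nat list \<Rightarrow> real" where
  "eps [] = 1"
| "eps (x # xs) = (\<Prod>y\<leftarrow>xs. if x < y then 1 else if y < x then - 1 else 0) * eps xs"

lemma eps_antisym: "eps (xs @ a # b # ys) = - eps (xs @ b # a # ys)"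
  by (induction xs) auto

lemma skew_on_eps: "skew_on S k eps"
  by (intro skew_onI eps_antisym)

lemma eps_sorted: "sorted xs \<Longrightarrow> distinct xs \<Longrightarrow> eps xs = 1"
proof (induction xs)
  case (Cons x xs)
  then have "\<forall>y\<in>set xs. x < y"
    by (auto simp: order.order_iff_strict)
  then have "(\<Prod>y\<leftarrow>xs. if x < y then 1 else if y < x then - 1 else (0::real)) = 1"
    by (induction xs) auto
  then show ?case using Cons by simp
qed simp

lemma eps_not_distinct: "\<not> distinct xs \<Longrightarrow> eps xs = 0"
  using skew_on_not_distinct[OF skew_on_eps, of xs UNIV] by (simp add: tuples_def)

lemma eps_square: "eps xs ^ 2 = (if distinct xs then 1 else 0)"
proof (cases "distinct xs")
  case True
  have "\<bar>eps ([] @ xs)\<bar> = \<bar>eps ([] @ sorted_list_of_set (set xs))\<bar>"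
    by (rule skew_on_mset[OF skew_on_eps[of UNIV "length xs"]])
       (use True in \<open>auto simp: tuples_def mset_set_set mset_sorted_list_of_multiset
          sorted_list_of_mset_set[symmetric]\<close>)
  then have "\<bar>eps xs\<bar> = 1" by (simp add: eps_sorted)
  then show ?thesis using True by (metis power2_abs power_one)
qed (simp add: eps_not_distinct)

text \<open>Antisymmetric functions of top degree form a line: the combination \<nu> of
  \<open>h\<close> and \<open>eps\<close> vanishes at the sorted list, hence by antisymmetry at all
  of its permutations.\<close>

lemma skew_on_top:
  fixes I :: "nat set"
  assumes "finite I" "skew_on I (card I) h" "xs \<in> tuples I (card I)"
  shows "h xs = h (sorted_list_of_set I) * eps xs"
proof (cases "distinct xs")
  case False
  then show ?thesis using assms skew_on_not_distinct eps_not_distinct by fastforce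
next
  case True
  define \<nu> where "\<nu> = (\<lambda>ys. eps (sorted_list_of_set I) * h ys - h (sorted_list_of_set I) * eps ys)"
  have \<nu>: "skew_on I (card I) \<nu>"
    unfolding \<nu>_def by (intro skew_on_diff assms skew_on_eps)
  have "set xs = I"
    using assms True by (auto simp: tuples_def card_subset_eq distinct_card)
  then have "mset xs = mset (sorted_list_of_set I)"
    using True assms(1) by (simp add: set_eq_iff_mset_eq_distinct[symmetric])
  from skew_on_mset[OF \<nu> this, of "[]"] have "\<bar>\<nu> xs\<bar> = \<bar>\<nu> (sorted_list_of_set I)\<bar>"
    using assms by simp
  then have "\<nu> xs = 0" by (simp add: \<nu>_def)
  then show ?thesis by (simp add: \<nu>_def eps_sorted)
qed

lemma sum_tuples_swap:
  "(\<Sum>xs\<in>tuples I (k + (Suc (Suc l))). h xs)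
   = (\<Sum>us\<in>tuples I k. \<Sum>x\<in>I. \<Sum>y\<in>I. \<Sum>vs\<in>tuples I l. h (us @ x # y # vs))"
  unfolding sum_tuples_add sum_tuples_Suc ..

text \<open>Exchanging two free indices is undone by renaming the two matching summation indices, at
  the cost of one exchange inside \<open>h\<close>. Determinants arise from this: a contraction of
  \<open>eps\<close> is again a multiple of \<open>eps\<close>.\<close>

lemma skew_on_contract:
  fixes A :: "nat \<Rightarrow> nat \<Rightarrow> real"
  assumes "finite I" "skew_on I n h"
  shows "skew_on J n (\<lambda>ys. \<Sum>xs\<in>tuples I n. h xs * pr A ys xs)"
proof (rule skew_onI)
  fix us vs :: "nat list" and a b assume n: "length us + length vs + 2 = n"
  define k l where "k = length us" and "l = length vs"
  have n': "n = k + Suc (Suc l)" using n by (simp add: k_def l_def)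
  let ?S = "\<lambda>a b x y. \<Sum>us'\<in>tuples I k. \<Sum>vs'\<in>tuples I l.
     h (us' @ x # y # vs') * (pr A us us' * (A a x * (A b y * pr A vs vs')))"
  have e: "(\<Sum>xs\<in>tuples I n. h xs * pr A (us @ a # b # vs) xs) = (\<Sum>x\<in>I. \<Sum>y\<in>I. ?S a b x y)" for a b
  proof -
    have "(\<Sum>xs\<in>tuples I n. h xs * pr A (us @ a # b # vs) xs)
       = (\<Sum>us'\<in>tuples I k. \<Sum>x\<in>I. \<Sum>y\<in>I. \<Sum>vs'\<in>tuples I l.
     h (us' @ x # y # vs') * (pr A us us' * (A a x * (A b y * pr A vs vs'))))"
      unfolding n' sum_tuples_swap
    proof (intro sum.cong refl)
      fix us' x y vs' assume "us' \<in> tuples I k"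
      then have "length us = length us'" by (simp add: k_def tuples_def)
      then show "h (us' @ x # y # vs') * pr A (us @ a # b # vs) (us' @ x # y # vs')
        = h (us' @ x # y # vs') * (pr A us us' * (A a x * (A b y * pr A vs vs')))"
        by (simp add: pr_append)
    qed
    also have "\<dots> = (\<Sum>x\<in>I. \<Sum>us'\<in>tuples I k. \<Sum>y\<in>I. \<Sum>vs'\<in>tuples I l.
     h (us' @ x # y # vs') * (pr A us us' * (A a x * (A b y * pr A vs vs'))))"
      by (rule sum.swap)
    also have "\<dots> = (\<Sum>x\<in>I. \<Sum>y\<in>I. ?S a b x y)"
      by (intro sum.cong refl) (rule sum.swap)
    finally show ?thesis .
  qed
  have s: "?S a b x y = - ?S b a y x" if "x \<in> I" "y \<in> I" for x y
    unfolding sum_negf[symmetric]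
  proof (intro sum.cong refl)
    fix us' vs' assume "us' \<in> tuples I k" "vs' \<in> tuples I l"
    then have "us' @ x # y # vs' \<in> tuples I n" using that n' by (simp add: tuples_def)
    from skew_onD[OF assms(2) this]
    show "h (us' @ x # y # vs') * (pr A us us' * (A a x * (A b y * pr A vs vs')))
      = - (h (us' @ y # x # vs') * (pr A us us' * (A b y * (A a x * pr A vs vs'))))" by simp
  qed
  have "(\<Sum>x\<in>I. \<Sum>y\<in>I. ?S a b x y) = (\<Sum>x\<in>I. \<Sum>y\<in>I. - ?S b a y x)"
    using s by (intro sum.cong refl) blast
  also have "\<dots> = - (\<Sum>x\<in>I. \<Sum>y\<in>I. ?S b a y x)" by (simp add: sum_negf)
  also have "(\<Sum>x\<in>I. \<Sum>y\<in>I. ?S b a y x) = (\<Sum>x\<in>I. \<Sum>y\<in>I. ?S b a x y)" by (rule sum.swap)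
  finally show "(\<Sum>xs\<in>tuples I n. h xs * pr A (us @ a # b # vs) xs)
      = - (\<Sum>xs\<in>tuples I n. h xs * pr A (us @ b # a # vs) xs)" unfolding e .
qed

lemma eps_tuples_square:
  assumes "finite I"
  shows "(\<Sum>xs\<in>tuples I (card I). eps xs * eps xs) > 0"
proof (rule sum_pos2)
  show "finite (tuples I (card I))" using assms by simp
  show "sorted_list_of_set I \<in> tuples I (card I)" using assms by (simp add: tuples_def)
  show "0 < eps (sorted_list_of_set I) * eps (sorted_list_of_set I)" by (simp add: eps_sorted)
qed simp

text \<open>A matrix and its transpose have the same determinant: the number obtained by contracting
  \<open>eps\<close> on both sides of the tensor power of \<open>A\<close> is evaluated in both
  orders, and the positive square sum of \<open>eps\<close> is cancelled.\<close>

lemma eps_det_transpose: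
  assumes "finite I"
    and 1: "\<And>xs. xs \<in> tuples I (card I) \<Longrightarrow> (\<Sum>ys\<in>tuples I (card I). eps ys * pr A ys xs) = c * eps xs"
    and "ys \<in> tuples I (card I)"
  shows "(\<Sum>xs\<in>tuples I (card I). eps xs * pr A ys xs) = c * eps ys"
proof -
  let ?T = "tuples I (card I)"
  define d where "d = (\<Sum>xs\<in>?T. eps xs * pr A (sorted_list_of_set I) xs)"
  have 2: "(\<Sum>xs\<in>?T. eps xs * pr A ys xs) = d * eps ys" if "ys \<in> ?T" for ys
    unfolding d_def
    by (rule skew_on_top[OF assms(1) skew_on_contract[OF assms(1) skew_on_eps] that])
  have "c * (\<Sum>xs\<in>?T. eps xs * eps xs) = (\<Sum>xs\<in>?T. (\<Sum>ys\<in>?T. eps ys * pr A ys xs) * eps xs)"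
    unfolding sum_distrib_left by (intro sum.cong refl) (simp add: 1)
  also have "\<dots> = (\<Sum>ys\<in>?T. (\<Sum>xs\<in>?T. eps xs * pr A ys xs) * eps ys)"
    unfolding sum_distrib_right by (subst sum.swap) (simp add: mult_ac)
  also have "\<dots> = d * (\<Sum>xs\<in>?T. eps xs * eps xs)"
    unfolding sum_distrib_left by (intro sum.cong refl) (simp add: 2)
  finally have "c = d" using eps_tuples_square[OF assms(1)] by simp
  then show ?thesis using 2 assms(3) by simp
qed

text \<open>The square of the determinant of an orthogonal matrix is \<open>1\<close>.\<close>

lemma eps_orthogonal:
  assumes "finite I"
    and "\<And>x z. x \<in> I \<Longrightarrow> z \<in> I \<Longrightarrow> (\<Sum>y\<in>I. A y x * A y z) = (if x = z then 1 else 0)"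
  shows "(\<Sum>xs\<in>tuples I (card I). eps xs * pr A (sorted_list_of_set I) xs) ^ 2 = 1"
proof -
  let ?T = "tuples I (card I)"
  define d where "d = (\<Sum>xs\<in>?T. eps xs * pr A (sorted_list_of_set I) xs)"
  have 2: "(\<Sum>xs\<in>?T. eps xs * pr A ys xs) = d * eps ys" if "ys \<in> ?T" for ys
    unfolding d_def
    by (rule skew_on_top[OF assms(1) skew_on_contract[OF assms(1) skew_on_eps] that])
  \<comment> \<open>The tensor power of A transposed times A is contracted with \<open>eps\<close>
    on both sides: each factor contributes one \<open>d\<close>, while their product is the
    identity.\<close>
  have "d\<^sup>2 * (\<Sum>ys\<in>?T. eps ys * eps ys) = (\<Sum>ys\<in>?T. \<Sum>xs\<in>?T. eps xs * (pr (\<lambda>x y. A y x) xs ys * (d * eps ys)))"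
  proof -
    have "d * d * (eps ys * eps ys) = (\<Sum>xs\<in>?T. eps xs * (pr (\<lambda>x y. A y x) xs ys * (d * eps ys)))"
      if "ys \<in> ?T" for ys
    proof -
      have "(\<Sum>xs\<in>?T. eps xs * (pr (\<lambda>x y. A y x) xs ys * (d * eps ys)))
          = (\<Sum>xs\<in>?T. eps xs * pr A ys xs) * (d * eps ys)"
        unfolding sum_distrib_right pr_transpose[of A] by (simp only: mult.assoc)
      then show ?thesis using 2[OF that] by (simp only: mult_ac)
    qed
    then show ?thesis unfolding sum_distrib_left power2_eq_square by (intro sum.cong refl)
  qed
  moreover have "(\<Sum>ys\<in>?T. \<Sum>xs\<in>?T. eps xs * (pr (\<lambda>x y. A y x) xs ys * (d * eps ys)))
      = (\<Sum>xs\<in>?T. eps xs * (\<Sum>ys\<in>?T. pr (\<lambda>x y. A y x) xs ys * (d * eps ys)))"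
    unfolding sum_distrib_left by (rule sum.swap)
  moreover have "(\<Sum>ys\<in>?T. pr (\<lambda>x y. A y x) xs ys * (d * eps ys)) = eps xs" if "xs \<in> ?T" for xs
  proof -
    have "(\<Sum>ys\<in>?T. pr (\<lambda>x y. A y x) xs ys * (d * eps ys))
        = (\<Sum>ys\<in>?T. pr (\<lambda>x y. A y x) xs ys * (\<Sum>zs\<in>?T. pr A ys zs * eps zs))"
      using 2 by (intro sum.cong refl) (simp add: mult.commute)
    also have "\<dots> = eps xs"
      using assms that by (intro pr_cancel) auto
    finally show ?thesis .
  qed
  ultimately have "d\<^sup>2 * (\<Sum>ys\<in>?T. eps ys * eps ys) = (\<Sum>ys\<in>?T. eps ys * eps ys)"
    by simp
  then show ?thesis using eps_tuples_square[OF assms(1)] by (simp add: d_def)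
qed

lemma skew_on_subset: "skew_on S k h \<Longrightarrow> S' \<subseteq> S \<Longrightarrow> skew_on S' k h"
  by (rule skew_onI, erule skew_onD) (auto simp: tuples_def)

lemma skew_on_sort:
  fixes h :: "nat list \<Rightarrow> real"
  assumes "skew_on I k h" "xs \<in> tuples I k" "distinct xs"
  shows "h xs = h (sorted_list_of_set (set xs)) * eps xs"
proof -
  have k: "card (set xs) = k" using assms by (simp add: tuples_def distinct_card)
  show ?thesis
    by (rule skew_on_top)
       (use assms k in \<open>auto simp: tuples_def intro: skew_on_subset\<close>)
qed

text \<open>Each subset is listed in \<open>fact k\<close> orders, and in a product of two
  antisymmetric functions the signs cancel. This passes from the subsets in
  \<open>coframe_hodge\<close> to the tuples that suit changes of frame.\<close>

lemma sum_tuples_subsets: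
  fixes h h' :: "nat list \<Rightarrow> real"
  assumes "finite I" "skew_on I k h" "skew_on I k h'"
  shows "(\<Sum>xs\<in>tuples I k. h xs * h' xs)
    = fact k * (\<Sum>S | S \<subseteq> I \<and> card S = k. h (sorted_list_of_set S) * h' (sorted_list_of_set S))"
proof -
  let ?D = "{xs \<in> tuples I k. distinct xs}" and ?p = "\<lambda>xs. h xs * h' xs"
  have f: "finite ?D" "finite {S. S \<subseteq> I \<and> card S = k}" using assms(1) by auto
  have "(\<Sum>xs\<in>tuples I k. ?p xs) = (\<Sum>xs\<in>?D. ?p xs)"
    using assms skew_on_not_distinct[OF assms(2)] by (intro sum.mono_neutral_right) auto
  also have "\<dots> = (\<Sum>S | S \<subseteq> I \<and> card S = k. \<Sum>xs | xs \<in> ?D \<and> set xs = S. ?p xs)"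
    by (rule sum.group[symmetric]) (use f in \<open>auto simp: tuples_def distinct_card\<close>)
  also have "\<dots> = (\<Sum>S | S \<subseteq> I \<and> card S = k. fact k * ?p (sorted_list_of_set S))"
  proof (intro sum.cong refl)
    fix S assume S: "S \<in> {S. S \<subseteq> I \<and> card S = k}"
    then have fS: "finite S" using assms(1) finite_subset by auto
    have eq: "{xs. xs \<in> ?D \<and> set xs = S} = permutations_of_set S"
      using S by (auto simp: permutations_of_set_def tuples_def distinct_card)
    have "?p xs = ?p (sorted_list_of_set S)" if "xs \<in> permutations_of_set S" for xs
    proof -
      have *: "xs \<in> tuples I k" "distinct xs" "set xs = S" using that eq by auto
      have "?p xs = ?p (sorted_list_of_set S) * (eps xs)\<^sup>2"
        using skew_on_sort[OF assms(2) *(1,2)] skew_on_sort[OF assms(3) *(1,2)] *(3)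
        by (simp add: power2_eq_square)
      then show ?thesis using *(2) by (simp add: eps_square)
    qed
    then have "(\<Sum>xs\<in>permutations_of_set S. ?p xs) = (\<Sum>xs\<in>permutations_of_set S. ?p (sorted_list_of_set S))"
      by (intro sum.cong refl)
    then show "(\<Sum>xs | xs \<in> ?D \<and> set xs = S. ?p xs) = fact k * ?p (sorted_list_of_set S)"
      unfolding eq using S fS by simp
  qed
  finally show ?thesis by (simp add: sum_distrib_left)
qed

section \<open>Multilinear and alternating forms\<close>

text \<open>Keeps the literal index and degree \<open>1\<close> from becoming \<open>Suc 0\<close>,
  so that rules stated with \<open>1\<close> keep matching.\<close>

declare One_nat_def [simp del]

lemma wedge_Nil [simp]: "wedge k \<alpha> \<beta> [] = (if k = 0 then \<alpha> [] * \<beta> [] else 0)"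
proof -
  have "{I :: nat set. I \<subseteq> {..<0} \<and> card I = k} = (if k = 0 then {{}} else {})"
    by auto
  then show ?thesis by (simp add: wedge_def)
qed

lemma wedge_0 [simp]: "wedge 0 \<alpha> \<beta> vs = \<alpha> [] * \<beta> vs"
proof -
  have "{I :: nat set. I \<subseteq> {..<length vs} \<and> card I = 0} = {{}}"
    by (auto dest: finite_subset[OF _ finite_lessThan])
  then show ?thesis by (simp add: wedge_def nths_all)
qed

text \<open>Contraction with \<open>v\<close> is a graded derivation. The index sets are split by
  whether they contain position 0: if so, this position causes no inversion and \<open>v\<close>
  goes to \<alpha>; if not, each of the k + 1 chosen positions lies after it, which gives the sign,
  and \<open>v\<close> goes to \<beta>.\<close>

lemma wedge_Suc_Cons:
  "wedge (Suc k) \<alpha> \<beta> (v # vs)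
   = wedge k (\<lambda>ws. \<alpha> (v # ws)) \<beta> vs + (- 1) ^ Suc k * wedge (Suc k) \<alpha> (\<lambda>ws. \<beta> (v # ws)) vs"
proof -
  define n where "n = length vs"
  let ?inv = "\<lambda>n I. {(i, j). i \<in> I \<and> j \<in> {..<n} - I \<and> j < (i::nat)}"
  let ?t = "\<lambda>I. (- 1) ^ card (?inv (Suc n) I) * \<alpha> (nths (v # vs) I) * \<beta> (nths (v # vs) (- I))"
  let ?P = "\<lambda>n k. {I. I \<subseteq> {..<n} \<and> card I = (k::nat)}"
  let ?a = "\<lambda>I. insert 0 (Suc ` I)" and ?b = "\<lambda>I. Suc ` I"
  have fin: "finite I" if "I \<subseteq> {..<n}" for I using that finite_subset by blast
  have split: "?P (Suc n) (Suc k) = ?a ` ?P n k \<union> ?b ` ?P n (Suc k)"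
  proof (intro equalityI subsetI)
    fix K assume K: "K \<in> ?P (Suc n) (Suc k)"
    define L where "L = {i. Suc i \<in> K}"
    have L: "L \<subseteq> {..<n}" using K by (auto simp: L_def)
    have KL: "K - {0} = Suc ` L" by (auto simp: L_def image_iff) (metis not0_implies_Suc)
    have cL: "card (Suc ` L) = card L" by (rule card_image) simp
    have fK: "finite K" using K finite_subset by auto
    show "K \<in> ?a ` ?P n k \<union> ?b ` ?P n (Suc k)"
    proof (cases "0 \<in> K")
      case True
      then have "K = ?a L" using KL by auto
      moreover have "card L = k" using K True fK KL cL by (metis (mono_tags, lifting) card_Diff_singleton diff_Suc_1 mem_Collect_eq)
      ultimately show ?thesis using L by blast
    next
      case False
      then have "K = ?b L" using KL by auto
      moreover have "card L = Suc k" using K calculation cL by auto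
      ultimately show ?thesis using L by blast
    qed
  next
    fix K assume "K \<in> ?a ` ?P n k \<union> ?b ` ?P n (Suc k)"
    then show "K \<in> ?P (Suc n) (Suc k)"
    proof
      assume "K \<in> ?a ` ?P n k"
      then obtain I where I: "K = ?a I" "I \<subseteq> {..<n}" "card I = k" by auto
      have "card (Suc ` I) = k" using I by (simp add: card_image)
      moreover have "finite (Suc ` I)" using fin I by blast
      ultimately show ?thesis using I by auto
    next
      assume "K \<in> ?b ` ?P n (Suc k)"
      then obtain I where I: "K = ?b I" "I \<subseteq> {..<n}" "card I = Suc k" by auto
      have "card (Suc ` I) = Suc k" using I by (simp add: card_image)
      then show ?thesis using I by auto
    qed
  qed
  have fP: "finite (?P n j)" for j by simp
  have inja: "inj_on ?a (?P n k)"
    by (rule inj_on_inverseI[where g = "\<lambda>K. {i. Suc i \<in> K}"]) auto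
  have injb: "inj_on ?b (?P n (Suc k))"
    by (rule inj_on_inverseI[where g = "\<lambda>K. {i. Suc i \<in> K}"]) auto
  have "wedge (Suc k) \<alpha> \<beta> (v # vs) = sum ?t (?P (Suc n) (Suc k))"
    by (simp add: wedge_def n_def)
  also have "\<dots> = sum ?t (?a ` ?P n k) + sum ?t (?b ` ?P n (Suc k))"
    unfolding split by (rule sum.union_disjoint) auto
  also have "sum ?t (?a ` ?P n k) = (\<Sum>I\<in>?P n k. ?t (?a I))"
    using sum.reindex[OF inja, of ?t] by (simp add: comp_def)
  also have "sum ?t (?b ` ?P n (Suc k)) = (\<Sum>I\<in>?P n (Suc k). ?t (?b I))"
    using sum.reindex[OF injb, of ?t] by (simp add: comp_def)
  also have "(\<Sum>I\<in>?P n k. ?t (?a I)) = wedge k (\<lambda>ws. \<alpha> (v # ws)) \<beta> vs"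
    unfolding wedge_def n_def[symmetric]
  proof (intro sum.cong refl)
    fix I assume "I \<in> ?P n k"
    have "?inv (Suc n) (?a I) = (\<lambda>(i, j). (Suc i, Suc j)) ` ?inv n I"
    proof (intro equalityI subsetI)
      fix x assume "x \<in> ?inv (Suc n) (?a I)"
      then obtain i j where x: "x = (i, j)" "i \<in> ?a I" "j \<in> {..<Suc n} - ?a I" "j < i" by auto
      then obtain i' j' where "i = Suc i'" "j = Suc j'" by (metis DiffD2 insertI1 less_nat_zero_code not0_implies_Suc)
      then show "x \<in> (\<lambda>(i, j). (Suc i, Suc j)) ` ?inv n I" using x by auto
    qed auto
    then have "card (?inv (Suc n) (?a I)) = card (?inv n I)"
      by (simp add: card_image inj_on_def)
    moreover have "{j. Suc j \<in> ?a I} = I" "{j. Suc j \<in> - ?a I} = - I" by auto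
    then have "nths (v # vs) (?a I) = v # nths vs I" "nths (v # vs) (- ?a I) = nths vs (- I)"
      by (simp_all add: nths_Cons)
    ultimately show "?t (?a I) = (- 1) ^ card (?inv n I) * \<alpha> (v # nths vs I) * \<beta> (nths vs (- I))"
      by (simp only:)
  qed
  also have "(\<Sum>I\<in>?P n (Suc k). ?t (?b I)) = (- 1) ^ Suc k * wedge (Suc k) \<alpha> (\<lambda>ws. \<beta> (v # ws)) vs"
    unfolding wedge_def n_def[symmetric] sum_distrib_left
  proof (intro sum.cong refl)
    fix I assume I: "I \<in> ?P n (Suc k)"
    \<comment> \<open>The second set holds the new inversions, between the unchosen position 0 and
      each chosen one.\<close>
    have *: "?inv (Suc n) (?b I) = (\<lambda>(i, j). (Suc i, Suc j)) ` ?inv n I \<union> (\<lambda>i. (Suc i, 0)) ` I"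
    proof (intro equalityI subsetI)
      fix x assume "x \<in> ?inv (Suc n) (?b I)"
      then obtain i j where x: "x = (i, j)" "i \<in> ?b I" "j \<in> {..<Suc n} - ?b I" "j < i" by auto
      then show "x \<in> (\<lambda>(i, j). (Suc i, Suc j)) ` ?inv n I \<union> (\<lambda>i. (Suc i, 0)) ` I"
        by (cases j) auto
    qed auto
    have finv: "finite (?inv n I)"
      by (rule finite_subset[of _ "I \<times> {..<n}"]) (use fin I in auto)
    have "card (?inv (Suc n) (?b I)) = card ((\<lambda>(i, j). (Suc i, Suc j)) ` ?inv n I) + card ((\<lambda>i. (Suc i, 0::nat)) ` I)"
      unfolding * by (rule card_Un_disjoint) (use finv fin I in auto)
    also have "\<dots> = card (?inv n I) + Suc k"
      using I by (simp add: card_image inj_on_def)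
    finally have "(- 1::real) ^ card (?inv (Suc n) (?b I)) = (- 1) ^ Suc k * (- 1) ^ card (?inv n I)"
      by (simp only: power_add mult.commute)
    moreover have "{j. Suc j \<in> ?b I} = I" "{j. Suc j \<in> - ?b I} = - I" by auto
    then have "nths (v # vs) (?b I) = nths vs I" "nths (v # vs) (- ?b I) = v # nths vs (- I)"
      by (simp_all add: nths_Cons image_iff)
    ultimately show "?t (?b I) = (- 1) ^ Suc k * ((- 1) ^ card (?inv n I) * \<alpha> (nths vs I) * \<beta> (v # nths vs (- I)))"
      by (simp only: mult.assoc)
  qed
  finally show ?thesis .
qed

lemma wedge_1_Cons: "wedge 1 \<alpha> \<beta> (v # vs) = \<alpha> [v] * \<beta> vs - wedge 1 \<alpha> (\<lambda>ws. \<beta> (v # ws)) vs"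
  using wedge_Suc_Cons[of 0 \<alpha> \<beta> v vs] by (simp add: One_nat_def)

lemma wedge_1_linear:
  "wedge 1 \<alpha> (\<lambda>ws. a * \<beta> ws + b * \<gamma> ws) vs = a * wedge 1 \<alpha> \<beta> vs + b * wedge 1 \<alpha> \<gamma> vs"
  by (simp add: wedge_def sum_distrib_left sum.distrib[symmetric] algebra_simps)

lemma wedge_1_cong:
  assumes "\<And>ws. set ws \<subseteq> set vs \<Longrightarrow> Suc (length ws) = length vs \<Longrightarrow> \<beta> ws = \<gamma> ws"
  shows "wedge 1 \<alpha> \<beta> vs = wedge 1 \<alpha> \<gamma> vs"
  using assms
proof (induction vs arbitrary: \<beta> \<gamma>)
  case (Cons v vs)
  have "wedge 1 \<alpha> (\<lambda>ws. \<beta> (v # ws)) vs = wedge 1 \<alpha> (\<lambda>ws. \<gamma> (v # ws)) vs"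
    by (intro Cons.IH Cons.prems) auto
  moreover have "\<beta> vs = \<gamma> vs" by (intro Cons.prems) auto
  ultimately show ?case by (simp add: wedge_1_Cons)
qed simp

lemma skew_on_wedge_1:
  assumes "skew_on V k \<beta>"
  shows "skew_on V (Suc k) (wedge 1 \<alpha> \<beta>)"
proof (rule skew_onI)
  fix xs a b ys
  assume "set xs \<subseteq> V" "a \<in> V" "b \<in> V" "set ys \<subseteq> V" "length xs + length ys + 2 = Suc k"
  then show "wedge 1 \<alpha> \<beta> (xs @ a # b # ys) = - wedge 1 \<alpha> \<beta> (xs @ b # a # ys)"
    using assms
  proof (induction xs arbitrary: k \<beta>)
    case Nil
    have "wedge 1 \<alpha> (\<lambda>ws. \<beta> (a # b # ws)) ys = wedge 1 \<alpha> (\<lambda>ws. (- 1) * \<beta> (b # a # ws) + 0 * \<beta> ws) ys"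
    proof (rule wedge_1_cong)
      fix ws assume "set ws \<subseteq> set ys" "Suc (length ws) = length ys"
      then show "\<beta> (a # b # ws) = (- 1) * \<beta> (b # a # ws) + 0 * \<beta> ws"
        using skew_onD[OF Nil.prems(6), of "[]" a b ws] Nil.prems by (simp add: tuples_def subset_iff)
    qed
    also have "\<dots> = - wedge 1 \<alpha> (\<lambda>ws. \<beta> (b # a # ws)) ys"
      by (simp only: wedge_1_linear)
    finally show ?case by (simp add: wedge_1_Cons)
  next
    case (Cons x xs)
    from Cons.prems(5) obtain l where k: "k = Suc l" by (cases k) auto
    have "skew_on V l (\<lambda>ws. \<beta> (x # ws))"
      using skew_on_prefix[of V 1 l \<beta> "[x]"] Cons.prems k by (simp add: tuples_def One_nat_def)
    then have "wedge 1 \<alpha> (\<lambda>ws. \<beta> (x # ws)) (xs @ a # b # ys) = - wedge 1 \<alpha> (\<lambda>ws. \<beta> (x # ws)) (xs @ b # a # ys)"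
      using Cons.prems k by (intro Cons.IH[of l]) auto
    moreover have "\<beta> (xs @ a # b # ys) = - \<beta> (xs @ b # a # ys)"
      using Cons.prems k by (intro skew_onD[OF Cons.prems(6)]) (simp add: tuples_def)
    ultimately show ?case by (simp add: wedge_1_Cons)
  qed
qed

text \<open>The list is split as prefix, argument and suffix, in place of the list update of
  \<open>alternating_on\<close>; fixing the leading or trailing arguments then amounts to
  concatenation.\<close>

definition multilin_on :: "'a::real_vector set \<Rightarrow> nat \<Rightarrow> 'a aform \<Rightarrow> bool" where
  "multilin_on V k \<omega> \<longleftrightarrow>
     (\<forall>xs ys u w a b. set xs \<subseteq> V \<longrightarrow> u \<in> V \<longrightarrow> w \<in> V \<longrightarrow> set ys \<subseteq> V \<longrightarrow> length xs + length ys + 1 = k \<longrightarrow>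
        \<omega> (xs @ (a *\<^sub>R u + b *\<^sub>R w) # ys) = a * \<omega> (xs @ u # ys) + b * \<omega> (xs @ w # ys))"

lemma multilin_onD:
  assumes "multilin_on V k \<omega>" "set xs \<subseteq> V" "u \<in> V" "w \<in> V" "set ys \<subseteq> V" "length xs + length ys + 1 = k"
  shows "\<omega> (xs @ (a *\<^sub>R u + b *\<^sub>R w) # ys) = a * \<omega> (xs @ u # ys) + b * \<omega> (xs @ w # ys)"
  using assms unfolding multilin_on_def by blast

lemma multilin_on_prefix:
  assumes "multilin_on V (k + l) \<omega>" "us \<in> tuples V k"
  shows "multilin_on V l (\<lambda>xs. \<omega> (us @ xs))"
  unfolding multilin_on_def
proof (intro allI impI)
  fix xs ys u w a b
  assume "set xs \<subseteq> V" "u \<in> V" "w \<in> V" "set ys \<subseteq> V" "length xs + length ys + 1 = l"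
  then show "\<omega> (us @ xs @ (a *\<^sub>R u + b *\<^sub>R w) # ys) = a * \<omega> (us @ xs @ u # ys) + b * \<omega> (us @ xs @ w # ys)"
    using multilin_onD[OF assms(1), of "us @ xs" u w ys a b] assms(2) by (simp add: tuples_def)
qed

lemma multilin_on_suffix:
  assumes "multilin_on V (k + l) \<omega>" "vs \<in> tuples V l"
  shows "multilin_on V k (\<lambda>xs. \<omega> (xs @ vs))"
  unfolding multilin_on_def
proof (intro allI impI)
  fix xs ys u w a b
  assume "set xs \<subseteq> V" "u \<in> V" "w \<in> V" "set ys \<subseteq> V" "length xs + length ys + 1 = k"
  then show "\<omega> ((xs @ (a *\<^sub>R u + b *\<^sub>R w) # ys) @ vs) = a * \<omega> ((xs @ u # ys) @ vs) + b * \<omega> ((xs @ w # ys) @ vs)"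
    using multilin_onD[OF assms(1), of xs u w "ys @ vs" a b] assms(2) by (simp add: tuples_def)
qed

lemma multilin_on_wedge_1:
  assumes "\<And>u w a b. u \<in> V \<Longrightarrow> w \<in> V \<Longrightarrow> \<alpha> [a *\<^sub>R u + b *\<^sub>R w] = a * \<alpha> [u] + b * \<alpha> [w]"
    and "multilin_on V k \<beta>"
  shows "multilin_on V (Suc k) (wedge 1 \<alpha> \<beta>)"
  unfolding multilin_on_def
proof (intro allI impI)
  fix xs ys u w and a b :: real
  assume "set xs \<subseteq> V" "u \<in> V" "w \<in> V" "set ys \<subseteq> V" "length xs + length ys + 1 = Suc k"
  then show "wedge 1 \<alpha> \<beta> (xs @ (a *\<^sub>R u + b *\<^sub>R w) # ys)
    = a * wedge 1 \<alpha> \<beta> (xs @ u # ys) + b * wedge 1 \<alpha> \<beta> (xs @ w # ys)"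
    using assms(2)
  proof (induction xs arbitrary: k \<beta>)
    case Nil
    have "wedge 1 \<alpha> (\<lambda>ws. \<beta> ((a *\<^sub>R u + b *\<^sub>R w) # ws)) ys
        = wedge 1 \<alpha> (\<lambda>ws. a * \<beta> (u # ws) + b * \<beta> (w # ws)) ys"
    proof (rule wedge_1_cong)
      fix ws assume "set ws \<subseteq> set ys" "Suc (length ws) = length ys"
      then show "\<beta> ((a *\<^sub>R u + b *\<^sub>R w) # ws) = a * \<beta> (u # ws) + b * \<beta> (w # ws)"
        using multilin_onD[OF Nil.prems(6), of "[]" u w ws a b] Nil.prems by (simp add: subset_iff)
    qed
    then show ?case using Nil.prems assms(1) by (simp add: wedge_1_Cons wedge_1_linear algebra_simps)
  next
    case (Cons x xs)
    from Cons.prems(5) obtain l where k: "k = Suc l" by (cases k) auto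
    have "multilin_on V l (\<lambda>ws. \<beta> (x # ws))"
      using multilin_on_prefix[of V 1 l \<beta> "[x]"] Cons.prems k by (simp add: tuples_def One_nat_def One_nat_def)
    then have "wedge 1 \<alpha> (\<lambda>ws. \<beta> (x # ws)) (xs @ (a *\<^sub>R u + b *\<^sub>R w) # ys)
      = a * wedge 1 \<alpha> (\<lambda>ws. \<beta> (x # ws)) (xs @ u # ys) + b * wedge 1 \<alpha> (\<lambda>ws. \<beta> (x # ws)) (xs @ w # ys)"
      using Cons.prems k by (intro Cons.IH[of l]) auto
    moreover have "\<beta> (xs @ (a *\<^sub>R u + b *\<^sub>R w) # ys) = a * \<beta> (xs @ u # ys) + b * \<beta> (xs @ w # ys)"
      using Cons.prems k by (intro multilin_onD[OF Cons.prems(6)]) auto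
    ultimately show ?case by (simp add: wedge_1_Cons algebra_simps)
  qed
qed

text \<open>To pass from vanishing on repeated arguments to antisymmetry one polarises with a + b in
  both slots, which is where \<open>V\<close> has to be closed under addition.\<close>

lemma alternating_on_iff:
  assumes V: "subspace V"
  shows "alternating_on V k \<omega> \<longleftrightarrow> multilin_on V k \<omega> \<and> skew_on V k \<omega>"
proof
  assume A: "alternating_on V k \<omega>"
  have m: "multilin_on V k \<omega>"
    unfolding multilin_on_def
  proof (intro allI impI)
    fix xs ys u w a b
    assume *: "set xs \<subseteq> V" "u \<in> V" "w \<in> V" "set ys \<subseteq> V" "length xs + length ys + 1 = k"
    then have "xs @ u # ys \<in> tuples V k" "length xs < k" by (auto simp: tuples_def)
    then have "\<omega> ((xs @ u # ys)[length xs := a *\<^sub>R u + b *\<^sub>R w])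
       = a * \<omega> ((xs @ u # ys)[length xs := u]) + b * \<omega> ((xs @ u # ys)[length xs := w])"
      using A * unfolding alternating_on_def by blast
    then show "\<omega> (xs @ (a *\<^sub>R u + b *\<^sub>R w) # ys) = a * \<omega> (xs @ u # ys) + b * \<omega> (xs @ w # ys)" by simp
  qed
  moreover have "skew_on V k \<omega>"
  proof (rule skew_onI)
    fix xs a b ys assume *: "set xs \<subseteq> V" "a \<in> V" "b \<in> V" "set ys \<subseteq> V" "length xs + length ys + 2 = k"
    have ab: "a + b \<in> V" using V * by (simp add: subspace_add)
    have z: "\<omega> (xs @ u # u # ys) = 0" if "u \<in> V" for u
    proof -
      have "xs @ u # u # ys \<in> tuples V k" "length xs < k" "Suc (length xs) < k"
        using * that by (auto simp: tuples_def)
      moreover have "(xs @ u # u # ys) ! length xs = (xs @ u # u # ys) ! Suc (length xs)"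
        by (simp add: nth_append)
      ultimately show ?thesis using A unfolding alternating_on_def by (metis n_not_Suc_n)
    qed
    have add: "\<omega> (xs @ (a + b) # v # ys) = \<omega> (xs @ a # v # ys) + \<omega> (xs @ b # v # ys)" if "v \<in> V" for v
      using multilin_onD[OF m, of xs a b "v # ys" 1 1] * that by simp
    have add': "\<omega> (xs @ v # (a + b) # ys) = \<omega> (xs @ v # a # ys) + \<omega> (xs @ v # b # ys)" if "v \<in> V" for v
      using multilin_onD[OF m, of "xs @ [v]" a b ys 1 1] * that by simp
    have "\<omega> (xs @ (a + b) # (a + b) # ys) = 0" by (rule z[OF ab])
    then show "\<omega> (xs @ a # b # ys) = - \<omega> (xs @ b # a # ys)"
      using add[OF ab] add'[of a] add'[of b] z[of a] z[of b] * by simp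
  qed
  ultimately show "multilin_on V k \<omega> \<and> skew_on V k \<omega>" by blast
next
  assume A: "multilin_on V k \<omega> \<and> skew_on V k \<omega>"
  show "alternating_on V k \<omega>"
    unfolding alternating_on_def
  proof (intro conjI ballI allI impI)
    fix vs i u w a b assume *: "vs \<in> tuples V k" "i < k" "u \<in> V" "w \<in> V"
    then have "i < length vs" by (simp add: tuples_def)
    moreover have "set (take i vs) \<subseteq> V" "set (drop (Suc i) vs) \<subseteq> V"
      using * set_take_subset set_drop_subset by (fastforce simp: tuples_def)+
    ultimately show "\<omega> (vs[i := a *\<^sub>R u + b *\<^sub>R w]) = a * \<omega> (vs[i := u]) + b * \<omega> (vs[i := w])"
      using A * multilin_onD[of V k \<omega> "take i vs" u w "drop (Suc i) vs" a b]
      by (simp add: upd_conv_take_nth_drop tuples_def)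
  next
    fix vs i j assume *: "vs \<in> tuples V k" "i < k" "j < k" "i \<noteq> j \<and> vs ! i = vs ! j"
    then have "\<not> distinct vs" by (auto simp: tuples_def distinct_conv_nth)
    then show "\<omega> vs = 0" using A * skew_on_not_distinct by blast
  qed
qed

lemma multilin_on_sum_Cons:
  assumes "multilin_on V (Suc k) \<omega>" "subspace V" "finite A" "\<And>j. j \<in> A \<Longrightarrow> u j \<in> V" "vs \<in> tuples V k"
  shows "\<omega> ((\<Sum>j\<in>A. c j *\<^sub>R u j) # vs) = (\<Sum>j\<in>A. c j * \<omega> (u j # vs))"
  using assms(3,4)
proof (induction A)
  case empty
  have "(0::'a) \<in> V" using assms(2) by (rule subspace_0)
  then show ?case using multilin_onD[OF assms(1), of "[]" 0 0 vs 0 0] assms(5) by (simp add: tuples_def)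
next
  case (insert x A)
  have "(\<Sum>j\<in>A. c j *\<^sub>R u j) \<in> V"
    using insert assms(2) by (intro subspace_sum subspace_scale) auto
  then show ?case
    using multilin_onD[OF assms(1), of "[]" "u x" "\<Sum>j\<in>A. c j *\<^sub>R u j" vs "c x" 1] insert assms(5)
    by (simp add: tuples_def)
qed

lemma pr_map_right: "pr A xs (map g ys) = pr (\<lambda>x y. A x (g y)) xs ys"
  by (induction xs ys rule: list_induct2') auto

section \<open>Coframes\<close>

locale coframed =
  fixes V :: "'a::real_vector set" and f :: "nat \<Rightarrow> 'a aform"
  assumes subspace: "subspace V" and coframe: "coframe V f"
begin

abbreviation F :: "nat \<Rightarrow> 'a" where "F \<equiv> dual_frame V f"

abbreviation vol :: "'a aform" where "vol \<equiv> coframe_wedge f [1,2,3,4,5,6,7]"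

lemma ex1: "\<exists>!v. v \<in> V \<and> (\<forall>i\<in>{1..7}. f i [v] = c i)"
  using coframe by (simp add: coframe_def)

text \<open>\<open>dual_in\<close> holds for every index \<open>j\<close>: outside {1..7} all
  prescribed values are 0 and \<open>F j\<close> is the zero vector. Hence \<open>map F xs\<close>
  is a list in \<open>V\<close> for any \<open>xs\<close>.\<close>

lemma dual_in [simp]: "F j \<in> V" and dual: "i \<in> {1..7} \<Longrightarrow> f i [F j] = (if i = j then 1 else 0)"
  using theI'[OF ex1[of "\<lambda>i. if i = j then 1 else 0"]] by (auto simp: dual_frame_def)

lemma linear:
  assumes "i \<in> {1..7}" "u \<in> V" "w \<in> V"
  shows "f i [a *\<^sub>R u + b *\<^sub>R w] = a * f i [u] + b * f i [w]"
proof -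
  have "multilin_on V 1 (f i)"
    using coframe assms(1) by (auto simp: coframe_def alternating_on_iff[OF subspace])
  from multilin_onD[OF this, of "[]" u w "[]" a b] show ?thesis using assms by simp
qed

lemma zero: "i \<in> {1..7} \<Longrightarrow> f i [0] = 0"
  using linear[of i 0 0 0 0] subspace_0[OF subspace] by simp

lemma linear_sum:
  assumes "i \<in> {1..7}" "finite A" "\<And>j. j \<in> A \<Longrightarrow> u j \<in> V"
  shows "f i [\<Sum>j\<in>A. c j *\<^sub>R u j] = (\<Sum>j\<in>A. c j * f i [u j])"
proof -
  have "multilin_on V 1 (f i)"
    using coframe assms(1) by (auto simp: coframe_def alternating_on_iff[OF subspace])
  then show ?thesis using multilin_on_sum_Cons[of V 0 "f i" A u "[]" c] assms subspace by (simp add: One_nat_def)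
qed

lemma eqI:
  assumes "u \<in> V" "w \<in> V" "\<And>i. i \<in> {1..7} \<Longrightarrow> f i [u] = f i [w]"
  shows "u = w"
  using ex1[of "\<lambda>i. f i [w]"] assms by auto

lemma sum_in: "(\<Sum>j\<in>A. c j *\<^sub>R F j) \<in> V"
  by (intro subspace_sum subspace_scale subspace) simp

lemma expand:
  assumes "v \<in> V"
  shows "v = (\<Sum>j\<in>{1..7}. f j [v] *\<^sub>R F j)"
proof (rule eqI)
  fix i :: nat assume i: "i \<in> {1..7}"
  have "f i [\<Sum>j\<in>{1..7}. f j [v] *\<^sub>R F j] = (\<Sum>j\<in>{1..7}. f j [v] * f i [F j])"
    using i by (intro linear_sum) auto
  also have "\<dots> = (\<Sum>j\<in>{1..7}. if j = i then f j [v] else 0)"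
    using i by (intro sum.cong refl) (simp add: dual)
  also have "\<dots> = f i [v]" using i by (simp add: sum.delta)
  finally show "f i [v] = f i [\<Sum>j\<in>{1..7}. f j [v] *\<^sub>R F j]" ..
qed (use assms sum_in in auto)

text \<open>Each argument is expanded in the dual frame, so the coefficients form the tensor power
  of the coordinates. Identities of forms are later reduced to their components through
  this.\<close>

lemma multilin_on_expand:
  assumes "multilin_on V k \<omega>" "vs \<in> tuples V k"
  shows "\<omega> vs = (\<Sum>is\<in>tuples {1..7} k. pr (\<lambda>i v. f i [v]) is vs * \<omega> (map F is))"
  using assms
proof (induction vs arbitrary: k \<omega>)
  case (Cons v vs)
  then obtain l where k: "k = Suc l" and v: "v \<in> V" "vs \<in> tuples V l" by (auto simp: Cons_tuples)
  have "\<omega> (v # vs) = (\<Sum>j\<in>{1..7}. f j [v] * \<omega> (F j # vs))"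
    by (subst expand[OF v(1)])
       (rule multilin_on_sum_Cons[of V l], use Cons.prems k v subspace in auto)
  also have "\<dots> = (\<Sum>j\<in>{1..7}. f j [v] * (\<Sum>is\<in>tuples {1..7} l. pr (\<lambda>i v. f i [v]) is vs * \<omega> (F j # map F is)))"
  proof (intro sum.cong refl arg_cong2[where f = "(*)"])
    fix j
    have "multilin_on V l (\<lambda>ws. \<omega> (F j # ws))"
      using multilin_on_prefix[of V 1 l \<omega> "[F j]"] Cons.prems k by (simp add: tuples_def One_nat_def)
    from Cons.IH[OF this v(2)]
    show "\<omega> (F j # vs) = (\<Sum>is\<in>tuples {1..7} l. pr (\<lambda>i v. f i [v]) is vs * \<omega> (F j # map F is))" .
  qed
  finally show ?case by (simp add: k sum_tuples_Suc sum_distrib_left mult.assoc)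
qed simp

lemma multilin_on_eqI:
  assumes "multilin_on V k \<omega>" "multilin_on V k \<omega>'" "vs \<in> tuples V k"
    and "\<And>is. is \<in> tuples {1..7} k \<Longrightarrow> \<omega> (map F is) = \<omega>' (map F is)"
  shows "\<omega> vs = \<omega>' vs"
  using assms by (simp add: multilin_on_expand[of k \<omega>] multilin_on_expand[of k \<omega>'])

lemma antisym_coframe_wedge: "skew_on S (length is) (coframe_wedge g is)"
proof (induction "is")
  case Nil
  then show ?case by (intro skew_onI) simp
next
  case (Cons i "is")
  then show ?case using skew_on_wedge_1 by auto
qed

lemma multilin_coframe_wedge: "set is \<subseteq> {1..7} \<Longrightarrow> multilin_on V (length is) (coframe_wedge f is)"
proof (induction "is")
  case Nil
  then show ?case by (simp add: multilin_on_def)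
next
  case (Cons i "is")
  then show ?case
    using multilin_on_wedge_1[of V "f i" "length is" "coframe_wedge f is"] linear[of i] by simp
qed

lemma alternating_coframe_wedge: "set is \<subseteq> {1..7} \<Longrightarrow> alternating_on V (length is) (coframe_wedge f is)"
  by (simp add: alternating_on_iff[OF subspace] antisym_coframe_wedge multilin_coframe_wedge)

lemma wedge_dual_notin:
  assumes "i \<in> {1..7}" "i \<notin> set xs"
  shows "wedge 1 (f i) \<beta> (map F xs) = 0"
  using assms
proof (induction xs arbitrary: \<beta>)
  case (Cons x xs)
  have "wedge 1 (f i) (\<lambda>ws. \<beta> (F x # ws)) (map F xs) = 0"
    by (rule Cons.IH) (use Cons.prems in auto)
  then show ?case using Cons.prems by (simp only: list.map wedge_1_Cons) (simp add: dual)
qed simp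

lemma coframe_wedge_dual: "distinct is \<Longrightarrow> set is \<subseteq> {1..7} \<Longrightarrow> coframe_wedge f is (map F is) = 1"
proof (induction "is")
  case (Cons i "is")
  have "wedge 1 (f i) (\<lambda>ws. coframe_wedge f is (F i # ws)) (map F is) = 0"
    by (rule wedge_dual_notin) (use Cons.prems in auto)
  then show ?case using Cons by (simp only: list.map wedge_1_Cons coframe_wedge.simps) (simp add: dual)
qed simp

lemma sorted_list_17: "sorted_list_of_set {1..7::nat} = [1,2,3,4,5,6,7]"
proof -
  have "{1..7::nat} = set [1,2,3,4,5,6,7]" by auto
  then show ?thesis by (simp only: sorted_list_of_set_sort_remdups) simp
qed

lemma alternating_top:
  assumes "alternating_on V 7 \<mu>" "xs \<in> tuples {1..7} 7"
  shows "\<mu> (map F xs) = \<mu> (map F [1,2,3,4,5,6,7]) * eps xs"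
proof -
  have "skew_on {1..7} 7 (\<lambda>xs. \<mu> (map F xs))"
  proof (rule skew_onI)
    fix xs ys :: "nat list" and a b assume "length xs + length ys + 2 = 7"
    then have "map F xs @ F a # F b # map F ys \<in> tuples V 7" by (auto simp: tuples_def)
    then show "\<mu> (map F (xs @ a # b # ys)) = - \<mu> (map F (xs @ b # a # ys))"
      using assms(1) skew_onD by (fastforce simp: alternating_on_iff[OF subspace])
  qed
  then show ?thesis using assms(2) skew_on_top[of "{1..7}" "\<lambda>xs. \<mu> (map F xs)" xs]
    by (simp add: sorted_list_17)
qed

lemma alternating_vol: "alternating_on V 7 vol"
  using alternating_coframe_wedge[of "[1,2,3,4,5,6,7]"]
  by (simp add: eval_nat_numeral One_nat_def del: coframe_wedge.simps)

lemma vol_dual: "xs \<in> tuples {1..7} 7 \<Longrightarrow> vol (map F xs) = eps xs"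
  using alternating_top[OF alternating_vol] coframe_wedge_dual[of "[1,2,3,4,5,6,7]"]
  by (simp del: coframe_wedge.simps list.map)

lemma alternating_top_vol:
  assumes "alternating_on V 7 \<mu>" "vs \<in> tuples V 7"
  shows "\<mu> vs = \<mu> (map F [1,2,3,4,5,6,7]) * vol vs"
proof -
  have m: "multilin_on V 7 \<mu>" "multilin_on V 7 vol"
    using assms(1) alternating_vol by (auto simp: alternating_on_iff[OF subspace])
  show ?thesis
    unfolding multilin_on_expand[OF m(1) assms(2)] multilin_on_expand[OF m(2) assms(2)] sum_distrib_left
    by (intro sum.cong refl) (simp only: alternating_top[OF assms(1)] vol_dual mult_ac)
qed

end

section \<open>Two coframes on the same space\<close>

lemma sum_rotate:
  "(\<Sum>x\<in>A. \<Sum>y\<in>B. \<Sum>z\<in>C. h x y z) = (\<Sum>y\<in>B. \<Sum>z\<in>C. \<Sum>x\<in>A. h x y z)"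
proof -
  have "(\<Sum>x\<in>A. \<Sum>y\<in>B. \<Sum>z\<in>C. h x y z) = (\<Sum>y\<in>B. \<Sum>x\<in>A. \<Sum>z\<in>C. h x y z)"
    by (rule sum.swap)
  also have "\<dots> = (\<Sum>y\<in>B. \<Sum>z\<in>C. \<Sum>x\<in>A. h x y z)"
    by (intro sum.cong refl) (rule sum.swap)
  finally show ?thesis .
qed

lemma sum_product_scaled:
  fixes c :: real
  shows "(\<Sum>l\<in>S. A l * w l) * (c * (\<Sum>m\<in>T. B m * v m)) = (\<Sum>l\<in>S. \<Sum>m\<in>T. c * (w l * v m) * (A l * B m))"
proof -
  have "(\<Sum>l\<in>S. A l * w l) * (c * (\<Sum>m\<in>T. B m * v m)) = c * ((\<Sum>l\<in>S. A l * w l) * (\<Sum>m\<in>T. B m * v m))"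
    by simp
  also have "\<dots> = (\<Sum>l\<in>S. \<Sum>m\<in>T. c * (w l * v m) * (A l * B m))"
    apply (simp only: sum_product)
    unfolding sum_distrib_left by (intro sum.cong refl) (simp only: mult_ac)
  finally show ?thesis .
qed

locale coframed_pair = e: coframed V e + f: coframed V f
  for V :: "'a::real_vector set" and e f :: "nat \<Rightarrow> 'a aform"
begin

text \<open>\<open>N\<close> and \<open>M\<close> are the mutually inverse transition matrices,
  \<open>c\<close> is the volume factor (\<open>vol_f_e\<close>), and \<open>\<G>\<close> is the
  Gram matrix of the covectors of \<open>e\<close> in the metric of \<open>f\<close>, that is, the
  inverse metric of \<open>f\<close> in the frame of \<open>e\<close>.\<close>

definition "N y x = f y [e.F x]"
definition "M x y = e x [f.F y]"
definition "c = f.vol (map e.F [1,2,3,4,5,6,7])"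
definition "\<G> x z = (\<Sum>y\<in>{1..7}. M x y * M z y)"

lemma M_N:
  assumes "x \<in> {1..7}" "z \<in> {1..7}"
  shows "(\<Sum>y\<in>{1..7}. M x y * N y z) = (if x = z then 1 else 0)"
proof -
  have "e x [e.F z] = e x [\<Sum>y\<in>{1..7}. f y [e.F z] *\<^sub>R f.F y]"
    by (subst f.expand[of "e.F z"]) auto
  also have "\<dots> = (\<Sum>y\<in>{1..7}. f y [e.F z] * e x [f.F y])"
    using assms by (intro e.linear_sum) auto
  finally show ?thesis using assms by (simp add: e.dual M_def N_def mult.commute)
qed

lemma N_M:
  assumes "x \<in> {1..7}" "z \<in> {1..7}"
  shows "(\<Sum>y\<in>{1..7}. N x y * M y z) = (if x = z then 1 else 0)"
proof -
  have "f x [f.F z] = f x [\<Sum>y\<in>{1..7}. e y [f.F z] *\<^sub>R e.F y]"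
    by (subst e.expand[of "f.F z"]) auto
  also have "\<dots> = (\<Sum>y\<in>{1..7}. e y [f.F z] * f x [e.F y])"
    using assms by (intro f.linear_sum) auto
  finally show ?thesis using assms by (simp add: f.dual M_def N_def mult.commute)
qed

lemma comp_e_f:
  "multilin_on V k \<omega> \<Longrightarrow> xs \<in> tuples {1..7} k \<Longrightarrow>
    \<omega> (map e.F xs) = (\<Sum>ys\<in>tuples {1..7} k. pr N ys xs * \<omega> (map f.F ys))"
  using f.multilin_on_expand[of k \<omega> "map e.F xs"]
  by (simp add: map_tuples[where A = "{1..7}"] pr_map_right N_def[abs_def])

lemma comp_f_e:
  "multilin_on V k \<omega> \<Longrightarrow> xs \<in> tuples {1..7} k \<Longrightarrow>
    \<omega> (map f.F xs) = (\<Sum>ys\<in>tuples {1..7} k. pr M ys xs * \<omega> (map e.F ys))"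
  using e.multilin_on_expand[of k \<omega> "map f.F xs"]
  by (simp add: map_tuples[where A = "{1..7}"] pr_map_right M_def[abs_def])

lemma vol_f_e: "vs \<in> tuples V 7 \<Longrightarrow> f.vol vs = c * e.vol vs"
  unfolding c_def by (rule e.alternating_top_vol[OF f.alternating_vol])

lemma vol_e_f: "e.vol (map f.F [1,2,3,4,5,6,7]) * c = 1"
proof -
  have "f.vol (map f.F [1,2,3,4,5,6,7]) = 1"
    by (rule f.coframe_wedge_dual) auto
  moreover have "map f.F [1,2,3,4,5,6,7] \<in> tuples V 7"
    by (auto simp: tuples_def)
  ultimately show ?thesis using vol_f_e by (metis mult.commute)
qed

text \<open>Both sides are the value of \<open>f.vol\<close> on frame vectors of \<open>e\<close>;
  thus \<open>c\<close> is the determinant of \<open>N\<close>.\<close>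

lemma eps_N:
  assumes "xs \<in> tuples {1..7} 7"
  shows "(\<Sum>ys\<in>tuples {1..7} 7. eps ys * pr N ys xs) = c * eps xs"
proof -
  have "map e.F xs \<in> tuples V 7" using assms by (auto simp: tuples_def)
  then have "c * eps xs = f.vol (map e.F xs)" using vol_f_e e.vol_dual[OF assms] by simp
  also have "\<dots> = (\<Sum>ys\<in>tuples {1..7} 7. pr N ys xs * f.vol (map f.F ys))"
    using comp_e_f[of 7 f.vol] assms f.alternating_vol by (simp only: alternating_on_iff[OF e.subspace])
  also have "\<dots> = (\<Sum>ys\<in>tuples {1..7} 7. eps ys * pr N ys xs)"
    by (intro sum.cong refl) (simp only: f.vol_dual mult.commute)
  finally show ?thesis ..
qed

lemma eps_N_transpose:
  assumes "ys \<in> tuples {1..7} 7"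
  shows "(\<Sum>xs\<in>tuples {1..7} 7. eps xs * pr N ys xs) = c * eps ys"
  using eps_det_transpose[where I = "{1..7}" and A = N and c = c and ys = ys] eps_N assms by simp

lemma pr_M_M:
  "xs \<in> tuples {1..7} k \<Longrightarrow> zs \<in> tuples {1..7} k \<Longrightarrow>
    (\<Sum>ys\<in>tuples {1..7} k. pr M xs ys * pr M zs ys) = pr \<G> xs zs"
  using pr_comp[where xs = xs and k = k and zs = zs and I = "{1..7}" and A = M and B = "\<lambda>x y. M y x"]
  by (simp add: length_tuples pr_transpose[of M] \<G>_def[abs_def])

text \<open>After the sum over subsets is replaced by 1/k! times the sum over tuples, both factors
  are expanded from the frame of \<open>f\<close> to that of \<open>e\<close>; the sum over
  \<open>f\<close>-indices leaves the Gram matrix. So \<open>f\<close> enters its Hodge operator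
  only through \<open>c\<close> and \<open>\<G>\<close>.\<close>

lemma hodge_e:
  assumes \<omega>: "alternating_on V k \<omega>" and k: "k + l = 7" and vs: "vs \<in> tuples V l"
  shows "coframe_hodge V f k \<omega> vs = c / fact k *
    (\<Sum>ls\<in>tuples {1..7} k. \<Sum>ms\<in>tuples {1..7} k. \<omega> (map e.F ls) * pr \<G> ls ms * e.vol (map e.F ms @ vs))"
proof -
  let ?T = "tuples {1..7::nat} k"
  have mo: "multilin_on V k \<omega>" "skew_on V k \<omega>"
    and mv: "multilin_on V 7 e.vol" "multilin_on V 7 f.vol" "skew_on V 7 f.vol"
    using \<omega> e.alternating_vol f.alternating_vol by (auto simp: alternating_on_iff[OF e.subspace])
  have mv': "multilin_on V k (\<lambda>us. e.vol (us @ vs))"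
    using multilin_on_suffix[of V k l] mv vs k by simp
  have a1: "skew_on {1..7} k (\<lambda>xs. \<omega> (map f.F xs))"
  proof (rule skew_onI)
    fix xs ys :: "nat list" and a b assume "length xs + length ys + 2 = k"
    then have "map f.F xs @ f.F a # f.F b # map f.F ys \<in> tuples V k" by (auto simp: tuples_def)
    from skew_onD[OF mo(2) this]
    show "\<omega> (map f.F (xs @ a # b # ys)) = - \<omega> (map f.F (xs @ b # a # ys))" by simp
  qed
  have a2: "skew_on {1..7} k (\<lambda>xs. f.vol (map f.F xs @ vs))"
  proof (rule skew_onI)
    fix xs ys :: "nat list" and a b assume "length xs + length ys + 2 = k"
    then have "map f.F xs @ f.F a # f.F b # (map f.F ys @ vs) \<in> tuples V 7"
      using vs k by (auto simp: tuples_def)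
    from skew_onD[OF mv(3) this]
    show "f.vol (map f.F (xs @ a # b # ys) @ vs) = - f.vol (map f.F (xs @ b # a # ys) @ vs)"
      by (simp del: coframe_wedge.simps)
  qed
  have "fact k * coframe_hodge V f k \<omega> vs = (\<Sum>xs\<in>?T. \<omega> (map f.F xs) * f.vol (map f.F xs @ vs))"
    by (subst sum_tuples_subsets[OF _ a1 a2]) (simp_all add: coframe_hodge_def Let_def del: coframe_wedge.simps)
  also have "\<dots> = (\<Sum>xs\<in>?T. (\<Sum>ls\<in>?T. pr M ls xs * \<omega> (map e.F ls)) * (c * (\<Sum>ms\<in>?T. pr M ms xs * e.vol (map e.F ms @ vs))))"
  proof (intro sum.cong refl arg_cong2[where f = "(*)"])
    fix xs assume xs: "xs \<in> ?T"
    show "\<omega> (map f.F xs) = (\<Sum>ls\<in>?T. pr M ls xs * \<omega> (map e.F ls))"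
      by (rule comp_f_e[OF mo(1) xs])
    have "map f.F xs @ vs \<in> tuples V 7"
      using xs vs k by (auto simp: tuples_def)
    then show "f.vol (map f.F xs @ vs) = c * (\<Sum>ms\<in>?T. pr M ms xs * e.vol (map e.F ms @ vs))"
      using comp_f_e[OF mv' xs] vol_f_e by simp
  qed
  also have "\<dots> = (\<Sum>xs\<in>?T. \<Sum>ls\<in>?T. \<Sum>ms\<in>?T. c * (\<omega> (map e.F ls) * e.vol (map e.F ms @ vs)) * (pr M ls xs * pr M ms xs))"
    unfolding sum_product_scaled ..
  also have "\<dots> = (\<Sum>ls\<in>?T. \<Sum>ms\<in>?T. \<Sum>xs\<in>?T. c * (\<omega> (map e.F ls) * e.vol (map e.F ms @ vs)) * (pr M ls xs * pr M ms xs))"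
    by (rule sum_rotate)
  also have "\<dots> = (\<Sum>ls\<in>?T. \<Sum>ms\<in>?T. c * (\<omega> (map e.F ls) * e.vol (map e.F ms @ vs)) * pr \<G> ls ms)"
    unfolding sum_distrib_left[symmetric] by (intro sum.cong refl) (simp only: pr_M_M)
  also have "\<dots> = c * (\<Sum>ls\<in>?T. \<Sum>ms\<in>?T. \<omega> (map e.F ls) * pr \<G> ls ms * e.vol (map e.F ms @ vs))"
    unfolding sum_distrib_left by (intro sum.cong refl) (simp only: mult_ac)
  finally show ?thesis by (simp add: field_simps del: coframe_wedge.simps)
qed

text \<open>The pair (e, e) has volume factor 1 and the identity as Gram matrix, so
  \<open>hodge_e\<close> gives the same formula for both operators.\<close>

lemma hodge_eqI:
  assumes "c = 1" "\<And>x z. x \<in> {1..7} \<Longrightarrow> z \<in> {1..7} \<Longrightarrow> \<G> x z = (if x = z then 1 else 0)"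
    and \<omega>: "alternating_on V k \<omega>" and k: "k + l = 7" and vs: "vs \<in> tuples V l"
  shows "coframe_hodge V f k \<omega> vs = coframe_hodge V e k \<omega> vs"
proof -
  interpret ee: coframed_pair V e e by unfold_locales
  have M: "ee.M x y = (if x = y then 1 else 0)" if "x \<in> {1..7}" for x y
    using that by (simp add: ee.M_def e.dual)
  have G: "ee.\<G> x z = (if x = z then 1 else 0)" if "x \<in> {1..7}" "z \<in> {1..7}" for x z
  proof -
    have "ee.\<G> x z = (\<Sum>y\<in>{1..7}. if y = x then ee.M z y else 0)"
      unfolding ee.\<G>_def using that by (intro sum.cong refl) (auto simp: M)
    then show ?thesis using that by (simp add: sum.delta M eq_commute)
  qed
  have "ee.c = 1" unfolding ee.c_def by (rule e.coframe_wedge_dual) auto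
  moreover have "pr \<G> ls ms = pr ee.\<G> ls ms" if "ls \<in> tuples {1..7} k" "ms \<in> tuples {1..7} k" for ls ms
  proof (rule pr_cong)
    fix x y assume "x \<in> set ls" "y \<in> set ms"
    then have "x \<in> {1..7}" "y \<in> {1..7}" using that by (meson set_tuples subsetD)+
    then show "\<G> x y = ee.\<G> x y" by (simp only: assms(2) G)
  qed
  ultimately show ?thesis
    unfolding hodge_e[OF \<omega> k vs] ee.hodge_e[OF \<omega> k vs] using assms(1)
    by (simp del: coframe_wedge.simps)
qed

text \<open>The hypothesis says that \<open>M\<close> times its transpose is 1. Hence the inverse
  \<open>N\<close> is the transpose of \<open>M\<close>, and the product in the other order is 1
  too; that order occurs in the metric on vectors.\<close>

lemma metric_eqI:
  assumes G: "\<And>x z. x \<in> {1..7} \<Longrightarrow> z \<in> {1..7} \<Longrightarrow> \<G> x z = (if x = z then 1 else 0)"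
    and v: "v \<in> V" "w \<in> V"
  shows "coframe_metric f v w = coframe_metric e v w"
proof -
  have e: "e i [v] = (\<Sum>j\<in>{1..7}. f j [v] * M i j)" if "v \<in> V" "i \<in> {1..7}" for v i
    by (subst f.expand[OF that(1)], subst e.linear_sum) (use that in \<open>auto simp: M_def\<close>)
  have MN: "M x y = N y x" if "x \<in> {1..7}" "y \<in> {1..7}" for x y
  proof -
    have "M x y = (\<Sum>z\<in>{1..7}. if z = y then M x z else 0)"
      using that by (simp add: sum.delta)
    also have "\<dots> = (\<Sum>z\<in>{1..7}. (\<Sum>u\<in>{1..7}. N y u * M u z) * M x z)"
      using that by (intro sum.cong refl) (auto simp: N_M)
    also have "\<dots> = (\<Sum>u\<in>{1..7}. N y u * \<G> u x)"
      unfolding \<G>_def sum_distrib_left sum_distrib_right by (subst sum.swap) (simp only: mult_ac)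
    also have "\<dots> = (\<Sum>u\<in>{1..7}. if u = x then N y u else 0)"
      using that by (intro sum.cong refl) (auto simp: G)
    finally show ?thesis using that by (simp add: sum.delta)
  qed
  have MM: "(\<Sum>i\<in>{1..7}. M i j * M i k) = (if j = k then 1 else 0)" if "j \<in> {1..7}" "k \<in> {1..7}" for j k
    using N_M[OF that] that by (simp add: MN)
  have "coframe_metric e v w = (\<Sum>i\<in>{1..7}. \<Sum>j\<in>{1..7}. \<Sum>k\<in>{1..7}. f j [v] * f k [w] * (M i j * M i k))"
    unfolding coframe_metric_def using v
  proof (intro sum.cong refl)
    fix i :: nat assume i: "i \<in> {1..7}"
    show "e i [v] * e i [w] = (\<Sum>j\<in>{1..7}. \<Sum>k\<in>{1..7}. f j [v] * f k [w] * (M i j * M i k))"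
      unfolding e[OF v(1) i] e[OF v(2) i] sum_product
      by (intro sum.cong refl) (simp only: mult_ac)
  qed
  also have "\<dots> = (\<Sum>j\<in>{1..7}. \<Sum>k\<in>{1..7}. \<Sum>i\<in>{1..7}. f j [v] * f k [w] * (M i j * M i k))"
    by (rule sum_rotate)
  also have "\<dots> = (\<Sum>j\<in>{1..7}. \<Sum>k\<in>{1..7}. if j = k then f j [v] * f k [w] else 0)"
    unfolding sum_distrib_left[symmetric] by (intro sum.cong refl) (simp add: MM)
  also have "\<dots> = coframe_metric f v w"
    by (simp add: coframe_metric_def)
  finally show ?thesis ..
qed

end

section \<open>Increasing multi-indices\<close>

text \<open>An executable list of the increasing multi-indices: identities between antisymmetric
  functions become finite case distinctions for the simplifier.\<close>

fun combs :: "nat \<Rightarrow> 'a list \<Rightarrow> 'a list list" where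
  "combs 0 xs = [[]]"
| "combs (Suc k) [] = []"
| "combs (Suc k) (x # xs) = map ((#) x) (combs k xs) @ combs (Suc k) xs"

lemma in_combs:
  assumes "sorted xs" "distinct xs" "sorted ys" "distinct ys" "set ys \<subseteq> set xs"
  shows "ys \<in> set (combs (length ys) (xs :: nat list))"
  using assms
proof (induction xs arbitrary: ys)
  case (Cons x xs)
  show ?case
  proof (cases ys)
    case (Cons y zs)
    show ?thesis
    proof (cases "x = y")
      case True
      have "set zs \<subseteq> set xs" using Cons.prems Cons True by auto
      then have "zs \<in> set (combs (length zs) xs)" using Cons.prems Cons by (intro Cons.IH) auto
      then show ?thesis using Cons True by simp
    next
      case False
      then have "y \<in> set xs" using Cons.prems Cons by auto
      then have "x \<le> y" using Cons.prems by simp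
      then have "x < y" using False by simp
      then have "x \<notin> set ys" using Cons.prems Cons by auto
      then have "ys \<in> set (combs (length ys) xs)" using Cons.prems by (intro Cons.IH) auto
      then show ?thesis using Cons by simp
    qed
  qed simp
qed simp

text \<open>The value on a list without repetitions is determined by the value on its sorted
  version, so at most 35 values have to be compared.\<close>

lemma skew_on_eqI:
  assumes "skew_on {1..7} k h" "skew_on {1..7} k h'"
    and "\<And>is. is \<in> set (combs k [1,2,3,4,5,6,7]) \<Longrightarrow> h is = h' is"
    and "xs \<in> tuples {1..7::nat} k"
  shows "h xs = h' xs"
proof (cases "distinct xs")
  case True
  let ?s = "sorted_list_of_set (set xs)"
  have "length ?s = k" "set ?s \<subseteq> set [1,2,3,4,5,6,7]"
    using assms(4) True by (auto simp: tuples_def distinct_card)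
  then have "?s \<in> set (combs k [1,2,3,4,5,6,7])"
    using in_combs[of "[1,2,3,4,5,6,7]" ?s] by simp
  then show ?thesis
    using skew_on_sort[OF assms(1,4) True] skew_on_sort[OF assms(2,4) True] assms(3) by simp
qed (use assms skew_on_not_distinct in metis)

lemma alternating_on_sum:
  assumes V: "subspace V" and "\<And>i. i \<in> A \<Longrightarrow> alternating_on V k (h i)"
  shows "alternating_on V k (\<lambda>vs. \<Sum>i\<in>A. c i * h i vs)"
  unfolding alternating_on_iff[OF V]
proof
  show "skew_on V k (\<lambda>vs. \<Sum>i\<in>A. c i * h i vs)"
    using assms by (intro skew_on_sum) (simp add: alternating_on_iff[OF V])
  have m: "multilin_on V k (h i)" if "i \<in> A" for i
    using assms that by (simp add: alternating_on_iff[OF V])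
  show "multilin_on V k (\<lambda>vs. \<Sum>i\<in>A. c i * h i vs)"
    unfolding multilin_on_def sum_distrib_left sum.distrib[symmetric]
    by (intro allI impI sum.cong refl) (simp add: multilin_onD[OF m] algebra_simps)
qed

lemma alternating_on_prefix:
  assumes V: "subspace V" and "alternating_on V (k + l) \<omega>" "us \<in> tuples V k"
  shows "alternating_on V l (\<lambda>vs. \<omega> (us @ vs))"
  using assms multilin_on_prefix skew_on_prefix unfolding alternating_on_iff[OF V] by blast

lemma alternating_on_cong:
  assumes V: "subspace V" and "\<And>vs. vs \<in> tuples V k \<Longrightarrow> \<omega> vs = \<omega>' vs"
  shows "alternating_on V k \<omega> \<longleftrightarrow> alternating_on V k \<omega>'"
proof -
  have *: "alternating_on V k \<omega>'"
    if eq: "\<And>vs. vs \<in> tuples V k \<Longrightarrow> \<omega> vs = \<omega>' vs" and a: "alternating_on V k \<omega>" for \<omega> \<omega>' :: "'a aform"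
    unfolding alternating_on_iff[OF V]
  proof
    show "multilin_on V k \<omega>'" unfolding multilin_on_def
    proof (intro allI impI)
      fix xs ys u w a b
      assume *: "set xs \<subseteq> V" "u \<in> V" "w \<in> V" "set ys \<subseteq> V" "length xs + length ys + 1 = k"
      then have "a *\<^sub>R u + b *\<^sub>R w \<in> V" by (intro subspace_add subspace_scale V)
      with * have t: "xs @ v # ys \<in> tuples V k" if "v \<in> {u, w, a *\<^sub>R u + b *\<^sub>R w}" for v
        using that by (auto simp: tuples_def)
      have m: "multilin_on V k \<omega>" using a by (simp add: alternating_on_iff[OF V])
      show "\<omega>' (xs @ (a *\<^sub>R u + b *\<^sub>R w) # ys) = a * \<omega>' (xs @ u # ys) + b * \<omega>' (xs @ w # ys)"
        using multilin_onD[OF m *, of a b] eq[OF t[of u]] eq[OF t[of w]] eq[OF t[of "a *\<^sub>R u + b *\<^sub>R w"]]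
        by simp
    qed
    show "skew_on V k \<omega>'"
    proof (rule skew_onI)
      fix xs a b ys
      assume *: "set xs \<subseteq> V" "a \<in> V" "b \<in> V" "set ys \<subseteq> V" "length xs + length ys + 2 = k"
      then have t: "xs @ a # b # ys \<in> tuples V k" "xs @ b # a # ys \<in> tuples V k"
        by (simp_all add: tuples_def)
      have "skew_on V k \<omega>" using a by (simp add: alternating_on_iff[OF V])
      from skew_onD[OF this t(1)] show "\<omega>' (xs @ a # b # ys) = - \<omega>' (xs @ b # a # ys)"
        using eq t by simp
    qed
  qed
  show ?thesis using *[of \<omega> \<omega>'] *[of \<omega>' \<omega>] assms(2) by metis
qed

section \<open>Components of the standard forms\<close>

text \<open>For increasing \<open>I\<close> these are the components of the basis form f^I, see
  \<open>coframe_wedge_comp\<close>.\<close>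

definition cw :: "nat list \<Rightarrow> nat list \<Rightarrow> real" where
  "cw I xs = (if sort xs = I then eps xs else 0)"

lemma cw_antisym: "cw I (xs @ a # b # ys) = - cw I (xs @ b # a # ys)"
proof -
  have "sort (xs @ a # b # ys) = sort (xs @ b # a # ys)"
    by (rule properties_for_sort) simp_all
  then show ?thesis unfolding cw_def using eps_antisym[of xs a b ys] by simp
qed

lemma cw_Nil: "cw I [] = (if I = [] then 1 else 0)"
  by (auto simp: cw_def)

text \<open>Contracting a basis form with the i-th frame vector removes \<open>i\<close> from
  \<open>I\<close>, with the sign of moving it to the front. As a rewrite rule this evaluates
  \<open>cw\<close> even when the tail of the list is a variable.\<close>

lemma cw_Cons:
  assumes "sorted I"
  shows "cw I (i # ps) = (if i \<in> set I then eps (i # remove1 i I) * cw (remove1 i I) ps else 0)"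
proof -
  have iff: "sort (i # ps) = I \<longleftrightarrow> i \<in> set I \<and> sort ps = remove1 i I"
  proof
    assume s: "sort (i # ps) = I"
    then have "i \<in> set I" by (metis list.set_intros(1) set_sort)
    moreover have "sort ps = remove1 i I" unfolding s[symmetric] by simp
    ultimately show "i \<in> set I \<and> sort ps = remove1 i I" ..
  next
    assume i: "i \<in> set I \<and> sort ps = remove1 i I"
    then have "mset ps = mset I - {#i#}" by (metis mset_remove1 mset_sort)
    moreover have "i \<in># mset I" using i by simp
    ultimately have "mset I = mset (i # ps)" by simp
    then show "sort (i # ps) = I" using assms by (intro properties_for_sort)
  qed
  have "eps (i # ps) = eps (i # remove1 i I) * eps ps" if "sort ps = remove1 i I" "eps ps \<noteq> 0"
  proof -
    let ?g = "\<lambda>y. if i < y then 1 else if y < i then - 1 else (0::real)"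
    have m: "mset (remove1 i I) = mset ps" using that(1) by (metis mset_sort)
    have "distinct ps" using that(2) eps_not_distinct by blast
    then have "eps (remove1 i I) = 1" using that(1) by (metis distinct_sort eps_sorted sorted_sort)
    moreover have "prod_list (map ?g xs) = prod_mset (image_mset ?g (mset xs))" for xs
      by (induction xs) auto
    then have "prod_list (map ?g (remove1 i I)) = prod_list (map ?g ps)"
      by (simp only: m)
    ultimately show ?thesis by simp
  qed
  then show ?thesis unfolding cw_def iff by (cases "eps ps = 0") auto
qed

lemma skew_on_cw: "skew_on S k (cw I)"
  by (intro skew_onI cw_antisym)

definition phi0 :: "nat list \<Rightarrow> real" where
  "phi0 xs = cw [1,2,3] xs + cw [1,4,5] xs + cw [1,6,7] xs
     + cw [2,4,6] xs - cw [2,5,7] xs - cw [3,4,7] xs - cw [3,5,6] xs"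

text \<open>The dual of \<open>phi0\<close> (\<open>dualc_phi0\<close>,
  \<open>hodge_standard_phi\<close>) and at the same time the components of the initial 4-form of
  the flow.\<close>

definition psi0 :: "nat list \<Rightarrow> real" where
  "psi0 xs = cw [4,5,6,7] xs + cw [2,3,6,7] xs + cw [2,3,4,5] xs
     + cw [1,3,5,7] xs - cw [1,3,4,6] xs - cw [1,2,5,6] xs - cw [1,2,4,7] xs"

lemma phi0_antisym: "phi0 (xs @ a # b # ys) = - phi0 (xs @ b # a # ys)"
  unfolding phi0_def cw_antisym[where a = a and b = b] by simp

lemma psi0_antisym: "psi0 (xs @ a # b # ys) = - psi0 (xs @ b # a # ys)"
  unfolding psi0_def cw_antisym[where a = a and b = b] by simp

lemma skew_on_phi0: "skew_on S k phi0" and skew_on_psi0: "skew_on S k psi0"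
  by (intro skew_onI phi0_antisym psi0_antisym)+

text \<open>The (unnormalised) dual of the \<open>k\<close>-form with components \<open>w\<close>.\<close>

definition dualc :: "nat \<Rightarrow> (nat list \<Rightarrow> real) \<Rightarrow> nat list \<Rightarrow> real" where
  "dualc k w us = (\<Sum>xs\<in>tuples {1..7} k. eps (us @ xs) * w xs)"

lemma skew_on_eps_append: "skew_on S k (\<lambda>xs. eps (us @ xs))"
proof (rule skew_onI)
  fix xs a b ys
  show "eps (us @ xs @ a # b # ys) = - eps (us @ xs @ b # a # ys)"
    using eps_antisym[of "us @ xs" a b ys] by simp
qed

lemma skew_on_append_eps: "skew_on S k (\<lambda>xs. eps (xs @ us))"
proof (rule skew_onI)
  fix xs a b ys
  show "eps ((xs @ a # b # ys) @ us) = - eps ((xs @ b # a # ys) @ us)"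
    using eps_antisym[of xs a b "ys @ us"] by simp
qed

text \<open>If \<open>us\<close> does not consist of exactly the entries of \<open>I\<close>, some
  entry of \<open>us @ J\<close> is repeated, because \<open>J\<close> is the complement of
  \<open>I\<close>. On permutations of \<open>I\<close> antisymmetry gives the sign.\<close>

lemma eps_append_compl:
  assumes IJ: "sort (I @ J) = [1,2,3,4,5,6,7]" and I: "sorted I" and "length I = k"
    and us: "us \<in> tuples {1..7} k"
  shows "eps (us @ J) = eps (I @ J) * cw I us"
proof -
  have "set (sort (I @ J)) = {1..7}" "distinct (sort (I @ J))" unfolding IJ by auto
  then have J: "set I \<union> set J = {1..7}" "set I \<inter> set J = {}" and dI: "distinct I"
    by (auto simp only: set_sort distinct_sort set_append distinct_append)
  note us = us[folded \<open>length I = k\<close>]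
  show ?thesis
  proof (cases "distinct us \<and> sort us = I")
  case True
  from skew_on_sort[OF skew_on_append_eps[of UNIV "length I" J], of us] show ?thesis
    using True us dI by (auto simp add: tuples_def cw_def sorted_list_of_set_sort_remdups distinct_remdups_id sorted_sort_id)
next
  case False
  have "\<not> distinct (us @ J)"
  proof
    assume d: "distinct (us @ J)"
    then have "set us \<subseteq> set I" using J us by (auto simp: tuples_def)
    moreover have "card (set us) = card (set I)"
      using d dI us by (simp add: tuples_def distinct_card)
    ultimately have "set us = set I" by (simp add: card_subset_eq)
    then have "sort us = sort I"
      using d dI by (intro properties_for_sort) (auto simp: set_eq_iff_mset_eq_distinct)
    then show False using False d I by (simp add: sorted_sort_id)
  qed
  moreover have "cw I us = 0" using False by (auto simp: cw_def eps_not_distinct)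
  ultimately show ?thesis by (simp add: eps_not_distinct)
  qed
qed

text \<open>Only the subset formed by the entries of \<open>I\<close> contributes, once for each of
  its orderings.\<close>

lemma sum_cw:
  assumes "skew_on {1..7} k h" "sorted I" "distinct I" "set I \<subseteq> {1..7}" "length I = k"
  shows "(\<Sum>xs\<in>tuples {1..7} k. h xs * cw I xs) = fact k * h I"
proof -
  have *: "sorted_list_of_set (set I) = I"
    using assms by (simp add: sorted_list_of_set_sort_remdups distinct_remdups_id sorted_sort_id)
  have "(\<Sum>S | S \<subseteq> {1..7} \<and> card S = k. h (sorted_list_of_set S) * cw I (sorted_list_of_set S))
      = (\<Sum>S | S \<subseteq> {1..7} \<and> card S = k. if S = set I then h I else 0)"
  proof (intro sum.cong refl)
    fix S :: "nat set" assume "S \<in> {S. S \<subseteq> {1..7} \<and> card S = k}"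
    then have "finite S" by (auto intro: finite_subset[of S "{1..7}"])
    then show "h (sorted_list_of_set S) * cw I (sorted_list_of_set S) = (if S = set I then h I else 0)"
      using assms * by (auto simp: cw_def eps_sorted sorted_sort_id)
  qed
  also have "\<dots> = h I"
    using assms by (simp add: sum.delta distinct_card)
  finally show ?thesis
    by (subst sum_tuples_subsets) (auto intro: assms skew_on_cw)
qed

lemma sum_product_lin:
  fixes a b :: "'a \<Rightarrow> real"
  shows "(\<Sum>x\<in>A. h x * (a x + b x)) = (\<Sum>x\<in>A. h x * a x) + (\<Sum>x\<in>A. h x * b x)"
    and "(\<Sum>x\<in>A. h x * (a x - b x)) = (\<Sum>x\<in>A. h x * a x) - (\<Sum>x\<in>A. h x * b x)"
  by (simp_all add: algebra_simps sum.distrib sum_subtractf)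

lemma sum_phi0:
  assumes "skew_on {1..7} 3 h"
  shows "(\<Sum>xs\<in>tuples {1..7} 3. h xs * phi0 xs)
    = 6 * (h [1,2,3] + h [1,4,5] + h [1,6,7] + h [2,4,6] - h [2,5,7] - h [3,4,7] - h [3,5,6])"
  using assms by (simp add: phi0_def sum_product_lin sum_cw fact_numeral)

lemma sum_psi0:
  assumes "skew_on {1..7} 4 h"
  shows "(\<Sum>xs\<in>tuples {1..7} 4. h xs * psi0 xs)
    = 24 * (h [4,5,6,7] + h [2,3,6,7] + h [2,3,4,5] + h [1,3,5,7] - h [1,3,4,6] - h [1,2,5,6] - h [1,2,4,7])"
  using assms by (simp add: psi0_def sum_product_lin sum_cw fact_numeral)

lemma UNIV_17: "{1..7::nat} = {1,2,3,4,5,6,7}"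
  by auto

text \<open>Each monomial of \<open>phi0\<close> turns into the one on the complementary indices.
  The factor 6 = 3! counts orderings, because \<open>dualc\<close> is not normalised; in
  \<open>dualc_psi0\<close> it becomes 24 = 4!.\<close>

lemma dualc_phi0:
  assumes "us \<in> tuples {1..7} 4"
  shows "dualc 3 phi0 us = 6 * psi0 us"
  unfolding dualc_def sum_phi0[OF skew_on_eps_append] using assms
    eps_append_compl[of "[4,5,6,7]" "[1,2,3]" 4 us]
    eps_append_compl[of "[2,3,6,7]" "[1,4,5]" 4 us]
    eps_append_compl[of "[2,3,4,5]" "[1,6,7]" 4 us]
    eps_append_compl[of "[1,3,5,7]" "[2,4,6]" 4 us]
    eps_append_compl[of "[1,3,4,6]" "[2,5,7]" 4 us]
    eps_append_compl[of "[1,2,5,6]" "[3,4,7]" 4 us]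
    eps_append_compl[of "[1,2,4,7]" "[3,5,6]" 4 us]
  by (simp add: psi0_def)

lemma dualc_psi0:
  assumes "us \<in> tuples {1..7} 3"
  shows "dualc 4 psi0 us = 24 * phi0 us"
  unfolding dualc_def sum_psi0[OF skew_on_eps_append] using assms
    eps_append_compl[of "[1,2,3]" "[4,5,6,7]" 3 us]
    eps_append_compl[of "[1,4,5]" "[2,3,6,7]" 3 us]
    eps_append_compl[of "[1,6,7]" "[2,3,4,5]" 3 us]
    eps_append_compl[of "[2,4,6]" "[1,3,5,7]" 3 us]
    eps_append_compl[of "[2,5,7]" "[1,3,4,6]" 3 us]
    eps_append_compl[of "[3,4,7]" "[1,2,5,6]" 3 us]
    eps_append_compl[of "[3,5,6]" "[1,2,4,7]" 3 us]
  by (simp add: phi0_def)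

text \<open>Seven monomials with coefficient 1 or -1, each counted in 3! = 6 orderings; for
  \<open>psi0_norm\<close> in 4! = 24.\<close>

lemma phi0_norm: "(\<Sum>xs\<in>tuples {1..7} 3. phi0 xs * phi0 xs) = 42"
  unfolding sum_phi0[OF skew_on_phi0] by (simp add: phi0_def cw_def)

lemma psi0_norm: "(\<Sum>xs\<in>tuples {1..7} 4. psi0 xs * psi0 xs) = 168"
  unfolding sum_psi0[OF skew_on_psi0] by (simp add: psi0_def cw_def)

text \<open>The lines of the Fano plane: \<open>phi0 [i, j, k] \<noteq> 0\<close> exactly if \<open>{i, j, k}\<close> is a line.\<close>

lemma sum_phi0_line:
  assumes "\<And>a b. h [b, a] = - h [a, b]"
  shows "(\<Sum>ps\<in>tuples {1..7} 2. phi0 (1 # ps) * h ps) = 2 * (h [2,3] + h [4,5] + h [6,7])"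
    and "(\<Sum>ps\<in>tuples {1..7} 2. phi0 (2 # ps) * h ps) = 2 * (- h [1,3] + h [4,6] - h [5,7])"
    and "(\<Sum>ps\<in>tuples {1..7} 2. phi0 (3 # ps) * h ps) = 2 * (h [1,2] - h [4,7] - h [5,6])"
    and "(\<Sum>ps\<in>tuples {1..7} 2. phi0 (4 # ps) * h ps) = 2 * (- h [1,5] - h [2,6] + h [3,7])"
    and "(\<Sum>ps\<in>tuples {1..7} 2. phi0 (5 # ps) * h ps) = 2 * (h [1,4] + h [2,7] + h [3,6])"
    and "(\<Sum>ps\<in>tuples {1..7} 2. phi0 (6 # ps) * h ps) = 2 * (- h [1,7] + h [2,4] - h [3,5])"
    and "(\<Sum>ps\<in>tuples {1..7} 2. phi0 (7 # ps) * h ps) = 2 * (h [1,6] - h [2,5] - h [3,4])"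
proof -
  have h: "skew_on {1..7} 2 h"
  proof (rule skew_onI)
    fix xs ys :: "nat list" and a b assume "length xs + length ys + 2 = 2"
    then show "h (xs @ a # b # ys) = - h (xs @ b # a # ys)" using assms[of b a] by simp
  qed
  have c: "(\<Sum>ps\<in>tuples {1..7} 2. cw I ps * h ps) = 2 * h I"
    if "sorted I" "distinct I" "set I \<subseteq> {1..7}" "length I = 2" for I
    using sum_cw[OF h that] by (simp add: mult.commute)
  note rules = phi0_def cw_Cons distrib_right left_diff_distrib sum.distrib sum_subtractf sum_negf c
  show "(\<Sum>ps\<in>tuples {1..7} 2. phi0 (1 # ps) * h ps) = 2 * (h [2,3] + h [4,5] + h [6,7])"
    and "(\<Sum>ps\<in>tuples {1..7} 2. phi0 (2 # ps) * h ps) = 2 * (- h [1,3] + h [4,6] - h [5,7])"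
    and "(\<Sum>ps\<in>tuples {1..7} 2. phi0 (3 # ps) * h ps) = 2 * (h [1,2] - h [4,7] - h [5,6])"
    and "(\<Sum>ps\<in>tuples {1..7} 2. phi0 (4 # ps) * h ps) = 2 * (- h [1,5] - h [2,6] + h [3,7])"
    and "(\<Sum>ps\<in>tuples {1..7} 2. phi0 (5 # ps) * h ps) = 2 * (h [1,4] + h [2,7] + h [3,6])"
    and "(\<Sum>ps\<in>tuples {1..7} 2. phi0 (6 # ps) * h ps) = 2 * (- h [1,7] + h [2,4] - h [3,5])"
    and "(\<Sum>ps\<in>tuples {1..7} 2. phi0 (7 # ps) * h ps) = 2 * (h [1,6] - h [2,5] - h [3,4])"
    by (simp_all add: rules)
qed

text \<open>Bryant's identity for the model forms. Contracting \<open>phi0\<close> with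
  \<open>psi0\<close> over two indices gives 4 times \<open>phi0\<close>, and contracting
  \<open>phi0\<close> with itself over two indices gives 6 times the identity, whence 24.\<close>

lemma psi0_lines:
  assumes "i \<in> {1..7}" "j \<in> {1..7}"
  shows "(\<Sum>ps\<in>tuples {1..7} 2. phi0 (i # ps) * (\<Sum>qs\<in>tuples {1..7} 2. phi0 (j # qs) * psi0 (ps @ qs)))
     = (if i = j then 24 else 0)"
proof -
  have 1: "psi0 (ps @ [b, a]) = - psi0 (ps @ [a, b])" for ps a b
    using psi0_antisym[of ps b a "[]"] by simp
  have 2: "(\<Sum>qs\<in>tuples {1..7} 2. phi0 (j # qs) * psi0 ([b, a] @ qs))
      = - (\<Sum>qs\<in>tuples {1..7} 2. phi0 (j # qs) * psi0 ([a, b] @ qs))" for j a b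
  proof -
    have "psi0 ([b, a] @ qs) = - psi0 ([a, b] @ qs)" for qs
      using psi0_antisym[of "[]" b a qs] by simp
    then show ?thesis by (simp add: sum_negf)
  qed
  \<comment> \<open>Both sums collapse to three terms, along the lines through \<open>i\<close> and
    through \<open>j\<close>, which leaves 49 cases of nine terms each.\<close>
  note L1 = sum_phi0_line[where h = "\<lambda>ps. \<Sum>qs\<in>tuples {1..7} 2. phi0 (j # qs) * psi0 (ps @ qs)" for j, OF 2]
  note L2 = sum_phi0_line[where h = "\<lambda>qs. psi0 (ps @ qs)" for ps, OF 1]
  from assms have "i \<in> {1,2,3,4,5,6,7}" "j \<in> {1,2,3,4,5,6,7}" by (simp_all only: UNIV_17)
  then show ?thesis
    apply (simp only: insert_iff empty_iff)
    apply (elim disjE FalseE; hypsubst)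
    apply (simp_all only: L1)
    apply (simp_all only: L2)
    apply (simp_all add: psi0_def cw_Cons cw_Nil)
    done
qed


section \<open>Forms in adapted coframes\<close>

lemma combs_numeral [simp]:
  "combs (numeral k) [] = []"
  "combs (numeral k) (x # xs) = map ((#) x) (combs (pred_numeral k) xs) @ combs (numeral k) xs"
  "combs 1 [] = []"
  "combs 1 (x # xs) = [x] # combs 1 xs"
  by (simp_all add: numeral_eq_Suc One_nat_def)

context coframed
begin

lemma coframe_wedge_notin:
  assumes "i \<in> set is" "set is \<subseteq> {1..7}" "i \<notin> set xs"
  shows "coframe_wedge f is (map F xs) = 0"
  using assms
proof (induction "is" arbitrary: xs)
  case (Cons j "is")
  show ?case
  proof (cases "i = j")
    case True
    then show ?thesis using Cons.prems by (simp add: wedge_dual_notin)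
  next
    case False
    have "wedge 1 (f j) (coframe_wedge f is) (map F xs) = wedge 1 (f j) (\<lambda>_. 0) (map F xs)"
    proof (rule wedge_1_cong)
      fix ws assume ws: "set ws \<subseteq> set (map F xs)"
      \<comment> \<open>The induction hypothesis is about images of index lists, so an index list is
        recovered from \<open>ws\<close>.\<close>
      define ys where "ys = map (inv_into (set xs) F) ws"
      have "map F ys = ws" "set ys \<subseteq> set xs"
        using ws by (auto simp: ys_def map_idI f_inv_into_f inv_into_into subset_iff)
      then show "coframe_wedge f is ws = 0"
        using Cons.IH[of ys] Cons.prems False by auto
    qed
    then show ?thesis by (simp add: wedge_def)
  qed
qed simp

lemma coframe_wedge_comp:
  assumes "sorted is" "distinct is" "set is \<subseteq> {1..7}" "length is = k" "xs \<in> tuples {1..7} k"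
  shows "coframe_wedge f is (map F xs) = cw is xs"
proof -
  note assms = assms(1-3) assms(5)[folded assms(4)]
  have a: "skew_on {1..7} (length is) (\<lambda>xs. coframe_wedge f is (map F xs))"
  proof (rule skew_onI)
    fix xs ys :: "nat list" and a b assume "length xs + length ys + 2 = length is"
    then have "map F xs @ F a # F b # map F ys \<in> tuples UNIV (length is)" by (simp add: tuples_def)
    from skew_onD[OF antisym_coframe_wedge this]
    show "coframe_wedge f is (map F (xs @ a # b # ys)) = - coframe_wedge f is (map F (xs @ b # a # ys))"
      by simp
  qed
  show ?thesis
  proof (cases "distinct xs")
    case d: True
    have s: "sort xs = sorted_list_of_set (set xs)"
      using d by (simp add: sorted_list_of_set_sort_remdups distinct_remdups_id)
    have 1: "coframe_wedge f is (map F xs) = coframe_wedge f is (map F (sort xs)) * eps xs"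
      using skew_on_sort[OF a assms(4) d] by (simp add: s)
    show ?thesis
    proof (cases "sort xs = is")
      case True
      then show ?thesis using 1 assms by (simp add: coframe_wedge_dual cw_def)
    next
      case False
      have "set is \<noteq> set xs"
        using False assms(1,2) sorted_distinct_set_unique[of "is" "sort xs"] d by auto
      moreover have "card (set is) = card (set xs)"
        using assms d by (simp add: distinct_card tuples_def)
      ultimately obtain i where "i \<in> set is" "i \<notin> set xs"
        by (metis List.finite_set card_subset_eq subsetI)
      then show ?thesis using False assms by (simp add: coframe_wedge_notin cw_def)
    qed
  next
    case False
    then show ?thesis using skew_on_not_distinct[OF a assms(4)] by (simp add: cw_def eps_not_distinct)
  qed
qed

lemma alternating_coframe_wedge':
  "set is \<subseteq> {1..7} \<Longrightarrow> length is = k \<Longrightarrow> alternating_on V k (coframe_wedge f is)"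
  using alternating_coframe_wedge by blast

lemma alternating_add: "alternating_on V k \<alpha> \<Longrightarrow> alternating_on V k \<beta> \<Longrightarrow> alternating_on V k (\<lambda>vs. a * \<alpha> vs + b * \<beta> vs)"
  using alternating_on_sum[OF subspace, of "{True, False}" k "\<lambda>i. if i then \<alpha> else \<beta>" "\<lambda>i. if i then a else b"]
  by simp

lemma alternating_standard_phi: "alternating_on V 3 (standard_phi f)"
proof -
  let ?h = "\<lambda>i. coframe_wedge f ([[1,2,3],[1,4,5],[1,6,7],[2,4,6],[2,5,7],[3,4,7],[3,5,6]] ! i)"
  have "alternating_on V 3 (\<lambda>vs. \<Sum>i<7. ([1,1,1,1,-1,-1,-1] ! i) * ?h i vs)"
    by (rule alternating_on_sum[OF subspace], rule alternating_coframe_wedge')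
       (auto simp: less_Suc_eq numeral_eq_Suc)
  moreover have "(\<lambda>vs. \<Sum>i<7. ([1,1,1,1,-1,-1,-1] ! i) * ?h i vs) = standard_phi f"
    by (rule ext) (simp add: standard_phi_def lessThan_Suc numeral_eq_Suc del: coframe_wedge.simps)
  ultimately show ?thesis by simp
qed

lemma standard_phi_comp: "xs \<in> tuples {1..7} 3 \<Longrightarrow> standard_phi f (map F xs) = phi0 xs"
  unfolding standard_phi_def phi0_def by (simp add: coframe_wedge_comp[where k = 3] del: coframe_wedge.simps)

lemma alternating_hodge: "k + l = 7 \<Longrightarrow> alternating_on V l (coframe_hodge V f k \<omega>)"
proof -
  assume k: "k + l = 7"
  let ?b = "\<lambda>I. map F (sorted_list_of_set I)"
  have "alternating_on V l (\<lambda>vs. \<Sum>I | I \<subseteq> {1..7} \<and> card I = k. \<omega> (?b I) * vol (?b I @ vs))"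
  proof (intro alternating_on_sum alternating_on_prefix subspace)
    show "alternating_on V (k + l) vol" using alternating_vol k by simp
    fix I :: "nat set" assume "I \<in> {I. I \<subseteq> {1..7} \<and> card I = k}"
    then show "?b I \<in> tuples V k" by (auto simp: tuples_def)
  qed
  then show ?thesis by (simp add: coframe_hodge_def[abs_def] Let_def)
qed

text \<open>In the sum that defines the Hodge operator only the subset complementary to
  \<open>js\<close> survives, since any other choice repeats a frame vector in
  \<open>vol\<close>.\<close>

lemma hodge_compl:
  assumes "sort (cs @ js) = [1,2,3,4,5,6,7]" "sorted cs" "length cs = k"
  shows "coframe_hodge V f k \<omega> (map F js) = eps (cs @ js) * \<omega> (map F cs)"
proof -
  have "set (sort (cs @ js)) = {1..7}" "distinct (sort (cs @ js))" "length (sort (cs @ js)) = 7"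
    unfolding assms(1) by auto
  then have s: "set cs \<subseteq> {1..7}" "set js \<subseteq> {1..7}" "distinct cs" "k + length js = 7"
    using assms(3) by (auto simp only: set_sort distinct_sort set_append distinct_append length_sort length_append)
  have "coframe_hodge V f k \<omega> (map F js)
      = (\<Sum>I | I \<subseteq> {1..7} \<and> card I = k. if I = set cs then eps (cs @ js) * \<omega> (map F cs) else 0)"
    unfolding coframe_hodge_def Let_def
  proof (intro sum.cong refl)
    fix I :: "nat set" assume I: "I \<in> {I. I \<subseteq> {1..7} \<and> card I = k}"
    let ?s = "sorted_list_of_set I"
    have fI: "finite I" using I by (auto intro: finite_subset[of I "{1..7}"])
    have t: "?s \<in> tuples {1..7} k" "?s @ js \<in> tuples {1..7} 7"
      using I s fI by (auto simp: tuples_def)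
    have "vol (map F ?s @ map F js) = eps (?s @ js)"
      using vol_dual[OF t(2)] by (simp del: coframe_wedge.simps)
    also have "\<dots> = eps (cs @ js) * cw cs ?s"
      by (rule eps_append_compl[OF assms t(1)])
    also have "cw cs ?s = (if I = set cs then 1 else 0)"
      using fI assms(2) s(3) by (auto simp: cw_def sorted_sort_id eps_sorted
          sorted_list_of_set_sort_remdups distinct_remdups_id)
    finally have v: "vol (map F ?s @ map F js) = eps (cs @ js) * (if I = set cs then 1 else 0)" .
    show "\<omega> (map F ?s) * vol (map F ?s @ map F js) = (if I = set cs then eps (cs @ js) * \<omega> (map F cs) else 0)"
      unfolding v using assms(2) s(3)
      by (auto simp: sorted_list_of_set_sort_remdups distinct_remdups_id sorted_sort_id)
  qed
  also have "\<dots> = eps (cs @ js) * \<omega> (map F cs)"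
    using s assms(3) by (simp add: sum.delta distinct_card)
  finally show ?thesis .
qed

lemma hodge_standard_phi:
  assumes "xs \<in> tuples {1..7} 4"
  shows "coframe_hodge V f 3 (standard_phi f) (map F xs) = psi0 xs"
proof -
  have a: "skew_on V 4 (coframe_hodge V f 3 (standard_phi f))"
    using alternating_hodge[of 3 4] by (simp add: alternating_on_iff[OF subspace])
  have "skew_on {1..7} 4 (\<lambda>xs. coframe_hodge V f 3 (standard_phi f) (map F xs))"
  proof (rule skew_onI)
    fix xs ys :: "nat list" and a b assume "length xs + length ys + 2 = 4"
    then have "map F xs @ F a # F b # map F ys \<in> tuples V 4" by (auto simp: tuples_def)
    from skew_onD[OF a this]
    show "coframe_hodge V f 3 (standard_phi f) (map F (xs @ a # b # ys))
      = - coframe_hodge V f 3 (standard_phi f) (map F (xs @ b # a # ys))" by simp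
  qed
  then show ?thesis
  proof (rule skew_on_eqI[OF _ skew_on_psi0 _ assms])
    fix js :: "nat list" assume js: "js \<in> set (combs 4 [1,2,3,4,5,6,7])"
    define cs where "cs = filter (\<lambda>i. i \<notin> set js) [1,2,3,4,5,6,7]"
    \<comment> \<open>The 35 increasing multi-indices are evaluated by the simplifier, each together
      with its complement \<open>cs\<close>.\<close>
    have all: "\<forall>js\<in>set (combs 4 [1,2,3,4,5,6,7::nat]). let cs = filter (\<lambda>i. i \<notin> set js) [1,2,3,4,5,6,7] in
        sort (cs @ js) = [1,2,3,4,5,6,7] \<and> sorted cs \<and> length cs = 3 \<and> cs \<in> tuples {1..7} 3 \<and>
        eps (cs @ js) * phi0 cs = psi0 js"
      by (simp add: phi0_def psi0_def cw_Cons cw_Nil tuples_def)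
    show "coframe_hodge V f 3 (standard_phi f) (map F js) = psi0 js"
      using bspec[OF all js] hodge_compl[of cs js 3 "standard_phi f"] standard_phi_comp[of cs]
      unfolding cs_def[symmetric] Let_def by simp
  qed
qed

end

section \<open>The metric is determined by the definite form\<close>

text \<open>For a definite form this is the inverse metric times the square of the volume factor, up
  to the constant of \<open>bryant_psi_eq\<close>. It is polynomial in \<open>w\<close>, so it needs
  no coframe and is Lipschitz on bounded sets.\<close>

definition bryant_psi :: "(nat list \<Rightarrow> real) \<Rightarrow> nat \<Rightarrow> nat \<Rightarrow> real" where
  "bryant_psi w i j = (\<Sum>ps\<in>tuples {1..7} 2. dualc 4 w (i # ps) *
     (\<Sum>qs\<in>tuples {1..7} 2. dualc 4 w (j # qs) * w (ps @ qs)))"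

text \<open>The square norm of \<open>w\<close> with \<open>bryant_psi w\<close> as inverse metric;
  \<open>psi_norm_eq\<close> recovers the volume factor from it.\<close>

definition psi_norm :: "(nat list \<Rightarrow> real) \<Rightarrow> real" where
  "psi_norm w = (\<Sum>xs\<in>tuples {1..7} 4. (\<Sum>ys\<in>tuples {1..7} 4. pr (bryant_psi w) xs ys * w ys) * w xs)"

definition bryant_phi :: "(nat list \<Rightarrow> real) \<Rightarrow> nat \<Rightarrow> nat \<Rightarrow> real" where
  "bryant_phi w i j = (\<Sum>ps\<in>tuples {1..7} 2. w (i # ps) *
     (\<Sum>qs\<in>tuples {1..7} 2. w (j # qs) * dualc 3 w (ps @ qs)))"

lemma dualc_cong: "(\<And>xs. xs \<in> tuples {1..7} k \<Longrightarrow> w xs = w' xs) \<Longrightarrow> dualc k w us = dualc k w' us"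
  unfolding dualc_def by (intro sum.cong refl) simp

lemma sum_scaled_left:
  fixes \<alpha> :: real
  shows "(\<Sum>p\<in>P. (\<alpha> * (\<Sum>k\<in>K. m k * x k p)) * g p) = \<alpha> * (\<Sum>k\<in>K. m k * (\<Sum>p\<in>P. x k p * g p))"
proof -
  have "(\<Sum>p\<in>P. (\<alpha> * (\<Sum>k\<in>K. m k * x k p)) * g p) = (\<Sum>p\<in>P. \<Sum>k\<in>K. \<alpha> * (m k * (x k p * g p)))"
    by (intro sum.cong refl) (simp only: sum_distrib_left sum_distrib_right mult.assoc)
  also have "\<dots> = (\<Sum>k\<in>K. \<Sum>p\<in>P. \<alpha> * (m k * (x k p * g p)))" by (rule sum.swap)
  finally show ?thesis by (simp only: sum_distrib_left)
qed

lemma sum_scaled_right: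
  fixes \<alpha> :: real
  shows "(\<Sum>p\<in>P. g p * (\<alpha> * (\<Sum>k\<in>K. m k * x k p))) = \<alpha> * (\<Sum>k\<in>K. m k * (\<Sum>p\<in>P. g p * x k p))"
  using sum_scaled_left[where x = x and m = m and g = g and \<alpha> = \<alpha> and K = K and P = P]
  by (simp only: mult.commute[of "g _"])

context coframed_pair
begin

text \<open>Here \<open>a\<close> transforms with \<open>M\<close> and \<open>b\<close> with its
  inverse \<open>N\<close>, so the two changes of frame cancel in the contraction. In a longer
  expression each group of indices can be changed separately in this way.\<close>

lemma contract:
  assumes a: "\<And>ps. ps \<in> tuples {1..7} k \<Longrightarrow> a ps = (\<Sum>qs\<in>tuples {1..7} k. pr M ps qs * a' qs)"
    and b: "\<And>ps. ps \<in> tuples {1..7} k \<Longrightarrow> b ps = (\<Sum>qs\<in>tuples {1..7} k. pr N qs ps * b' qs)"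
  shows "(\<Sum>ps\<in>tuples {1..7} k. a ps * b ps) = (\<Sum>ps\<in>tuples {1..7} k. a' ps * b' ps)"
proof -
  let ?T = "tuples {1..7::nat} k"
  have "(\<Sum>ps\<in>?T. a ps * b ps) = (\<Sum>ps\<in>?T. \<Sum>qs\<in>?T. a' qs * (pr (\<lambda>x y. M y x) qs ps * b ps))"
  proof (intro sum.cong refl)
    fix ps assume ps: "ps \<in> ?T"
    show "a ps * b ps = (\<Sum>qs\<in>?T. a' qs * (pr (\<lambda>x y. M y x) qs ps * b ps))"
      unfolding a[OF ps] pr_transpose[of M] sum_distrib_right by (intro sum.cong refl) simp
  qed
  also have "\<dots> = (\<Sum>qs\<in>?T. a' qs * (\<Sum>ps\<in>?T. pr (\<lambda>x y. M y x) qs ps * b ps))"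
    unfolding sum_distrib_left by (rule sum.swap)
  also have "\<dots> = (\<Sum>qs\<in>?T. a' qs * b' qs)"
  proof (intro sum.cong refl arg_cong2[where f = "(*)"])
    fix qs assume qs: "qs \<in> ?T"
    have "(\<Sum>ps\<in>?T. pr (\<lambda>x y. M y x) qs ps * b ps)
        = (\<Sum>ps\<in>?T. pr (\<lambda>x y. M y x) qs ps * (\<Sum>rs\<in>?T. pr (\<lambda>x y. N y x) ps rs * b' rs))"
      using b by (intro sum.cong refl) (simp add: pr_transpose[of N])
    also have "\<dots> = b' qs"
    proof (rule pr_cancel[OF _ _ qs])
      fix x z :: nat assume "x \<in> {1..7}" "z \<in> {1..7}"
      then show "(\<Sum>y\<in>{1..7}. M y x * N z y) = (if x = z then 1 else 0)"
        using N_M[of z x] by (simp add: mult.commute eq_commute)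
    qed simp
    finally show "(\<Sum>ps\<in>?T. pr (\<lambda>x y. M y x) qs ps * b ps) = b' qs" .
  qed
  finally show ?thesis .
qed

text \<open>\<open>eps\<close> is a tensor density: \<open>N\<close> acting on all 7 slots
  multiplies it by \<open>c\<close> (\<open>eps_N_transpose\<close>). Cancelling \<open>N\<close> on
  the first \<open>l\<close> slots by \<open>M\<close> leaves a rule in which the free indices
  transform contravariantly.\<close>

lemma dualc_transform:
  assumes \<omega>: "multilin_on V k \<omega>" and k: "l + k = 7" and us: "us \<in> tuples {1..7} l"
  shows "dualc k (\<lambda>xs. \<omega> (map e.F xs)) us
    = c * (\<Sum>vs\<in>tuples {1..7} l. pr M us vs * dualc k (\<lambda>xs. \<omega> (map f.F xs)) vs)"
proof -
  let ?T = "tuples {1..7::nat}"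
  have 1: "(\<Sum>xs\<in>?T k. eps (us @ xs) * pr N ys xs) = (\<Sum>vs\<in>?T l. pr M us vs * (c * eps (vs @ ys)))"
    if ys: "ys \<in> ?T k" for ys
  proof -
    define h where "h us' = (\<Sum>xs\<in>?T k. eps (us' @ xs) * pr N ys xs)" for us'
    have "(\<Sum>us'\<in>?T l. pr N vs us' * h us') = c * eps (vs @ ys)" if vs: "vs \<in> ?T l" for vs
    proof -
      have "vs @ ys \<in> ?T (l + k)" using vs ys by (rule append_tuples)
      then have "c * eps (vs @ ys) = (\<Sum>zs\<in>?T (l + k). eps zs * pr N (vs @ ys) zs)"
        using eps_N_transpose unfolding k by simp
      also have "\<dots> = (\<Sum>us'\<in>?T l. \<Sum>xs\<in>?T k. eps (us' @ xs) * pr N (vs @ ys) (us' @ xs))"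
        by (rule sum_tuples_add)
      also have "\<dots> = (\<Sum>us'\<in>?T l. pr N vs us' * h us')"
        unfolding h_def sum_distrib_left
        using vs by (intro sum.cong refl) (simp add: pr_append length_tuples)
      finally show ?thesis ..
    qed
    then have "(\<Sum>vs\<in>?T l. pr M us vs * (\<Sum>us'\<in>?T l. pr N vs us' * h us')) = (\<Sum>vs\<in>?T l. pr M us vs * (c * eps (vs @ ys)))"
      by (intro sum.cong refl) simp
    moreover have "(\<Sum>vs\<in>?T l. pr M us vs * (\<Sum>us'\<in>?T l. pr N vs us' * h us')) = h us"
      by (rule pr_cancel[OF _ _ us]) (simp_all only: M_N finite_atLeastAtMost)
    ultimately show ?thesis by (simp add: h_def)
  qed
  let ?w = "\<lambda>ys. \<omega> (map f.F ys)"
  have "dualc k (\<lambda>xs. \<omega> (map e.F xs)) us = (\<Sum>xs\<in>?T k. \<Sum>ys\<in>?T k. (eps (us @ xs) * pr N ys xs) * ?w ys)"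
    unfolding dualc_def
    by (intro sum.cong refl) (simp only: comp_e_f[OF \<omega>] sum_distrib_left mult.assoc)
  also have "\<dots> = (\<Sum>ys\<in>?T k. (\<Sum>xs\<in>?T k. eps (us @ xs) * pr N ys xs) * ?w ys)"
    unfolding sum_distrib_right by (rule sum.swap)
  also have "\<dots> = (\<Sum>ys\<in>?T k. \<Sum>vs\<in>?T l. c * (pr M us vs * (eps (vs @ ys) * ?w ys)))"
  proof (rule sum.cong[OF refl])
    fix ys assume "ys \<in> ?T k"
    then show "(\<Sum>xs\<in>?T k. eps (us @ xs) * pr N ys xs) * ?w ys = (\<Sum>vs\<in>?T l. c * (pr M us vs * (eps (vs @ ys) * ?w ys)))"
      unfolding 1[OF \<open>ys \<in> ?T k\<close>] sum_distrib_right by (intro sum.cong refl) (simp only: mult_ac)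
  qed
  also have "\<dots> = (\<Sum>vs\<in>?T l. \<Sum>ys\<in>?T k. c * (pr M us vs * (eps (vs @ ys) * ?w ys)))"
    by (rule sum.swap)
  finally show ?thesis by (simp only: dualc_def sum_distrib_left)
qed

text \<open>Each dual contributes 24 c through \<open>dualc_transform\<close> and
  \<open>dualc_psi0\<close>, and \<open>psi0_lines\<close> contributes the last 24, so the constant
  is 24^3. The two free indices keep one factor \<open>M\<close> each, and these pair up to
  \<open>\<G>\<close>.\<close>

lemma bryant_psi_eq:
  assumes \<psi>: "multilin_on V 4 \<psi>" and 0: "\<And>xs. xs \<in> tuples {1..7} 4 \<Longrightarrow> \<psi> (map f.F xs) = psi0 xs"
    and i: "i \<in> {1..7}" "j \<in> {1..7}"
  shows "bryant_psi (\<lambda>xs. \<psi> (map e.F xs)) i j = 13824 * c\<^sup>2 * \<G> i j"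
proof -
  let ?T = "tuples {1..7::nat}" and ?w = "\<lambda>xs. \<psi> (map e.F xs)" and ?v = "\<lambda>xs. \<psi> (map f.F xs)"
  \<comment> \<open>The dual form with its first index in the frame of \<open>e\<close> and the
    other two already in that of \<open>f\<close>.\<close>
  define P where "P i qs = 24 * c * (\<Sum>k\<in>{1..7}. M i k * phi0 (k # qs))" for i qs
  have D: "dualc 4 ?w (i # ps) = (\<Sum>qs\<in>?T 2. pr M ps qs * P i qs)"
    if "i \<in> {1..7}" "ps \<in> ?T 2" for i ps
  proof -
    have T3: "3 = Suc 2" by simp
    have "i # ps \<in> ?T (Suc 2)" using that by (simp only: Cons_tuples_Suc simp_thms)
    then have "i # ps \<in> ?T 3" by (simp only: T3)
    from dualc_transform[OF \<psi> _ this]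
    have "dualc 4 ?w (i # ps) = c * (\<Sum>vs\<in>?T 3. pr M (i # ps) vs * dualc 4 ?v vs)" by simp
    also have "\<dots> = c * (\<Sum>vs\<in>?T 3. pr M (i # ps) vs * (24 * phi0 vs))"
    proof (intro arg_cong2[where f = "(*)"] sum.cong refl)
      fix vs assume "vs \<in> ?T 3"
      then show "dualc 4 ?v vs = 24 * phi0 vs"
        using dualc_cong[of 4 ?v psi0 vs] 0 dualc_psi0 by simp
    qed
    also have "\<dots> = (\<Sum>k\<in>{1..7}. \<Sum>qs\<in>?T 2. c * (M i k * pr M ps qs * (24 * phi0 (k # qs))))"
      unfolding T3 sum_tuples_Suc pr_simps sum_distrib_left ..
    also have "\<dots> = (\<Sum>qs\<in>?T 2. \<Sum>k\<in>{1..7}. c * (M i k * pr M ps qs * (24 * phi0 (k # qs))))"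
      by (rule sum.swap)
    also have "\<dots> = (\<Sum>qs\<in>?T 2. pr M ps qs * P i qs)"
      unfolding P_def sum_distrib_left by (intro sum.cong refl) simp
    finally show ?thesis .
  qed
  \<comment> \<open>Mixed components: the first pair of indices refers to \<open>f\<close>, the
    second to \<open>e\<close>. The two pairs are changed one after the other.\<close>
  define W where "W ps qs = (\<Sum>rs\<in>?T 2. pr N rs qs * psi0 (ps @ rs))" for ps qs
  have W: "?w (ps @ qs) = (\<Sum>rs\<in>?T 2. pr N rs ps * W rs qs)" if "ps \<in> ?T 2" "qs \<in> ?T 2" for ps qs
  proof -
    have "ps @ qs \<in> ?T (2 + 2)" using that by (rule append_tuples)
    then have "?w (ps @ qs) = (\<Sum>ys\<in>?T (2 + 2). pr N ys (ps @ qs) * ?v ys)"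
      using comp_e_f[OF \<psi>, of "ps @ qs"] by simp
    also have "\<dots> = (\<Sum>rs\<in>?T 2. \<Sum>ys\<in>?T 2. pr N (rs @ ys) (ps @ qs) * ?v (rs @ ys))"
      by (rule sum_tuples_add)
    also have "\<dots> = (\<Sum>rs\<in>?T 2. \<Sum>ys\<in>?T 2. pr N rs ps * (pr N ys qs * psi0 (rs @ ys)))"
    proof (intro sum.cong refl)
      fix rs ys assume *: "rs \<in> ?T 2" "ys \<in> ?T 2"
      have "rs @ ys \<in> ?T 4" using append_tuples[OF *] by simp
      then show "pr N (rs @ ys) (ps @ qs) * ?v (rs @ ys) = pr N rs ps * (pr N ys qs * psi0 (rs @ ys))"
        using * that by (simp add: pr_append length_tuples 0 del: map_append)
    qed
    finally show ?thesis by (simp only: W_def sum_distrib_left)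
  qed
  have "bryant_psi ?w i j = (\<Sum>ps\<in>?T 2. P i ps * (\<Sum>qs\<in>?T 2. dualc 4 ?w (j # qs) * W ps qs))"
    unfolding bryant_psi_def
  proof (rule contract)
    fix ps assume ps: "ps \<in> ?T 2"
    then show "dualc 4 ?w (i # ps) = (\<Sum>qs\<in>?T 2. pr M ps qs * P i qs)" using D i by blast
    have "(\<Sum>qs\<in>?T 2. dualc 4 ?w (j # qs) * ?w (ps @ qs))
        = (\<Sum>qs\<in>?T 2. \<Sum>rs\<in>?T 2. pr N rs ps * (dualc 4 ?w (j # qs) * W rs qs))"
      using ps by (intro sum.cong refl) (simp only: W sum_distrib_left mult.left_commute)
    also have "\<dots> = (\<Sum>rs\<in>?T 2. pr N rs ps * (\<Sum>qs\<in>?T 2. dualc 4 ?w (j # qs) * W rs qs))"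
      unfolding sum_distrib_left by (rule sum.swap)
    finally show "(\<Sum>qs\<in>?T 2. dualc 4 ?w (j # qs) * ?w (ps @ qs))
        = (\<Sum>rs\<in>?T 2. pr N rs ps * (\<Sum>qs\<in>?T 2. dualc 4 ?w (j # qs) * W rs qs))" .
  qed
  also have "\<dots> = (\<Sum>ps\<in>?T 2. P i ps * (\<Sum>qs\<in>?T 2. P j qs * psi0 (ps @ qs)))"
  proof (rule sum.cong[OF refl], rule arg_cong2[where f = "(*)", OF refl])
    fix ps
    show "(\<Sum>qs\<in>?T 2. dualc 4 ?w (j # qs) * W ps qs) = (\<Sum>qs\<in>?T 2. P j qs * psi0 (ps @ qs))"
      by (rule contract) (use D i W_def in auto)
  qed
  also have "\<dots> = 24 * c * (\<Sum>k\<in>{1..7}. M i k * (24 * c * (\<Sum>l\<in>{1..7}. M j l *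
      (\<Sum>ps\<in>?T 2. phi0 (k # ps) * (\<Sum>qs\<in>?T 2. phi0 (l # qs) * psi0 (ps @ qs))))))"
    unfolding P_def sum_scaled_left sum_scaled_right ..
  also have "\<dots> = 24 * c * (\<Sum>k\<in>{1..7}. M i k * (24 * c * (\<Sum>l\<in>{1..7}. if l = k then 24 * M j l else 0)))"
    by (intro arg_cong2[where f = "(*)"] sum.cong refl) (simp add: psi0_lines)
  also have "\<dots> = 24 * c * (\<Sum>k\<in>{1..7}. M i k * (24 * c * (24 * M j k)))"
    by (intro arg_cong2[where f = "(*)"] sum.cong refl) (simp add: sum.delta)
  finally show ?thesis
    by (simp add: \<G>_def sum_distrib_left power2_eq_square mult_ac)
qed

text \<open>The matrix \<open>bryant_psi\<close> carries c^2 and acts on four slots, hence c^8; what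
  remains is the square norm 168 of \<open>psi0\<close> in its own metric.\<close>

lemma psi_norm_eq:
  assumes \<psi>: "multilin_on V 4 \<psi>" and 0: "\<And>xs. xs \<in> tuples {1..7} 4 \<Longrightarrow> \<psi> (map f.F xs) = psi0 xs"
  shows "psi_norm (\<lambda>xs. \<psi> (map e.F xs)) = 13824 ^ 4 * 168 * c ^ 8"
proof -
  let ?T = "tuples {1..7::nat} 4" and ?w = "\<lambda>xs. \<psi> (map e.F xs)"
  have B: "pr (bryant_psi ?w) xs ys = (13824 * c\<^sup>2) ^ 4 * pr \<G> xs ys" if "xs \<in> ?T" "ys \<in> ?T" for xs ys
  proof -
    have "pr (bryant_psi ?w) xs ys = pr (\<lambda>i j. 13824 * c\<^sup>2 * \<G> i j) xs ys"
    proof (rule pr_cong)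
      fix i j assume "i \<in> set xs" "j \<in> set ys"
      then have "i \<in> {1..7}" "j \<in> {1..7}" using that by (meson set_tuples subsetD)+
      then show "bryant_psi ?w i j = 13824 * c\<^sup>2 * \<G> i j" by (intro bryant_psi_eq \<psi> 0)
    qed
    then show ?thesis using that by (simp only: pr_scale length_tuples)
  qed
  have G: "(\<Sum>ys\<in>?T. pr \<G> xs ys * ?w ys) = (\<Sum>zs\<in>?T. pr M xs zs * psi0 zs)" if xs: "xs \<in> ?T" for xs
  proof -
    have "(\<Sum>ys\<in>?T. pr \<G> xs ys * ?w ys) = (\<Sum>ys\<in>?T. \<Sum>zs\<in>?T. pr M xs zs * (pr M ys zs * ?w ys))"
      using xs by (intro sum.cong refl) (simp only: pr_M_M[symmetric] sum_distrib_right mult.assoc)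
    also have "\<dots> = (\<Sum>zs\<in>?T. pr M xs zs * (\<Sum>ys\<in>?T. pr M ys zs * ?w ys))"
      unfolding sum_distrib_left by (rule sum.swap)
    also have "\<dots> = (\<Sum>zs\<in>?T. pr M xs zs * psi0 zs)"
      by (intro sum.cong refl) (simp only: comp_f_e[OF \<psi>, symmetric] 0)
    finally show ?thesis .
  qed
  have "psi_norm ?w = (\<Sum>xs\<in>?T. (13824 * c\<^sup>2) ^ 4 * ((\<Sum>zs\<in>?T. pr M xs zs * psi0 zs) * ?w xs))"
    unfolding psi_norm_def
  proof (intro sum.cong refl)
    fix xs assume xs: "xs \<in> ?T"
    have "(\<Sum>ys\<in>?T. pr (bryant_psi ?w) xs ys * ?w ys) = (13824 * c\<^sup>2) ^ 4 * (\<Sum>ys\<in>?T. pr \<G> xs ys * ?w ys)"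
      unfolding sum_distrib_left using xs by (intro sum.cong refl) (simp only: B mult.assoc)
    then show "(\<Sum>ys\<in>?T. pr (bryant_psi ?w) xs ys * ?w ys) * ?w xs
        = (13824 * c\<^sup>2) ^ 4 * ((\<Sum>zs\<in>?T. pr M xs zs * psi0 zs) * ?w xs)"
      using G[OF xs] by simp
  qed
  also have "\<dots> = (13824 * c\<^sup>2) ^ 4 * (\<Sum>xs\<in>?T. psi0 xs * psi0 xs)"
    unfolding sum_distrib_left[symmetric]
    by (intro arg_cong2[where f = "(*)"] refl contract) (simp_all add: comp_e_f[OF \<psi>] 0)
  finally show ?thesis by (simp add: psi0_norm power_mult_distrib power_mult[symmetric])
qed

text \<open>For a 3-form no orientation is prescribed. Bryant's identity gives that \<open>c\<close>
  times N transposed times N is 1, so \<open>M\<close> is \<open>c\<close> times the transpose of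
  \<open>N\<close>; comparing the square norm of \<open>phi0\<close> in both frames then gives c^3 =
  1. The odd exponent fixes the sign: \<phi> determines the orientation as well.\<close>

lemma phi_rigid:
  assumes \<phi>: "multilin_on V 3 \<phi>"
    and f: "\<And>xs. xs \<in> tuples {1..7} 3 \<Longrightarrow> \<phi> (map f.F xs) = phi0 xs"
    and e: "\<And>xs. xs \<in> tuples {1..7} 3 \<Longrightarrow> \<phi> (map e.F xs) = phi0 xs"
  shows "c = 1" and "\<And>x z. x \<in> {1..7} \<Longrightarrow> z \<in> {1..7} \<Longrightarrow> \<G> x z = (if x = z then 1 else 0)"
proof -
  let ?T = "tuples {1..7::nat}"
  have dd: "6 * psi0 us = c * (\<Sum>vs\<in>?T 4. pr M us vs * (6 * psi0 vs))" if us: "us \<in> ?T 4" for us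
  proof -
    have "6 * psi0 us = dualc 3 (\<lambda>xs. \<phi> (map e.F xs)) us"
      using dualc_cong[of 3 "\<lambda>xs. \<phi> (map e.F xs)" phi0 us] e dualc_phi0[OF us] by simp
    also have "\<dots> = c * (\<Sum>vs\<in>?T 4. pr M us vs * dualc 3 (\<lambda>xs. \<phi> (map f.F xs)) vs)"
      by (rule dualc_transform[OF \<phi> _ us]) simp
    also have "\<dots> = c * (\<Sum>vs\<in>?T 4. pr M us vs * (6 * psi0 vs))"
    proof (intro arg_cong2[where f = "(*)"] sum.cong refl)
      fix vs assume "vs \<in> ?T 4"
      then show "dualc 3 (\<lambda>xs. \<phi> (map f.F xs)) vs = 6 * psi0 vs"
        using dualc_cong[of 3 "\<lambda>xs. \<phi> (map f.F xs)" phi0 vs] f dualc_phi0 by simp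
    qed
    finally show ?thesis .
  qed
  have pp: "phi0 xs = (\<Sum>ys\<in>?T 3. pr N ys xs * phi0 ys)" if "xs \<in> ?T 3" for xs
    using comp_e_f[OF \<phi> that] e[OF that] f by simp
  define W where "W ps qs = (\<Sum>rs\<in>?T 2. pr M qs rs * (c * psi0 (ps @ rs)))" for ps qs
  have W: "psi0 (ps @ qs) = (\<Sum>rs\<in>?T 2. pr M ps rs * W rs qs)" if "ps \<in> ?T 2" "qs \<in> ?T 2" for ps qs
  proof -
    have "ps @ qs \<in> ?T (2 + 2)" using that by (rule append_tuples)
    then have "6 * psi0 (ps @ qs) = c * (\<Sum>ys\<in>?T (2 + 2). pr M (ps @ qs) ys * (6 * psi0 ys))"
      using dd[of "ps @ qs"] by simp
    also have "(\<Sum>ys\<in>?T (2 + 2). pr M (ps @ qs) ys * (6 * psi0 ys))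
        = (\<Sum>rs\<in>?T 2. \<Sum>ys\<in>?T 2. pr M (ps @ qs) (rs @ ys) * (6 * psi0 (rs @ ys)))"
      by (rule sum_tuples_add)
    also have "\<dots> = (\<Sum>rs\<in>?T 2. \<Sum>ys\<in>?T 2. 6 * (pr M ps rs * (pr M qs ys * psi0 (rs @ ys))))"
      using that by (intro sum.cong refl) (simp add: pr_append length_tuples)
    finally have "6 * psi0 (ps @ qs) = 6 * (\<Sum>rs\<in>?T 2. pr M ps rs * W rs qs)"
      by (simp add: W_def sum_distrib_left mult_ac)
    then show ?thesis by simp
  qed
  define P where "P i qs = (\<Sum>k\<in>{1..7}. N k i * phi0 (k # qs))" for i qs
  have D: "phi0 (i # ps) = (\<Sum>qs\<in>?T 2. pr N qs ps * P i qs)" if "i \<in> {1..7}" "ps \<in> ?T 2" for i ps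
  proof -
    have T3: "3 = Suc 2" by simp
    have "i # ps \<in> ?T (Suc 2)" using that by (simp only: Cons_tuples_Suc simp_thms)
    then have "i # ps \<in> ?T 3" by (simp only: T3)
    then have "phi0 (i # ps) = (\<Sum>ys\<in>?T 3. pr N ys (i # ps) * phi0 ys)" by (rule pp)
    also have "\<dots> = (\<Sum>k\<in>{1..7}. \<Sum>qs\<in>?T 2. pr N qs ps * (N k i * phi0 (k # qs)))"
      unfolding T3 sum_tuples_Suc pr_simps by (simp only: mult_ac)
    also have "\<dots> = (\<Sum>qs\<in>?T 2. pr N qs ps * P i qs)"
      unfolding P_def sum_distrib_left by (rule sum.swap)
    finally show ?thesis .
  qed
  have NN: "c * (\<Sum>k\<in>{1..7}. N k i * N k j) = (if i = j then 1 else 0)" if ij: "i \<in> {1..7}" "j \<in> {1..7}" for i j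
  proof -
    have "(if i = j then 24 else 0)
        = (\<Sum>ps\<in>?T 2. (\<Sum>qs\<in>?T 2. psi0 (ps @ qs) * phi0 (j # qs)) * phi0 (i # ps))"
      using psi0_lines[OF ij] by (simp add: mult.commute)
    also have "\<dots> = (\<Sum>ps\<in>?T 2. (\<Sum>qs\<in>?T 2. W ps qs * phi0 (j # qs)) * P i ps)"
    proof (rule contract)
      fix ps assume ps: "ps \<in> ?T 2"
      then show "phi0 (i # ps) = (\<Sum>qs\<in>?T 2. pr N qs ps * P i qs)" using D ij by blast
      have "(\<Sum>qs\<in>?T 2. psi0 (ps @ qs) * phi0 (j # qs))
          = (\<Sum>qs\<in>?T 2. \<Sum>rs\<in>?T 2. pr M ps rs * (W rs qs * phi0 (j # qs)))"
        using ps by (intro sum.cong refl) (simp only: W sum_distrib_right mult.assoc)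
      also have "\<dots> = (\<Sum>rs\<in>?T 2. pr M ps rs * (\<Sum>qs\<in>?T 2. W rs qs * phi0 (j # qs)))"
        unfolding sum_distrib_left by (rule sum.swap)
      finally show "(\<Sum>qs\<in>?T 2. psi0 (ps @ qs) * phi0 (j # qs))
          = (\<Sum>rs\<in>?T 2. pr M ps rs * (\<Sum>qs\<in>?T 2. W rs qs * phi0 (j # qs)))" .
    qed
    also have "\<dots> = (\<Sum>ps\<in>?T 2. (\<Sum>qs\<in>?T 2. c * psi0 (ps @ qs) * P j qs) * P i ps)"
    proof (rule sum.cong[OF refl], rule arg_cong2[where f = "(*)", OF _ refl])
      fix ps
      show "(\<Sum>qs\<in>?T 2. W ps qs * phi0 (j # qs)) = (\<Sum>qs\<in>?T 2. c * psi0 (ps @ qs) * P j qs)"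
        by (rule contract) (use D ij W_def in auto)
    qed
    also have "\<dots> = (\<Sum>ps\<in>?T 2. (1 * (\<Sum>k\<in>{1..7}. N k i * phi0 (k # ps))) *
        (\<Sum>qs\<in>?T 2. (c * (\<Sum>l\<in>{1..7}. N l j * phi0 (l # qs))) * psi0 (ps @ qs)))"
      unfolding P_def by (simp only: mult_ac mult_1)
    also have "\<dots> = 1 * (\<Sum>k\<in>{1..7}. N k i * (c * (\<Sum>l\<in>{1..7}. N l j *
        (\<Sum>ps\<in>?T 2. phi0 (k # ps) * (\<Sum>qs\<in>?T 2. phi0 (l # qs) * psi0 (ps @ qs))))))"
      unfolding sum_scaled_left sum_scaled_right ..
    also have "\<dots> = 1 * (\<Sum>k\<in>{1..7}. N k i * (c * (\<Sum>l\<in>{1..7}. if l = k then 24 * N l j else 0)))"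
      by (intro arg_cong2[where f = "(*)"] sum.cong refl) (simp add: psi0_lines)
    also have "\<dots> = 1 * (\<Sum>k\<in>{1..7}. N k i * (c * (24 * N k j)))"
      by (intro arg_cong2[where f = "(*)"] sum.cong refl) (simp add: sum.delta)
    also have "\<dots> = 24 * (c * (\<Sum>k\<in>{1..7}. N k i * N k j))"
      by (simp add: sum_distrib_left mult_ac)
    finally show ?thesis by (simp split: if_splits)
  qed
  have MN: "M x y = c * N y x" if "x \<in> {1..7}" "y \<in> {1..7}" for x y
  proof -
    have "M x y = (\<Sum>z\<in>{1..7}. if z = x then M z y else 0)"
      using that by (simp add: sum.delta)
    also have "\<dots> = (\<Sum>z\<in>{1..7}. (c * (\<Sum>k\<in>{1..7}. N k x * N k z)) * M z y)"
      using that by (intro sum.cong refl) (auto simp: NN)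
    also have "\<dots> = c * (\<Sum>k\<in>{1..7}. N k x * (\<Sum>z\<in>{1..7}. N k z * M z y))"
      by (rule sum_scaled_left)
    also have "\<dots> = c * (\<Sum>k\<in>{1..7}. if k = y then N k x else 0)"
      using that by (intro arg_cong2[where f = "(*)"] sum.cong refl) (simp add: N_M)
    finally show ?thesis using that by (simp add: sum.delta)
  qed
  have prMN: "pr M xs ys = c ^ 3 * pr N ys xs" if "xs \<in> ?T 3" "ys \<in> ?T 3" for xs ys
  proof -
    have "pr M xs ys = pr (\<lambda>x y. c * N y x) xs ys"
    proof (rule pr_cong)
      fix x y assume "x \<in> set xs" "y \<in> set ys"
      then have "x \<in> {1..7}" "y \<in> {1..7}" using that by (meson set_tuples subsetD)+
      then show "M x y = c * N y x" by (rule MN)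
    qed
    then show ?thesis using that pr_scale[of xs ys c "\<lambda>x y. N y x"]
      by (simp add: length_tuples pr_transpose[of N])
  qed
  have "(\<Sum>xs\<in>?T 3. (c ^ 3 * phi0 xs) * phi0 xs) = (\<Sum>xs\<in>?T 3. phi0 xs * phi0 xs)"
  proof (rule contract)
    fix xs assume xs: "xs \<in> ?T 3"
    show "phi0 xs = (\<Sum>ys\<in>?T 3. pr N ys xs * phi0 ys)" by (rule pp[OF xs])
    show "c ^ 3 * phi0 xs = (\<Sum>ys\<in>?T 3. pr M xs ys * phi0 ys)"
      by (subst pp[OF xs]) (simp add: sum_distrib_left prMN[OF xs] mult.assoc)
  qed
  moreover have "(\<Sum>xs\<in>?T 3. (c ^ 3 * phi0 xs) * phi0 xs) = c ^ 3 * (\<Sum>xs\<in>?T 3. phi0 xs * phi0 xs)"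
    by (simp only: sum_distrib_left mult.assoc)
  ultimately have "c ^ 3 = 1" by (simp add: phi0_norm)
  then show c: "c = 1"
    using power_eq_iff_eq_base[of 3 c 1] zero_le_odd_power[of 3 c] by simp
  fix x z :: nat assume "x \<in> {1..7}" "z \<in> {1..7}"
  then show "\<G> x z = (if x = z then 1 else 0)"
    unfolding \<G>_def using M_N[of x z] MN[of z] c by simp
qed

end

section \<open>Independence of the adapted coframe\<close>

lemma adapted_psi_coframed:
  assumes "subspace V" "adapted_psi V vol \<psi> f"
  shows "coframed V f" and "alternating_on V 4 \<psi>"
    and "\<And>xs. xs \<in> tuples {1..7} 4 \<Longrightarrow> \<psi> (map (dual_frame V f) xs) = psi0 xs"
    and "vol (map (dual_frame V f) [1,2,3,4,5,6,7]) > 0"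
proof -
  show *: "coframed V f" using assms by (simp add: coframed_def adapted_psi_def)
  interpret coframed V f by (rule *)
  have \<psi>: "\<psi> vs = coframe_hodge V f 3 (standard_phi f) vs" if "vs \<in> tuples V 4" for vs
    using assms that by (simp add: adapted_psi_def)
  show "alternating_on V 4 \<psi>"
    using alternating_on_cong[OF subspace \<psi>] alternating_hodge[of 3 4] by simp
  show "\<psi> (map F xs) = psi0 xs" if "xs \<in> tuples {1..7} 4" for xs
    using that \<psi>[of "map F xs"] hodge_standard_phi[OF that] by (simp add: tuples_def image_subset_iff)
  show "vol (map F [1,2,3,4,5,6,7]) > 0" using assms by (simp add: adapted_psi_def)
qed

lemma adapted_phi_coframed:
  assumes "subspace V" "adapted_phi V \<phi> f"
  shows "coframed V f" and "alternating_on V 3 \<phi>"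
    and "\<And>xs. xs \<in> tuples {1..7} 3 \<Longrightarrow> \<phi> (map (dual_frame V f) xs) = phi0 xs"
proof -
  show *: "coframed V f" using assms by (simp add: coframed_def adapted_phi_def)
  interpret coframed V f by (rule *)
  have \<phi>: "\<phi> vs = standard_phi f vs" if "vs \<in> tuples V 3" for vs
    using assms that by (simp add: adapted_phi_def)
  show "alternating_on V 3 \<phi>"
    using alternating_on_cong[OF subspace \<phi>] alternating_standard_phi by simp
  show "\<phi> (map F xs) = phi0 xs" if "xs \<in> tuples {1..7} 3" for xs
    using that \<phi>[of "map F xs"] standard_phi_comp[OF that] by (simp add: tuples_def image_subset_iff)
qed

text \<open>Whatever adapted coframe \<open>f\<close> is taken, its volume factor and Gram matrix
  relative to \<open>e\<close> can be read off from the \<open>e\<close>-components of \<psi>.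
  Positivity of \<open>c\<close> comes from the orientation given by \<open>e\<close>.\<close>

lemma adapted_psi_pair:
  assumes V: "subspace V" and e: "coframed V e" and f: "adapted_psi V (coframe_wedge e [1,2,3,4,5,6,7]) \<psi> f"
  shows "coframed_pair V e f"
    and "coframed_pair.c V e f > 0"
    and "13824 ^ 4 * 168 * coframed_pair.c V e f ^ 8 = psi_norm (\<lambda>xs. \<psi> (map (dual_frame V e) xs))"
    and "\<And>i j. i \<in> {1..7} \<Longrightarrow> j \<in> {1..7} \<Longrightarrow>
      13824 * (coframed_pair.c V e f)\<^sup>2 * coframed_pair.\<G> V e f i j = bryant_psi (\<lambda>xs. \<psi> (map (dual_frame V e) xs)) i j"
proof -
  note a = adapted_psi_coframed[OF V f]
  show *: "coframed_pair V e f" using e a(1) by (simp add: coframed_pair_def)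
  interpret coframed_pair V e f by (rule *)
  have "e.vol (map f.F [1,2,3,4,5,6,7]) > 0" by (rule a(4))
  then show "c > 0" using vol_e_f by (metis zero_less_mult_pos zero_less_one)
  have m: "multilin_on V 4 \<psi>" using a(2) by (simp add: alternating_on_iff[OF V])
  show "13824 ^ 4 * 168 * c ^ 8 = psi_norm (\<lambda>xs. \<psi> (map e.F xs))"
    using psi_norm_eq[OF m a(3)] by simp
  show "13824 * c\<^sup>2 * \<G> i j = bryant_psi (\<lambda>xs. \<psi> (map e.F xs)) i j" if "i \<in> {1..7}" "j \<in> {1..7}" for i j
    using bryant_psi_eq[OF m _ that] a(3) by simp
qed

text \<open>Comparison with the pair (e, e), where volume factor and Gram matrix are trivial: \<psi>
  determines c^8, both coframes are positive for \<open>vol\<close>, so c = 1, and then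
  \<open>bryant_psi_eq\<close> determines \<open>\<G>\<close>.\<close>

lemma adapted_psi_unique:
  assumes V: "subspace V" and vol: "alternating_on V 7 vol" and e: "adapted_psi V vol \<psi> e" and f: "adapted_psi V vol \<psi> f"
  shows "coframed_pair V e f" "coframed_pair.c V e f = 1"
    and "\<And>x z. x \<in> {1..7} \<Longrightarrow> z \<in> {1..7} \<Longrightarrow> coframed_pair.\<G> V e f x z = (if x = z then 1 else 0)"
proof -
  note ae = adapted_psi_coframed[OF V e] and af = adapted_psi_coframed[OF V f]
  show *: "coframed_pair V e f" using ae(1) af(1) by (simp add: coframed_pair_def)
  interpret coframed_pair V e f by (rule *)
  have m: "multilin_on V 4 \<psi>" using af(2) by (simp add: alternating_on_iff[OF V])
  interpret ee: coframed_pair V e e by unfold_locales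
  have "map e.F [1,2,3,4,5,6,7] \<in> tuples V 7" by (auto simp: tuples_def)
  then have "vol (map e.F [1,2,3,4,5,6,7]) = vol (map f.F [1,2,3,4,5,6,7]) * c"
    unfolding c_def by (rule f.alternating_top_vol[OF vol])
  then have "c > 0" using ae(4) af(4) by (metis zero_less_mult_pos)
  have "13824 ^ 4 * 168 * c ^ 8 = 13824 ^ 4 * 168 * ee.c ^ 8"
    using psi_norm_eq[OF m af(3)] ee.psi_norm_eq[OF m ae(3)] by simp
  moreover have c1: "ee.c = 1" unfolding ee.c_def by (rule e.coframe_wedge_dual) auto
  ultimately have "c ^ 8 = 1" by simp
  then show c: "c = 1" using \<open>c > 0\<close> power_eq_iff_eq_base[of 8 c 1] by simp
  fix x z :: nat assume xz: "x \<in> {1..7}" "z \<in> {1..7}"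
  have "ee.\<G> x z = (\<Sum>y\<in>{1..7}. if y = x then ee.M z y else 0)"
    unfolding ee.\<G>_def using xz by (intro sum.cong refl) (auto simp: ee.M_def e.dual)
  then have "ee.\<G> x z = (if x = z then 1 else 0)"
    using xz by (simp add: sum.delta ee.M_def e.dual eq_commute)
  then show "\<G> x z = (if x = z then 1 else 0)"
    using bryant_psi_eq[OF m _ xz] ee.bryant_psi_eq[OF m _ xz] af(3) ae(3) c c1 by simp
qed

text \<open>The coframe behind \<open>SOME\<close> can be exchanged for any adapted one at hand; the
  concrete computations of \<open>star_psi\<close> rest on this.\<close>

lemma psi_hodge_eq:
  assumes V: "subspace V" and vol: "alternating_on V 7 vol" and e: "adapted_psi V vol \<psi> e"
    and "alternating_on V k \<omega>" "k + l = 7" "vs \<in> tuples V l"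
  shows "psi_hodge V vol \<psi> k \<omega> vs = coframe_hodge V e k \<omega> vs"
proof -
  have "adapted_psi V vol \<psi> (SOME f. adapted_psi V vol \<psi> f)" using e someI[of "adapted_psi V vol \<psi>"] by blast
  note u = adapted_psi_unique[OF V vol e this]
  show ?thesis unfolding psi_hodge_def
    using coframed_pair.hodge_eqI[OF u] assms by blast
qed

lemma psi_metric_eq:
  assumes V: "subspace V" and vol: "alternating_on V 7 vol" and e: "adapted_psi V vol \<psi> e"
    and "v \<in> V" "w \<in> V"
  shows "psi_metric V vol \<psi> v w = coframe_metric e v w"
proof -
  have "adapted_psi V vol \<psi> (SOME f. adapted_psi V vol \<psi> f)" using e someI[of "adapted_psi V vol \<psi>"] by blast
  note u = adapted_psi_unique[OF V vol e this]
  show ?thesis unfolding psi_metric_def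
    using coframed_pair.metric_eqI[OF u(1,3)] assms by blast
qed

lemma phi_hodge_eq:
  assumes V: "subspace V" and e: "adapted_phi V \<phi> e"
    and "alternating_on V k \<omega>" "k + l = 7" "vs \<in> tuples V l"
  shows "phi_hodge V \<phi> k \<omega> vs = coframe_hodge V e k \<omega> vs"
proof -
  define f where "f = (SOME f. adapted_phi V \<phi> f)"
  have f: "adapted_phi V \<phi> f" unfolding f_def using e someI[of "adapted_phi V \<phi>"] by blast
  note ae = adapted_phi_coframed[OF V e] and af = adapted_phi_coframed[OF V f]
  interpret coframed_pair V e f using ae(1) af(1) by (simp add: coframed_pair_def)
  have m: "multilin_on V 3 \<phi>" using af(2) by (simp add: alternating_on_iff[OF V])
  show ?thesis unfolding phi_hodge_def f_def[symmetric]
    by (rule hodge_eqI[OF phi_rigid(1)[OF m] phi_rigid(2)[OF m]]) (use assms af(3) ae(3) in auto)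
qed

section \<open>Wedge products of alternating forms\<close>

lemma wedge_cong:
  assumes "\<And>ws. set ws \<subseteq> set vs \<Longrightarrow> length ws = k \<Longrightarrow> \<alpha> ws = \<alpha>' ws"
    and "\<And>ws. set ws \<subseteq> set vs \<Longrightarrow> length ws + k = length vs \<Longrightarrow> \<beta> ws = \<beta>' ws"
  shows "wedge k \<alpha> \<beta> vs = wedge k \<alpha>' \<beta>' vs"
  unfolding wedge_def
proof (intro sum.cong refl arg_cong2[where f = "(*)"])
  fix I assume I: "I \<in> {I. I \<subseteq> {..<length vs} \<and> card I = k}"
  have "{i. i < length vs \<and> i \<in> I} = I" using I by auto
  then show "\<alpha> (nths vs I) = \<alpha>' (nths vs I)"
    using I by (intro assms) (simp_all add: length_nths set_nths_subset)
  have "{i. i < length vs \<and> i \<in> - I} = {..<length vs} - I" by auto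
  then have "length (nths vs (- I)) = length vs - k"
    using I finite_subset[of I "{..<length vs}"] by (simp add: length_nths card_Diff_subset)
  moreover have "k \<le> length vs" using I card_mono[of "{..<length vs}" I] by auto
  ultimately show "\<beta> (nths vs (- I)) = \<beta>' (nths vs (- I))"
    by (intro assms) (simp_all add: set_nths_subset)
qed

lemma wedge_linear_left:
  "wedge k (\<lambda>ws. a * \<alpha> ws + b * \<alpha>' ws) \<beta> vs = a * wedge k \<alpha> \<beta> vs + b * wedge k \<alpha>' \<beta> vs"
  by (simp add: wedge_def sum_distrib_left sum.distrib[symmetric] algebra_simps)

lemma wedge_linear_right:
  "wedge k \<alpha> (\<lambda>ws. a * \<beta> ws + b * \<beta>' ws) vs = a * wedge k \<alpha> \<beta> vs + b * wedge k \<alpha> \<beta>' vs"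
  by (simp add: wedge_def sum_distrib_left sum.distrib[symmetric] algebra_simps)

lemma wedge_Cons:
  "wedge k \<alpha> \<beta> (v # vs)
   = (case k of 0 \<Rightarrow> 0 | Suc j \<Rightarrow> wedge j (\<lambda>ws. \<alpha> (v # ws)) \<beta> vs) + (- 1) ^ k * wedge k \<alpha> (\<lambda>ws. \<beta> (v # ws)) vs"
  by (cases k) (simp_all only: wedge_Suc_Cons nat.case wedge_0 power_0 mult_1 add_0_left)

lemma wedge_short:
  assumes "length vs < k"
  shows "wedge k \<alpha> \<beta> vs = 0"
proof -
  have "card I \<noteq> k" if "I \<subseteq> {..<length vs}" for I
    using card_mono[OF _ that] assms by simp
  then have "{I. I \<subseteq> {..<length vs} \<and> card I = k} = {}" by blast
  then show ?thesis unfolding wedge_def by (simp only: sum.empty)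
qed

lemma skew_on_Cons:
  assumes "skew_on V (Suc k) \<beta>" "x \<in> V"
  shows "skew_on V k (\<lambda>ws. \<beta> (x # ws))"
  using skew_on_prefix[of V 1 k \<beta> "[x]"] assms by (simp add: tuples_def One_nat_def)

lemma multilin_on_Cons:
  assumes "multilin_on V (Suc k) \<beta>" "x \<in> V"
  shows "multilin_on V k (\<lambda>ws. \<beta> (x # ws))"
  using multilin_on_prefix[of V 1 k \<beta> "[x]"] assms by (simp add: tuples_def One_nat_def)

text \<open>In the base case, the terms in which one factor receives both \<open>a\<close> and
  \<open>b\<close> change sign by hypothesis, while the two terms in which each factor receives one
  of them have opposite signs and are exchanged.\<close>

lemma skew_on_wedge:
  assumes "skew_on V k \<alpha>" "skew_on V l \<beta>"
  shows "skew_on V (k + l) (wedge k \<alpha> \<beta>)"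
proof (rule skew_onI)
  fix xs a b ys
  assume "set xs \<subseteq> V" "a \<in> V" "b \<in> V" "set ys \<subseteq> V" "length xs + length ys + 2 = k + l"
  then show "wedge k \<alpha> \<beta> (xs @ a # b # ys) = - wedge k \<alpha> \<beta> (xs @ b # a # ys)"
    using assms
  proof (induction xs arbitrary: k l \<alpha> \<beta>)
    case Nil
    have \<beta>: "wedge j \<gamma> (\<lambda>ws. \<beta> (a # b # ws)) ys = - wedge j \<gamma> (\<lambda>ws. \<beta> (b # a # ws)) ys" if "j = k" for j \<gamma>
    proof -
      have "wedge j \<gamma> (\<lambda>ws. \<beta> (a # b # ws)) ys = wedge j \<gamma> (\<lambda>ws. (- 1) * \<beta> (b # a # ws) + 0 * \<beta> ws) ys"
      proof (rule wedge_cong)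
        fix ws assume "set ws \<subseteq> set ys" "length ws + j = length ys"
        then show "\<beta> (a # b # ws) = - 1 * \<beta> (b # a # ws) + 0 * \<beta> ws"
          using skew_onD[OF Nil.prems(7), of "[]" a b ws] Nil.prems that by (simp add: tuples_def subset_iff)
      qed simp
      then show ?thesis by (simp only: wedge_linear_right)
    qed
    have \<alpha>: "wedge j (\<lambda>ws. \<alpha> (a # b # ws)) \<gamma> ys = - wedge j (\<lambda>ws. \<alpha> (b # a # ws)) \<gamma> ys" if "Suc (Suc j) = k" for j \<gamma>
    proof -
      have "wedge j (\<lambda>ws. \<alpha> (a # b # ws)) \<gamma> ys = wedge j (\<lambda>ws. (- 1) * \<alpha> (b # a # ws) + 0 * \<alpha> ws) \<gamma> ys"
      proof (rule wedge_cong)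
        fix ws assume "set ws \<subseteq> set ys" "length ws = j"
        then show "\<alpha> (a # b # ws) = - 1 * \<alpha> (b # a # ws) + 0 * \<alpha> ws"
          using skew_onD[OF Nil.prems(6), of "[]" a b ws] Nil.prems that by (simp add: tuples_def subset_iff)
      qed simp
      then show ?thesis by (simp only: wedge_linear_left)
    qed
    show ?case
    proof (cases k)
      case 0
      then show ?thesis using \<beta>[of k] by (simp only: append_Nil wedge_Cons nat.case) simp
    next
      case (Suc j)
      show ?thesis
      proof (cases j)
        case 0
        then show ?thesis using Suc \<beta>[of k]
          by (simp only: append_Nil wedge_Cons nat.case) (simp add: algebra_simps)
      next
        case (Suc i)
        then show ?thesis using \<open>k = Suc j\<close> \<beta>[of k] \<alpha>[of i]
          by (simp only: append_Nil wedge_Cons nat.case) (simp add: algebra_simps)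
      qed
    qed
  next
    case (Cons x xs)
    have 1: "wedge j (\<lambda>ws. \<alpha> (x # ws)) \<beta> (xs @ a # b # ys) = - wedge j (\<lambda>ws. \<alpha> (x # ws)) \<beta> (xs @ b # a # ys)"
      if "k = Suc j" for j
      using Cons.prems that skew_on_Cons[of V j \<alpha> x] by - (rule Cons.IH[of j l], simp_all)
    have 2: "wedge k \<alpha> (\<lambda>ws. \<beta> (x # ws)) (xs @ a # b # ys) = - wedge k \<alpha> (\<lambda>ws. \<beta> (x # ws)) (xs @ b # a # ys)"
    proof (cases l)
      case 0
      then show ?thesis using Cons.prems(5) by (simp add: wedge_short)
    next
      case (Suc m)
      then show ?thesis using Cons.prems skew_on_Cons[of V m \<beta> x] by - (rule Cons.IH[of k m], simp_all)
    qed
    show ?case using 1 2 by (cases k) (simp_all add: wedge_Cons algebra_simps)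
  qed
qed

lemma multilin_on_wedge:
  assumes "multilin_on V k \<alpha>" "multilin_on V l \<beta>"
  shows "multilin_on V (k + l) (wedge k \<alpha> \<beta>)"
  unfolding multilin_on_def
proof (intro allI impI)
  fix xs ys u w and a b :: real
  assume "set xs \<subseteq> V" "u \<in> V" "w \<in> V" "set ys \<subseteq> V" "length xs + length ys + 1 = k + l"
  then show "wedge k \<alpha> \<beta> (xs @ (a *\<^sub>R u + b *\<^sub>R w) # ys)
    = a * wedge k \<alpha> \<beta> (xs @ u # ys) + b * wedge k \<alpha> \<beta> (xs @ w # ys)"
    using assms
  proof (induction xs arbitrary: k l \<alpha> \<beta>)
    case Nil
    let ?v = "a *\<^sub>R u + b *\<^sub>R w"
    have \<beta>: "wedge k \<alpha> (\<lambda>ws. \<beta> (?v # ws)) ys = a * wedge k \<alpha> (\<lambda>ws. \<beta> (u # ws)) ys + b * wedge k \<alpha> (\<lambda>ws. \<beta> (w # ws)) ys"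
      unfolding wedge_linear_right[symmetric]
    proof (rule wedge_cong)
      fix ws assume "set ws \<subseteq> set ys" "length ws + k = length ys"
      then show "\<beta> (?v # ws) = a * \<beta> (u # ws) + b * \<beta> (w # ws)"
        using multilin_onD[OF Nil.prems(7), of "[]" u w ws a b] Nil.prems by (simp add: subset_iff)
    qed simp
    have \<alpha>: "wedge j (\<lambda>ws. \<alpha> (?v # ws)) \<beta> ys = a * wedge j (\<lambda>ws. \<alpha> (u # ws)) \<beta> ys + b * wedge j (\<lambda>ws. \<alpha> (w # ws)) \<beta> ys"
      if "k = Suc j" for j
      unfolding wedge_linear_left[symmetric]
    proof (rule wedge_cong)
      fix ws assume "set ws \<subseteq> set ys" "length ws = j"
      then show "\<alpha> (?v # ws) = a * \<alpha> (u # ws) + b * \<alpha> (w # ws)"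
        using multilin_onD[OF Nil.prems(6), of "[]" u w ws a b] Nil.prems that by (simp add: subset_iff)
    qed simp
    show ?case using \<alpha> \<beta> by (cases k) (simp_all add: wedge_Cons algebra_simps)
  next
    case (Cons x xs)
    let ?v = "a *\<^sub>R u + b *\<^sub>R w"
    have 1: "wedge j (\<lambda>ws. \<alpha> (x # ws)) \<beta> (xs @ ?v # ys)
      = a * wedge j (\<lambda>ws. \<alpha> (x # ws)) \<beta> (xs @ u # ys) + b * wedge j (\<lambda>ws. \<alpha> (x # ws)) \<beta> (xs @ w # ys)"
      if "k = Suc j" for j
      using Cons.prems that multilin_on_Cons[of V j \<alpha> x] by - (rule Cons.IH[of j l], simp_all)
    have 2: "wedge k \<alpha> (\<lambda>ws. \<beta> (x # ws)) (xs @ ?v # ys)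
      = a * wedge k \<alpha> (\<lambda>ws. \<beta> (x # ws)) (xs @ u # ys) + b * wedge k \<alpha> (\<lambda>ws. \<beta> (x # ws)) (xs @ w # ys)"
    proof (cases l)
      case 0
      then show ?thesis using Cons.prems(5) by (simp add: wedge_short)
    next
      case (Suc m)
      then show ?thesis using Cons.prems multilin_on_Cons[of V m \<beta> x] by - (rule Cons.IH[of k m], simp_all)
    qed
    show ?case using 1 2 by (cases k) (simp_all add: wedge_Cons algebra_simps)
  qed
qed

lemma alternating_on_wedge:
  assumes "subspace V" "alternating_on V k \<alpha>" "alternating_on V l \<beta>"
  shows "alternating_on V (k + l) (wedge k \<alpha> \<beta>)"
  using assms skew_on_wedge multilin_on_wedge by (simp add: alternating_on_iff) blast

section \<open>The Chevalley-Eilenberg differential\<close>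

text \<open>Recursive form of the Chevalley-Eilenberg differential for a bracket \<open>br\<close>:
  \<open>\<iota>\<^sub>x d\<alpha> = - L\<^sub>x \<alpha> - d \<iota>\<^sub>x \<alpha>\<close>, where \<open>L\<^sub>x\<close> lets \<open>br x\<close> act on each slot.\<close>

fun lie_act :: "('a \<Rightarrow> 'a \<Rightarrow> 'a) \<Rightarrow> 'a \<Rightarrow> 'a aform \<Rightarrow> 'a aform" where
  "lie_act br x \<alpha> [] = 0"
| "lie_act br x \<alpha> (y # ys) = \<alpha> (br x y # ys) + lie_act br x (\<lambda>zs. \<alpha> (y # zs)) ys"

fun lie_diff :: "('a \<Rightarrow> 'a \<Rightarrow> 'a) \<Rightarrow> 'a aform \<Rightarrow> 'a aform" where
  "lie_diff br \<alpha> [] = 0"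
| "lie_diff br \<alpha> (x # xs) = - lie_act br x \<alpha> xs - lie_diff br (\<lambda>zs. \<alpha> (x # zs)) xs"

lemma lie_act_sum:
  "lie_act br x \<alpha> xs = (\<Sum>j<length xs. \<alpha> (take j xs @ br x (xs ! j) # drop (Suc j) xs))"
  by (induction xs arbitrary: \<alpha>) (simp_all add: sum.lessThan_Suc_shift del: sum.lessThan_Suc)

text \<open>The bracket part of \<open>ext_deriv\<close>; on left-invariant forms it is the whole
  exterior derivative, see \<open>ext_deriv_eq\<close>.\<close>

definition chev_eil :: "('a \<Rightarrow> 'a \<Rightarrow> 'a) \<Rightarrow> nat \<Rightarrow> 'a aform \<Rightarrow> 'a aform" where
  "chev_eil br k \<alpha> xs = (\<Sum>(i, j) | i < j \<and> j < Suc k. (- 1) ^ (i + j) *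
     \<alpha> (br (xs ! i) (xs ! j) # nths xs (- {i, j})))"

lemma nths_Compl_single: "j < length xs \<Longrightarrow> nths xs (- {j}) = take j xs @ drop (Suc j) xs"
proof (induction xs arbitrary: j)
  case (Cons x xs)
  have *: "\<And>m. {i. i \<noteq> m} = - {m::nat}" "{i. Suc i \<in> - {0}} = (UNIV :: nat set)"
    "\<And>m. {i. Suc i \<in> - {Suc m}} = - {m}" by auto
  show ?case using Cons by (cases j) (simp_all add: nths_Cons * nths_all)
qed simp

text \<open>The pairs with i = 0 give the Lie action, once the bracket has been moved from the front
  to its slot. For the other pairs both indices drop by one, which keeps the sign, but
  \<open>x\<close> has to pass the bracket.\<close>

lemma chev_eil_Cons:
  assumes "length xs = Suc n" "skew_on V (Suc n) \<alpha>" "set (x # xs) \<subseteq> V"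
    and br: "\<And>x y. x \<in> V \<Longrightarrow> y \<in> V \<Longrightarrow> br x y \<in> V"
  shows "chev_eil br (Suc n) \<alpha> (x # xs) = - lie_act br x \<alpha> xs - chev_eil br n (\<lambda>zs. \<alpha> (x # zs)) xs"
proof -
  let ?t = "\<lambda>(i, j). (- 1) ^ (i + j) * \<alpha> (br ((x # xs) ! i) ((x # xs) ! j) # nths (x # xs) (- {i, j}))"
  let ?P = "\<lambda>m. {(i, j). i < j \<and> j < Suc m}"
  have split: "?P (Suc n) = (\<lambda>j. (0, Suc j)) ` {..<Suc n} \<union> (\<lambda>(i, j). (Suc i, Suc j)) ` ?P n"
  proof (intro equalityI subsetI)
    fix z assume "z \<in> ?P (Suc n)"
    then obtain i j where z: "z = (i, j)" "i < j" "j < Suc (Suc n)" by auto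
    then show "z \<in> (\<lambda>j. (0, Suc j)) ` {..<Suc n} \<union> (\<lambda>(i, j). (Suc i, Suc j)) ` ?P n"
      by (cases i; cases j) auto
  qed auto
  have fin: "finite (?P n)"
    by (rule finite_subset[of _ "{..<Suc n} \<times> {..<Suc n}"]) auto
  have "chev_eil br (Suc n) \<alpha> (x # xs) = sum ?t (?P (Suc n))"
    by (simp add: chev_eil_def)
  also have "\<dots> = sum ?t ((\<lambda>j. (0, Suc j)) ` {..<Suc n}) + sum ?t ((\<lambda>(i, j). (Suc i, Suc j)) ` ?P n)"
    unfolding split using fin by (intro sum.union_disjoint) auto
  also have "sum ?t ((\<lambda>j. (0, Suc j)) ` {..<Suc n}) = (\<Sum>j<Suc n. ?t (0, Suc j))"
    by (subst sum.reindex) (auto simp: inj_on_def)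
  also have "\<dots> = - lie_act br x \<alpha> xs"
    unfolding lie_act_sum sum_negf[symmetric] assms(1)
  proof (intro sum.cong refl)
    fix j assume j: "j \<in> {..<Suc n}"
    let ?b = "br x (xs ! j)"
    have jn: "j < length xs" using j assms(1) by simp
    have "xs ! j \<in> V" using jn assms(3) nth_mem by fastforce
    then have b: "?b \<in> V" using br assms(3) by simp
    have "set (take j xs) \<subseteq> V" "set (drop (Suc j) xs) \<subseteq> V"
      using assms(3) set_take_subset[of j xs] set_drop_subset[of "Suc j" xs] by auto
    then have t: "[] @ take j xs @ ?b # drop (Suc j) xs \<in> tuples V (Suc n)"
      using b jn assms(1) by (simp add: tuples_def)
    have "{i. Suc i \<in> - {0, Suc j}} = - {j}" by auto
    then have "nths (x # xs) (- {0, Suc j}) = take j xs @ drop (Suc j) xs"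
      using nths_Compl_single[OF jn] by (simp add: nths_Cons)
    moreover have "\<alpha> (take j xs @ ?b # drop (Suc j) xs) = (- 1) ^ j * \<alpha> (?b # take j xs @ drop (Suc j) xs)"
      using skew_on_move[OF assms(2) t] jn by simp
    ultimately show "?t (0, Suc j) = - \<alpha> (take j xs @ ?b # drop (Suc j) xs)" by simp
  qed
  also have "sum ?t ((\<lambda>(i, j). (Suc i, Suc j)) ` ?P n) = (\<Sum>z\<in>?P n. ?t (case z of (i, j) \<Rightarrow> (Suc i, Suc j)))"
    by (subst sum.reindex) (auto simp: inj_on_def comp_def)
  also have "\<dots> = - chev_eil br n (\<lambda>zs. \<alpha> (x # zs)) xs"
    unfolding chev_eil_def sum_negf[symmetric]
  proof (intro sum.cong refl)
    fix z assume "z \<in> ?P n"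
    then obtain i j where z: "z = (i, j)" "i < j" "j < Suc n" by auto
    have m: "xs ! i \<in> V" "xs ! j \<in> V" using z assms(1,3) nth_mem[of i xs] nth_mem[of j xs] by auto
    let ?b = "br (xs ! i) (xs ! j)" and ?r = "nths xs (- {i, j})"
    have "{l. l < length xs \<and> l \<in> - {i, j}} = {..<Suc n} - {i, j}" using assms(1) by auto
    then have "length ?r = Suc n - 2" using z by (simp add: length_nths card_Diff_subset)
    moreover have "set ?r \<subseteq> V" using assms(3) set_nths_subset[of xs] by auto
    ultimately have t: "[] @ ?b # x # ?r \<in> tuples V (Suc n)"
      using z assms(3) br[OF m] by (auto simp: tuples_def)
    have "{l. Suc l \<in> - {Suc i, Suc j}} = - {i, j}" by auto
    then have "nths (x # xs) (- {Suc i, Suc j}) = x # ?r" by (simp add: nths_Cons)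
    then show "?t (case z of (i, j) \<Rightarrow> (Suc i, Suc j))
      = - (case z of (i, j) \<Rightarrow> (- 1) ^ (i + j) * \<alpha> (x # br (xs ! i) (xs ! j) # nths xs (- {i, j})))"
      using skew_onD[OF assms(2) t] z by simp
  qed
  finally show ?thesis by simp
qed

lemma chev_eil_eq:
  assumes "length xs = Suc n" "skew_on V n \<alpha>" "set xs \<subseteq> V"
    and br: "\<And>x y. x \<in> V \<Longrightarrow> y \<in> V \<Longrightarrow> br x y \<in> V"
  shows "chev_eil br n \<alpha> xs = lie_diff br \<alpha> xs"
  using assms(1-3)
proof (induction n arbitrary: xs \<alpha>)
  case 0
  then obtain x where "xs = [x]" by (auto simp: length_Suc_conv)
  moreover have "{(i, j). i < j \<and> j < Suc 0} = {}" by auto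
  ultimately show ?case by (simp only: chev_eil_def) simp
next
  case (Suc n)
  then obtain x ys where xs: "xs = x # ys" "length ys = Suc n" by (auto simp: length_Suc_conv)
  have "chev_eil br n (\<lambda>zs. \<alpha> (x # zs)) ys = lie_diff br (\<lambda>zs. \<alpha> (x # zs)) ys"
    using Suc.prems xs skew_on_Cons[of V n \<alpha> x] by - (rule Suc.IH, simp_all)
  then show ?case using chev_eil_Cons[OF xs(2) Suc.prems(2) _ br] Suc.prems(3) xs by simp
qed

lemma lie_act_cong:
  assumes "\<And>x y. x \<in> V \<Longrightarrow> y \<in> V \<Longrightarrow> br x y \<in> V" "x \<in> V" "set xs \<subseteq> V"
    and "\<And>ws. set ws \<subseteq> V \<Longrightarrow> length ws = length xs \<Longrightarrow> \<alpha> ws = \<beta> ws"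
  shows "lie_act br x \<alpha> xs = lie_act br x \<beta> xs"
  using assms(3,4)
proof (induction xs arbitrary: \<alpha> \<beta>)
  case (Cons y ys)
  have "lie_act br x (\<lambda>zs. \<alpha> (y # zs)) ys = lie_act br x (\<lambda>zs. \<beta> (y # zs)) ys"
    using Cons.prems by - (rule Cons.IH, simp_all)
  then show ?case using Cons.prems assms(1,2) by simp
qed simp

lemma lie_diff_cong:
  assumes "\<And>x y. x \<in> V \<Longrightarrow> y \<in> V \<Longrightarrow> br x y \<in> V" "set xs \<subseteq> V"
    and "\<And>ws. set ws \<subseteq> V \<Longrightarrow> Suc (length ws) = length xs \<Longrightarrow> \<alpha> ws = \<beta> ws"
  shows "lie_diff br \<alpha> xs = lie_diff br \<beta> xs"
  using assms(2,3)
proof (induction xs arbitrary: \<alpha> \<beta>)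
  case (Cons y ys)
  have "lie_diff br (\<lambda>zs. \<alpha> (y # zs)) ys = lie_diff br (\<lambda>zs. \<beta> (y # zs)) ys"
    using Cons.prems by - (rule Cons.IH, simp_all)
  moreover have "lie_act br y \<alpha> ys = lie_act br y \<beta> ys"
    using Cons.prems by (intro lie_act_cong[of V]) (auto intro: assms(1))
  ultimately show ?case by simp
qed simp

lemma lie_act_linear:
  "lie_act br x (\<lambda>ws. a * \<alpha> ws + b * \<beta> ws) xs = a * lie_act br x \<alpha> xs + b * lie_act br x \<beta> xs"
  by (induction xs arbitrary: \<alpha> \<beta>) (simp_all add: algebra_simps)

lemma lie_diff_linear:
  "lie_diff br (\<lambda>ws. a * \<alpha> ws + b * \<beta> ws) xs = a * lie_diff br \<alpha> xs + b * lie_diff br \<beta> xs"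
  by (induction xs arbitrary: \<alpha> \<beta>) (simp_all add: lie_act_linear algebra_simps)

lemma skew_on_lie_act:
  assumes br: "\<And>x y. x \<in> V \<Longrightarrow> y \<in> V \<Longrightarrow> br x y \<in> V" "x \<in> V"
    and "skew_on V k \<alpha>"
  shows "skew_on V k (lie_act br x \<alpha>)"
proof (rule skew_onI)
  fix xs a b ys
  assume "set xs \<subseteq> V" "a \<in> V" "b \<in> V" "set ys \<subseteq> V" "length xs + length ys + 2 = k"
  then show "lie_act br x \<alpha> (xs @ a # b # ys) = - lie_act br x \<alpha> (xs @ b # a # ys)"
    using assms(3)
  proof (induction xs arbitrary: k \<alpha>)
    case Nil
    have *: "\<alpha> (u # v # ws) = - \<alpha> (v # u # ws)" if "u \<in> V" "v \<in> V" "set ws \<subseteq> V" "length ws + 2 = k" for u v ws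
      using skew_onD[OF Nil.prems(6), of "[]" u v ws] that by (simp add: tuples_def)
    have "lie_act br x (\<lambda>zs. \<alpha> (a # b # zs)) ys = lie_act br x (\<lambda>zs. (- 1) * \<alpha> (b # a # zs) + 0 * \<alpha> zs) ys"
      using Nil.prems br by (intro lie_act_cong[of V]) (auto intro!: *)
    also have "\<dots> = - lie_act br x (\<lambda>zs. \<alpha> (b # a # zs)) ys"
      by (simp only: lie_act_linear)
    finally show ?case
      using *[of "br x a" b ys] *[of a "br x b" ys] br Nil.prems by simp
  next
    case (Cons y xs)
    from Cons.prems(5) obtain l where k: "k = Suc l" by (cases k) auto
    have "lie_act br x (\<lambda>zs. \<alpha> (y # zs)) (xs @ a # b # ys) = - lie_act br x (\<lambda>zs. \<alpha> (y # zs)) (xs @ b # a # ys)"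
      using Cons.prems k skew_on_Cons[of V l \<alpha> y] by - (rule Cons.IH[of l], simp_all)
    moreover have "\<alpha> ((br x y # xs) @ a # b # ys) = - \<alpha> ((br x y # xs) @ b # a # ys)"
      using Cons.prems k br by (intro skew_onD[OF Cons.prems(6)]) (simp add: tuples_def)
    ultimately show ?case by simp
  qed
qed

text \<open>Unfolded twice, d\<alpha>(a, b, ...) is the sum of -\<alpha>([a, b], ...), of -L_a
  \<alpha>_b + L_b \<alpha>_a and of d(\<alpha>_ab). The first and last terms change sign with the
  bracket and with \<alpha>, the middle ones are exchanged.\<close>

lemma skew_on_lie_diff:
  assumes br: "\<And>x y. x \<in> V \<Longrightarrow> y \<in> V \<Longrightarrow> br x y \<in> V" "\<And>x y. br x y = - br y x"
    and V: "subspace V" and "alternating_on V k \<alpha>"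
  shows "skew_on V (Suc k) (lie_diff br \<alpha>)"
proof (rule skew_onI)
  fix xs a b ys
  assume "set xs \<subseteq> V" "a \<in> V" "b \<in> V" "set ys \<subseteq> V" "length xs + length ys + 2 = Suc k"
  moreover have "skew_on V k \<alpha>" "multilin_on V k \<alpha>" using assms(4) by (auto simp: alternating_on_iff[OF V])
  ultimately show "lie_diff br \<alpha> (xs @ a # b # ys) = - lie_diff br \<alpha> (xs @ b # a # ys)"
  proof (induction xs arbitrary: k \<alpha>)
    case Nil
    have "lie_diff br (\<lambda>zs. \<alpha> (a # b # zs)) ys = lie_diff br (\<lambda>zs. (- 1) * \<alpha> (b # a # zs) + 0 * \<alpha> zs) ys"
    proof (rule lie_diff_cong[of V])
      fix ws assume "set ws \<subseteq> V" "Suc (length ws) = length ys"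
      then show "\<alpha> (a # b # ws) = (- 1) * \<alpha> (b # a # ws) + 0 * \<alpha> ws"
        using skew_onD[OF Nil.prems(6), of "[]" a b ws] Nil.prems by (simp add: tuples_def)
    qed (use Nil.prems br(1) in auto)
    also have "\<dots> = - lie_diff br (\<lambda>zs. \<alpha> (b # a # zs)) ys"
      by (simp only: lie_diff_linear)
    finally have 1: "lie_diff br (\<lambda>zs. \<alpha> (a # b # zs)) ys = - lie_diff br (\<lambda>zs. \<alpha> (b # a # zs)) ys" .
    have "\<alpha> ([] @ ((- 1) *\<^sub>R br b a + 0 *\<^sub>R br b a) # ys) = (- 1) * \<alpha> ([] @ br b a # ys) + 0 * \<alpha> ([] @ br b a # ys)"
      using Nil.prems br(1) by (intro multilin_onD[OF Nil.prems(7)]) auto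
    then have 2: "\<alpha> (br a b # ys) = - \<alpha> (br b a # ys)"
      using br(2)[of a b] by simp
    show ?case using 1 2 by simp
  next
    case (Cons x xs)
    from Cons.prems(5) obtain l where k: "k = Suc l" by (cases k) auto
    have "lie_diff br (\<lambda>zs. \<alpha> (x # zs)) (xs @ a # b # ys) = - lie_diff br (\<lambda>zs. \<alpha> (x # zs)) (xs @ b # a # ys)"
      using Cons.prems k skew_on_Cons[of V l \<alpha> x] multilin_on_Cons[of V l \<alpha> x] by - (rule Cons.IH[of l], simp_all)
    moreover have "lie_act br x \<alpha> (xs @ a # b # ys) = - lie_act br x \<alpha> (xs @ b # a # ys)"
      using Cons.prems by (intro skew_onD[OF skew_on_lie_act[OF br(1)]]) (auto simp: tuples_def)
    ultimately show ?case by simp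
  qed
qed

lemma multilin_on_lie_act:
  assumes br: "\<And>x y. x \<in> V \<Longrightarrow> y \<in> V \<Longrightarrow> br x y \<in> V" "x \<in> V" "linear (br x)"
    and "multilin_on V k \<alpha>"
  shows "multilin_on V k (lie_act br x \<alpha>)"
  unfolding multilin_on_def
proof (intro allI impI)
  fix xs ys u w and a b :: real
  assume "set xs \<subseteq> V" "u \<in> V" "w \<in> V" "set ys \<subseteq> V" "length xs + length ys + 1 = k"
  let ?v = "a *\<^sub>R u + b *\<^sub>R w"
  note \<open>set xs \<subseteq> V\<close> \<open>u \<in> V\<close> \<open>w \<in> V\<close> \<open>set ys \<subseteq> V\<close> \<open>length xs + length ys + 1 = k\<close>
  then show "lie_act br x \<alpha> (xs @ ?v # ys) = a * lie_act br x \<alpha> (xs @ u # ys) + b * lie_act br x \<alpha> (xs @ w # ys)"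
    using assms(4)
  proof (induction xs arbitrary: k \<alpha>)
    case Nil
    have "lie_act br x (\<lambda>zs. \<alpha> (?v # zs)) ys = lie_act br x (\<lambda>zs. a * \<alpha> (u # zs) + b * \<alpha> (w # zs)) ys"
    proof (rule lie_act_cong[of V])
      fix ws assume "set ws \<subseteq> V" "length ws = length ys"
      then show "\<alpha> (?v # ws) = a * \<alpha> (u # ws) + b * \<alpha> (w # ws)"
        using multilin_onD[OF Nil.prems(6), of "[]" u w ws a b] Nil.prems by simp
    qed (use Nil.prems br in auto)
    moreover have "\<alpha> (br x ?v # ys) = a * \<alpha> (br x u # ys) + b * \<alpha> (br x w # ys)"
      using multilin_onD[OF Nil.prems(6), of "[]" "br x u" "br x w" ys a b] Nil.prems br
      by (simp add: linear_add linear_scale)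
    ultimately show ?case by (simp add: lie_act_linear algebra_simps)
  next
    case (Cons y xs)
    from Cons.prems(5) obtain l where k: "k = Suc l" by (cases k) auto
    have "lie_act br x (\<lambda>zs. \<alpha> (y # zs)) (xs @ ?v # ys)
       = a * lie_act br x (\<lambda>zs. \<alpha> (y # zs)) (xs @ u # ys) + b * lie_act br x (\<lambda>zs. \<alpha> (y # zs)) (xs @ w # ys)"
      using Cons.prems k multilin_on_Cons[of V l \<alpha> y] by - (rule Cons.IH[of l], simp_all)
    moreover have "\<alpha> ((br x y # xs) @ ?v # ys) = a * \<alpha> ((br x y # xs) @ u # ys) + b * \<alpha> ((br x y # xs) @ w # ys)"
      using Cons.prems k br by (intro multilin_onD[OF Cons.prems(6)]) auto
    ultimately show ?case by (simp add: algebra_simps)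
  qed
qed

lemma lie_act_linear_arg:
  assumes br: "\<And>x y. x \<in> V \<Longrightarrow> y \<in> V \<Longrightarrow> br x y \<in> V" "\<And>y. linear (\<lambda>x. br x y)" and "multilin_on V k \<alpha>"
    "u \<in> V" "w \<in> V" "set xs \<subseteq> V" "length xs = k"
  shows "lie_act br (a *\<^sub>R u + b *\<^sub>R w) \<alpha> xs = a * lie_act br u \<alpha> xs + b * lie_act br w \<alpha> xs"
  using assms(3-)
proof (induction xs arbitrary: k \<alpha>)
  case (Cons y ys)
  from Cons.prems(5) obtain l where k: "k = Suc l" by (cases k) auto
  have "br (a *\<^sub>R u + b *\<^sub>R w) y = a *\<^sub>R br u y + b *\<^sub>R br w y"
    using linear_add[OF br(2)[of y], of "a *\<^sub>R u" "b *\<^sub>R w"] linear_scale[OF br(2)[of y]] by simp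
  then have "\<alpha> (br (a *\<^sub>R u + b *\<^sub>R w) y # ys) = a * \<alpha> (br u y # ys) + b * \<alpha> (br w y # ys)"
    using multilin_onD[OF Cons.prems(1), of "[]" "br u y" "br w y" ys a b] Cons.prems br(1) by simp
  moreover have "lie_act br (a *\<^sub>R u + b *\<^sub>R w) (\<lambda>zs. \<alpha> (y # zs)) ys
      = a * lie_act br u (\<lambda>zs. \<alpha> (y # zs)) ys + b * lie_act br w (\<lambda>zs. \<alpha> (y # zs)) ys"
    using Cons.prems k multilin_on_Cons[of V l \<alpha> y] by - (rule Cons.IH[of l], simp_all)
  ultimately show ?case by (simp add: algebra_simps)
qed simp

lemma multilin_on_lie_diff:
  assumes br: "\<And>x y. x \<in> V \<Longrightarrow> y \<in> V \<Longrightarrow> br x y \<in> V" "\<And>x. linear (br x)" "\<And>y. linear (\<lambda>x. br x y)"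
    and "multilin_on V k \<alpha>"
  shows "multilin_on V (Suc k) (lie_diff br \<alpha>)"
  unfolding multilin_on_def
proof (intro allI impI)
  fix xs ys u w and a b :: real
  assume "set xs \<subseteq> V" "u \<in> V" "w \<in> V" "set ys \<subseteq> V" "length xs + length ys + 1 = Suc k"
  let ?v = "a *\<^sub>R u + b *\<^sub>R w"
  note \<open>set xs \<subseteq> V\<close> \<open>u \<in> V\<close> \<open>w \<in> V\<close> \<open>set ys \<subseteq> V\<close> \<open>length xs + length ys + 1 = Suc k\<close>
  then show "lie_diff br \<alpha> (xs @ ?v # ys) = a * lie_diff br \<alpha> (xs @ u # ys) + b * lie_diff br \<alpha> (xs @ w # ys)"
    using assms(4)
  proof (induction xs arbitrary: k \<alpha>)
    case Nil
    have "lie_diff br (\<lambda>zs. \<alpha> (?v # zs)) ys = lie_diff br (\<lambda>zs. a * \<alpha> (u # zs) + b * \<alpha> (w # zs)) ys"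
    proof (rule lie_diff_cong[of V])
      fix ws assume "set ws \<subseteq> V" "Suc (length ws) = length ys"
      then show "\<alpha> (?v # ws) = a * \<alpha> (u # ws) + b * \<alpha> (w # ws)"
        using multilin_onD[OF Nil.prems(6), of "[]" u w ws a b] Nil.prems by simp
    qed (use Nil.prems br in auto)
    moreover have "lie_act br ?v \<alpha> ys = a * lie_act br u \<alpha> ys + b * lie_act br w \<alpha> ys"
      using Nil.prems br by (intro lie_act_linear_arg[of V]) auto
    ultimately show ?case by (simp add: lie_diff_linear algebra_simps)
  next
    case (Cons x xs)
    from Cons.prems(5) obtain l where k: "k = Suc l" by (cases k) auto
    have "lie_diff br (\<lambda>zs. \<alpha> (x # zs)) (xs @ ?v # ys)
       = a * lie_diff br (\<lambda>zs. \<alpha> (x # zs)) (xs @ u # ys) + b * lie_diff br (\<lambda>zs. \<alpha> (x # zs)) (xs @ w # ys)"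
      using Cons.prems k multilin_on_Cons[of V l \<alpha> x] by - (rule Cons.IH[of l], simp_all)
    moreover have "lie_act br x \<alpha> (xs @ ?v # ys) = a * lie_act br x \<alpha> (xs @ u # ys) + b * lie_act br x \<alpha> (xs @ w # ys)"
      using Cons.prems br by (intro multilin_onD[OF multilin_on_lie_act]) auto
    ultimately show ?case by (simp add: algebra_simps)
  qed
qed

lemma alternating_on_lie_diff:
  assumes "\<And>x y. x \<in> V \<Longrightarrow> y \<in> V \<Longrightarrow> br x y \<in> V" "\<And>x y. br x y = - br y x"
    and "\<And>x. linear (br x)" "\<And>y. linear (\<lambda>x. br x y)"
    and V: "subspace V" and "alternating_on V k \<alpha>"
  shows "alternating_on V (Suc k) (lie_diff br \<alpha>)"
  unfolding alternating_on_iff[OF V]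
proof
  have "multilin_on V k \<alpha>" using assms(6) by (simp add: alternating_on_iff[OF V])
  with assms(1,3,4) show "multilin_on V (Suc k) (lie_diff br \<alpha>)" by (rule multilin_on_lie_diff)
  show "skew_on V (Suc k) (lie_diff br \<alpha>)"
    by (rule skew_on_lie_diff[OF assms(1,2) V assms(6)])
qed

text \<open>The differential on components; \<open>C m i j\<close> is the \<open>m\<close>-th component of the bracket of the
  \<open>i\<close>-th and \<open>j\<close>-th frame vectors.\<close>

fun act_comp :: "(nat \<Rightarrow> nat \<Rightarrow> nat \<Rightarrow> real) \<Rightarrow> nat \<Rightarrow> (nat list \<Rightarrow> real) \<Rightarrow> nat list \<Rightarrow> real" where
  "act_comp C i w [] = 0"
| "act_comp C i w (j # js) = (\<Sum>m\<in>{1..7}. C m i j * w (m # js)) + act_comp C i (\<lambda>zs. w (j # zs)) js"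

fun diff_comp :: "(nat \<Rightarrow> nat \<Rightarrow> nat \<Rightarrow> real) \<Rightarrow> (nat list \<Rightarrow> real) \<Rightarrow> nat list \<Rightarrow> real" where
  "diff_comp C w [] = 0"
| "diff_comp C w (i # is) = - act_comp C i w is - diff_comp C (\<lambda>zs. w (i # zs)) is"

context coframed
begin

lemma lie_act_comp:
  assumes C: "\<And>i j. i \<in> {1..7} \<Longrightarrow> j \<in> {1..7} \<Longrightarrow> br (F i) (F j) = (\<Sum>m\<in>{1..7}. C m i j *\<^sub>R F m)"
    and "i \<in> {1..7}" "js \<in> tuples {1..7} k" "multilin_on V k \<alpha>"
    and "\<And>is. is \<in> tuples {1..7} k \<Longrightarrow> \<alpha> (map F is) = w is"
  shows "lie_act br (F i) \<alpha> (map F js) = act_comp C i w js"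
  using assms(3-)
proof (induction js arbitrary: k \<alpha> w)
  case (Cons j js)
  then obtain l where k: "k = Suc l" and j: "j \<in> {1..7}" "js \<in> tuples {1..7} l" by (auto simp: Cons_tuples)
  have js: "map F js \<in> tuples V l" using j by (auto simp: tuples_def)
  have "\<alpha> (br (F i) (F j) # map F js) = (\<Sum>m\<in>{1..7}. C m i j * \<alpha> (F m # map F js))"
    unfolding C[OF assms(2) j(1)]
    by (rule multilin_on_sum_Cons[OF _ subspace]) (use Cons.prems k js in auto)
  also have "\<dots> = (\<Sum>m\<in>{1..7}. C m i j * w (m # js))"
    using Cons.prems(3)[of "_ # js"] k j by (intro sum.cong refl) simp
  moreover have "lie_act br (F i) (\<lambda>zs. \<alpha> (F j # zs)) (map F js) = act_comp C i (\<lambda>zs. w (j # zs)) js"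
  proof (rule Cons.IH[OF j(2)])
    show "multilin_on V l (\<lambda>zs. \<alpha> (F j # zs))" using Cons.prems(2) k by (simp add: multilin_on_Cons)
    show "\<alpha> (F j # map F is) = w (j # is)" if "is \<in> tuples {1..7} l" for "is"
      using Cons.prems(3)[of "j # is"] k j that by simp
  qed
  ultimately show ?case by simp
qed simp

lemma lie_diff_comp:
  assumes C: "\<And>i j. i \<in> {1..7} \<Longrightarrow> j \<in> {1..7} \<Longrightarrow> br (F i) (F j) = (\<Sum>m\<in>{1..7}. C m i j *\<^sub>R F m)"
    and "js \<in> tuples {1..7} (Suc k)" "multilin_on V k \<alpha>"
    and "\<And>is. is \<in> tuples {1..7} k \<Longrightarrow> \<alpha> (map F is) = w is"
  shows "lie_diff br \<alpha> (map F js) = diff_comp C w js"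
  using assms(2-)
proof (induction js arbitrary: k \<alpha> w)
  case (Cons j js)
  then have j: "j \<in> {1..7}" "js \<in> tuples {1..7} k" by auto
  have "lie_act br (F j) \<alpha> (map F js) = act_comp C j w js"
    by (rule lie_act_comp[where br = br and C = C and k = k]) (use C j Cons.prems in simp_all)
  moreover have "lie_diff br (\<lambda>zs. \<alpha> (F j # zs)) (map F js) = diff_comp C (\<lambda>zs. w (j # zs)) js"
  proof (cases k)
    case 0
    then show ?thesis using j by simp
  next
    case (Suc l)
    show ?thesis
    proof (rule Cons.IH)
      show "js \<in> tuples {1..7} (Suc l)" using j Suc by simp
      show "multilin_on V l (\<lambda>zs. \<alpha> (F j # zs))" using Cons.prems(2) Suc by (simp add: multilin_on_Cons)
      show "\<alpha> (F j # map F is) = w (j # is)" if "is \<in> tuples {1..7} l" for "is"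
        using Cons.prems(3)[of "j # is"] Suc j that by simp
    qed
  qed
  ultimately show ?case by simp
qed simp

end

section \<open>Linear Lie groups\<close>

lemma in_combsD:
  assumes "js \<in> set (combs l xs)"
  shows "length js = l" "set js \<subseteq> set xs" "distinct xs \<Longrightarrow> distinct js" "sorted xs \<Longrightarrow> sorted js"
proof -
  have "length js = l \<and> set js \<subseteq> set xs \<and> (distinct xs \<longrightarrow> distinct js) \<and> (sorted xs \<longrightarrow> sorted js)"
    using assms
  proof (induction l xs arbitrary: js rule: combs.induct)
    case (3 k x xs)
    then consider ys where "js = x # ys" "ys \<in> set (combs k xs)" | "js \<in> set (combs (Suc k) xs)"
      by auto
    then show ?case
    proof cases
      case 1
      with "3.IH"(1)[OF 1(2)] show ?thesis by (simp add: subset_iff) blast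
    next
      case 2
      from "3.IH"(2)[OF 2] show ?thesis by (simp add: subset_iff)
    qed
  qed simp_all
  then show "length js = l" "set js \<subseteq> set xs" "distinct xs \<Longrightarrow> distinct js" "sorted xs \<Longrightarrow> sorted js"
    by auto
qed

lemma alternating_on_pullback:
  assumes V: "subspace V" and W: "subspace W" and "linear h" and h: "\<And>v. v \<in> V \<Longrightarrow> h v \<in> W" and "alternating_on W k \<omega>"
  shows "alternating_on V k (\<lambda>vs. \<omega> (map h vs))"
  unfolding alternating_on_iff[OF V]
proof
  have m: "multilin_on W k \<omega>" "skew_on W k \<omega>" using assms by (auto simp: alternating_on_iff[OF W])
  show "multilin_on V k (\<lambda>vs. \<omega> (map h vs))"
    unfolding multilin_on_def
  proof (intro allI impI)
    fix xs ys u w a b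
    assume *: "set xs \<subseteq> V" "u \<in> V" "w \<in> V" "set ys \<subseteq> V" "length xs + length ys + 1 = k"
    then have "\<omega> (map h xs @ (a *\<^sub>R h u + b *\<^sub>R h w) # map h ys)
        = a * \<omega> (map h xs @ h u # map h ys) + b * \<omega> (map h xs @ h w # map h ys)"
      using h by (intro multilin_onD[OF m(1)]) auto
    then show "\<omega> (map h (xs @ (a *\<^sub>R u + b *\<^sub>R w) # ys)) = a * \<omega> (map h (xs @ u # ys)) + b * \<omega> (map h (xs @ w # ys))"
      using assms(3) by (simp add: linear_add linear_scale)
  qed
  show "skew_on V k (\<lambda>vs. \<omega> (map h vs))"
  proof (rule skew_onI)
    fix xs a b ys
    assume "set xs \<subseteq> V" "a \<in> V" "b \<in> V" "set ys \<subseteq> V" "length xs + length ys + 2 = k"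
    then have "map h xs @ h a # h b # map h ys \<in> tuples W k" using h by (auto simp: tuples_def)
    from skew_onD[OF m(2) this]
    show "\<omega> (map h (xs @ a # b # ys)) = - \<omega> (map h (xs @ b # a # ys))" by simp
  qed
qed

lemma wedge_map: "wedge k \<alpha> \<beta> (map h xs) = wedge k (\<lambda>ys. \<alpha> (map h ys)) (\<lambda>ys. \<beta> (map h ys)) xs"
  by (simp add: wedge_def nths_map)

lemma (in coframed) skew_comp:
  assumes "alternating_on V k \<omega>"
  shows "skew_on {1..7} k (\<lambda>xs. \<omega> (map F xs))"
proof (rule skew_onI)
  fix xs ys :: "nat list" and a b assume "length xs + length ys + 2 = k"
  then have "map F xs @ F a # F b # map F ys \<in> tuples V k" by (auto simp: tuples_def)
  then show "\<omega> (map F (xs @ a # b # ys)) = - \<omega> (map F (xs @ b # a # ys))"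
    using assms skew_onD[of V k \<omega> "map F xs" "F a" "F b" "map F ys"] by (simp add: alternating_on_iff[OF subspace])
qed

text \<open>\<open>assoc\<close> and \<open>one\<close> are demanded on the whole ambient algebra
  because they are applied to tangent vectors. \<open>J\<close> is a linear map agreeing with
  inversion on the group (conjugation or conjugate transpose), which makes inversion continuous
  along parametrisations.\<close>

locale lin_group =
  fixes G :: "'a::euclidean_space monoid" and J :: "'a \<Rightarrow> 'a"
  assumes group: "group G"
    and bilinear: "bounded_bilinear (mult G)"
    and assoc: "(x \<otimes>\<^bsub>G\<^esub> y) \<otimes>\<^bsub>G\<^esub> z = x \<otimes>\<^bsub>G\<^esub> (y \<otimes>\<^bsub>G\<^esub> z)"
    and one: "\<one>\<^bsub>G\<^esub> \<otimes>\<^bsub>G\<^esub> x = x" "x \<otimes>\<^bsub>G\<^esub> \<one>\<^bsub>G\<^esub> = x"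
    and subspace_one: "subspace (tangent G \<one>\<^bsub>G\<^esub>)"
    and bracket_in: "x \<in> tangent G \<one>\<^bsub>G\<^esub> \<Longrightarrow> y \<in> tangent G \<one>\<^bsub>G\<^esub> \<Longrightarrow> bracket G x y \<in> tangent G \<one>\<^bsub>G\<^esub>"
    and linear_J: "linear J"
    and inv_J: "p \<in> carrier G \<Longrightarrow> inv\<^bsub>G\<^esub> p = J p"
begin

sublocale group G by (rule group)

abbreviation T where "T \<equiv> tangent G"

lemma linear_left: "linear (\<lambda>x. p \<otimes>\<^bsub>G\<^esub> x)" and linear_right: "linear (\<lambda>x. x \<otimes>\<^bsub>G\<^esub> p)"
  using bounded_bilinear.bounded_linear_right[OF bilinear] bounded_bilinear.bounded_linear_left[OF bilinear]
  by (auto intro: bounded_linear.linear)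

lemma tangent_mult:
  assumes "p \<in> carrier G" "v \<in> T q"
  shows "p \<otimes>\<^bsub>G\<^esub> v \<in> T (p \<otimes>\<^bsub>G\<^esub> q)"
proof -
  obtain c where c: "\<forall>s. c s \<in> carrier G" "c 0 = q" "(c has_vector_derivative v) (at (0::real))"
    using assms(2) by (auto simp: tangent_space_def)
  have "((\<lambda>s. p \<otimes>\<^bsub>G\<^esub> c s) has_vector_derivative p \<otimes>\<^bsub>G\<^esub> v) (at 0)"
    by (rule bounded_linear.has_vector_derivative[OF bounded_bilinear.bounded_linear_right[OF bilinear] c(3)])
  then show ?thesis
    using c(1,2) assms(1) by (auto simp: tangent_space_def intro!: exI[of _ "\<lambda>s. p \<otimes>\<^bsub>G\<^esub> c s"])
qed

lemma cancel: "p \<in> carrier G \<Longrightarrow> inv\<^bsub>G\<^esub> p \<otimes>\<^bsub>G\<^esub> (p \<otimes>\<^bsub>G\<^esub> v) = v" "p \<in> carrier G \<Longrightarrow> p \<otimes>\<^bsub>G\<^esub> (inv\<^bsub>G\<^esub> p \<otimes>\<^bsub>G\<^esub> v) = v"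
  by (simp_all add: assoc[symmetric] one)

lemma tangent_inv:
  assumes "p \<in> carrier G" "v \<in> T p"
  shows "inv\<^bsub>G\<^esub> p \<otimes>\<^bsub>G\<^esub> v \<in> T \<one>\<^bsub>G\<^esub>"
  using tangent_mult[of "inv\<^bsub>G\<^esub> p" v p] assms by simp

lemma tangent_one: "p \<in> carrier G \<Longrightarrow> v \<in> T \<one>\<^bsub>G\<^esub> \<Longrightarrow> p \<otimes>\<^bsub>G\<^esub> v \<in> T p"
  using tangent_mult[of p v "\<one>\<^bsub>G\<^esub>"] by (simp add: one)

lemma subspace_tangent:
  assumes "p \<in> carrier G"
  shows "subspace (T p)"
proof -
  have "T p = (\<lambda>v. p \<otimes>\<^bsub>G\<^esub> v) ` T \<one>\<^bsub>G\<^esub>"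
  proof
    show "T p \<subseteq> (\<lambda>v. p \<otimes>\<^bsub>G\<^esub> v) ` T \<one>\<^bsub>G\<^esub>"
      using assms tangent_inv cancel(2) by (metis imageI subsetI)
    show "(\<lambda>v. p \<otimes>\<^bsub>G\<^esub> v) ` T \<one>\<^bsub>G\<^esub> \<subseteq> T p" using assms tangent_one by blast
  qed
  then show ?thesis using linear_subspace_image[OF linear_left subspace_one] by metis
qed

lemma bracket_antisym: "bracket G x y = - bracket G y x"
  by (simp add: bracket_def)

lemma linear_bracket: "linear (bracket G x)" "linear (\<lambda>x. bracket G x y)"
  unfolding bracket_def by (intro linear_compose_sub linear_left linear_right)+

text \<open>Since \<open>v\<close> is tangent, there is a curve with velocity \<open>v\<close>; it
  pins down the value in the \<open>THE\<close> by uniqueness of derivatives.\<close>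

lemma directional_derivative_const:
  assumes "\<And>q. q \<in> carrier G \<Longrightarrow> h q = k" "v \<in> T p"
  shows "directional_derivative (carrier G) h p v = 0"
  unfolding directional_derivative_def
proof (rule the_equality)
  have const: "((\<lambda>s. h (c s)) has_real_derivative 0) (at 0)" if "\<forall>s. c s \<in> carrier G" for c :: "real \<Rightarrow> 'a"
  proof -
    have "(\<lambda>s. h (c s)) = (\<lambda>s. k)" using that assms(1) by auto
    then show ?thesis by simp
  qed
  then show "\<forall>c. (\<forall>s. c s \<in> carrier G) \<and> c 0 = p \<and> (c has_vector_derivative v) (at 0) \<longrightarrow>
        ((\<lambda>s. h (c s)) has_real_derivative 0) (at 0)" by blast
  fix D assume D: "\<forall>c::real \<Rightarrow> 'a. (\<forall>s. c s \<in> carrier G) \<and> c 0 = p \<and> (c has_vector_derivative v) (at 0) \<longrightarrow>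
        ((\<lambda>s. h (c s)) has_real_derivative D) (at 0)"
  obtain c where c: "\<forall>s. c s \<in> carrier G" "c 0 = p" "(c has_vector_derivative v) (at (0::real))"
    using assms(2) by (auto simp: tangent_space_def)
  then have "((\<lambda>s. h (c s)) has_real_derivative D) (at 0)" using D by blast
  then show "D = 0" using const[OF c(1)] DERIV_unique by blast
qed

end

section \<open>Left-invariant coframes and forms with constant components\<close>

locale lie_frame = lin_group G J for G :: "'a::euclidean_space monoid" and J +
  fixes e :: "nat \<Rightarrow> 'a form"
  assumes left_invariant_coframe: "left_invariant_coframe G e"
begin

abbreviation E where "E p \<equiv> dual_frame (T p) (\<lambda>i. e i p)"

lemma coframed_at: "p \<in> carrier G \<Longrightarrow> coframed (T p) (\<lambda>i. e i p)"
  using left_invariant_coframe subspace_tangent by (simp add: coframed_def left_invariant_coframe_def)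

lemma e_left:
  assumes "i \<in> {1..7}" "p \<in> carrier G" "q \<in> carrier G" "v \<in> T q"
  shows "e i (p \<otimes>\<^bsub>G\<^esub> q) [p \<otimes>\<^bsub>G\<^esub> v] = e i q [v]"
proof -
  have "[v] \<in> tuples (T q) 1" using assms by (simp add: tuples_def)
  moreover have "left_invariant_form G 1 (e i)"
    using left_invariant_coframe assms(1) by (simp add: left_invariant_coframe_def)
  ultimately have "e i (p \<otimes>\<^bsub>G\<^esub> q) (map (\<lambda>v. p \<otimes>\<^bsub>G\<^esub> v) [v]) = e i q [v]"
    using assms(2,3) unfolding left_invariant_form_def by blast
  then show ?thesis by simp
qed

lemma E_left:
  assumes "p \<in> carrier G" "q \<in> carrier G"
  shows "E (p \<otimes>\<^bsub>G\<^esub> q) j = p \<otimes>\<^bsub>G\<^esub> E q j"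
proof -
  interpret q: coframed "T q" "\<lambda>i. e i q" using assms coframed_at by simp
  interpret pq: coframed "T (p \<otimes>\<^bsub>G\<^esub> q)" "\<lambda>i. e i (p \<otimes>\<^bsub>G\<^esub> q)" using assms coframed_at by simp
  show ?thesis
    by (rule pq.eqI) (use assms tangent_mult[OF assms(1)] e_left pq.dual q.dual in simp_all)
qed

lemma E_one: "p \<in> carrier G \<Longrightarrow> E p j = p \<otimes>\<^bsub>G\<^esub> E \<one>\<^bsub>G\<^esub> j"
  using E_left[of p "\<one>\<^bsub>G\<^esub>" j] by (simp add: one)

text \<open>Left-invariance together with the values on the Lie algebra: in the frame
  \<open>E\<close> the components of such a form do not depend on the point
  (\<open>has_comp_left_invariant\<close>, \<open>left_invariant_has_comp\<close>). Outside
  \<open>tuples {1..7} k\<close> the function \<open>w\<close> is arbitrary.\<close>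

definition has_comp :: "nat \<Rightarrow> 'a form \<Rightarrow> (nat list \<Rightarrow> real) \<Rightarrow> bool" where
  "has_comp k \<omega> w \<longleftrightarrow> (\<forall>p\<in>carrier G. alternating_on (T p) k (\<omega> p) \<and>
     (\<forall>js\<in>tuples {1..7} k. \<omega> p (map (E p) js) = w js))"

lemma has_compD:
  assumes "has_comp k \<omega> w" "p \<in> carrier G"
  shows "alternating_on (T p) k (\<omega> p)" "js \<in> tuples {1..7} k \<Longrightarrow> \<omega> p (map (E p) js) = w js"
    "multilin_on (T p) k (\<omega> p)" "skew_on (T p) k (\<omega> p)"
  using assms by (auto simp: has_comp_def alternating_on_iff[OF subspace_tangent])

lemma has_comp_form_eq:
  assumes "form_eq (carrier G) k \<omega> \<omega>'"
  shows "has_comp k \<omega> w \<longleftrightarrow> has_comp k \<omega>' w"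
proof -
  have "(alternating_on (T p) k (\<omega> p) \<and> (\<forall>js\<in>tuples {1..7} k. \<omega> p (map (E p) js) = w js))
    \<longleftrightarrow> (alternating_on (T p) k (\<omega>' p) \<and> (\<forall>js\<in>tuples {1..7} k. \<omega>' p (map (E p) js) = w js))"
    if p: "p \<in> carrier G" for p
  proof -
    interpret coframed "T p" "\<lambda>i. e i p" using p coframed_at by simp
    have eq: "\<omega> p vs = \<omega>' p vs" if "vs \<in> tuples (T p) k" for vs
      using assms p that by (auto simp: form_eq_def)
    have "map F js \<in> tuples (T p) k" if "js \<in> tuples {1..7} k" for js using that by (auto simp: tuples_def)
    then show ?thesis using alternating_on_cong[OF subspace eq] eq by simp
  qed
  then show ?thesis unfolding has_comp_def by blast
qed

lemma has_comp_unique: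
  assumes "has_comp k \<omega> w" "has_comp k \<omega>' w'" "\<And>js. js \<in> tuples {1..7} k \<Longrightarrow> w js = w' js"
  shows "form_eq (carrier G) k \<omega> \<omega>'"
  unfolding form_eq_def
proof (intro ballI)
  fix p vs assume p: "p \<in> carrier G" and vs: "vs \<in> tuples (T p) k"
  interpret coframed "T p" "\<lambda>i. e i p" using p coframed_at by simp
  show "\<omega> p vs = \<omega>' p vs"
    by (rule multilin_on_eqI[OF has_compD(3)[OF assms(1) p] has_compD(3)[OF assms(2) p] vs])
       (simp add: has_compD[OF assms(1) p] has_compD[OF assms(2) p] assms(3))
qed

lemma has_comp_cong:
  assumes "has_comp k \<omega> w" "\<And>js. js \<in> tuples {1..7} k \<Longrightarrow> w js = w' js"
  shows "has_comp k \<omega> w'"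
  using assms by (simp add: has_comp_def)

lemma has_comp_antisym:
  assumes "has_comp k \<omega> w"
  shows "skew_on {1..7} k w"
proof -
  interpret coframed "T \<one>\<^bsub>G\<^esub>" "\<lambda>i. e i \<one>\<^bsub>G\<^esub>" using coframed_at by simp
  have a: "skew_on {1..7} k (\<lambda>xs. \<omega> \<one>\<^bsub>G\<^esub> (map F xs))"
    using has_compD[OF assms] by (intro skew_comp) simp
  show ?thesis
  proof (rule skew_onI)
    fix xs ys :: "nat list" and a b :: nat
    assume "set xs \<subseteq> {1..7}" "a \<in> {1..7}" "b \<in> {1..7}" "set ys \<subseteq> {1..7}" "length xs + length ys + 2 = k"
    then have t: "xs @ a # b # ys \<in> tuples {1..7} k" "xs @ b # a # ys \<in> tuples {1..7} k"
      by (auto simp: tuples_def)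
    show "w (xs @ a # b # ys) = - w (xs @ b # a # ys)"
      using skew_onD[OF a t(1)] has_compD(2)[OF assms one_closed t(1)] has_compD(2)[OF assms one_closed t(2)] by simp
  qed
qed

text \<open>Components that come from a general formula are replaced by a closed expression after a
  check on increasing multi-indices only.\<close>

lemma has_comp_combs:
  assumes "has_comp k \<omega> w" "skew_on {1..7} k w'" "\<And>js. js \<in> set (combs k [1,2,3,4,5,6,7]) \<Longrightarrow> w js = w' js"
  shows "has_comp k \<omega> w'"
  by (rule has_comp_cong[OF assms(1)]) (rule skew_on_eqI[OF has_comp_antisym[OF assms(1)] assms(2,3)])

lemma has_comp_add:
  assumes "has_comp k \<alpha> w" "has_comp k \<beta> w'"
  shows "has_comp k (\<lambda>p vs. a * \<alpha> p vs + b * \<beta> p vs) (\<lambda>js. a * w js + b * w' js)"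
  unfolding has_comp_def
proof (intro ballI conjI)
  fix p assume p: "p \<in> carrier G"
  interpret coframed "T p" "\<lambda>i. e i p" using p coframed_at by simp
  show "alternating_on (T p) k (\<lambda>vs. a * \<alpha> p vs + b * \<beta> p vs)"
    using has_compD(1)[OF assms(1) p] has_compD(1)[OF assms(2) p] by (rule alternating_add)
qed (use has_compD(2)[OF assms(1)] has_compD(2)[OF assms(2)] in simp)

lemma has_comp_scale: "has_comp k \<alpha> w \<Longrightarrow> has_comp k (\<lambda>p vs. a * \<alpha> p vs) (\<lambda>js. a * w js)"
  using has_comp_add[of k \<alpha> w \<alpha> w a 0] by simp

text \<open>\<open>wedge\<close> is polymorphic in the entries of the lists, so it also multiplies
  component functions on index lists.\<close>

lemma has_comp_wedge:
  assumes "has_comp k \<alpha> w" "has_comp l \<beta> w'"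
  shows "has_comp (k + l) (\<lambda>p. wedge k (\<alpha> p) (\<beta> p)) (wedge k w w')"
  unfolding has_comp_def
proof (intro ballI conjI)
  fix p assume p: "p \<in> carrier G"
  show "alternating_on (T p) (k + l) (wedge k (\<alpha> p) (\<beta> p))"
    using has_compD(1)[OF assms(1) p] has_compD(1)[OF assms(2) p] subspace_tangent[OF p]
    by (intro alternating_on_wedge)
  fix js :: "nat list" assume js: "js \<in> tuples {1..7} (k + l)"
  have "wedge k (\<lambda>ys. \<alpha> p (map (E p) ys)) (\<lambda>ys. \<beta> p (map (E p) ys)) js = wedge k w w' js"
  proof (rule wedge_cong)
    fix ws assume "set ws \<subseteq> set js" "length ws = k"
    then have "ws \<in> tuples {1..7} k" using js by (auto simp: tuples_def)
    then show "\<alpha> p (map (E p) ws) = w ws" by (rule has_compD(2)[OF assms(1) p])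
  next
    fix ws assume "set ws \<subseteq> set js" "length ws + k = length js"
    then have "ws \<in> tuples {1..7} l" using js by (auto simp: tuples_def)
    then show "\<beta> p (map (E p) ws) = w' ws" by (rule has_compD(2)[OF assms(2) p])
  qed
  then show "wedge k (\<alpha> p) (\<beta> p) (map (E p) js) = wedge k w w' js" by (simp only: wedge_map)
qed

lemma has_comp_ew:
  assumes "sorted is" "distinct is" "set is \<subseteq> {1..7}" "length is = k"
  shows "has_comp k (ew e is) (cw is)"
  unfolding has_comp_def ew_def
proof (intro ballI conjI)
  fix p assume p: "p \<in> carrier G"
  interpret coframed "T p" "\<lambda>i. e i p" using p coframed_at by simp
  show "alternating_on (T p) k (coframe_wedge (\<lambda>i. e i p) is)"
    using alternating_coframe_wedge'[OF assms(3,4)] .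
  show "coframe_wedge (\<lambda>i. e i p) is (map F js) = cw is js" if "js \<in> tuples {1..7} k" for js
    using coframe_wedge_comp[OF assms that] .
qed

lemma has_comp_e:
  assumes "i \<in> {1..7}"
  shows "has_comp 1 (e i) (cw [i])"
  unfolding has_comp_def
proof (intro ballI conjI)
  fix p assume p: "p \<in> carrier G"
  interpret coframed "T p" "\<lambda>i. e i p" using p coframed_at by simp
  show "alternating_on (T p) 1 (e i p)" using coframe assms by (simp add: coframe_def)
  fix js :: "nat list" assume "js \<in> tuples {1..7} 1"
  then obtain j where "js = [j]" by (auto simp: tuples_def length_Suc_conv One_nat_def)
  then show "e i p (map F js) = cw [i] js" using assms dual by (simp add: cw_Cons cw_Nil)
qed

lemma has_comp_left:
  assumes \<omega>: "has_comp k \<omega> w" and p: "p \<in> carrier G" and q: "q \<in> carrier G" and vs: "vs \<in> tuples (T q) k"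
  shows "\<omega> (p \<otimes>\<^bsub>G\<^esub> q) (map (\<lambda>v. p \<otimes>\<^bsub>G\<^esub> v) vs) = \<omega> q vs"
proof -
  have pq: "p \<otimes>\<^bsub>G\<^esub> q \<in> carrier G" using p q by simp
  interpret coframed "T q" "\<lambda>i. e i q" using q coframed_at by simp
  have "alternating_on (T q) k (\<lambda>vs. \<omega> (p \<otimes>\<^bsub>G\<^esub> q) (map (\<lambda>v. p \<otimes>\<^bsub>G\<^esub> v) vs))"
    using p by (intro alternating_on_pullback[OF subspace subspace_tangent[OF pq] linear_left _ has_compD(1)[OF \<omega> pq]] tangent_mult)
  then have m: "multilin_on (T q) k (\<lambda>vs. \<omega> (p \<otimes>\<^bsub>G\<^esub> q) (map (\<lambda>v. p \<otimes>\<^bsub>G\<^esub> v) vs))"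
    by (simp add: alternating_on_iff[OF subspace])
  show ?thesis
  proof (rule multilin_on_eqI[OF m has_compD(3)[OF \<omega> q] vs])
    fix "is" :: "nat list" assume "is": "is \<in> tuples {1..7} k"
    have eq: "map (\<lambda>v. p \<otimes>\<^bsub>G\<^esub> v) (map F is) = map (E (p \<otimes>\<^bsub>G\<^esub> q)) is"
      using E_left[OF p q] by simp
    show "\<omega> (p \<otimes>\<^bsub>G\<^esub> q) (map (\<lambda>v. p \<otimes>\<^bsub>G\<^esub> v) (map F is)) = \<omega> q (map F is)"
      unfolding eq using has_compD(2)[OF \<omega> pq "is"] has_compD(2)[OF \<omega> q "is"] by simp
  qed
qed

lemma has_comp_left_invariant: "has_comp k \<omega> w \<Longrightarrow> left_invariant_form G k \<omega>"
  unfolding left_invariant_form_def is_form_def using has_compD(1) has_comp_left by blast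

lemma left_invariant_has_comp:
  assumes \<omega>: "left_invariant_form G k \<omega>"
  shows "has_comp k \<omega> (\<lambda>js. \<omega> \<one>\<^bsub>G\<^esub> (map (E \<one>\<^bsub>G\<^esub>) js))"
  unfolding has_comp_def
proof (intro ballI conjI)
  fix p assume p: "p \<in> carrier G"
  show "alternating_on (T p) k (\<omega> p)" using \<omega> p by (simp add: left_invariant_form_def is_form_def)
  interpret coframed "T \<one>\<^bsub>G\<^esub>" "\<lambda>i. e i \<one>\<^bsub>G\<^esub>" using coframed_at by simp
  fix js :: "nat list" assume "js \<in> tuples {1..7} k"
  then have "map F js \<in> tuples (T \<one>\<^bsub>G\<^esub>) k" by (auto simp: tuples_def)
  then have "\<omega> (p \<otimes>\<^bsub>G\<^esub> \<one>\<^bsub>G\<^esub>) (map (\<lambda>v. p \<otimes>\<^bsub>G\<^esub> v) (map F js)) = \<omega> \<one>\<^bsub>G\<^esub> (map F js)"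
    using \<omega> p unfolding left_invariant_form_def by blast
  moreover have "map (\<lambda>v. p \<otimes>\<^bsub>G\<^esub> v) (map F js) = map (E p) js" using E_one[OF p] by simp
  ultimately show "\<omega> p (map (E p) js) = \<omega> \<one>\<^bsub>G\<^esub> (map F js)" by (simp only: one)
qed

text \<open>Evaluated on left-invariant fields a left-invariant form is constant, so all directional
  derivatives vanish, and the bracket terms can be moved to the identity.\<close>

lemma ext_deriv_eq:
  assumes \<omega>: "has_comp k \<omega> w" and p: "p \<in> carrier G" and vs: "vs \<in> tuples (T p) (Suc k)"
  shows "ext_deriv G k \<omega> p vs = lie_diff (bracket G) (\<omega> \<one>\<^bsub>G\<^esub>) (map (\<lambda>v. inv\<^bsub>G\<^esub> p \<otimes>\<^bsub>G\<^esub> v) vs)"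
proof -
  define xs where "xs = map (\<lambda>v. inv\<^bsub>G\<^esub> p \<otimes>\<^bsub>G\<^esub> v) vs"
  have xs: "length xs = Suc k" "set xs \<subseteq> T \<one>\<^bsub>G\<^esub>"
    using vs tangent_inv[OF p] by (auto simp: xs_def tuples_def)
  have left: "\<omega> q (map (\<lambda>x. q \<otimes>\<^bsub>G\<^esub> x) ys) = \<omega> \<one>\<^bsub>G\<^esub> ys" if "q \<in> carrier G" "ys \<in> tuples (T \<one>\<^bsub>G\<^esub>) k" for q ys
    using has_comp_left[OF \<omega> that(1) one_closed that(2)] that(1) by (simp add: one)
  have 1: "directional_derivative (carrier G) (\<lambda>q. \<omega> q (map (\<lambda>x. q \<otimes>\<^bsub>G\<^esub> x) (nths xs (- {i})))) p (vs ! i) = 0"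
    if i: "i < Suc k" for i
  proof (rule directional_derivative_const)
    have "{l. l < length xs \<and> l \<in> - {i}} = {..<Suc k} - {i}" using xs by auto
    then have "nths xs (- {i}) \<in> tuples (T \<one>\<^bsub>G\<^esub>) k"
      using i xs set_nths_subset[of xs] by (auto simp: tuples_def length_nths)
    then show "\<omega> q (map (\<lambda>x. q \<otimes>\<^bsub>G\<^esub> x) (nths xs (- {i}))) = \<omega> \<one>\<^bsub>G\<^esub> (nths xs (- {i}))" if "q \<in> carrier G" for q
      using left that by blast
    show "vs ! i \<in> T p" using vs i by (auto simp: tuples_def)
  qed
  have 2: "\<omega> p (map (\<lambda>x. p \<otimes>\<^bsub>G\<^esub> x) (bracket G (xs ! i) (xs ! j) # nths xs (- {i, j})))
      = \<omega> \<one>\<^bsub>G\<^esub> (bracket G (xs ! i) (xs ! j) # nths xs (- {i, j}))" if ij: "i < j" "j < Suc k" for i j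
  proof (rule left[OF p])
    have "{l. l < length xs \<and> l \<in> - {i, j}} = {..<Suc k} - {i, j}" using xs by auto
    then have "length (nths xs (- {i, j})) = Suc k - 2" using ij by (simp add: length_nths card_Diff_subset)
    moreover have "xs ! i \<in> T \<one>\<^bsub>G\<^esub>" "xs ! j \<in> T \<one>\<^bsub>G\<^esub>"
      using ij xs nth_mem[of i xs] nth_mem[of j xs] by auto
    ultimately show "bracket G (xs ! i) (xs ! j) # nths xs (- {i, j}) \<in> tuples (T \<one>\<^bsub>G\<^esub>) k"
      using ij xs set_nths_subset[of xs] bracket_in by (auto simp: tuples_def)
  qed
  have "ext_deriv G k \<omega> p vs = (\<Sum>(i, j) | i < j \<and> j < Suc k. (- 1) ^ (i + j) *
      \<omega> p (map (\<lambda>x. p \<otimes>\<^bsub>G\<^esub> x) (bracket G (xs ! i) (xs ! j) # nths xs (- {i, j}))))"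
    unfolding ext_deriv_def xs_def[symmetric] Let_def using 1 by simp
  also have "\<dots> = chev_eil (bracket G) k (\<omega> \<one>\<^bsub>G\<^esub>) xs"
    unfolding chev_eil_def by (intro sum.cong refl) (use 2 in auto)
  also have "\<dots> = lie_diff (bracket G) (\<omega> \<one>\<^bsub>G\<^esub>) xs"
    using xs has_compD(4)[OF \<omega> one_closed] bracket_in by (intro chev_eil_eq) auto
  finally show ?thesis by (simp add: xs_def)
qed

definition structure_constants :: "(nat \<Rightarrow> nat \<Rightarrow> nat \<Rightarrow> real) \<Rightarrow> bool" where
  "structure_constants C \<longleftrightarrow> (\<forall>m\<in>{1..7}. \<forall>i\<in>{1..7}. \<forall>j\<in>{1..7}.
     e m \<one>\<^bsub>G\<^esub> [bracket G (E \<one>\<^bsub>G\<^esub> i) (E \<one>\<^bsub>G\<^esub> j)] = C m i j)"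

lemma has_comp_ext_deriv:
  assumes \<omega>: "has_comp k \<omega> w" and C: "structure_constants C"
  shows "has_comp (Suc k) (ext_deriv G k \<omega>) (diff_comp C w)"
  unfolding has_comp_def
proof (intro ballI conjI)
  fix p assume p: "p \<in> carrier G"
  let ?\<alpha> = "lie_diff (bracket G) (\<omega> \<one>\<^bsub>G\<^esub>)"
  interpret o: coframed "T \<one>\<^bsub>G\<^esub>" "\<lambda>i. e i \<one>\<^bsub>G\<^esub>" using coframed_at by simp
  have a: "alternating_on (T \<one>\<^bsub>G\<^esub>) (Suc k) ?\<alpha>"
    by (rule alternating_on_lie_diff[OF bracket_in bracket_antisym linear_bracket o.subspace has_compD(1)[OF \<omega> one_closed]])
  have "alternating_on (T p) (Suc k) (\<lambda>vs. ?\<alpha> (map (\<lambda>v. inv\<^bsub>G\<^esub> p \<otimes>\<^bsub>G\<^esub> v) vs))"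
    by (rule alternating_on_pullback[OF subspace_tangent[OF p] o.subspace linear_left tangent_inv[OF p] a])
  then show "alternating_on (T p) (Suc k) (ext_deriv G k \<omega> p)"
    using alternating_on_cong[OF subspace_tangent[OF p] ext_deriv_eq[OF \<omega> p]] by simp
  fix js :: "nat list" assume js: "js \<in> tuples {1..7} (Suc k)"
  interpret p: coframed "T p" "\<lambda>i. e i p" using p coframed_at by simp
  have "map (E p) js \<in> tuples (T p) (Suc k)" using js by (auto simp: tuples_def)
  from ext_deriv_eq[OF \<omega> p this]
  have "ext_deriv G k \<omega> p (map (E p) js) = ?\<alpha> (map (\<lambda>v. inv\<^bsub>G\<^esub> p \<otimes>\<^bsub>G\<^esub> v) (map (E p) js))" .
  also have "map (\<lambda>v. inv\<^bsub>G\<^esub> p \<otimes>\<^bsub>G\<^esub> v) (map (E p) js) = map (E \<one>\<^bsub>G\<^esub>) js"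
    using E_one[OF p] cancel(1)[OF p] by simp
  also have "?\<alpha> (map (E \<one>\<^bsub>G\<^esub>) js) = diff_comp C w js"
  proof (rule o.lie_diff_comp[OF _ js has_compD(3)[OF \<omega> one_closed] has_compD(2)[OF \<omega> one_closed]])
    fix i j :: nat assume ij: "i \<in> {1..7}" "j \<in> {1..7}"
    have "bracket G (o.F i) (o.F j) = (\<Sum>m\<in>{1..7}. e m \<one>\<^bsub>G\<^esub> [bracket G (o.F i) (o.F j)] *\<^sub>R o.F m)"
      by (intro o.expand bracket_in) auto
    then show "bracket G (o.F i) (o.F j) = (\<Sum>m\<in>{1..7}. C m i j *\<^sub>R o.F m)"
      using C ij by (simp add: structure_constants_def)
  qed
  finally show "ext_deriv G k \<omega> p (map (E p) js) = diff_comp C w js" .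
qed

text \<open>Stated for any \<beta> that agrees with the Hodge operator of the frame, to serve
  \<open>star_phi\<close> and \<open>star_psi\<close> alike. The premise \<open>eq\<close> relates
  each increasing multi-index to its complement.\<close>

lemma has_comp_hodge:
  assumes \<omega>: "has_comp k \<omega> w" and k: "k + l = 7" and w': "skew_on {1..7} l w'"
    and eq: "\<And>js. js \<in> set (combs l [1,2,3,4,5,6,7]) \<Longrightarrow>
      (let cs = filter (\<lambda>i. i \<notin> set js) [1,2,3,4,5,6,7] in eps (cs @ js) * w cs) = w' js"
    and \<beta>: "\<And>p vs. p \<in> carrier G \<Longrightarrow> vs \<in> tuples (T p) l \<Longrightarrow>
      \<beta> p vs = coframe_hodge (T p) (\<lambda>i. e i p) k (\<omega> p) vs"
  shows "has_comp l \<beta> w'"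
  unfolding has_comp_def
proof (intro ballI conjI)
  fix p assume p: "p \<in> carrier G"
  interpret coframed "T p" "\<lambda>i. e i p" using p coframed_at by simp
  let ?h = "coframe_hodge (T p) (\<lambda>i. e i p) k (\<omega> p)"
  show "alternating_on (T p) l (\<beta> p)"
    using alternating_on_cong[OF subspace \<beta>[OF p]] alternating_hodge[OF k] by simp
  fix js :: "nat list" assume js: "js \<in> tuples {1..7} l"
  then have "map F js \<in> tuples (T p) l" by (auto simp: tuples_def)
  then have "\<beta> p (map F js) = ?h (map F js)" by (rule \<beta>[OF p])
  also have "\<dots> = w' js"
  proof (rule skew_on_eqI[OF skew_comp[OF alternating_hodge[OF k]] w' _ js])
    fix js :: "nat list" assume js: "js \<in> set (combs l [1,2,3,4,5,6,7])"
    let ?cs = "filter (\<lambda>i. i \<notin> set js) [1,2,3,4,5,6,7]"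
    note d = in_combsD[OF js]
    have dj: "distinct js" using d(3) by simp
    have set: "set ?cs \<union> set js = set [1,2,3,4,5,6,7]" "set ?cs \<inter> set js = {}" "distinct ?cs"
      using d(2) by auto
    have s: "sort (?cs @ js) = [1,2,3,4,5,6,7]"
    proof (rule sorted_distinct_set_unique)
      show "distinct (sort (?cs @ js))" using dj set by (simp del: filter.simps)
      show "set (sort (?cs @ js)) = set [1,2,3,4,5,6,7]" using set(1) by (simp del: filter.simps)
    qed simp_all
    have "length ?cs + length js = length (sort (?cs @ js))" by (simp del: filter.simps)
    also have "\<dots> = 7" by (simp only: s) simp
    finally have len: "length ?cs = k" using d(1) k by simp
    have "sorted ?cs" by (rule sorted_wrt_filter) simp
    then have "?h (map F js) = eps (?cs @ js) * \<omega> p (map F ?cs)"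
      by (rule hodge_compl[OF s _ len])
    also have "\<omega> p (map F ?cs) = w ?cs"
      using len set(1) by (intro has_compD(2)[OF \<omega> p]) (auto simp: tuples_def)
    finally show "?h (map F js) = w' js" using eq[OF js] by (simp add: Let_def)
  qed
  finally show "\<beta> p (map F js) = w' js" .
qed

end

section \<open>The structure equations\<close>

definition de_comp :: "real \<Rightarrow> nat \<Rightarrow> nat list \<Rightarrow> real" where
  "de_comp l m js = (if m = 1 then l * cw [2,3] js else if m = 2 then - (l * cw [1,3] js)
     else if m = 3 then l * cw [1,2] js else if m = 4 then cw [5,6] js
     else if m = 5 then - cw [4,6] js else if m = 6 then cw [4,5] js else 0)"

text \<open>The sign comes from de(x, y) = -e([x, y]) for left-invariant fields.\<close>

definition str :: "real \<Rightarrow> nat \<Rightarrow> nat \<Rightarrow> nat \<Rightarrow> real" where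
  "str l m i j = - de_comp l m [i, j]"

lemma cw_2: "a < b \<Longrightarrow> cw [a, b] [i, j] = (if i = a \<and> j = b then 1 else if i = b \<and> j = a then - 1 else 0)"
  by (auto simp: cw_def)

lemma str_sum:
  "(\<Sum>m\<in>{1..7}. str l m i j * w m) =
    (if i = 2 \<and> j = 3 then - (l * w 1) else if i = 3 \<and> j = 2 then l * w 1
     else if i = 1 \<and> j = 3 then l * w 2 else if i = 3 \<and> j = 1 then - (l * w 2)
     else if i = 1 \<and> j = 2 then - (l * w 3) else if i = 2 \<and> j = 1 then l * w 3
     else if i = 5 \<and> j = 6 then - w 4 else if i = 6 \<and> j = 5 then w 4
     else if i = 4 \<and> j = 6 then w 5 else if i = 6 \<and> j = 4 then - w 5
     else if i = 4 \<and> j = 5 then - w 6 else if i = 5 \<and> j = 4 then w 6 else 0)"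
  unfolding UNIV_17 str_def de_comp_def by (simp add: cw_2)

text \<open>A bracket of frame vectors is a multiple of a single frame vector, so the sum in
  \<open>act_comp\<close> has at most one nonzero term. This rule replaces the defining equation in
  the computations below.\<close>

lemma act_comp_str:
  "act_comp (str l) i w (j # js) =
    (if i = 2 \<and> j = 3 then - (l * w (1 # js)) else if i = 3 \<and> j = 2 then l * w (1 # js)
     else if i = 1 \<and> j = 3 then l * w (2 # js) else if i = 3 \<and> j = 1 then - (l * w (2 # js))
     else if i = 1 \<and> j = 2 then - (l * w (3 # js)) else if i = 2 \<and> j = 1 then l * w (3 # js)
     else if i = 5 \<and> j = 6 then - w (4 # js) else if i = 6 \<and> j = 5 then w (4 # js)
     else if i = 4 \<and> j = 6 then w (5 # js) else if i = 6 \<and> j = 4 then - w (5 # js)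
     else if i = 4 \<and> j = 5 then - w (6 # js) else if i = 5 \<and> j = 4 then w (6 # js) else 0)
    + act_comp (str l) i (\<lambda>zs. w (j # zs)) js"
  using str_sum[of l i j "\<lambda>m. w (m # js)"] by simp

definition scaled :: "real \<Rightarrow> (nat \<Rightarrow> 'a form) \<Rightarrow> nat \<Rightarrow> 'a form" where
  "scaled r e i p vs = (if i \<le> 3 then r else 1) * e i p vs"

text \<open>Within the first block one factor \<open>r\<close> on the covector meets two factors 1/r
  on the vectors; the second block is not rescaled, and there are no mixed brackets.\<close>

lemma str_scaled:
  assumes "r > 0" "i \<in> {1..7}" "j \<in> {1..7}" "m \<in> {1..7}"
  shows "(if m \<le> 3 then r else 1) * (str k m i j / ((if i \<le> 3 then r else 1) * (if j \<le> 3 then r else 1)))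
    = str (k / r) m i j"
  using assms(1) unfolding str_def de_comp_def by (auto simp: cw_2 field_simps)

text \<open>The Hodge operator of an oriented orthonormal frame on components, in the shape required
  by \<open>has_comp_hodge\<close>.\<close>

definition star_comp :: "nat \<Rightarrow> (nat list \<Rightarrow> real) \<Rightarrow> (nat list \<Rightarrow> real) \<Rightarrow> bool" where
  "star_comp l w w' \<longleftrightarrow> (\<forall>js\<in>set (combs l [1,2,3,4,5,6,7]).
     (let cs = filter (\<lambda>i. i \<notin> set js) [1,2,3,4,5,6,7] in eps (cs @ js) * w cs) = w' js)"

context lie_frame
begin

lemma structure_equation:
  assumes m: "m \<in> {1..7}" and "form_eq (carrier G) 2 (ext_deriv G 1 (e m)) \<beta>" and \<beta>: "has_comp 2 \<beta> w"
    and ij: "i \<in> {1..7}" "j \<in> {1..7}"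
  shows "e m \<one>\<^bsub>G\<^esub> [bracket G (E \<one>\<^bsub>G\<^esub> i) (E \<one>\<^bsub>G\<^esub> j)] = - w [i, j]"
proof -
  interpret coframed "T \<one>\<^bsub>G\<^esub>" "\<lambda>i. e i \<one>\<^bsub>G\<^esub>" using coframed_at by simp
  have t: "[F i, F j] \<in> tuples (T \<one>\<^bsub>G\<^esub>) 2" by (simp add: tuples_def)
  have "w [i, j] = \<beta> \<one>\<^bsub>G\<^esub> (map F [i, j])"
    using ij by (intro has_compD(2)[OF \<beta> one_closed, symmetric]) (simp add: tuples_def)
  also have "\<dots> = ext_deriv G 1 (e m) \<one>\<^bsub>G\<^esub> [F i, F j]"
    using assms(2) t by (simp add: form_eq_def)
  also have "\<dots> = lie_diff (bracket G) (e m \<one>\<^bsub>G\<^esub>) (map (\<lambda>v. inv\<^bsub>G\<^esub> \<one>\<^bsub>G\<^esub> \<otimes>\<^bsub>G\<^esub> v) [F i, F j])"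
    using t by (intro ext_deriv_eq[OF has_comp_e[OF m]]) (simp_all add: tuples_def)
  also have "\<dots> = - e m \<one>\<^bsub>G\<^esub> [bracket G (F i) (F j)]" by (simp add: one)
  finally show ?thesis by simp
qed

lemma structure_constants_str:
  assumes "form_eq (carrier G) 2 (ext_deriv G 1 (e 1)) (\<lambda>p vs. k * ew e [2,3] p vs)"
    and "form_eq (carrier G) 2 (ext_deriv G 1 (e 2)) (\<lambda>p vs. - k * ew e [1,3] p vs)"
    and "form_eq (carrier G) 2 (ext_deriv G 1 (e 3)) (\<lambda>p vs. k * ew e [1,2] p vs)"
    and "form_eq (carrier G) 2 (ext_deriv G 1 (e 4)) (ew e [5,6])"
    and "form_eq (carrier G) 2 (ext_deriv G 1 (e 5)) (\<lambda>p vs. - ew e [4,6] p vs)"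
    and "form_eq (carrier G) 2 (ext_deriv G 1 (e 6)) (ew e [4,5])"
    and "form_eq (carrier G) 2 (ext_deriv G 1 (e 7)) (\<lambda>p vs. 0)"
  shows "structure_constants (str k)"
proof -
  have ew: "has_comp 2 (ew e [a, b]) (cw [a, b])" if "a < b" "a \<in> {1..7}" "b \<in> {1..7}" for a b
    using that by (intro has_comp_ew) auto
  have "has_comp 2 (\<lambda>p vs. k * ew e [2,3] p vs) (de_comp k 1)"
    "has_comp 2 (\<lambda>p vs. - k * ew e [1,3] p vs) (de_comp k 2)"
    "has_comp 2 (\<lambda>p vs. k * ew e [1,2] p vs) (de_comp k 3)"
    "has_comp 2 (ew e [5,6]) (de_comp k 4)"
    "has_comp 2 (\<lambda>p vs. - ew e [4,6] p vs) (de_comp k 5)"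
    "has_comp 2 (ew e [4,5]) (de_comp k 6)"
    "has_comp 2 (\<lambda>p vs. 0) (de_comp k 7)"
    using has_comp_scale[OF ew[of 2 3], of k] has_comp_scale[OF ew[of 1 3], of "- k"]
      has_comp_scale[OF ew[of 1 2], of k] ew[of 5 6] has_comp_scale[OF ew[of 4 6], of "- 1"]
      ew[of 4 5] has_comp_scale[OF ew[of 4 5], of 0]
    by (simp_all add: de_comp_def[abs_def])
  then have "- de_comp k m [i, j] = e m \<one>\<^bsub>G\<^esub> [bracket G (E \<one>\<^bsub>G\<^esub> i) (E \<one>\<^bsub>G\<^esub> j)]"
    if "m \<in> {1,2,3,4,5,6,7}" "i \<in> {1..7}" "j \<in> {1..7}" for m i j
    using that(1) structure_equation[OF _ assms(1) _ that(2,3)] structure_equation[OF _ assms(2) _ that(2,3)]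
      structure_equation[OF _ assms(3) _ that(2,3)] structure_equation[OF _ assms(4) _ that(2,3)]
      structure_equation[OF _ assms(5) _ that(2,3)] structure_equation[OF _ assms(6) _ that(2,3)]
      structure_equation[OF _ assms(7) _ that(2,3)]
    by auto
  then show ?thesis unfolding structure_constants_def str_def UNIV_17[symmetric] by simp
qed

lemma coframe_scaled:
  assumes r: "r > 0" and p: "p \<in> carrier G"
  shows "coframe (T p) (\<lambda>i. scaled r e i p)"
    and "j \<in> {1..7} \<Longrightarrow> dual_frame (T p) (\<lambda>i. scaled r e i p) j = (1 / (if j \<le> 3 then r else 1)) *\<^sub>R E p j"
proof -
  interpret coframed "T p" "\<lambda>i. e i p" using p coframed_at by simp
  let ?s = "\<lambda>i. if i \<le> (3::nat) then r else 1"
  have s: "?s i > 0" for i using r by simp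
  show cf: "coframe (T p) (\<lambda>i. scaled r e i p)"
    unfolding coframe_def
  proof (intro conjI ballI allI)
    fix i :: nat assume "i \<in> {1..7}"
    then have "alternating_on (T p) 1 (e i p)" using coframe by (simp add: coframe_def)
    from alternating_add[OF this this, of "?s i" 0] show "alternating_on (T p) 1 (scaled r e i p)"
      by (simp add: scaled_def[abs_def])
  next
    fix c :: "nat \<Rightarrow> real"
    have "scaled r e i p [v] = c i \<longleftrightarrow> e i p [v] = c i / ?s i" for i v
      using s[of i] by (simp only: scaled_def) (auto simp: field_simps)
    then show "\<exists>!v. v \<in> T p \<and> (\<forall>i\<in>{1..7}. scaled r e i p [v] = c i)"
      using ex1[of "\<lambda>i. c i / ?s i"] by simp
  qed
  interpret f: coframed "T p" "\<lambda>i. scaled r e i p" using cf subspace by (simp add: coframed_def)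
  assume j: "j \<in> {1..7}"
  show "f.F j = (1 / ?s j) *\<^sub>R F j"
  proof (rule f.eqI)
    show "(1 / ?s j) *\<^sub>R F j \<in> T p" by (intro subspace_scale subspace) simp
    fix i :: nat assume i: "i \<in> {1..7}"
    have "e i p [(1 / ?s j) *\<^sub>R F j] = (1 / ?s j) * e i p [F j]"
      using linear[OF i, of "F j" "F j" "1 / ?s j" 0] by simp
    then have "?s i * e i p [(1 / ?s j) *\<^sub>R F j] = (if i = j then 1 else 0)"
      using s[of j] by (simp only: dual[OF i]) auto
    then show "scaled r e i p [f.F j] = scaled r e i p [(1 / ?s j) *\<^sub>R F j]"
      unfolding f.dual[OF i] by (simp only: scaled_def)
  qed simp
qed

lemma lie_frame_scaled:
  assumes r: "r > 0"
  shows "lie_frame G J (scaled r e)"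
proof
  show "left_invariant_coframe G (scaled r e)"
    unfolding left_invariant_coframe_def
  proof (intro conjI ballI)
    fix i :: nat assume "i \<in> {1..7}"
    from has_comp_scale[OF has_comp_e[OF this], of "if i \<le> 3 then r else 1"]
    show "left_invariant_form G 1 (scaled r e i)"
      by (simp add: scaled_def[abs_def] has_comp_left_invariant)
  qed (use coframe_scaled r in blast)
qed

lemma structure_scaled:
  assumes r: "r > 0" and C: "structure_constants (str k)"
  shows "lie_frame.structure_constants G (scaled r e) (str (k / r))"
proof -
  interpret f: lie_frame G J "scaled r e" by (rule lie_frame_scaled[OF r])
  interpret coframed "T \<one>\<^bsub>G\<^esub>" "\<lambda>i. e i \<one>\<^bsub>G\<^esub>" using coframed_at by simp
  let ?s = "\<lambda>i. if i \<le> (3::nat) then r else 1"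
  show ?thesis unfolding f.structure_constants_def
  proof (intro ballI)
    fix m i j :: nat assume *: "m \<in> {1..7}" "i \<in> {1..7}" "j \<in> {1..7}"
    define s where "s = (\<lambda>i. if i \<le> (3::nat) then r else 1)"
    have fE: "f.E \<one>\<^bsub>G\<^esub> i = (1 / s i) *\<^sub>R F i" if "i \<in> {1..7}" for i
      using coframe_scaled(2)[OF r one_closed that] by (simp add: s_def)
    have "bracket G (f.E \<one>\<^bsub>G\<^esub> i) (f.E \<one>\<^bsub>G\<^esub> j) = (1 / (s i * s j)) *\<^sub>R bracket G (F i) (F j)"
      using linear_scale[OF linear_bracket(1)] linear_scale[OF linear_bracket(2)]
      by (simp add: fE[OF *(2)] fE[OF *(3)] mult.commute)
    moreover have b: "bracket G (F i) (F j) \<in> T \<one>\<^bsub>G\<^esub>" by (intro bracket_in) simp_all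
    ultimately have "e m \<one>\<^bsub>G\<^esub> [bracket G (f.E \<one>\<^bsub>G\<^esub> i) (f.E \<one>\<^bsub>G\<^esub> j)] = 1 / (s i * s j) * e m \<one>\<^bsub>G\<^esub> [bracket G (F i) (F j)]"
      using linear[OF *(1) b b, of "1 / (s i * s j)" 0] by simp
    also have "e m \<one>\<^bsub>G\<^esub> [bracket G (F i) (F j)] = str k m i j"
      using C * by (simp add: structure_constants_def)
    finally have e: "e m \<one>\<^bsub>G\<^esub> [bracket G (f.E \<one>\<^bsub>G\<^esub> i) (f.E \<one>\<^bsub>G\<^esub> j)] = 1 / (s i * s j) * str k m i j" .
    have "scaled r e m \<one>\<^bsub>G\<^esub> vs = s m * e m \<one>\<^bsub>G\<^esub> vs" for vs
      by (simp only: scaled_def s_def)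
    then have "scaled r e m \<one>\<^bsub>G\<^esub> [bracket G (f.E \<one>\<^bsub>G\<^esub> i) (f.E \<one>\<^bsub>G\<^esub> j)] = s m * (str k m i j / (s i * s j))"
      using e by simp
    then show "scaled r e m \<one>\<^bsub>G\<^esub> [bracket G (f.E \<one>\<^bsub>G\<^esub> i) (f.E \<one>\<^bsub>G\<^esub> j)] = str (k / r) m i j"
      using str_scaled[OF r *(2,3,1)] by (simp only: s_def)
  qed
qed

lemma adapted_psi_frame:
  assumes \<psi>: "has_comp 4 \<psi> psi0" and p: "p \<in> carrier G" and "vol (map (E p) [1,2,3,4,5,6,7]) > 0"
  shows "adapted_psi (T p) vol (\<psi> p) (\<lambda>i. e i p)"
proof -
  interpret coframed "T p" "\<lambda>i. e i p" using p coframed_at by simp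
  have "multilin_on (T p) 4 (coframe_hodge (T p) (\<lambda>i. e i p) 3 (standard_phi (\<lambda>i. e i p)))"
    using alternating_hodge[of 3 4] by (simp add: alternating_on_iff[OF subspace])
  then have "\<psi> p vs = coframe_hodge (T p) (\<lambda>i. e i p) 3 (standard_phi (\<lambda>i. e i p)) vs" if "vs \<in> tuples (T p) 4" for vs
    by (rule multilin_on_eqI[OF has_compD(3)[OF \<psi> p] _ that])
       (simp add: has_compD(2)[OF \<psi> p] hodge_standard_phi)
  then show ?thesis using assms(3) coframe by (simp add: adapted_psi_def)
qed

lemma adapted_phi_frame:
  assumes \<phi>: "has_comp 3 \<phi> phi0" and p: "p \<in> carrier G"
  shows "adapted_phi (T p) (\<phi> p) (\<lambda>i. e i p)"
proof -
  interpret coframed "T p" "\<lambda>i. e i p" using p coframed_at by simp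
  have "multilin_on (T p) 3 (standard_phi (\<lambda>i. e i p))"
    using alternating_standard_phi by (simp add: alternating_on_iff[OF subspace])
  then have "\<phi> p vs = standard_phi (\<lambda>i. e i p) vs" if "vs \<in> tuples (T p) 3" for vs
    by (rule multilin_on_eqI[OF has_compD(3)[OF \<phi> p] _ that])
       (simp add: has_compD(2)[OF \<phi> p] standard_phi_comp)
  then show ?thesis using coframe by (simp add: adapted_phi_def)
qed

lemma has_comp_star_phi:
  assumes \<phi>: "has_comp 3 \<phi> phi0" and \<omega>: "has_comp k \<omega> w" and k: "k + l = 7" and w': "skew_on {1..7} l w'"
    and eq: "star_comp l w w'"
  shows "has_comp l (star_phi G \<phi> k \<omega>) w'"
proof (rule has_comp_hodge[OF \<omega> k w' bspec[OF eq[unfolded star_comp_def]]])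
  fix p vs assume p: "p \<in> carrier G" and vs: "vs \<in> tuples (T p) l"
  show "star_phi G \<phi> k \<omega> p vs = coframe_hodge (T p) (\<lambda>i. e i p) k (\<omega> p) vs"
    unfolding star_phi_def
    by (rule phi_hodge_eq[OF subspace_tangent[OF p] adapted_phi_frame[OF \<phi> p] has_compD(1)[OF \<omega> p] k vs])
qed

end

section \<open>The explicit solution\<close>

text \<open>Explicit forms are kept as lists of coefficients and multi-indices, so that
  \<open>skew_on_lc\<close> gives antisymmetry for all of them at once.\<close>

fun lc :: "(real \<times> nat list) list \<Rightarrow> nat list \<Rightarrow> real" where
  "lc [] xs = 0"
| "lc ((a, I) # ts) xs = a * cw I xs + lc ts xs"

lemma skew_on_lc: "skew_on S k (lc ts)"
proof (rule skew_onI)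
  fix xs a b ys
  show "lc ts (xs @ a # b # ys) = - lc ts (xs @ b # a # ys)"
  proof (induction ts)
    case (Cons t ts)
    then show ?case by (cases t) (simp add: cw_antisym[where a = a and b = b])
  qed simp
qed

text \<open>The intermediate forms of the two halves of the Laplacian: in the names,
  \<open>d\<close> and \<open>star\<close> are applied to \<open>phi0\<close> and
  \<open>psi0\<close> for the structure constants \<open>str l\<close>. Each form is verified below
  on the increasing multi-indices.\<close>

abbreviation (input) "dphi l \<equiv> lc [(l, [2,3,4,5]), (l, [2,3,6,7]), (- 1, [1,4,5,7]), (- l, [1,3,4,6]),
  (l, [1,3,5,7]), (- 1, [2,4,6,7]), (- l, [1,2,4,7]), (1, [3,5,6,7]), (- l, [1,2,5,6])]"

abbreviation (input) "star_dphi l \<equiv> lc [(l, [1,6,7]), (l, [1,4,5]), (1, [2,3,6]), (- l, [2,5,7]),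
  (l, [2,4,6]), (1, [1,3,5]), (- l, [3,5,6]), (- 1, [1,2,4]), (- l, [3,4,7])]"

abbreviation (input) "d_star_dphi l \<equiv> lc [(l\<^sup>2, [2,3,6,7]), (- l, [1,4,5,7]), (l\<^sup>2 + 1, [2,3,4,5]), (l\<^sup>2, [1,3,5,7]),
  (- l, [2,4,6,7]), (- l\<^sup>2 - 1, [1,3,4,6]), (- l\<^sup>2 - 1, [1,2,5,6]), (- l\<^sup>2, [1,2,4,7]), (l, [3,5,6,7])]"

abbreviation (input) "dpsi \<equiv> lc [(1, [2,3,4,5,7]), (- 1, [1,3,4,6,7]), (- 1, [1,2,5,6,7])]"

abbreviation (input) "star_dpsi \<equiv> lc [(1, [1,6]), (- 1, [2,5]), (- 1, [3,4])]"

abbreviation (input) "d_star_dpsi l \<equiv> lc [(l, [2,3,6]), (- 1, [1,4,5]), (l, [1,3,5]), (- 1, [2,4,6]),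
  (- l, [1,2,4]), (1, [3,5,6])]"

abbreviation (input) "star_d_star_dpsi l \<equiv> lc [(- l, [1,4,5,7]), (- 1, [2,3,6,7]), (- l, [2,4,6,7]),
  (- 1, [1,3,5,7]), (l, [3,5,6,7]), (1, [1,2,4,7])]"

lemmas comp_simps = act_comp_str phi0_def psi0_def cw_Cons cw_Nil

lemma dphi_comp: "js \<in> set (combs 4 [1,2,3,4,5,6,7]) \<Longrightarrow> diff_comp (str l) phi0 js = dphi l js"
  by (simp, elim disjE; simp add: comp_simps del: act_comp.simps(2))

lemma d_star_dphi_comp: "js \<in> set (combs 4 [1,2,3,4,5,6,7]) \<Longrightarrow> diff_comp (str l) (star_dphi l) js = d_star_dphi l js"
  by (simp, elim disjE; simp add: comp_simps power2_eq_square del: act_comp.simps(2))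

lemma dpsi_comp: "js \<in> set (combs 5 [1,2,3,4,5,6,7]) \<Longrightarrow> diff_comp (str l) psi0 js = dpsi js"
  by (simp, elim disjE; simp add: comp_simps del: act_comp.simps(2))

lemma d_star_dpsi_comp: "js \<in> set (combs 3 [1,2,3,4,5,6,7]) \<Longrightarrow> diff_comp (str l) star_dpsi js = d_star_dpsi l js"
  by (simp, elim disjE; simp add: comp_simps del: act_comp.simps(2))


lemma star_comps:
  "star_comp 3 psi0 phi0" "star_comp 4 phi0 psi0"
  "star_comp 3 (dphi l) (star_dphi l)" "star_comp 2 dpsi star_dpsi"
  "star_comp 4 (d_star_dpsi l) (star_d_star_dpsi l)"
  by (simp_all add: star_comp_def psi0_def phi0_def cw_Cons cw_Nil)

lemma star_comp_theta_phi:
  "star_comp 3 (wedge 1 (cw [7]) phi0) (lc [(1, [4,5,6]), (1, [2,3,6]), (1, [1,3,5]), (- 1, [1,2,4])])"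
  by (simp add: star_comp_def wedge_1_Cons phi0_def cw_Cons cw_Nil)

lemma theta_psi_comp: "\<forall>js\<in>set (combs 5 [1,2,3,4,5,6,7]). wedge 1 (cw [7]) psi0 js = dpsi js"
  by (simp add: wedge_1_Cons psi0_def cw_Cons cw_Nil)

text \<open>Through this the coefficient 1/6 \<star>(d\<phi> \<and> \<phi>) of \<phi> in the torsion
  form becomes \<open>l\<close>.\<close>

lemma wedge_dphi_phi: "wedge 4 (dphi l) phi0 [1,2,3,4,5,6,7] = 6 * l"
proof -
  \<comment> \<open>The degree 4 is written with \<open>Suc\<close> so that the contraction rule
    \<open>wedge_Suc_Cons\<close> applies, and is translated back at the end.\<close>
  have "wedge (Suc (Suc (Suc (Suc 0)))) (dphi l) phi0 [1,2,3,4,5,6,7] = 6 * l"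
    by (simp only: wedge_Suc_Cons wedge_0 wedge_Nil) (simp add: phi0_def cw_Cons cw_Nil)
  then show ?thesis by (simp only: numeral_eq_Suc pred_numeral_simps BitM.simps)
qed

text \<open>The torsion form is l e^123 + e^456. Both monomials are top-degree forms on
  three-dimensional factors of the group, hence closed.\<close>

lemma T_comp: "js \<in> set (combs 4 [1,2,3,4,5,6,7]) \<Longrightarrow> diff_comp (str l) (lc [(l, [1,2,3]), (1, [4,5,6])]) js = lc [] js"
  by (simp, elim disjE; simp add: comp_simps del: act_comp.simps(2))

context lie_frame
begin

lemma has_comp_star_psi:
  assumes \<psi>: "has_comp 4 \<psi> psi0"
    and vol: "\<And>p. p \<in> carrier G \<Longrightarrow> alternating_on (T p) 7 (vol p)"
      "\<And>p. p \<in> carrier G \<Longrightarrow> vol p (map (E p) [1,2,3,4,5,6,7]) > 0"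
    and \<omega>: "has_comp k \<omega> w" and k: "k + l = 7" and w': "skew_on {1..7} l w'"
    and eq: "star_comp l w w'"
  shows "has_comp l (star_psi G vol \<psi> k \<omega>) w'"
proof (rule has_comp_hodge[OF \<omega> k w' bspec[OF eq[unfolded star_comp_def]]])
  fix p vs assume p: "p \<in> carrier G" and vs: "vs \<in> tuples (T p) l"
  show "star_psi G vol \<psi> k \<omega> p vs = coframe_hodge (T p) (\<lambda>i. e i p) k (\<omega> p) vs"
    unfolding star_psi_def
    by (rule psi_hodge_eq[OF subspace_tangent[OF p] vol(1)[OF p] adapted_psi_frame[OF \<psi> p, where vol = "vol p", OF vol(2)[OF p]]
          has_compD(1)[OF \<omega> p] k vs])
qed

text \<open>The terms linear in \<open>l\<close> agree in d\<star>d\<star>\<psi> and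
  \<star>d\<star>d\<psi> and cancel in the difference; the constant and quadratic terms add up to 1
  + l^2 on each of the six mixed monomials. So the Laplacian is a multiple of the mixed part of
  \<psi>, which keeps the ansatz invariant.\<close>

lemma laplacian:
  assumes C: "structure_constants (str l)" and \<psi>: "has_comp 4 \<psi> psi0"
    and vol: "\<And>p. p \<in> carrier G \<Longrightarrow> alternating_on (T p) 7 (vol p)"
      "\<And>p. p \<in> carrier G \<Longrightarrow> vol p (map (E p) [1,2,3,4,5,6,7]) > 0"
  shows "has_comp 3 (star_psi G vol \<psi> 4 \<psi>) phi0"
    and "has_comp 4 (hodge_laplacian G vol \<psi> 4 \<psi>) (\<lambda>js. (1 + l\<^sup>2) * (psi0 js - cw [4,5,6,7] js))"
proof -
  have star: "has_comp l' (star_psi G vol \<psi> k \<omega>) w'"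
    if "has_comp k \<omega> w" "k + l' = 7" "skew_on {1..7} l' w'" "star_comp l' w w'" for k l' \<omega> w w'
    by (rule has_comp_star_psi[OF \<psi> _ _ that]) (use vol in blast)+
  note diff = has_comp_ext_deriv[OF _ C]
  show \<phi>: "has_comp 3 (star_psi G vol \<psi> 4 \<psi>) phi0"
    by (rule star[OF \<psi> _ skew_on_phi0 star_comps(1)]) simp
  have 4: "Suc 3 = 4" "Suc 4 = 5" "Suc 2 = 3" by simp_all
  have "has_comp 4 (ext_deriv G 3 (star_psi G vol \<psi> 4 \<psi>)) (dphi l)"
    by (rule has_comp_combs[OF diff[OF \<phi>, unfolded 4] skew_on_lc dphi_comp])
  then have "has_comp 3 (star_psi G vol \<psi> 4 (ext_deriv G 3 (star_psi G vol \<psi> 4 \<psi>))) (star_dphi l)"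
    by (rule star[OF _ _ skew_on_lc star_comps(3)]) simp
  moreover have "codiff G vol \<psi> 4 \<psi> = star_psi G vol \<psi> 4 (ext_deriv G 3 (star_psi G vol \<psi> 4 \<psi>))"
    by (intro ext) (simp add: codiff_def)
  ultimately have "has_comp 3 (codiff G vol \<psi> 4 \<psi>) (star_dphi l)" by simp
  from has_comp_combs[OF diff[OF this, unfolded 4] skew_on_lc d_star_dphi_comp]
  have 1: "has_comp 4 (ext_deriv G 3 (codiff G vol \<psi> 4 \<psi>)) (d_star_dphi l)" .
  have "has_comp 5 (ext_deriv G 4 \<psi>) dpsi"
    by (rule has_comp_combs[OF diff[OF \<psi>, unfolded 4] skew_on_lc dpsi_comp])
  then have "has_comp 2 (star_psi G vol \<psi> 5 (ext_deriv G 4 \<psi>)) star_dpsi"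
    by (rule star[OF _ _ skew_on_lc star_comps(4)]) simp
  from has_comp_combs[OF diff[OF this, unfolded 4] skew_on_lc d_star_dpsi_comp]
  have "has_comp 3 (ext_deriv G 2 (star_psi G vol \<psi> 5 (ext_deriv G 4 \<psi>))) (d_star_dpsi l)" .
  then have "has_comp 4 (star_psi G vol \<psi> 3 (ext_deriv G 2 (star_psi G vol \<psi> 5 (ext_deriv G 4 \<psi>)))) (star_d_star_dpsi l)"
    by (rule star[OF _ _ skew_on_lc star_comps(5)]) simp
  \<comment> \<open>The codifferential of a 5-form carries the sign (-1)^5, hence the coefficient
    -1.\<close>
  from has_comp_add[OF 1 this, of 1 "- 1"]
  have "has_comp 4 (hodge_laplacian G vol \<psi> 4 \<psi>) (\<lambda>js. 1 * d_star_dphi l js + - 1 * star_d_star_dpsi l js)"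
    by (simp add: hodge_laplacian_def[abs_def] codiff_def[of G vol \<psi> 5] del: lc.simps)
  then show "has_comp 4 (hodge_laplacian G vol \<psi> 4 \<psi>) (\<lambda>js. (1 + l\<^sup>2) * (psi0 js - cw [4,5,6,7] js))"
    by (rule has_comp_cong) (simp add: psi0_def algebra_simps)
qed

text \<open>The Lee form is e^7, since d\<psi> = e^7 \<and> \<psi>. In l\<phi> - \<star>d\<phi> the
  terms linear in \<open>l\<close> cancel except l e^123; the rest is cancelled by \<star>(e^7
  \<and> \<phi>), which leaves e^456.\<close>

lemma strong_G2T_frame:
  assumes C: "structure_constants (str l)" and \<phi>: "has_comp 3 \<phi> phi0"
  shows "strong_G2T G \<phi>"
proof -
  note star = has_comp_star_phi[OF \<phi>] and diff = has_comp_ext_deriv[OF _ C]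
  have 4: "Suc 3 = 4" "Suc 4 = 5" "(1::nat) + 4 = 5" "(1::nat) + 3 = 4" "(4::nat) + 3 = 7" by simp_all
  have \<theta>: "has_comp 1 (e 7) (cw [7])" by (rule has_comp_e) simp
  have \<psi>: "has_comp 4 (star_phi G \<phi> 3 \<phi>) psi0"
    by (rule star[OF \<phi> _ skew_on_psi0 star_comps(2)]) simp
  have d\<psi>: "has_comp 5 (ext_deriv G 4 (star_phi G \<phi> 3 \<phi>)) dpsi"
    by (rule has_comp_combs[OF diff[OF \<psi>, unfolded 4] skew_on_lc dpsi_comp])
  have \<theta>\<psi>: "has_comp 5 (\<lambda>p. wedge 1 (e 7 p) (star_phi G \<phi> 3 \<phi> p)) dpsi"
    by (rule has_comp_combs[OF has_comp_wedge[OF \<theta> \<psi>, unfolded 4] skew_on_lc bspec[OF theta_psi_comp]])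
  have "G2_structure G \<phi>"
    using has_compD(1)[OF \<phi>] adapted_phi_frame[OF \<phi>] by (auto simp: G2_structure_def is_form_def)
  then have Lee: "G2T_with_Lee_form G \<phi> (e 7)"
    using has_compD(1)[OF \<theta>] has_comp_unique[OF d\<psi> \<theta>\<psi>] by (simp add: G2T_with_Lee_form_def is_form_def)
  have d\<phi>: "has_comp 4 (ext_deriv G 3 \<phi>) (dphi l)"
    by (rule has_comp_combs[OF diff[OF \<phi>, unfolded 4] skew_on_lc dphi_comp])
  have \<tau>0: "has_comp 0 (star_phi G \<phi> 7 (\<lambda>q. wedge 4 (ext_deriv G 3 \<phi> q) (\<phi> q))) (\<lambda>_. 6 * l)"
  proof (rule star[OF has_comp_wedge[OF d\<phi> \<phi>, unfolded 4]])
    show "star_comp 0 (wedge 4 (dphi l) phi0) (\<lambda>_. 6 * l)"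
      using wedge_dphi_phi[of l] by (simp add: star_comp_def del: lc.simps)
    show "skew_on {1..7} 0 (\<lambda>_. 6 * l)" by (rule skew_onI) simp
  qed simp
  then have \<tau>: "star_phi G \<phi> 7 (\<lambda>q. wedge 4 (ext_deriv G 3 \<phi> q) (\<phi> q)) p [] = 6 * l" if "p \<in> carrier G" for p
    using has_compD(2)[OF \<tau>0 that, of "[]"] by simp
  have sd: "has_comp 3 (star_phi G \<phi> 4 (ext_deriv G 3 \<phi>)) (star_dphi l)"
    by (rule star[OF d\<phi> _ skew_on_lc star_comps(3)]) simp
  have s\<theta>: "has_comp 3 (star_phi G \<phi> 4 (\<lambda>q. wedge 1 (e 7 q) (\<phi> q))) (lc [(1, [4,5,6]), (1, [2,3,6]), (1, [1,3,5]), (- 1, [1,2,4])])"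
    by (rule star[OF has_comp_wedge[OF \<theta> \<phi>, unfolded 4] _ skew_on_lc star_comp_theta_phi]) simp
  have "has_comp 3 (\<lambda>p vs. 1 * (l * \<phi> p vs + (- 1) * star_phi G \<phi> 4 (ext_deriv G 3 \<phi>) p vs)
        + 1 * star_phi G \<phi> 4 (\<lambda>q. wedge 1 (e 7 q) (\<phi> q)) p vs) (lc [(l, [1,2,3]), (1, [4,5,6])])"
    by (rule has_comp_cong[OF has_comp_add[OF has_comp_add[OF \<phi> sd] s\<theta>]]) (simp add: phi0_def algebra_simps)
  moreover have "form_eq (carrier G) 3 (torsion_form G \<phi> (e 7)) (\<lambda>p vs. 1 * (l * \<phi> p vs + (- 1) * star_phi G \<phi> 4 (ext_deriv G 3 \<phi>) p vs)
        + 1 * star_phi G \<phi> 4 (\<lambda>q. wedge 1 (e 7 q) (\<phi> q)) p vs)"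
    by (simp add: form_eq_def torsion_form_def \<tau>)
  ultimately have T: "has_comp 3 (torsion_form G \<phi> (e 7)) (lc [(l, [1,2,3]), (1, [4,5,6])])"
    using has_comp_form_eq by blast
  have dT: "has_comp 4 (ext_deriv G 3 (torsion_form G \<phi> (e 7))) (lc [])"
    by (rule has_comp_combs[OF diff[OF T, unfolded 4] skew_on_lc T_comp])
  have "has_comp 4 (\<lambda>p vs. 0) (lc [])"
    using has_comp_scale[OF \<psi>, of 0] by (simp add: lc.simps[abs_def])
  from has_comp_unique[OF dT this] Lee show ?thesis
    unfolding strong_G2T_def by blast
qed

end

section \<open>Uniqueness\<close>

text \<open>Pairs of functions that are bounded on \<open>S\<close> and differ by at most a multiple of \<open>\<delta>\<close>; the
  components of the Laplacians of two definite forms are such a pair if those of the forms are.\<close>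

definition lip :: "real set \<Rightarrow> (real \<Rightarrow> real) \<Rightarrow> (real \<Rightarrow> real) \<Rightarrow> (real \<Rightarrow> real) \<Rightarrow> bool" where
  "lip S \<delta> x y \<longleftrightarrow> (\<exists>L\<ge>0. \<forall>t\<in>S. \<bar>x t\<bar> \<le> L \<and> \<bar>y t\<bar> \<le> L \<and> \<bar>x t - y t\<bar> \<le> L * \<delta> t)"

locale lip_context =
  fixes S :: "real set" and \<delta> :: "real \<Rightarrow> real"
  assumes \<delta>: "\<And>t. t \<in> S \<Longrightarrow> \<delta> t \<ge> 0"
begin

abbreviation lp where "lp \<equiv> lip S \<delta>"

lemma lip_const: "lp (\<lambda>t. a) (\<lambda>t. a)"
  unfolding lip_def using \<delta> by (intro exI[of _ "\<bar>a\<bar>"]) auto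

lemma lip_add:
  assumes "lp x y" "lp x' y'"
  shows "lp (\<lambda>t. x t + x' t) (\<lambda>t. y t + y' t)"
proof -
  obtain L L' where L: "L \<ge> 0" "\<forall>t\<in>S. \<bar>x t\<bar> \<le> L \<and> \<bar>y t\<bar> \<le> L \<and> \<bar>x t - y t\<bar> \<le> L * \<delta> t"
    and L': "L' \<ge> 0" "\<forall>t\<in>S. \<bar>x' t\<bar> \<le> L' \<and> \<bar>y' t\<bar> \<le> L' \<and> \<bar>x' t - y' t\<bar> \<le> L' * \<delta> t"
    using assms unfolding lip_def by blast
  have "\<bar>x t + x' t\<bar> \<le> L + L' \<and> \<bar>y t + y' t\<bar> \<le> L + L' \<and> \<bar>x t + x' t - (y t + y' t)\<bar> \<le> (L + L') * \<delta> t"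
    if "t \<in> S" for t
  proof -
    have "\<bar>x t\<bar> \<le> L" "\<bar>y t\<bar> \<le> L" "\<bar>x t - y t\<bar> \<le> L * \<delta> t" "\<bar>x' t\<bar> \<le> L'" "\<bar>y' t\<bar> \<le> L'" "\<bar>x' t - y' t\<bar> \<le> L' * \<delta> t"
      using L L' that by auto
    then show ?thesis unfolding distrib_right by linarith
  qed
  then show ?thesis unfolding lip_def using L(1) L'(1) by (intro exI[of _ "L + L'"]) auto
qed

lemma lip_mult:
  assumes "lp x y" "lp x' y'"
  shows "lp (\<lambda>t. x t * x' t) (\<lambda>t. y t * y' t)"
proof -
  obtain L L' where L: "L \<ge> 0" "\<forall>t\<in>S. \<bar>x t\<bar> \<le> L \<and> \<bar>y t\<bar> \<le> L \<and> \<bar>x t - y t\<bar> \<le> L * \<delta> t"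
    and L': "L' \<ge> 0" "\<forall>t\<in>S. \<bar>x' t\<bar> \<le> L' \<and> \<bar>y' t\<bar> \<le> L' \<and> \<bar>x' t - y' t\<bar> \<le> L' * \<delta> t"
    using assms unfolding lip_def by blast
  have "\<bar>x t * x' t\<bar> \<le> 2 * (L * L') \<and> \<bar>y t * y' t\<bar> \<le> 2 * (L * L') \<and> \<bar>x t * x' t - y t * y' t\<bar> \<le> 2 * (L * L') * \<delta> t"
    if t: "t \<in> S" for t
  proof -
    have b: "\<bar>x t\<bar> \<le> L" "\<bar>y t\<bar> \<le> L" "\<bar>x t - y t\<bar> \<le> L * \<delta> t" "\<bar>x' t\<bar> \<le> L'" "\<bar>y' t\<bar> \<le> L'" "\<bar>x' t - y' t\<bar> \<le> L' * \<delta> t"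
      using L L' t by auto
    have "\<bar>x t * x' t\<bar> \<le> L * L'" "\<bar>y t * y' t\<bar> \<le> L * L'"
      unfolding abs_mult using b L(1) by (auto intro: mult_mono)
    moreover have "L * L' \<ge> 0" using L(1) L'(1) by simp
    moreover have "\<bar>x t * x' t - y t * y' t\<bar> \<le> 2 * (L * L') * \<delta> t"
    proof -
      have "x t * x' t - y t * y' t = (x t - y t) * x' t + y t * (x' t - y' t)" by (simp add: algebra_simps)
      then have "\<bar>x t * x' t - y t * y' t\<bar> \<le> \<bar>x t - y t\<bar> * \<bar>x' t\<bar> + \<bar>y t\<bar> * \<bar>x' t - y' t\<bar>"
        by (metis abs_mult abs_triangle_ineq)
      also have "\<dots> \<le> (L * \<delta> t) * L' + L * (L' * \<delta> t)"
        using b L(1) \<delta>[OF t] by (intro add_mono mult_mono) auto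
      finally show ?thesis by (simp add: algebra_simps)
    qed
    ultimately show ?thesis by linarith
  qed
  then show ?thesis unfolding lip_def using L(1) L'(1) by (intro exI[of _ "2 * (L * L')"]) auto
qed

lemma lip_minus: "lp x y \<Longrightarrow> lp (\<lambda>t. - x t) (\<lambda>t. - y t)"
  using lip_mult[OF lip_const[of "- 1"]] by fastforce

lemma lip_diff: "lp x y \<Longrightarrow> lp x' y' \<Longrightarrow> lp (\<lambda>t. x t - x' t) (\<lambda>t. y t - y' t)"
  using lip_add[OF _ lip_minus] by fastforce

lemma lip_sum: "(\<And>i. i \<in> A \<Longrightarrow> lp (x i) (y i)) \<Longrightarrow> lp (\<lambda>t. \<Sum>i\<in>A. x i t) (\<lambda>t. \<Sum>i\<in>A. y i t)"
  by (induction A rule: infinite_finite_induct) (simp_all add: lip_const lip_add)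

lemma lip_inverse:
  assumes "lp x y" and m: "m > 0" "\<And>t. t \<in> S \<Longrightarrow> x t \<ge> m \<and> y t \<ge> m"
  shows "lp (\<lambda>t. inverse (x t)) (\<lambda>t. inverse (y t))"
proof -
  obtain L where L: "L \<ge> 0" "\<forall>t\<in>S. \<bar>x t\<bar> \<le> L \<and> \<bar>y t\<bar> \<le> L \<and> \<bar>x t - y t\<bar> \<le> L * \<delta> t"
    using assms unfolding lip_def by blast
  let ?L = "inverse m + L * inverse m * inverse m"
  have "\<bar>inverse (x t)\<bar> \<le> ?L \<and> \<bar>inverse (y t)\<bar> \<le> ?L \<and> \<bar>inverse (x t) - inverse (y t)\<bar> \<le> ?L * \<delta> t"
    if t: "t \<in> S" for t
  proof -
    have xy: "x t \<ge> m" "y t \<ge> m" using m t by auto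
    then have p: "x t > 0" "y t > 0" using m(1) by auto
    have i: "inverse (x t) \<le> inverse m" "inverse (y t) \<le> inverse m" "inverse (x t) > 0" "inverse (y t) > 0" "inverse m > 0"
      using xy m(1) p by (auto intro: le_imp_inverse_le)
    have "\<bar>inverse (x t) - inverse (y t)\<bar> = \<bar>x t - y t\<bar> * (inverse (x t) * inverse (y t))"
    proof -
      have "inverse (x t) - inverse (y t) = (y t - x t) * (inverse (x t) * inverse (y t))"
        using p by (simp add: field_simps)
      then show ?thesis using i by (simp add: abs_mult abs_minus_commute)
    qed
    also have "\<dots> \<le> (L * \<delta> t) * (inverse m * inverse m)"
      using L t i \<delta>[OF t] by (intro mult_mono) auto
    also have "\<dots> \<le> ?L * \<delta> t"
      using \<delta>[OF t] i(5) by (simp add: algebra_simps)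
    finally have "\<bar>inverse (x t) - inverse (y t)\<bar> \<le> ?L * \<delta> t" .
    moreover have "L * inverse m * inverse m \<ge> 0" using L(1) i(5) by simp
    ultimately show ?thesis using i
      unfolding abs_of_pos[OF i(3)] abs_of_pos[OF i(4)] by linarith
  qed
  moreover have "?L \<ge> 0" using L(1) m(1) by simp
  ultimately show ?thesis unfolding lip_def by blast
qed

text \<open>Above a positive bound \<open>m\<close> the eighth root is Lipschitz, because u^8 - v^8
  is at least (u - v) m^7 for u \<ge> v \<ge> m. In this way the volume factor inherits the estimate
  for its eighth power.\<close>

lemma lip_power8:
  assumes "lp (\<lambda>t. x t ^ 8) (\<lambda>t. y t ^ 8)" and m: "m > 0" "\<And>t. t \<in> S \<Longrightarrow> x t \<ge> m \<and> y t \<ge> m"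
  shows "lp x y"
proof -
  obtain L where L: "L \<ge> 0" "\<forall>t\<in>S. \<bar>x t ^ 8\<bar> \<le> L \<and> \<bar>y t ^ 8\<bar> \<le> L \<and> \<bar>x t ^ 8 - y t ^ 8\<bar> \<le> L * \<delta> t"
    using assms unfolding lip_def by blast
  have le: "z \<le> 1 + z ^ 8" if "z \<ge> 0" for z :: real
  proof (cases "z \<le> 1")
    case False
    then have "z ^ 1 \<le> z ^ 8" by (intro power_increasing) auto
    then show ?thesis by simp
  qed (use that in \<open>simp add: add_increasing2\<close>)
  have key: "(u - v) * m ^ 7 \<le> \<bar>u ^ 8 - v ^ 8\<bar>" if "u \<ge> v" "v \<ge> m" for u v :: real
  proof -
    have "m ^ 7 \<le> v ^ 7" "v ^ 7 \<le> u ^ 7" using that m(1) by (auto intro: power_mono)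
    then have "(u - v) * m ^ 7 \<le> (u - v) * v ^ 7" using that by (intro mult_left_mono) auto
    also have "\<dots> \<le> u * u ^ 7 - v * v ^ 7"
      using \<open>v ^ 7 \<le> u ^ 7\<close> that m(1) by (simp add: left_diff_distrib mult_left_mono)
    also have "\<dots> = u ^ 8 - v ^ 8" by (simp add: power_Suc[symmetric] del: power_Suc)
    finally show ?thesis by linarith
  qed
  let ?L = "1 + L + L / m ^ 7"
  have m7: "m ^ 7 > 0" using m(1) by simp
  have "\<bar>x t\<bar> \<le> ?L \<and> \<bar>y t\<bar> \<le> ?L \<and> \<bar>x t - y t\<bar> \<le> ?L * \<delta> t" if t: "t \<in> S" for t
  proof -
    have xy: "x t \<ge> m" "y t \<ge> m" using m t by auto
    have p: "L / m ^ 7 \<ge> 0" using L(1) m7 by simp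
    have "\<bar>x t - y t\<bar> * m ^ 7 \<le> \<bar>x t ^ 8 - y t ^ 8\<bar>"
      using key[of "x t" "y t"] key[of "y t" "x t"] xy by (cases "x t \<ge> y t") (auto simp: abs_minus_commute)
    also have "\<dots> \<le> L * \<delta> t" using L t by auto
    finally have "\<bar>x t - y t\<bar> \<le> L / m ^ 7 * \<delta> t" using m7 by (simp add: field_simps)
    also have "\<dots> \<le> ?L * \<delta> t" using L(1) \<delta>[OF t] by (intro mult_right_mono) auto
    finally have "\<bar>x t - y t\<bar> \<le> ?L * \<delta> t" .
    moreover have "\<bar>x t\<bar> \<le> 1 + L" "\<bar>y t\<bar> \<le> 1 + L"
      using le[of "x t"] le[of "y t"] xy m(1) L t by fastforce+
    ultimately show ?thesis using p by linarith
  qed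
  moreover have "?L \<ge> 0" using L(1) m7 by simp
  ultimately show ?thesis unfolding lip_def by blast
qed

lemma lip_pr:
  assumes "\<And>i j. i \<in> set xs \<Longrightarrow> j \<in> set ys \<Longrightarrow> lp (\<lambda>t. A t i j) (\<lambda>t. B t i j)"
  shows "lp (\<lambda>t. pr (A t) xs ys) (\<lambda>t. pr (B t) xs ys)"
  using assms by (induction xs ys rule: list_induct2') (simp_all add: lip_const lip_mult)

definition lipw :: "nat \<Rightarrow> (real \<Rightarrow> nat list \<Rightarrow> real) \<Rightarrow> (real \<Rightarrow> nat list \<Rightarrow> real) \<Rightarrow> bool" where
  "lipw k w w' \<longleftrightarrow> (\<forall>js\<in>tuples {1..7} k. lp (\<lambda>t. w t js) (\<lambda>t. w' t js))"

lemma lipw_act_comp: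
  assumes "lipw k w w'" "js \<in> tuples {1..7} k"
  shows "lp (\<lambda>t. act_comp C i (w t) js) (\<lambda>t. act_comp C i (w' t) js)"
  using assms
proof (induction js arbitrary: k w w')
  case (Cons j js)
  then obtain l where k: "k = Suc l" and j: "j \<in> {1..7}" "js \<in> tuples {1..7} l" by (auto simp: Cons_tuples)
  have "lipw l (\<lambda>t zs. w t (j # zs)) (\<lambda>t zs. w' t (j # zs))"
    using Cons.prems(1) k j by (simp add: lipw_def)
  from Cons.IH[OF this j(2)]
  have "lp (\<lambda>t. act_comp C i (\<lambda>zs. w t (j # zs)) js) (\<lambda>t. act_comp C i (\<lambda>zs. w' t (j # zs)) js)" .
  moreover have "lp (\<lambda>t. \<Sum>m\<in>{1..7}. C m i j * w t (m # js)) (\<lambda>t. \<Sum>m\<in>{1..7}. C m i j * w' t (m # js))"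
    using Cons.prems(1) k j by (intro lip_sum lip_mult lip_const) (simp add: lipw_def)
  ultimately show ?case by (simp add: lip_add)
qed (simp add: lip_const)

lemma lipw_diff_comp:
  assumes "lipw k w w'"
  shows "lipw (Suc k) (\<lambda>t. diff_comp C (w t)) (\<lambda>t. diff_comp C (w' t))"
proof -
  have "lp (\<lambda>t. diff_comp C (w t) js) (\<lambda>t. diff_comp C (w' t) js)" if "js \<in> tuples {1..7} (Suc k)" for js
    using that assms
  proof (induction js arbitrary: k w w')
    case (Cons j js)
    then have j: "j \<in> {1..7}" "js \<in> tuples {1..7} k" by auto
    have a: "lp (\<lambda>t. act_comp C j (w t) js) (\<lambda>t. act_comp C j (w' t) js)"
      by (rule lipw_act_comp[OF Cons.prems(2) j(2)])
    have "lp (\<lambda>t. diff_comp C (\<lambda>zs. w t (j # zs)) js) (\<lambda>t. diff_comp C (\<lambda>zs. w' t (j # zs)) js)"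
    proof (cases k)
      case 0
      then show ?thesis using j by (simp add: lip_const)
    next
      case (Suc l)
      have "lipw l (\<lambda>t zs. w t (j # zs)) (\<lambda>t zs. w' t (j # zs))"
        using Cons.prems(2) Suc j by (simp add: lipw_def)
      then show ?thesis using Cons.IH[of l] j Suc by simp
    qed
    then show ?case using a by (simp add: lip_diff lip_minus)
  qed (simp add: lip_const)
  then show ?thesis by (simp add: lipw_def)
qed

end

section \<open>The Laplacian as a function of the components\<close>

definition hodge_comp :: "real \<Rightarrow> (nat \<Rightarrow> nat \<Rightarrow> real) \<Rightarrow> nat \<Rightarrow> (nat list \<Rightarrow> real) \<Rightarrow> nat list \<Rightarrow> real" where
  "hodge_comp c g k w js = c / fact k *
     (\<Sum>ls\<in>tuples {1..7} k. \<Sum>ms\<in>tuples {1..7} k. w ls * pr g ls ms * eps (ms @ js))"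

text \<open>The equations \<open>psi_norm_eq\<close> and \<open>bryant_psi_eq\<close> solved for the
  volume factor and, in \<open>psi_g\<close>, for the Gram matrix; \<open>hodge_comp\<close> is the
  formula of \<open>hodge_e\<close> with these two as parameters.\<close>

definition psi_c :: "(nat list \<Rightarrow> real) \<Rightarrow> real" where
  "psi_c w = root 8 (psi_norm w / (13824 ^ 4 * 168))"

definition psi_g :: "(nat list \<Rightarrow> real) \<Rightarrow> nat \<Rightarrow> nat \<Rightarrow> real" where
  "psi_g w i j = inverse (psi_c w) * inverse (psi_c w) * (bryant_psi w i j / 13824)"

definition psi_star :: "(nat list \<Rightarrow> real) \<Rightarrow> nat \<Rightarrow> (nat list \<Rightarrow> real) \<Rightarrow> nat list \<Rightarrow> real" where
  "psi_star w = hodge_comp (psi_c w) (psi_g w)"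

definition laplacian_comp :: "(nat \<Rightarrow> nat \<Rightarrow> nat \<Rightarrow> real) \<Rightarrow> (nat list \<Rightarrow> real) \<Rightarrow> nat list \<Rightarrow> real" where
  "laplacian_comp C w js = diff_comp C (psi_star w 4 (diff_comp C (psi_star w 4 w))) js
     - psi_star w 3 (diff_comp C (psi_star w 5 (diff_comp C w))) js"

lemma psi_c_power: "psi_norm w > 0 \<Longrightarrow> psi_c w > 0 \<and> psi_c w ^ 8 = psi_norm w / (13824 ^ 4 * 168)"
  unfolding psi_c_def by (simp add: real_root_pow_pos2)

lemma bryant_psi_cong:
  assumes "\<And>xs. xs \<in> tuples {1..7} 4 \<Longrightarrow> w xs = w' xs"
  shows "bryant_psi w i j = bryant_psi w' i j"
proof -
  have "ps @ qs \<in> tuples {1..7} 4" if "ps \<in> tuples {1..7} 2" "qs \<in> tuples {1..7} 2" for ps qs :: "nat list"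
    using append_tuples[OF that] by simp
  then show ?thesis
    unfolding bryant_psi_def using dualc_cong[of 4 w w'] assms by (intro sum.cong refl arg_cong2[where f = "(*)"]) auto
qed

lemma psi_norm_cong:
  assumes "\<And>xs. xs \<in> tuples {1..7} 4 \<Longrightarrow> w xs = w' xs"
  shows "psi_norm w = psi_norm w'"
proof -
  have "bryant_psi w = bryant_psi w'" by (intro ext bryant_psi_cong assms)
  then show ?thesis unfolding psi_norm_def using assms by (intro sum.cong refl arg_cong2[where f = "(*)"]) simp_all
qed

lemma continuous_on_pr:
  assumes "\<And>i j. continuous_on S (\<lambda>t. A t i j)"
  shows "continuous_on S (\<lambda>t. pr (A t) xs ys)"
  by (induction xs ys rule: list_induct2') (simp_all add: assms continuous_on_mult)

lemma continuous_on_psi_norm: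
  assumes "\<And>js. js \<in> tuples {1..7} 4 \<Longrightarrow> continuous_on S (\<lambda>t. w t js)"
  shows "continuous_on S (\<lambda>t. psi_norm (w t))"
proof -
  have "ps @ qs \<in> tuples {1..7} 4" if "ps \<in> tuples {1..7} 2" "qs \<in> tuples {1..7} 2" for ps qs :: "nat list"
    using append_tuples[OF that] by simp
  then have "continuous_on S (\<lambda>t. bryant_psi (w t) i j)" for i j
    unfolding bryant_psi_def dualc_def by (intro continuous_intros assms) auto
  then show ?thesis
    unfolding psi_norm_def by (intro continuous_intros continuous_on_pr assms) auto
qed

context lip_context
begin

lemma lip_dualc: "lipw k w w' \<Longrightarrow> lp (\<lambda>t. dualc k (w t) us) (\<lambda>t. dualc k (w' t) us)"
  unfolding dualc_def lipw_def by (intro lip_sum lip_mult lip_const) simp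

lemma lip_bryant_psi:
  assumes "lipw 4 w w'"
  shows "lp (\<lambda>t. bryant_psi (w t) i j) (\<lambda>t. bryant_psi (w' t) i j)"
proof -
  have "ps @ qs \<in> tuples {1..7} 4" if "ps \<in> tuples {1..7} 2" "qs \<in> tuples {1..7} 2" for ps qs :: "nat list"
    using append_tuples[OF that] by simp
  then have "lp (\<lambda>t. w t (ps @ qs)) (\<lambda>t. w' t (ps @ qs))" if "ps \<in> tuples {1..7} 2" "qs \<in> tuples {1..7} 2" for ps qs
    using assms that by (simp add: lipw_def)
  then show ?thesis
    unfolding bryant_psi_def by (intro lip_sum lip_mult lip_dualc assms)
qed

lemma lip_psi_norm:
  assumes "lipw 4 w w'"
  shows "lp (\<lambda>t. psi_norm (w t)) (\<lambda>t. psi_norm (w' t))"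
proof -
  have "lp (\<lambda>t. w t xs) (\<lambda>t. w' t xs)" if "xs \<in> tuples {1..7} 4" for xs using assms that by (simp add: lipw_def)
  then show ?thesis unfolding psi_norm_def by (intro lip_sum lip_mult lip_pr lip_bryant_psi assms)
qed

text \<open>All operations are polynomial except the root in \<open>psi_c\<close> and the inverse in
  \<open>psi_g\<close>; the common lower bound \<open>m\<close> for \<open>psi_norm\<close> keeps
  both away from their singularity at 0.\<close>

lemma lipw_laplacian:
  assumes w: "lipw 4 w w'" and m: "m > 0" "\<And>t. t \<in> S \<Longrightarrow> psi_norm (w t) \<ge> m \<and> psi_norm (w' t) \<ge> m"
  shows "lipw 4 (\<lambda>t. laplacian_comp C (w t)) (\<lambda>t. laplacian_comp C (w' t))"
proof -
  define K :: real where "K = 13824 ^ 4 * 168"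
  define m' where "m' = root 8 (m / K)"
  have K: "K > 0" by (simp add: K_def)
  have m': "m' > 0" using m(1) K by (simp add: m'_def)
  have c: "psi_c v \<ge> m'" if "psi_norm v \<ge> m" for v
    unfolding psi_c_def m'_def K_def using that by (intro real_root_le_mono divide_right_mono) auto
  have "lp (\<lambda>t. psi_norm (w t) * inverse K) (\<lambda>t. psi_norm (w' t) * inverse K)"
    by (intro lip_mult lip_psi_norm w lip_const)
  then have "lp (\<lambda>t. psi_c (w t) ^ 8) (\<lambda>t. psi_c (w' t) ^ 8)"
  proof -
    have "psi_c v ^ 8 = psi_norm v * inverse K" if "psi_norm v \<ge> m" for v
      using psi_c_power[of v] that m(1) by (simp add: K_def field_simps)
    then have "psi_c (w t) ^ 8 = psi_norm (w t) * inverse K \<and> psi_c (w' t) ^ 8 = psi_norm (w' t) * inverse K" if "t \<in> S" for t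
      using m(2)[OF that] by blast
    then show ?thesis using \<open>lp (\<lambda>t. psi_norm (w t) * inverse K) _\<close> unfolding lip_def by simp
  qed
  then have lc: "lp (\<lambda>t. psi_c (w t)) (\<lambda>t. psi_c (w' t))"
    by (rule lip_power8[OF _ m']) (use c m(2) in blast)
  have li: "lp (\<lambda>t. inverse (psi_c (w t))) (\<lambda>t. inverse (psi_c (w' t)))"
    by (rule lip_inverse[OF lc m']) (use c m(2) in blast)
  have lg: "lp (\<lambda>t. psi_g (w t) i j) (\<lambda>t. psi_g (w' t) i j)" for i j
  proof -
    have "lp (\<lambda>t. bryant_psi (w t) i j * inverse 13824) (\<lambda>t. bryant_psi (w' t) i j * inverse 13824)"
      by (intro lip_mult lip_bryant_psi w lip_const)
    from lip_mult[OF lip_mult[OF li li] this] show ?thesis unfolding psi_g_def divide_inverse .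
  qed
  have star: "lipw l (\<lambda>t. psi_star (w t) k (v t)) (\<lambda>t. psi_star (w' t) k (v' t))" if "lipw k v v'" for k l v v'
    unfolding lipw_def
  proof
    fix js
    have "lp (\<lambda>t. v t ls) (\<lambda>t. v' t ls)" if "ls \<in> tuples {1..7} k" for ls
      using \<open>lipw k v v'\<close> that by (simp add: lipw_def)
    then show "lp (\<lambda>t. psi_star (w t) k (v t) js) (\<lambda>t. psi_star (w' t) k (v' t) js)"
      unfolding psi_star_def hodge_comp_def divide_inverse
      by (intro lip_sum lip_mult lip_pr lg lc lip_const)
  qed
  have n: "Suc 3 = 4" "Suc 4 = 5" "Suc 2 = 3" by simp_all
  note d3 = lipw_diff_comp[of 3, unfolded n] and d4 = lipw_diff_comp[of 4, unfolded n] and d2 = lipw_diff_comp[of 2, unfolded n]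
  have "lipw 4 (\<lambda>t. diff_comp C (psi_star (w t) 4 (diff_comp C (psi_star (w t) 4 (w t)))))
      (\<lambda>t. diff_comp C (psi_star (w' t) 4 (diff_comp C (psi_star (w' t) 4 (w' t)))))"
    by (intro d3 star w)
  moreover have "lipw 4 (\<lambda>t. psi_star (w t) 3 (diff_comp C (psi_star (w t) 5 (diff_comp C (w t)))))
      (\<lambda>t. psi_star (w' t) 3 (diff_comp C (psi_star (w' t) 5 (diff_comp C (w' t)))))"
    by (intro d2 d4 star w)
  ultimately show ?thesis unfolding lipw_def laplacian_comp_def by (simp add: lip_diff)
qed

end

text \<open>The function exp(-C x) u(x) is nonincreasing, so it cannot be positive at
  \<open>T\<close> if it starts at 0.\<close>

lemma gronwall_zero:
  fixes u :: "real \<Rightarrow> real"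
  assumes T: "T \<ge> 0" and cont: "continuous_on {0..T} u"
    and d: "\<And>x. 0 < x \<Longrightarrow> x < T \<Longrightarrow> \<exists>D. (u has_real_derivative D) (at x) \<and> D \<le> C * u x"
    and u: "u 0 = 0" "u T \<ge> 0"
  shows "u T = 0"
proof (cases "T = 0")
  case False
  then have "T > 0" using T by simp
  let ?f = "\<lambda>x. exp (- C * x) * u x"
  have "?f 0 \<ge> ?f T"
  proof (rule DERIV_nonpos_imp_decreasing_open[OF T])
    show "continuous_on {0..T} ?f" by (intro continuous_intros cont)
    fix x assume "0 < x" "x < T"
    from d[OF this] obtain D where D: "(u has_real_derivative D) (at x)" "D \<le> C * u x" by blast
    have "(?f has_real_derivative exp (- C * x) * (D - C * u x)) (at x)"
      by (auto intro!: derivative_eq_intros D(1) simp: algebra_simps)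
    moreover have "exp (- C * x) * (D - C * u x) \<le> 0"
      using D(2) by (simp add: mult_nonneg_nonpos)
    ultimately show "\<exists>y. (?f has_real_derivative y) (at x) \<and> y \<le> 0" by blast
  qed
  then show ?thesis using u by (simp add: mult_le_0_iff)
qed (use u in simp)

text \<open>The factor \<sigma> is 1 or -1 in the applications; the latter covers solutions with
  reversed time. Compactness of {0..T} bounds the components and gives both \<open>psi_norm\<close>
  functions a positive lower bound, as the Lipschitz estimate requires.\<close>

lemma laplacian_comp_unique:
  fixes w1 w2 :: "real \<Rightarrow> nat list \<Rightarrow> real"
  assumes T: "T \<ge> 0"
    and d1: "\<And>t js. t \<in> {0..T} \<Longrightarrow> js \<in> tuples {1..7} 4 \<Longrightarrow>
      ((\<lambda>s. w1 s js) has_real_derivative \<sigma> * laplacian_comp C (w1 t) js) (at t within {0..T})"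
    and d2: "\<And>t js. t \<in> {0..T} \<Longrightarrow> js \<in> tuples {1..7} 4 \<Longrightarrow>
      ((\<lambda>s. w2 s js) has_real_derivative \<sigma> * laplacian_comp C (w2 t) js) (at t within {0..T})"
    and pos: "\<And>t. t \<in> {0..T} \<Longrightarrow> psi_norm (w1 t) > 0 \<and> psi_norm (w2 t) > 0"
    and eq: "\<And>js. js \<in> tuples {1..7} 4 \<Longrightarrow> w1 0 js = w2 0 js" and js: "js \<in> tuples {1..7} 4"
  shows "w1 T js = w2 T js"
proof -
  let ?S = "{0..T}" and ?I = "tuples {1..7::nat} 4"
  define \<delta> where "\<delta> t = (\<Sum>js\<in>?I. \<bar>w1 t js - w2 t js\<bar>)" for t
  interpret lip_context ?S \<delta> by unfold_locales (simp add: \<delta>_def sum_nonneg)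
  have c1: "continuous_on ?S (\<lambda>t. w1 t js)" if "js \<in> ?I" for js
    by (rule DERIV_continuous_on[where D = "\<lambda>t. \<sigma> * laplacian_comp C (w1 t) js"]) (rule d1[OF _ that])
  have c2: "continuous_on ?S (\<lambda>t. w2 t js)" if "js \<in> ?I" for js
    by (rule DERIV_continuous_on[where D = "\<lambda>t. \<sigma> * laplacian_comp C (w2 t) js"]) (rule d2[OF _ that])
  have bounded: "\<exists>B. \<forall>t\<in>?S. \<bar>f t\<bar> \<le> B" if "continuous_on ?S f" for f :: "real \<Rightarrow> real"
  proof -
    have "bounded (f ` ?S)" using that by (intro compact_imp_bounded compact_continuous_image) auto
    then show ?thesis by (auto simp: bounded_iff)
  qed
  have w: "lipw 4 w1 w2"
    unfolding lipw_def
  proof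
    fix js assume js: "js \<in> ?I"
    obtain B1 B2 where B: "\<forall>t\<in>?S. \<bar>w1 t js\<bar> \<le> B1" "\<forall>t\<in>?S. \<bar>w2 t js\<bar> \<le> B2"
      using bounded[OF c1[OF js]] bounded[OF c2[OF js]] by blast
    have le: "\<bar>w1 t js - w2 t js\<bar> \<le> \<delta> t" for t
      unfolding \<delta>_def using js by (intro member_le_sum) auto
    have nn: "\<delta> t \<ge> 0" for t by (simp add: \<delta>_def sum_nonneg)
    have d: "\<bar>w1 t js - w2 t js\<bar> \<le> (1 + \<bar>B1\<bar> + \<bar>B2\<bar>) * \<delta> t" for t
    proof -
      have "1 * \<delta> t \<le> (1 + \<bar>B1\<bar> + \<bar>B2\<bar>) * \<delta> t"
        using nn by (intro mult_right_mono) auto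
      then show ?thesis using le[of t] by linarith
    qed
    show "lp (\<lambda>t. w1 t js) (\<lambda>t. w2 t js)"
      unfolding lip_def
    proof (intro exI[of _ "1 + \<bar>B1\<bar> + \<bar>B2\<bar>"] conjI ballI d)
      fix t assume "t \<in> ?S"
      then have "\<bar>w1 t js\<bar> \<le> B1" "\<bar>w2 t js\<bar> \<le> B2" using B by auto
      then show "\<bar>w1 t js\<bar> \<le> 1 + \<bar>B1\<bar> + \<bar>B2\<bar>" "\<bar>w2 t js\<bar> \<le> 1 + \<bar>B1\<bar> + \<bar>B2\<bar>" by linarith+
    qed simp
  qed
  have lower: "\<exists>m>0. \<forall>t\<in>?S. f t \<ge> m" if "continuous_on ?S f" "\<And>t. t \<in> ?S \<Longrightarrow> f t > 0" for f :: "real \<Rightarrow> real"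
  proof -
    have "?S \<noteq> {}" using T by auto
    from continuous_attains_inf[OF compact_Icc this that(1)]
    obtain x where "x \<in> ?S" "\<forall>y\<in>?S. f x \<le> f y" by blast
    then show ?thesis using that(2) by blast
  qed
  have "\<exists>m>0. \<forall>t\<in>?S. psi_norm (w1 t) \<ge> m"
  proof (rule lower)
    show "continuous_on ?S (\<lambda>t. psi_norm (w1 t))" by (rule continuous_on_psi_norm) (rule c1)
  qed (use pos in blast)
  moreover have "\<exists>m>0. \<forall>t\<in>?S. psi_norm (w2 t) \<ge> m"
  proof (rule lower)
    show "continuous_on ?S (\<lambda>t. psi_norm (w2 t))" by (rule continuous_on_psi_norm) (rule c2)
  qed (use pos in blast)
  ultimately obtain m1 m2 where m12: "m1 > 0" "\<forall>t\<in>?S. psi_norm (w1 t) \<ge> m1" "m2 > 0" "\<forall>t\<in>?S. psi_norm (w2 t) \<ge> m2"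
    by blast
  have "lipw 4 (\<lambda>t. laplacian_comp C (w1 t)) (\<lambda>t. laplacian_comp C (w2 t))"
  proof (rule lipw_laplacian[OF w])
    show "min m1 m2 > 0" using m12 by simp
    show "psi_norm (w1 t) \<ge> min m1 m2 \<and> psi_norm (w2 t) \<ge> min m1 m2" if "t \<in> ?S" for t
      using m12 that by (meson min.cobounded1 min.cobounded2 order_trans)
  qed
  then have "\<forall>js\<in>?I. \<exists>L\<ge>0. \<forall>t\<in>?S. \<bar>laplacian_comp C (w1 t) js - laplacian_comp C (w2 t) js\<bar> \<le> L * \<delta> t"
    unfolding lipw_def lip_def by blast
  then obtain L where L: "\<And>js. js \<in> ?I \<Longrightarrow> L js \<ge> 0 \<and> (\<forall>t\<in>?S. \<bar>laplacian_comp C (w1 t) js - laplacian_comp C (w2 t) js\<bar> \<le> L js * \<delta> t)"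
    by metis
  define B where "B = (\<Sum>js\<in>?I. L js)"
  have LB: "L js \<le> B" if "js \<in> ?I" for js
    unfolding B_def using that L by (intro member_le_sum) auto
  \<comment> \<open>The Lipschitz estimate is in terms of the sum \<delta> of absolute values, but
    Gronwall's argument needs a differentiable distance, hence the sum of squares.\<close>
  define u where "u t = (\<Sum>js\<in>?I. (w1 t js - w2 t js)\<^sup>2)" for t
  \<comment> \<open>The 2 comes from differentiating squares, and \<open>card ?I\<close> from
    bounding the square of \<delta> by \<open>u\<close> with Cauchy-Schwarz.\<close>
  define C' where "C' = 2 * \<bar>\<sigma>\<bar> * B * card ?I"
  have "u T = 0"
  proof (rule gronwall_zero[OF T, of u C'])
    show "continuous_on ?S u" unfolding u_def by (intro continuous_intros c1 c2) auto
    show "u 0 = 0" unfolding u_def using eq by (intro sum.neutral) simp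
    show "u T \<ge> 0" unfolding u_def by (simp add: sum_nonneg)
    fix x assume x: "0 < x" "x < T"
    then have xS: "x \<in> ?S" and at: "at x within ?S = at x"
      by (auto intro!: at_within_interior)
    let ?D = "\<lambda>js. \<sigma> * laplacian_comp C (w1 x) js - \<sigma> * laplacian_comp C (w2 x) js"
    have "(u has_real_derivative (\<Sum>js\<in>?I. 2 * (w1 x js - w2 x js) * ?D js)) (at x)"
      unfolding u_def
    proof (rule DERIV_sum)
      fix js assume js: "js \<in> ?I"
      have "((\<lambda>t. w1 t js - w2 t js) has_real_derivative ?D js) (at x)"
        using d1[OF xS js] d2[OF xS js] unfolding at by (rule DERIV_diff)
      then show "((\<lambda>t. (w1 t js - w2 t js)\<^sup>2) has_real_derivative 2 * (w1 x js - w2 x js) * ?D js) (at x)"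
        by (rule DERIV_cong[OF DERIV_power[where n = 2]]) (simp add: algebra_simps)
    qed
    moreover have "(\<Sum>js\<in>?I. 2 * (w1 x js - w2 x js) * ?D js) \<le> C' * u x"
    proof -
      have "2 * (w1 x js - w2 x js) * ?D js \<le> 2 * \<bar>\<sigma>\<bar> * B * \<delta> x * \<bar>w1 x js - w2 x js\<bar>" if js: "js \<in> ?I" for js
      proof -
        have "\<bar>laplacian_comp C (w1 x) js - laplacian_comp C (w2 x) js\<bar> \<le> L js * \<delta> x"
          using L js xS by blast
        also have "\<dots> \<le> B * \<delta> x" using LB[OF js] \<delta>[OF xS] by (rule mult_right_mono)
        finally have "\<bar>\<sigma>\<bar> * \<bar>laplacian_comp C (w1 x) js - laplacian_comp C (w2 x) js\<bar> \<le> \<bar>\<sigma>\<bar> * (B * \<delta> x)"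
          by (rule mult_left_mono) simp
        then have "\<bar>?D js\<bar> \<le> \<bar>\<sigma>\<bar> * (B * \<delta> x)"
          by (simp add: abs_mult[symmetric] right_diff_distrib)
        then have "2 * \<bar>w1 x js - w2 x js\<bar> * \<bar>?D js\<bar> \<le> 2 * \<bar>w1 x js - w2 x js\<bar> * (\<bar>\<sigma>\<bar> * (B * \<delta> x))"
          by (rule mult_left_mono) simp
        moreover have "2 * (w1 x js - w2 x js) * ?D js \<le> 2 * \<bar>w1 x js - w2 x js\<bar> * \<bar>?D js\<bar>"
          using abs_ge_self[of "(w1 x js - w2 x js) * ?D js"] unfolding abs_mult mult.assoc
          by (rule mult_left_mono) simp
        ultimately show ?thesis by (simp add: mult_ac)
      qed
      then have "(\<Sum>js\<in>?I. 2 * (w1 x js - w2 x js) * ?D js) \<le> (\<Sum>js\<in>?I. 2 * \<bar>\<sigma>\<bar> * B * \<delta> x * \<bar>w1 x js - w2 x js\<bar>)"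
        by (rule sum_mono)
      also have "\<dots> = 2 * \<bar>\<sigma>\<bar> * B * (\<delta> x)\<^sup>2"
        unfolding sum_distrib_left[symmetric] \<delta>_def[symmetric] by (simp add: power2_eq_square)
      also have "(\<delta> x)\<^sup>2 \<le> u x * card ?I"
        using sum_squared_le_sum_of_squares[of "\<lambda>js. \<bar>w1 x js - w2 x js\<bar>" ?I]
        by (simp add: \<delta>_def u_def mult.commute)
      also have "2 * \<bar>\<sigma>\<bar> * B * (u x * card ?I) = C' * u x" by (simp add: C'_def)
      finally show ?thesis using L by (simp add: B_def sum_nonneg mult_left_mono)
    qed
    ultimately show "\<exists>D. (u has_real_derivative D) (at x) \<and> D \<le> C' * u x" by blast
  qed
  then have "(w1 T js - w2 T js)\<^sup>2 = 0"
    using js unfolding u_def by (subst (asm) sum_nonneg_eq_0_iff) auto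
  then show ?thesis by simp
qed

section \<open>The Laplacian coflow\<close>

definition ansatz :: "(nat \<Rightarrow> 'a form) \<Rightarrow> real \<Rightarrow> 'a form" where
  "ansatz e s p vs = ew e [4,5,6,7] p vs
     + s * (ew e [2,3,4,5] p vs + ew e [2,3,6,7] p vs - ew e [1,3,4,6] p vs + ew e [1,3,5,7] p vs
            - ew e [1,2,4,7] p vs - ew e [1,2,5,6] p vs)"

abbreviation ew_vol :: "(nat \<Rightarrow> 'a form) \<Rightarrow> 'a form" where
  "ew_vol e \<equiv> ew e [1,2,3,4,5,6,7]"

lemma ew_scaled: "ew (scaled r e) is p vs = r ^ length (filter (\<lambda>i. i \<le> 3) is) * ew e is p vs"
proof (induction "is" arbitrary: vs)
  case (Cons i "is")
  have "ew (scaled r e) (i # is) p vs = wedge 1 (scaled r e i p) (ew (scaled r e) is p) vs"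
    by (simp add: ew_def)
  also have "\<dots> = wedge 1 (\<lambda>vs. (if i \<le> 3 then r else 1) * e i p vs + 0 * e i p vs)
      (\<lambda>vs. r ^ length (filter (\<lambda>i. i \<le> 3) is) * ew e is p vs + 0 * ew e is p vs) vs"
    by (rule wedge_cong) (simp_all add: scaled_def Cons.IH)
  finally show ?case by (simp only: wedge_linear_left wedge_linear_right) (simp add: ew_def)
qed (simp add: ew_def)

text \<open>Each of the six mixed monomials has exactly two indices in {1, 2, 3}, so it acquires the
  square of \<open>sqrt s\<close>, while e^4567 is not rescaled.\<close>

lemma ansatz_scaled:
  assumes "s > 0"
  shows "ansatz e s = ansatz (scaled (sqrt s) e) 1"
  using assms by (intro ext) (simp add: ansatz_def ew_scaled algebra_simps)

context lie_frame
begin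

lemma has_comp_ansatz:
  "has_comp 4 (ansatz e s) (\<lambda>js. cw [4,5,6,7] js + s * (psi0 js - cw [4,5,6,7] js))"
proof -
  have ew: "has_comp 4 (ew e [a,b,c,d]) (cw [a,b,c,d])" if "a < b" "b < c" "c < d" "1 \<le> a" "d \<le> 7" for a b c d
    using that by (intro has_comp_ew) auto
  note r = has_comp_add[OF has_comp_add[OF has_comp_add[OF has_comp_add[OF has_comp_add[OF has_comp_add[OF
    ew[of 4 5 6 7] ew[of 2 3 4 5], of 1 s] ew[of 2 3 6 7], of 1 s] ew[of 1 3 4 6], of 1 "- s"]
    ew[of 1 3 5 7], of 1 s] ew[of 1 2 4 7], of 1 "- s"] ew[of 1 2 5 6], of 1 "- s"]
  have "has_comp 4 (ansatz e s) (\<lambda>js. 1 * (1 * (1 * (1 * (1 * (1 * cw [4,5,6,7] js + s * cw [2,3,4,5] js)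
      + s * cw [2,3,6,7] js) + - s * cw [1,3,4,6] js) + s * cw [1,3,5,7] js) + - s * cw [1,2,4,7] js)
      + - s * cw [1,2,5,6] js)"
    using r by (simp add: ansatz_def[abs_def] algebra_simps)
  then show ?thesis by (rule has_comp_cong) (simp add: psi0_def algebra_simps)
qed

lemma alternating_vol: "p \<in> carrier G \<Longrightarrow> alternating_on (T p) 7 (ew_vol e p)"
  using has_compD(1)[OF has_comp_ew[of "[1,2,3,4,5,6,7]" 7]] by simp

lemma scaled_vol_pos:
  assumes r: "r > 0" and p: "p \<in> carrier G"
  shows "ew_vol e p (map (dual_frame (T p) (\<lambda>i. scaled r e i p)) [1,2,3,4,5,6,7]) > 0"
proof -
  interpret f: coframed "T p" "\<lambda>i. scaled r e i p"
    using coframe_scaled(1)[OF r p] subspace_tangent[OF p] by (simp add: coframed_def)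
  have "r ^ 3 * ew_vol e p (map f.F [1,2,3,4,5,6,7]) = ew_vol (scaled r e) p (map f.F [1,2,3,4,5,6,7])"
    by (simp only: ew_scaled) (simp add: numeral_3_eq_3)
  also have "\<dots> = 1" unfolding ew_def by (rule f.coframe_wedge_dual) auto
  finally show ?thesis using r by (smt (verit) zero_less_mult_pos zero_less_power)
qed

context
  fixes k s :: real
  assumes str: "structure_constants (str k)" and s: "s > 0"
begin

interpretation f: lie_frame G J "scaled (sqrt s) e"
  by (rule lie_frame_scaled) (use s in simp)

lemma ansatz_psi0: "f.has_comp 4 (ansatz e s) psi0"
  using f.has_comp_ansatz[of 1] by (simp add: ansatz_scaled[OF s])

lemma ansatz_adapted:
  "p \<in> carrier G \<Longrightarrow> adapted_psi (T p) (ew_vol e p) (ansatz e s p) (\<lambda>i. scaled (sqrt s) e i p)"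
  using f.adapted_psi_frame[OF ansatz_psi0] scaled_vol_pos[of "sqrt s"] s by simp

lemma ansatz_definite: "definite_4form G (ew_vol e) (ansatz e s)"
  using ansatz_adapted has_compD(1)[OF has_comp_ansatz] by (auto simp: definite_4form_def is_form_def)

lemma ansatz_metric:
  assumes "p \<in> carrier G" "v \<in> T p" "w \<in> T p"
  shows "metric_psi G (ew_vol e) (ansatz e s) p v w
    = s * (\<Sum>i\<in>{1..3}. e i p [v] * e i p [w]) + (\<Sum>i\<in>{4..7}. e i p [v] * e i p [w])"
proof -
  have "metric_psi G (ew_vol e) (ansatz e s) p v w = coframe_metric (\<lambda>i. scaled (sqrt s) e i p) v w"
    unfolding metric_psi_def
    by (rule psi_metric_eq[OF subspace_tangent alternating_vol ansatz_adapted]) (use assms in simp_all)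
  also have "\<dots> = (\<Sum>i\<in>{1..7}. (if i \<le> 3 then s else 1) * (e i p [v] * e i p [w]))"
    unfolding coframe_metric_def scaled_def using s by (intro sum.cong refl) simp
  also have "{1..7::nat} = {1..3} \<union> {4..7}" by auto
  also have "(\<Sum>i\<in>{1..3} \<union> {4..7}. (if i \<le> 3 then s else 1) * (e i p [v] * e i p [w]))
     = (\<Sum>i\<in>{1..3}. (if i \<le> 3 then s else 1) * (e i p [v] * e i p [w]))
     + (\<Sum>i\<in>{4..7}. (if i \<le> 3 then s else 1) * (e i p [v] * e i p [w]))"
    by (rule sum.union_disjoint) auto
  finally show ?thesis by (simp add: sum_distrib_left)
qed

lemma f_structure: "f.structure_constants (str (k / sqrt s))"
  by (rule structure_scaled[OF _ str]) (use s in simp)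

lemma ansatz_star: "f.has_comp 3 (star_psi G (ew_vol e) (ansatz e s) 4 (ansatz e s)) phi0"
  by (rule f.laplacian(1)[OF f_structure ansatz_psi0]) (use alternating_vol scaled_vol_pos[of "sqrt s"] s in simp_all)

lemma ansatz_star_eq:
  "form_eq (carrier G) 3 (star_psi G (ew_vol e) (ansatz e s) 4 (ansatz e s)) (\<lambda>p. standard_phi (\<lambda>i. scaled (sqrt s) e i p))"
proof -
  have "f.has_comp 3 (\<lambda>p. standard_phi (\<lambda>i. scaled (sqrt s) e i p)) phi0"
    unfolding f.has_comp_def
  proof (intro ballI conjI)
    fix p assume "p \<in> carrier G"
    then interpret coframed "T p" "\<lambda>i. scaled (sqrt s) e i p" by (rule f.coframed_at)
    show "alternating_on (T p) 3 (standard_phi (\<lambda>i. scaled (sqrt s) e i p))" by (rule alternating_standard_phi)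
  next
    fix p and js :: "nat list" assume p: "p \<in> carrier G" and js: "js \<in> tuples {1..7} 3"
    from p interpret coframed "T p" "\<lambda>i. scaled (sqrt s) e i p" by (rule f.coframed_at)
    show "standard_phi (\<lambda>i. scaled (sqrt s) e i p) (map F js) = phi0 js" by (rule standard_phi_comp[OF js])
  qed
  from f.has_comp_unique[OF ansatz_star this] show ?thesis by simp
qed

lemma ansatz_strong: "strong_G2T G (star_psi G (ew_vol e) (ansatz e s) 4 (ansatz e s))"
  by (rule f.strong_G2T_frame[OF f_structure ansatz_star])

text \<open>With l = k / sqrt s the factor in \<open>laplacian\<close> is 1 + k^2/s, and the mixed
  part in the scaled coframe is \<open>s\<close> times that of \<open>e\<close>; the product is s +
  k^2. The difference of the ansatz at 1 and at 0 isolates the mixed part.\<close>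

lemma ansatz_laplacian:
  "form_eq (carrier G) 4 (hodge_laplacian G (ew_vol e) (ansatz e s) 4 (ansatz e s))
     (\<lambda>p vs. (s + k\<^sup>2) * (ansatz e 1 p vs - ansatz e 0 p vs))"
proof -
  let ?l = "k / sqrt s"
  have 1: "f.has_comp 4 (hodge_laplacian G (ew_vol e) (ansatz e s) 4 (ansatz e s))
      (\<lambda>js. (1 + ?l\<^sup>2) * (psi0 js - cw [4,5,6,7] js))"
    by (rule f.laplacian(2)[OF f_structure ansatz_psi0]) (use alternating_vol scaled_vol_pos[of "sqrt s"] s in simp_all)
  have 2: "f.has_comp 4 (\<lambda>p vs. (1 + ?l\<^sup>2) * ansatz (scaled (sqrt s) e) 1 p vs + - (1 + ?l\<^sup>2) * ansatz (scaled (sqrt s) e) 0 p vs)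
      (\<lambda>js. (1 + ?l\<^sup>2) * (cw [4,5,6,7] js + 1 * (psi0 js - cw [4,5,6,7] js))
        + - (1 + ?l\<^sup>2) * (cw [4,5,6,7] js + 0 * (psi0 js - cw [4,5,6,7] js)))"
    by (intro f.has_comp_add f.has_comp_ansatz)
  have l: "(1 + ?l\<^sup>2) * s = s + k\<^sup>2" using s by (simp add: power_divide field_simps)
  have "(1 + ?l\<^sup>2) * ansatz (scaled (sqrt s) e) 1 p vs + - (1 + ?l\<^sup>2) * ansatz (scaled (sqrt s) e) 0 p vs
      = (s + k\<^sup>2) * (ansatz e 1 p vs - ansatz e 0 p vs)" for p vs
  proof -
    have "ansatz (scaled (sqrt s) e) 1 p vs - ansatz (scaled (sqrt s) e) 0 p vs = s * (ansatz e 1 p vs - ansatz e 0 p vs)"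
      using s by (simp add: ansatz_def ew_scaled algebra_simps)
    moreover have "(1 + ?l\<^sup>2) * ansatz (scaled (sqrt s) e) 1 p vs + - (1 + ?l\<^sup>2) * ansatz (scaled (sqrt s) e) 0 p vs
        = (1 + ?l\<^sup>2) * (ansatz (scaled (sqrt s) e) 1 p vs - ansatz (scaled (sqrt s) e) 0 p vs)"
      by (simp add: algebra_simps)
    ultimately show ?thesis by (simp only: l[symmetric] mult.assoc)
  qed
  moreover have "form_eq (carrier G) 4 (hodge_laplacian G (ew_vol e) (ansatz e s) 4 (ansatz e s))
      (\<lambda>p vs. (1 + ?l\<^sup>2) * ansatz (scaled (sqrt s) e) 1 p vs + - (1 + ?l\<^sup>2) * ansatz (scaled (sqrt s) e) 0 p vs)"
    by (rule f.has_comp_unique[OF 1 2]) (simp add: algebra_simps)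
  ultimately show ?thesis by (simp only:)
qed

end

lemma ansatz_coflow:
  assumes str: "structure_constants (str k)"
    and a: "\<And>t. t \<in> I \<Longrightarrow> a t > 0 \<and> (a has_real_derivative (a t + k\<^sup>2)) (at t)"
  shows "left_invariant_laplacian_coflow G (ew_vol e) I (\<lambda>t. ansatz e (a t))"
  unfolding left_invariant_laplacian_coflow_def
proof (intro ballI conjI)
  fix t assume t: "t \<in> I"
  show "left_invariant_form G 4 (ansatz e (a t))" by (rule has_comp_left_invariant[OF has_comp_ansatz])
  show "definite_4form G (ew_vol e) (ansatz e (a t))" using ansatz_definite[OF str] a t by blast
  fix p vs assume "p \<in> carrier G" "vs \<in> tuples (T p) 4"
  then have L: "hodge_laplacian G (ew_vol e) (ansatz e (a t)) 4 (ansatz e (a t)) p vs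
      = (a t + k\<^sup>2) * (ansatz e 1 p vs - ansatz e 0 p vs)"
    using ansatz_laplacian[OF str, of "a t"] a[OF t] by (simp add: form_eq_def)
  have eq: "ansatz e x p vs = ansatz e 0 p vs + x * (ansatz e 1 p vs - ansatz e 0 p vs)" for x
    by (simp add: ansatz_def)
  have da: "(a has_real_derivative (a t + k\<^sup>2)) (at t within I)"
    using a[OF t] by (blast intro: has_field_derivative_at_within)
  have "((\<lambda>s. ansatz e 0 p vs + a s * (ansatz e 1 p vs - ansatz e 0 p vs)) has_real_derivative
      0 + (a t + k\<^sup>2) * (ansatz e 1 p vs - ansatz e 0 p vs)) (at t within I)"
    by (intro DERIV_add DERIV_const DERIV_cmult_right da)
  moreover have "(\<lambda>s. ansatz e (a s) p vs) = (\<lambda>s. ansatz e 0 p vs + a s * (ansatz e 1 p vs - ansatz e 0 p vs))"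
    by (rule ext) (rule eq)
  ultimately show "((\<lambda>s. ansatz e (a s) p vs) has_real_derivative
      hodge_laplacian G (ew_vol e) (ansatz e (a t)) 4 (ansatz e (a t)) p vs) (at t within I)"
    unfolding L by simp
qed

section \<open>Uniqueness of the coflow\<close>

text \<open>The adapted coframe is taken separately at each point, without regard to
  left-invariance. Still the result has constant components, because volume factor and Gram matrix,
  and with them the Hodge operator, are computed from the components of \<psi> alone.\<close>

lemma has_comp_star_gen:
  assumes \<psi>: "has_comp 4 \<psi> v" and def: "definite_4form G (ew_vol e) \<psi>"
    and \<omega>: "has_comp k \<omega> w" and k: "k + l = 7"
  shows "psi_norm v > 0" and "has_comp l (star_psi G (ew_vol e) \<psi> k \<omega>) (psi_star v k w)"
proof -
  have main: "psi_norm v > 0 \<and> alternating_on (T p) l (star_psi G (ew_vol e) \<psi> k \<omega> p) \<and>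
      (\<forall>js\<in>tuples {1..7} l. star_psi G (ew_vol e) \<psi> k \<omega> p (map (E p) js) = psi_star v k w js)"
    if p: "p \<in> carrier G" for p
  proof -
    have V: "subspace (T p)" by (rule subspace_tangent[OF p])
    obtain f where f: "adapted_psi (T p) (ew_vol e p) (\<psi> p) f"
      using def p by (auto simp: definite_4form_def)
    note pr = adapted_psi_pair[OF V coframed_at[OF p] f[unfolded ew_def]]
    interpret coframed_pair "T p" "\<lambda>i. e i p" f by (rule pr(1))
    have v: "psi_norm (\<lambda>xs. \<psi> p (map e.F xs)) = psi_norm v"
      by (rule psi_norm_cong) (rule has_compD(2)[OF \<psi> p])
    have b: "bryant_psi (\<lambda>xs. \<psi> p (map e.F xs)) i j = bryant_psi v i j" for i j
      by (rule bryant_psi_cong) (rule has_compD(2)[OF \<psi> p])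
    have norm: "psi_norm v = 13824 ^ 4 * 168 * c ^ 8" using pr(3) v by simp
    have pos: "psi_norm v > 0" unfolding norm using pr(2) by simp
    have "psi_c v ^ 8 = c ^ 8" using psi_c_power[OF pos] unfolding norm by simp
    then have c: "psi_c v = c"
      using psi_c_power[OF pos] pr(2) power_eq_iff_eq_base[of 8 "psi_c v" c] by simp
    have g: "\<G> i j = psi_g v i j" if "i \<in> {1..7}" "j \<in> {1..7}" for i j
      using pr(4)[OF that] pr(2) unfolding b psi_g_def c by (simp add: field_simps power2_eq_square)
    have star: "star_psi G (ew_vol e) \<psi> k \<omega> p vs = coframe_hodge (T p) f k (\<omega> p) vs" if "vs \<in> tuples (T p) l" for vs
      unfolding star_psi_def
      by (rule psi_hodge_eq[OF V alternating_vol[OF p] f has_compD(1)[OF \<omega> p] k that])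
    have "star_psi G (ew_vol e) \<psi> k \<omega> p (map e.F js) = psi_star v k w js" if js: "js \<in> tuples {1..7} l" for js
    proof -
      have t: "map e.F js \<in> tuples (T p) l" using js by (auto simp: tuples_def)
      show ?thesis
        unfolding star[OF t] hodge_e[OF has_compD(1)[OF \<omega> p] k t] psi_star_def hodge_comp_def c
      proof (intro arg_cong2[where f = "(*)"] refl sum.cong)
        fix ls ms :: "nat list" assume l: "ls \<in> tuples {1..7} k" and m: "ms \<in> tuples {1..7} k"
        show "\<omega> p (map e.F ls) = w ls" by (rule has_compD(2)[OF \<omega> p l])
        show "pr \<G> ls ms = pr (psi_g v) ls ms"
        proof (rule pr_cong)
          fix x y assume "x \<in> set ls" "y \<in> set ms"
          then have "x \<in> {1..7}" "y \<in> {1..7}" using l m by (meson set_tuples subsetD)+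
          then show "\<G> x y = psi_g v x y" by (rule g)
        qed
        have "ms @ js \<in> tuples {1..7} 7" using append_tuples[OF m js] k by simp
        then show "e.vol (map e.F ms @ map e.F js) = eps (ms @ js)"
          using e.vol_dual by (simp only: map_append[symmetric])
      qed
    qed
    then show ?thesis
      using pos alternating_on_cong[OF V star] f.alternating_hodge[OF k] by simp
  qed
  then show "psi_norm v > 0" using one_closed by blast
  show "has_comp l (star_psi G (ew_vol e) \<psi> k \<omega>) (psi_star v k w)"
    using main by (simp add: has_comp_def)
qed

lemma has_comp_laplacian_gen:
  assumes C: "structure_constants C" and \<psi>: "has_comp 4 \<psi> v" and def: "definite_4form G (ew_vol e) \<psi>"
  shows "has_comp 4 (hodge_laplacian G (ew_vol e) \<psi> 4 \<psi>) (laplacian_comp C v)"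
proof -
  note star = has_comp_star_gen(2)[OF \<psi> def] and diff = has_comp_ext_deriv[OF _ C]
  have 4: "Suc 3 = 4" "Suc 4 = 5" "Suc 2 = 3" by simp_all
  have "has_comp 3 (star_psi G (ew_vol e) \<psi> 4 \<psi>) (psi_star v 4 v)" by (rule star[OF \<psi>]) simp
  from star[OF diff[OF this, unfolded 4], of 3]
  have "has_comp 3 (star_psi G (ew_vol e) \<psi> 4 (ext_deriv G 3 (star_psi G (ew_vol e) \<psi> 4 \<psi>)))
      (psi_star v 4 (diff_comp C (psi_star v 4 v)))" by simp
  from diff[OF this, unfolded 4]
  have 1: "has_comp 4 (ext_deriv G 3 (codiff G (ew_vol e) \<psi> 4 \<psi>)) (diff_comp C (psi_star v 4 (diff_comp C (psi_star v 4 v))))"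
    by (simp add: codiff_def[abs_def])
  have "has_comp 2 (star_psi G (ew_vol e) \<psi> 5 (ext_deriv G 4 \<psi>)) (psi_star v 5 (diff_comp C v))"
    by (rule star[OF diff[OF \<psi>, unfolded 4]]) simp
  from star[OF diff[OF this, unfolded 4], of 4]
  have "has_comp 4 (star_psi G (ew_vol e) \<psi> 3 (ext_deriv G 2 (star_psi G (ew_vol e) \<psi> 5 (ext_deriv G 4 \<psi>))))
      (psi_star v 3 (diff_comp C (psi_star v 5 (diff_comp C v))))" by simp
  from has_comp_add[OF 1 this, of 1 "- 1"] show ?thesis
    by (simp add: hodge_laplacian_def[abs_def] codiff_def[of G _ \<psi> 5] laplacian_comp_def[abs_def])
qed

text \<open>Left-invariance turns the flow into an ordinary differential equation for the components
  at the identity, to which \<open>laplacian_comp_unique\<close> applies. The closed segment allows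
  both signs of \<open>b\<close>; for negative \<open>b\<close> time is reversed.\<close>

lemma coflow_unique:
  assumes C: "structure_constants C"
    and 1: "left_invariant_laplacian_coflow G (ew_vol e) J1 \<psi>1" and 2: "left_invariant_laplacian_coflow G (ew_vol e) J2 \<psi>2"
    and T: "closed_segment 0 b \<subseteq> J1 \<inter> J2" and 0: "form_eq (carrier G) 4 (\<psi>1 0) (\<psi>2 0)"
  shows "form_eq (carrier G) 4 (\<psi>1 b) (\<psi>2 b)"
proof -
  define w where "w \<psi> t js = \<psi> t \<one>\<^bsub>G\<^esub> (map (E \<one>\<^bsub>G\<^esub>) js)" for \<psi> :: "real \<Rightarrow> 'a form" and t js
  interpret coframed "T \<one>\<^bsub>G\<^esub>" "\<lambda>i. e i \<one>\<^bsub>G\<^esub>" using coframed_at by simp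
  have t: "map (E \<one>\<^bsub>G\<^esub>) js \<in> tuples (T \<one>\<^bsub>G\<^esub>) 4" if "js \<in> tuples {1..7} 4" for js
    using that by (auto simp: tuples_def)
  have comp: "has_comp 4 (\<psi> t) (w \<psi> t)" "psi_norm (w \<psi> t) > 0"
    "\<And>js. js \<in> tuples {1..7} 4 \<Longrightarrow> ((\<lambda>s. w \<psi> s js) has_real_derivative laplacian_comp C (w \<psi> t) js) (at t within J)"
    if flow: "left_invariant_laplacian_coflow G (ew_vol e) J \<psi>" and tJ: "t \<in> J" for \<psi> J t
  proof -
    have li: "left_invariant_form G 4 (\<psi> t)" and def: "definite_4form G (ew_vol e) (\<psi> t)"
      and d: "\<And>p vs. p \<in> carrier G \<Longrightarrow> vs \<in> tuples (T p) 4 \<Longrightarrow>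
        ((\<lambda>s. \<psi> s p vs) has_real_derivative hodge_laplacian G (ew_vol e) (\<psi> t) 4 (\<psi> t) p vs) (at t within J)"
      using flow tJ unfolding left_invariant_laplacian_coflow_def by blast+
    show c: "has_comp 4 (\<psi> t) (w \<psi> t)" unfolding w_def[abs_def] by (rule left_invariant_has_comp[OF li])
    show "psi_norm (w \<psi> t) > 0" by (rule has_comp_star_gen(1)[OF c def c, of 3]) simp
    fix js :: "nat list" assume js: "js \<in> tuples {1..7} 4"
    show "((\<lambda>s. w \<psi> s js) has_real_derivative laplacian_comp C (w \<psi> t) js) (at t within J)"
      using d[OF one_closed t[OF js]] has_compD(2)[OF has_comp_laplacian_gen[OF C c def] one_closed js]
      by (simp add: w_def)
  qed
  have eq0: "w \<psi>1 0 js = w \<psi>2 0 js" if "js \<in> tuples {1..7} 4" for js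
    using 0 t[OF that] by (simp add: form_eq_def w_def)
  have eqT: "w \<psi>1 b js = w \<psi>2 b js" if js: "js \<in> tuples {1..7} 4" for js
  proof (cases "b \<ge> 0")
    case True
    then have S: "{0..b} \<subseteq> J1" "{0..b} \<subseteq> J2" using T by (simp_all add: closed_segment_eq_real_ivl)
    show ?thesis
    proof (rule laplacian_comp_unique[OF True, of "w \<psi>1" 1 C "w \<psi>2", OF _ _ _ eq0 js])
      fix t js assume *: "t \<in> {0..b}" "js \<in> tuples {1..7::nat} 4"
      show "((\<lambda>s. w \<psi>1 s js) has_real_derivative 1 * laplacian_comp C (w \<psi>1 t) js) (at t within {0..b})"
        using DERIV_subset[OF comp(3)[OF 1 _ *(2)] S(1), of t] * S by auto
      show "((\<lambda>s. w \<psi>2 s js) has_real_derivative 1 * laplacian_comp C (w \<psi>2 t) js) (at t within {0..b})"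
        using DERIV_subset[OF comp(3)[OF 2 _ *(2)] S(2), of t] * S by auto
    next
      fix t assume "t \<in> {0..b}"
      then show "psi_norm (w \<psi>1 t) > 0 \<and> psi_norm (w \<psi>2 t) > 0" using comp(2)[OF 1] comp(2)[OF 2] S by blast
    qed
  next
    case False
    then have S: "{b..0} \<subseteq> J1" "{b..0} \<subseteq> J2" and T': "- b \<ge> 0" using T by (simp_all add: closed_segment_eq_real_ivl)
    \<comment> \<open>With time reversed the components solve the equation with the opposite sign,
      which is the case \<sigma> = -1.\<close>
    have refl: "((\<lambda>s. w \<psi> (- s) js) has_real_derivative - 1 * laplacian_comp C (w \<psi> (- t)) js) (at t within {0..- b})"
      if flow: "left_invariant_laplacian_coflow G (ew_vol e) J \<psi>" and J: "{b..0} \<subseteq> J"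
        and t: "t \<in> {0..- b}" and js: "js \<in> tuples {1..7} 4" for \<psi> J t js
    proof -
      have "- t \<in> J" using t J by auto
      from comp(3)[OF flow this js]
      have "((\<lambda>s. w \<psi> s js) has_real_derivative laplacian_comp C (w \<psi> (- t)) js) (at (- t) within uminus ` {0..- b})"
        by (rule DERIV_subset) (use J in auto)
      moreover have "(uminus has_real_derivative - 1) (at t within {0..- b})"
        by (auto intro!: derivative_eq_intros)
      ultimately show ?thesis
        using DERIV_image_chain[of "\<lambda>s. w \<psi> s js" _ uminus t "{0..- b}" "- 1"] by (simp add: comp_def)
    qed
    have "w \<psi>1 (- (- b)) js = w \<psi>2 (- (- b)) js"
    proof (rule laplacian_comp_unique[OF T', of "\<lambda>s. w \<psi>1 (- s)" "- 1" C "\<lambda>s. w \<psi>2 (- s)", OF _ _ _ _ js])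
      fix t js assume *: "t \<in> {0..- b}" "js \<in> tuples {1..7::nat} 4"
      show "((\<lambda>s. w \<psi>1 (- s) js) has_real_derivative - 1 * laplacian_comp C (w \<psi>1 (- t)) js) (at t within {0..- b})"
        by (rule refl[OF 1 S(1) *])
      show "((\<lambda>s. w \<psi>2 (- s) js) has_real_derivative - 1 * laplacian_comp C (w \<psi>2 (- t)) js) (at t within {0..- b})"
        by (rule refl[OF 2 S(2) *])
    next
      fix t assume "t \<in> {0..- b}"
      then have "- t \<in> J1" "- t \<in> J2" using S by auto
      then show "psi_norm (w \<psi>1 (- t)) > 0 \<and> psi_norm (w \<psi>2 (- t)) > 0" using comp(2)[OF 1] comp(2)[OF 2] by blast
    qed (simp add: eq0)
    then show ?thesis by simp
  qed
  have TJ: "b \<in> J1" "b \<in> J2" using T by auto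
  show ?thesis by (rule has_comp_unique[OF comp(1)[OF 1 TJ(1)] comp(1)[OF 2 TJ(2)] eqT])
qed

lemma coflow_continuous:
  assumes "left_invariant_laplacian_coflow G vol S \<psi>" "p \<in> carrier G" "vs \<in> tuples (T p) 4"
  shows "continuous_on S (\<lambda>t. \<psi> t p vs)"
  by (rule DERIV_continuous_on[where D = "\<lambda>t. hodge_laplacian G vol (\<psi> t) 4 (\<psi> t) p vs"])
     (use assms in \<open>simp add: left_invariant_laplacian_coflow_def\<close>)

end

text \<open>The dual of e^4567 involves only the indices 1, 2, 3, while the form itself involves
  only 4, ..., 7. So every contraction in \<open>bryant_psi\<close> vanishes.\<close>

lemma psi_norm_degenerate: "psi_norm (cw [4,5,6,7]) = 0"
proof -
  have z: "cw [1,2,3] (i # ps) = 0 \<or> cw [4,5,6,7] (ps @ qs) = 0" if ps: "ps \<in> tuples {1..7} 2" for i ps qs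
  proof (rule ccontr)
    assume "\<not> ?thesis"
    then have s: "sort (i # ps) = [1,2,3]" "sort (ps @ qs) = [4,5,6,7]" unfolding cw_def by (metis (full_types))+
    obtain p where p: "p \<in> set ps" using ps by (cases ps) (auto simp: tuples_def)
    have "p \<in> set (sort (i # ps))" "p \<in> set (sort (ps @ qs))" using p by (simp_all del: sort_key_simps(2))
    then show False unfolding s by auto
  qed
  have d: "dualc 4 (cw [4,5,6,7]) us = 24 * cw [1,2,3] us" if "us \<in> tuples {1..7} 3" for us
    unfolding dualc_def
    using sum_cw[OF skew_on_eps_append, of "[4,5,6,7]" 4 us] eps_append_compl[of "[1,2,3]" "[4,5,6,7]" 3 us] that
    by (simp add: fact_numeral)
  have "bryant_psi (cw [4,5,6,7]) i j = 0" if ij: "i \<in> {1..7}" "j \<in> {1..7}" for i j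
    unfolding bryant_psi_def
  proof (intro sum.neutral ballI)
    fix ps assume ps: "ps \<in> tuples {1..7::nat} 2"
    have "i # ps \<in> tuples {1..7} 3" using ij ps by (simp add: tuples_def)
    then have "dualc 4 (cw [4,5,6,7]) (i # ps) = 24 * cw [1,2,3] (i # ps)" by (rule d)
    then have z0: "dualc 4 (cw [4,5,6,7]) (i # ps) * cw [4,5,6,7] (ps @ qs) = 0" for qs
      using z[OF ps, of i qs] by auto
    show "dualc 4 (cw [4,5,6,7]) (i # ps) * (\<Sum>qs\<in>tuples {1..7} 2. dualc 4 (cw [4,5,6,7]) (j # qs) * cw [4,5,6,7] (ps @ qs)) = 0"
      unfolding sum_distrib_left
    proof (intro sum.neutral ballI)
      fix qs
      show "dualc 4 (cw [4,5,6,7]) (i # ps) * (dualc 4 (cw [4,5,6,7]) (j # qs) * cw [4,5,6,7] (ps @ qs)) = 0"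
        unfolding mult.left_commute[of "dualc 4 (cw [4,5,6,7]) (i # ps)"] z0 by (rule mult_zero_right)
    qed
  qed
  then have "pr (bryant_psi (cw [4,5,6,7])) xs ys = 0" if "xs \<in> tuples {1..7} 4" "ys \<in> tuples {1..7} 4" for xs ys
    using that by (cases xs; cases ys) (auto simp: tuples_def)
  then show ?thesis unfolding psi_norm_def by (intro sum.neutral ballI) (simp add: sum.neutral)
qed

section \<open>Products, the circle and \<open>SU(2)\<close>\<close>

lemma tangent_space_Times:
  "tangent_space (A \<times> B) (p, q) = tangent_space A p \<times> tangent_space B q"
proof (intro equalityI subsetI)
  fix v assume "v \<in> tangent_space (A \<times> B) (p, q)"
  then obtain c where c: "\<forall>s. c s \<in> A \<times> B" "c 0 = (p, q)" "(c has_vector_derivative v) (at (0::real))"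
    by (auto simp: tangent_space_def)
  have "((\<lambda>s. fst (c s)) has_vector_derivative fst v) (at 0)" "((\<lambda>s. snd (c s)) has_vector_derivative snd v) (at 0)"
    using c(3) by (auto intro: bounded_linear.has_vector_derivative[OF bounded_linear_fst]
      bounded_linear.has_vector_derivative[OF bounded_linear_snd])
  moreover have "\<forall>s. fst (c s) \<in> A" "\<forall>s. snd (c s) \<in> B" using c(1) by (simp_all add: mem_Times_iff)
  ultimately have "fst v \<in> tangent_space A p" "snd v \<in> tangent_space B q"
    using c(2) by (auto simp: tangent_space_def intro!: exI[of _ "\<lambda>s. fst (c s)"] exI[of _ "\<lambda>s. snd (c s)"])
  then show "v \<in> tangent_space A p \<times> tangent_space B q" by (simp add: mem_Times_iff)
next
  fix v assume "v \<in> tangent_space A p \<times> tangent_space B q"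
  then obtain c d where c: "\<forall>s. c s \<in> A" "c 0 = p" "(c has_vector_derivative fst v) (at (0::real))"
    and d: "\<forall>s. d s \<in> B" "d 0 = q" "(d has_vector_derivative snd v) (at (0::real))"
    by (auto simp: tangent_space_def)
  have "((\<lambda>s. (c s, d s)) has_vector_derivative (fst v, snd v)) (at 0)"
    by (rule has_vector_derivative_Pair[OF c(3) d(3)])
  then show "v \<in> tangent_space (A \<times> B) (p, q)"
    using c(1,2) d(1,2) by (auto simp: tangent_space_def intro!: exI[of _ "\<lambda>s. (c s, d s)"])
qed

lemma tangent_space_singleton: "tangent_space {x} x = {0}"
proof (intro equalityI subsetI)
  fix v assume "v \<in> tangent_space {x} x"
  then obtain c where c: "\<forall>s. c s = x" "(c has_vector_derivative v) (at (0::real))"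
    by (auto simp: tangent_space_def)
  then have "c = (\<lambda>s. x)" by auto
  then show "v \<in> {0}" using c(2) vector_derivative_unique_at[OF c(2), of 0] by simp
qed (auto simp: tangent_space_def intro!: exI[of _ "\<lambda>s. x"])

lemma lin_group_DirProd:
  assumes "lin_group Y JY" "lin_group X JX"
  shows "lin_group (Y \<times>\<times> X) (map_prod JY JX)"
proof -
  interpret Y: lin_group Y JY by (rule assms(1))
  interpret X: lin_group X JX by (rule assms(2))
  have mult: "mult (Y \<times>\<times> X) = (\<lambda>p q. (fst p \<otimes>\<^bsub>Y\<^esub> fst q, snd p \<otimes>\<^bsub>X\<^esub> snd q))"
    by (intro ext) (auto simp: DirProd_def case_prod_unfold)
  have T: "tangent (Y \<times>\<times> X) \<one>\<^bsub>Y \<times>\<times> X\<^esub> = tangent Y \<one>\<^bsub>Y\<^esub> \<times> tangent X \<one>\<^bsub>X\<^esub>"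
    by (simp add: DirProd_def tangent_space_Times)
  have g: "group (Y \<times>\<times> X)" by (rule DirProd_group[OF Y.group X.group])
  show ?thesis
  proof (rule lin_group.intro)
    show "group (Y \<times>\<times> X)" by (rule g)
    show "bounded_bilinear (mult (Y \<times>\<times> X))"
    proof -
      have 1: "bounded_bilinear (\<lambda>p q. fst p \<otimes>\<^bsub>Y\<^esub> fst q)" "bounded_bilinear (\<lambda>p q. snd p \<otimes>\<^bsub>X\<^esub> snd q)"
        using bounded_bilinear.comp[OF Y.bilinear bounded_linear_fst bounded_linear_fst]
          bounded_bilinear.comp[OF X.bilinear bounded_linear_snd bounded_linear_snd] by simp_all
      have "bilinear (mult (Y \<times>\<times> X))"
        unfolding mult bilinear_def
        by (intro conjI allI linearI)
           (simp_all add: bounded_bilinear.add_left[OF Y.bilinear] bounded_bilinear.add_right[OF Y.bilinear]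
             bounded_bilinear.add_left[OF X.bilinear] bounded_bilinear.add_right[OF X.bilinear]
             bounded_bilinear.scaleR_left[OF Y.bilinear] bounded_bilinear.scaleR_right[OF Y.bilinear]
             bounded_bilinear.scaleR_left[OF X.bilinear] bounded_bilinear.scaleR_right[OF X.bilinear])
      then show ?thesis by (simp add: bilinear_conv_bounded_bilinear)
    qed
    show "(x \<otimes>\<^bsub>Y \<times>\<times> X\<^esub> y) \<otimes>\<^bsub>Y \<times>\<times> X\<^esub> z = x \<otimes>\<^bsub>Y \<times>\<times> X\<^esub> (y \<otimes>\<^bsub>Y \<times>\<times> X\<^esub> z)" for x y z
      by (simp add: mult Y.assoc X.assoc)
    show "\<one>\<^bsub>Y \<times>\<times> X\<^esub> \<otimes>\<^bsub>Y \<times>\<times> X\<^esub> x = x" "x \<otimes>\<^bsub>Y \<times>\<times> X\<^esub> \<one>\<^bsub>Y \<times>\<times> X\<^esub> = x" for x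
      by (simp_all add: mult Y.one X.one)
    show "subspace (tangent (Y \<times>\<times> X) \<one>\<^bsub>Y \<times>\<times> X\<^esub>)"
      unfolding T by (rule subspace_Times[OF Y.subspace_one X.subspace_one])
    show "bracket (Y \<times>\<times> X) x y \<in> tangent (Y \<times>\<times> X) \<one>\<^bsub>Y \<times>\<times> X\<^esub>"
      if "x \<in> tangent (Y \<times>\<times> X) \<one>\<^bsub>Y \<times>\<times> X\<^esub>" "y \<in> tangent (Y \<times>\<times> X) \<one>\<^bsub>Y \<times>\<times> X\<^esub>" for x y
      using that Y.bracket_in X.bracket_in unfolding T bracket_def mult by (auto simp: mem_Times_iff bracket_def)
    show "linear (map_prod JY JX)"
      by (intro linearI) (simp_all add: map_prod_def case_prod_unfold linear_add[OF Y.linear_J] linear_add[OF X.linear_J]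
        linear_scale[OF Y.linear_J] linear_scale[OF X.linear_J])
    fix p assume "p \<in> carrier (Y \<times>\<times> X)"
    then show "inv\<^bsub>Y \<times>\<times> X\<^esub> p = map_prod JY JX p"
      using inv_DirProd[OF Y.group X.group, of "fst p" "snd p"] Y.inv_J X.inv_J by (cases p) auto
  qed
qed

section \<open>The circle and SU(2) as linear Lie groups\<close>

lemma group_U1: "group U1"
proof (rule groupI)
  fix x assume "x \<in> carrier U1"
  then show "\<exists>y\<in>carrier U1. y \<otimes>\<^bsub>U1\<^esub> x = \<one>\<^bsub>U1\<^esub>"
    by (intro bexI[of _ "cnj x"]) (auto simp: U1_def complex_norm_square[symmetric] mult.commute)
qed (auto simp: U1_def norm_mult)

text \<open>Differentiating the square norm of a curve in the circle gives Re v = 0; conversely the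
  curve \<open>cis (Im v * s)\<close> has velocity \<open>v\<close>.\<close>

lemma tangent_U1: "tangent U1 1 = {v. Re v = 0}"
proof (intro equalityI subsetI)
  fix v assume "v \<in> tangent U1 1"
  then obtain c where c: "\<forall>s. norm (c s) = 1" "c 0 = 1" "(c has_vector_derivative v) (at (0::real))"
    by (auto simp: tangent_space_def U1_def)
  have "((\<lambda>s. c s \<bullet> c s) has_real_derivative 2 * Re v) (at 0)"
  proof -
    have "((\<lambda>s. c s \<bullet> c s) has_derivative (\<lambda>h. c 0 \<bullet> (h *\<^sub>R v) + (h *\<^sub>R v) \<bullet> c 0)) (at 0)"
      using c(3) by (intro has_derivative_inner) (auto simp: has_vector_derivative_def)
    then show ?thesis
      by (rule has_derivative_imp_has_field_derivative) (simp add: c(2) inner_complex_def)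
  qed
  moreover have "(\<lambda>s. c s \<bullet> c s) = (\<lambda>s. 1)" using c(1) by (simp add: dot_square_norm)
  ultimately show "v \<in> {v. Re v = 0}" using DERIV_unique[of "\<lambda>s. 1" "2 * Re v" 0 0] by simp
next
  fix v assume rv: "v \<in> {v. Re v = 0}"
  have "((\<lambda>s. cis (Im v * s)) has_vector_derivative v) (at 0)"
  proof -
    have "((\<lambda>s. Complex (cos (Im v * s)) (sin (Im v * s))) has_vector_derivative Complex (- sin (Im v * 0) * Im v) (cos (Im v * 0) * Im v)) (at 0)"
      unfolding has_vector_derivative_complex_iff by (auto intro!: derivative_eq_intros)
    moreover have "Complex 0 (Im v) = v" using rv by (simp add: complex_eq_iff)
    ultimately show ?thesis by (simp add: cis.ctr)
  qed
  then show "v \<in> tangent U1 1"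
    unfolding tangent_space_def U1_def by (auto intro!: exI[of _ "\<lambda>s. cis (Im v * s)"])
qed

lemma lin_group_U1: "lin_group U1 cnj"
proof (rule lin_group.intro)
  show "group U1" by (rule group_U1)
  show "bounded_bilinear (mult U1)" using bounded_bilinear_mult[where 'a = complex] by (simp add: U1_def)
  have one: "\<one>\<^bsub>U1\<^esub> = 1" by (simp add: U1_def)
  have "subspace {v. Re v = 0}" by (auto simp: subspace_def)
  then show "subspace (tangent U1 \<one>\<^bsub>U1\<^esub>)" by (simp add: one tangent_U1)
  show "bracket U1 x y \<in> tangent U1 \<one>\<^bsub>U1\<^esub>" for x y
    unfolding one tangent_U1 by (simp add: bracket_def U1_def)
  show "linear cnj" by (intro linearI) auto
  fix p assume p: "p \<in> carrier U1"
  then show "inv\<^bsub>U1\<^esub> p = cnj p"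
    by (intro group.inv_equality[OF group_U1])
       (auto simp: U1_def complex_norm_square[symmetric] mult.commute)
qed (simp_all add: U1_def)

text \<open>A quaternion as a complex matrix, given by its two complex coordinates. These matrices
  form a real algebra (\<open>quat_mult\<close>, \<open>quat_lin\<close>) whose unit sphere is
  SU(2).\<close>

definition quat :: "complex \<Rightarrow> complex \<Rightarrow> complex^2^2" where
  "quat a b = (\<chi> i j. if i = 1 then (if j = 1 then a else b) else (if j = 1 then - cnj b else cnj a))"

lemma quat_nth [simp]:
  "quat a b $ 1 $ 1 = a" "quat a b $ 1 $ 2 = b" "quat a b $ 2 $ 1 = - cnj b" "quat a b $ 2 $ 2 = cnj a"
  by (simp_all add: quat_def)

lemma mat2_eq_iff: "A = B \<longleftrightarrow> A $ 1 $ 1 = B $ 1 $ 1 \<and> A $ 1 $ 2 = B $ 1 $ 2 \<and> A $ 2 $ 1 = B $ 2 $ 1 \<and> A $ 2 $ 2 = B $ 2 $ 2"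
  for A B :: "'b^2^2"
  by (auto simp: vec_eq_iff forall_2)

lemma mult2_nth: "(A ** B) $ i $ j = A $ i $ 1 * B $ 1 $ j + A $ i $ 2 * B $ 2 $ j" for A B :: "complex^2^2"
  by (simp add: matrix_matrix_mult_def sum_2)

lemma quat_mult: "quat a b ** quat c d = quat (a * c - b * cnj d) (a * d + b * cnj c)"
  by (simp add: mat2_eq_iff mult2_nth algebra_simps)

lemma quat_one: "mat 1 = quat 1 0"
  by (simp add: mat2_eq_iff mat_def)

text \<open>Multiplying the entries of the second column by the square norm 1 of the first, and
  using orthogonality and det = 1, expresses the second column through the first.\<close>

lemma carrier_SU2: "carrier SU2 = {quat a b | a b. (cmod a)\<^sup>2 + (cmod b)\<^sup>2 = 1}"
proof (intro equalityI subsetI)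
  fix A assume "A \<in> carrier SU2"
  then have u: "(\<chi> i j. cnj (A $ j $ i)) ** A = mat 1" and d: "det A = 1" by (auto simp: SU2_def)
  define a b c d where "a = A $ 1 $ 1" and "b = A $ 1 $ 2" and "c = A $ 2 $ 1" and "d = A $ 2 $ 2"
  have e: "cnj a * a + cnj c * c = 1" "cnj a * b + cnj c * d = 0" "cnj b * b + cnj d * d = 1" "a * d - b * c = 1"
    using u d by (simp_all add: mat2_eq_iff mult2_nth mat_def det_2 a_def b_def c_def d_def)
  have "d = d * (cnj a * a + cnj c * c)" using e by simp
  also have "\<dots> = cnj a * (a * d - b * c) + c * (cnj a * b + cnj c * d)" by (simp add: algebra_simps)
  also have "\<dots> = cnj a" using e by simp
  finally have da: "d = cnj a" .
  have "b = b * (cnj a * a + cnj c * c)" using e by simp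
  also have "\<dots> = a * (cnj a * b + cnj c * d) - cnj c * (a * d - b * c)" by (simp add: algebra_simps)
  also have "\<dots> = - cnj c" using e by simp
  finally have cb: "c = - cnj b" by simp
  have "a * cnj a + b * cnj b = 1" using e(1) cb by (simp add: mult.commute)
  then have "complex_of_real ((cmod a)\<^sup>2 + (cmod b)\<^sup>2) = 1"
    by (simp only: of_real_add complex_norm_square)
  then have "(cmod a)\<^sup>2 + (cmod b)\<^sup>2 = 1" using of_real_eq_1_iff by blast
  moreover have "A = quat a b" using da cb by (simp add: mat2_eq_iff a_def b_def c_def d_def)
  ultimately show "A \<in> {quat a b | a b. (cmod a)\<^sup>2 + (cmod b)\<^sup>2 = 1}" by blast
next
  fix A assume "A \<in> {quat a b | a b. (cmod a)\<^sup>2 + (cmod b)\<^sup>2 = 1}"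
  then obtain a b where A: "A = quat a b" "(cmod a)\<^sup>2 + (cmod b)\<^sup>2 = 1" by blast
  have "complex_of_real ((cmod a)\<^sup>2 + (cmod b)\<^sup>2) = 1" using A by simp
  then have "a * cnj a + b * cnj b = 1" by (simp only: of_real_add complex_norm_square)
  then show "A \<in> carrier SU2"
    unfolding A SU2_def by (simp add: mat2_eq_iff mult2_nth mat_def det_2 algebra_simps)
qed

definition adj :: "complex^2^2 \<Rightarrow> complex^2^2" where
  "adj A = (\<chi> i j. cnj (A $ j $ i))"

lemma adj_quat: "adj (quat a b) = quat (cnj a) (- b)"
  by (simp add: mat2_eq_iff adj_def)

lemma quat_adj_mult: "(cmod a)\<^sup>2 + (cmod b)\<^sup>2 = 1 \<Longrightarrow> quat (cnj a) (- b) ** quat a b = mat 1"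
proof -
  assume "(cmod a)\<^sup>2 + (cmod b)\<^sup>2 = 1"
  then have "complex_of_real ((cmod a)\<^sup>2 + (cmod b)\<^sup>2) = 1" by simp
  then have "a * cnj a + b * cnj b = 1" by (simp only: of_real_add complex_norm_square)
  then show ?thesis unfolding quat_mult quat_one by (simp add: mult.commute)
qed

lemma quat_in_SU2: "(cmod a)\<^sup>2 + (cmod b)\<^sup>2 = 1 \<Longrightarrow> quat a b \<in> carrier SU2"
  by (auto simp: carrier_SU2)

text \<open>Multiplicativity of the quaternion norm, which is Euler's four-square identity; it makes
  SU(2) closed under products.\<close>

lemma norm_square_mult_add:
  "(cmod (a * c - b * cnj d))\<^sup>2 + (cmod (a * d + b * cnj c))\<^sup>2 = ((cmod a)\<^sup>2 + (cmod b)\<^sup>2) * ((cmod c)\<^sup>2 + (cmod d)\<^sup>2)"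
  unfolding cmod_power2 by simp algebra

lemma group_SU2: "group SU2"
proof (rule groupI)
  fix x assume "x \<in> carrier SU2"
  then obtain a b where x: "x = quat a b" "(cmod a)\<^sup>2 + (cmod b)\<^sup>2 = 1" by (auto simp: carrier_SU2)
  then show "\<exists>y\<in>carrier SU2. y \<otimes>\<^bsub>SU2\<^esub> x = \<one>\<^bsub>SU2\<^esub>"
    by (intro bexI[of _ "quat (cnj a) (- b)"]) (simp_all add: quat_in_SU2, simp add: SU2_def quat_adj_mult)
next
  fix x y assume "x \<in> carrier SU2" "y \<in> carrier SU2"
  then obtain a b c d where "x = quat a b" "(cmod a)\<^sup>2 + (cmod b)\<^sup>2 = 1" "y = quat c d" "(cmod c)\<^sup>2 + (cmod d)\<^sup>2 = 1"
    by (auto simp: carrier_SU2)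
  moreover have "x \<otimes>\<^bsub>SU2\<^esub> y = x ** y" by (simp add: SU2_def)
  ultimately show "x \<otimes>\<^bsub>SU2\<^esub> y \<in> carrier SU2"
    by (simp add: quat_mult quat_in_SU2 norm_square_mult_add)
next
  show "\<one>\<^bsub>SU2\<^esub> \<in> carrier SU2" using quat_in_SU2[of 1 0] by (simp add: SU2_def quat_one)
qed (simp_all add: SU2_def matrix_mul_assoc)

lemma quat_lin:
  "quat a b + quat c d = quat (a + c) (b + d)" "r *\<^sub>R quat a b = quat (r *\<^sub>R a) (r *\<^sub>R b)"
  "quat a b - quat c d = quat (a - c) (b - d)" "(0 :: complex^2^2) = quat 0 0"
  by (simp_all add: mat2_eq_iff)

lemma linear_mat2: "linear f \<Longrightarrow> bounded_linear f" for f :: "complex^2^2 \<Rightarrow> 'b::real_normed_vector"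
  by (simp add: linear_conv_bounded_linear)

lemma tangent_SU2: "tangent SU2 (mat 1) = {quat a b | a b. Re a = 0}"
proof (intro equalityI subsetI)
  fix v assume "v \<in> tangent SU2 (mat 1)"
  then obtain c where c: "\<forall>s. c s \<in> carrier SU2" "c 0 = mat 1" "(c has_vector_derivative v) (at (0::real))"
    by (auto simp: tangent_space_def)
  have nth: "((\<lambda>s. c s $ i $ j) has_vector_derivative v $ i $ j) (at 0)" for i j
    by (rule bounded_linear.has_vector_derivative[OF _ c(3), of "\<lambda>A. A $ i $ j"])
       (auto intro!: linear_mat2 linearI)
  have cq: "c s $ 2 $ 1 = - cnj (c s $ 1 $ 2)" "c s $ 2 $ 2 = cnj (c s $ 1 $ 1)" "(cmod (c s $ 1 $ 1))\<^sup>2 + (cmod (c s $ 1 $ 2))\<^sup>2 = 1" for s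
  proof -
    have "c s \<in> carrier SU2" using c(1) by blast
    then obtain a b where "c s = quat a b" "(cmod a)\<^sup>2 + (cmod b)\<^sup>2 = 1" unfolding carrier_SU2 by blast
    then show "c s $ 2 $ 1 = - cnj (c s $ 1 $ 2)" "c s $ 2 $ 2 = cnj (c s $ 1 $ 1)" "(cmod (c s $ 1 $ 1))\<^sup>2 + (cmod (c s $ 1 $ 2))\<^sup>2 = 1"
      by simp_all
  qed
  have "((\<lambda>s. - cnj (c s $ 1 $ 2)) has_vector_derivative - cnj (v $ 1 $ 2)) (at 0)"
    by (intro has_vector_derivative_minus bounded_linear.has_vector_derivative[OF bounded_linear_cnj nth])
  from vector_derivative_unique_at[OF nth[of 2 1, unfolded cq(1)] this]
  have v21: "v $ 2 $ 1 = - cnj (v $ 1 $ 2)" .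
  have "((\<lambda>s. cnj (c s $ 1 $ 1)) has_vector_derivative cnj (v $ 1 $ 1)) (at 0)"
    by (intro bounded_linear.has_vector_derivative[OF bounded_linear_cnj nth])
  from vector_derivative_unique_at[OF nth[of 2 2, unfolded cq(2)] this]
  have v22: "v $ 2 $ 2 = cnj (v $ 1 $ 1)" .
  let ?N = "\<lambda>s. c s $ 1 $ 1 \<bullet> c s $ 1 $ 1 + c s $ 1 $ 2 \<bullet> c s $ 1 $ 2"
  have "(?N has_real_derivative 2 * Re (v $ 1 $ 1)) (at 0)"
  proof -
    have "(?N has_derivative (\<lambda>h. (c 0 $ 1 $ 1 \<bullet> (h *\<^sub>R v $ 1 $ 1) + (h *\<^sub>R v $ 1 $ 1) \<bullet> c 0 $ 1 $ 1)
        + (c 0 $ 1 $ 2 \<bullet> (h *\<^sub>R v $ 1 $ 2) + (h *\<^sub>R v $ 1 $ 2) \<bullet> c 0 $ 1 $ 2))) (at 0)"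
      using nth[of 1 1] nth[of 1 2]
      by (intro has_derivative_add has_derivative_inner) (auto simp: has_vector_derivative_def)
    then show ?thesis
      by (rule has_derivative_imp_has_field_derivative) (simp add: c(2) inner_complex_def mat_def)
  qed
  moreover have "?N = (\<lambda>s. 1)" using cq(3) by (simp add: dot_square_norm)
  ultimately have "Re (v $ 1 $ 1) = 0" using DERIV_unique[of "\<lambda>s. 1" "2 * Re (v $ 1 $ 1)" 0 0] by simp
  moreover have "v = quat (v $ 1 $ 1) (v $ 1 $ 2)" using v21 v22 by (simp add: mat2_eq_iff)
  ultimately show "v \<in> {quat a b | a b. Re a = 0}" by blast
next
  fix v assume "v \<in> {quat a b | a b. Re a = 0}"
  then obtain a b where v: "v = quat a b" "Re a = 0" by blast
  define n where "n = sqrt ((cmod a)\<^sup>2 + (cmod b)\<^sup>2)"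
  have n2: "n\<^sup>2 = (cmod a)\<^sup>2 + (cmod b)\<^sup>2" by (simp add: n_def)
  \<comment> \<open>This is exp(s v), because the square of the matrix \<open>v\<close> is -n^2. If
    n = 0 then v = 0 and the curve is constant.\<close>
  define c where "c = (\<lambda>s. cos (n * s) *\<^sub>R mat 1 + (if n = 0 then 0 else sin (n * s) / n) *\<^sub>R v)"
  have "c s \<in> carrier SU2" for s
  proof (cases "n = 0")
    case True
    then have "v = 0" using n2 v by (simp add: mat2_eq_iff sum_power2_eq_zero_iff)
    then show ?thesis using True quat_in_SU2[of 1 0] by (simp add: c_def quat_one)
  next
    case False
    let ?k = "sin (n * s) / n"
    have "c s = quat (cos (n * s) + ?k * a) (?k * b)"
    proof -
      have "c s = cos (n * s) *\<^sub>R quat 1 0 + ?k *\<^sub>R quat a b" using False by (simp add: c_def v quat_one)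
      also have "\<dots> = quat (cos (n * s) *\<^sub>R 1 + ?k *\<^sub>R a) (cos (n * s) *\<^sub>R 0 + ?k *\<^sub>R b)" by (simp only: quat_lin)
      also have "\<dots> = quat (cos (n * s) + ?k * a) (?k * b)" by (simp add: scaleR_conv_of_real)
      finally show ?thesis .
    qed
    moreover have "(cmod (cos (n * s) + ?k * a))\<^sup>2 + (cmod (?k * b))\<^sup>2 = 1"
    proof -
      have "(cmod (cos (n * s) + ?k * a))\<^sup>2 = (cos (n * s))\<^sup>2 + ?k\<^sup>2 * (cmod a)\<^sup>2"
        using v(2) by (simp add: cmod_power2 power_mult_distrib power_divide)
      moreover have "(cmod (?k * b))\<^sup>2 = ?k\<^sup>2 * (cmod b)\<^sup>2"
        by (simp add: norm_mult norm_divide power_mult_distrib power_divide)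
      ultimately have "(cmod (cos (n * s) + ?k * a))\<^sup>2 + (cmod (?k * b))\<^sup>2 = (cos (n * s))\<^sup>2 + ?k\<^sup>2 * n\<^sup>2"
        by (simp add: n2 algebra_simps)
      also have "\<dots> = 1" using False by (simp add: power_divide)
      finally show ?thesis .
    qed
    ultimately show ?thesis by (simp add: quat_in_SU2)
  qed
  moreover have "c 0 = mat 1" by (simp add: c_def)
  moreover have "(c has_vector_derivative v) (at 0)"
  proof (cases "n = 0")
    case True
    then have "v = 0" using n2 v by (simp add: mat2_eq_iff sum_power2_eq_zero_iff)
    then show ?thesis using True by (simp add: c_def)
  next
    case False
    have "((\<lambda>s. cos (n * s)) has_real_derivative 0) (at 0)" "((\<lambda>s. sin (n * s) / n) has_real_derivative 1) (at 0)"
      using False by (auto intro!: derivative_eq_intros)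
    then have "((\<lambda>s. cos (n * s) *\<^sub>R mat 1 + (sin (n * s) / n) *\<^sub>R v) has_vector_derivative (cos (n * 0) *\<^sub>R 0 + 0 *\<^sub>R mat 1) + ((sin (n * 0) / n) *\<^sub>R 0 + 1 *\<^sub>R v)) (at 0)"
      by (intro has_vector_derivative_add has_vector_derivative_scaleR has_vector_derivative_const)
    then show ?thesis using False by (simp add: c_def)
  qed
  ultimately show "v \<in> tangent SU2 (mat 1)" unfolding tangent_space_def by blast
qed

lemma lin_group_SU2: "lin_group SU2 adj"
proof (rule lin_group.intro)
  show "group SU2" by (rule group_SU2)
  have m: "mult SU2 = (**)" by (simp add: SU2_def)
  have "bilinear ((**) :: complex^2^2 \<Rightarrow> complex^2^2 \<Rightarrow> complex^2^2)"
    unfolding bilinear_def by (intro conjI allI linearI) (simp_all add: mat2_eq_iff mult2_nth algebra_simps)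
  then show "bounded_bilinear (mult SU2)" by (simp add: m bilinear_conv_bounded_bilinear)
  have one: "\<one>\<^bsub>SU2\<^esub> = mat 1" by (simp add: SU2_def)
  note q = quat_lin
  show "subspace (tangent SU2 \<one>\<^bsub>SU2\<^esub>)"
    unfolding one tangent_SU2
  proof (rule subspaceI)
    have "Re 0 = 0" by simp
    then show "(0 :: complex^2^2) \<in> {quat a b | a b. Re a = 0}" unfolding q(4) by blast
  next
    fix x y assume "x \<in> {quat a b | a b. Re a = 0}" "y \<in> {quat a b | a b. Re a = 0}"
    then obtain a b c d where "x = quat a b" "y = quat c d" "Re a = 0" "Re c = 0" by blast
    then have "x + y = quat (a + c) (b + d)" "Re (a + c) = 0" by (simp_all add: q)
    then show "x + y \<in> {quat a b | a b. Re a = 0}" by blast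
  next
    fix r x assume "x \<in> {quat a b | a b. Re a = 0}"
    then obtain a b where "x = quat a b" "Re a = 0" by blast
    then have "r *\<^sub>R x = quat (r *\<^sub>R a) (r *\<^sub>R b)" "Re (r *\<^sub>R a) = 0" by (simp_all add: q)
    then show "r *\<^sub>R x \<in> {quat a b | a b. Re a = 0}" by blast
  qed
  show "bracket SU2 x y \<in> tangent SU2 \<one>\<^bsub>SU2\<^esub>" if xy: "x \<in> tangent SU2 \<one>\<^bsub>SU2\<^esub>" "y \<in> tangent SU2 \<one>\<^bsub>SU2\<^esub>" for x y
  proof -
    obtain a b c d where "x = quat a b" "y = quat c d" "Re a = 0" "Re c = 0"
      using xy unfolding one tangent_SU2 by blast
    then have "bracket SU2 x y = quat ((a * c - b * cnj d) - (c * a - d * cnj b)) ((a * d + b * cnj c) - (c * b + d * cnj a))"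
      by (simp add: bracket_def m quat_mult q)
    moreover have "Re ((a * c - b * cnj d) - (c * a - d * cnj b)) = 0" by simp
    ultimately show ?thesis unfolding one tangent_SU2 by blast
  qed
  show "linear adj" by (intro linearI) (simp_all add: adj_def vec_eq_iff)
  fix p assume "p \<in> carrier SU2"
  then obtain a b where "p = quat a b" "(cmod a)\<^sup>2 + (cmod b)\<^sup>2 = 1" by (auto simp: carrier_SU2)
  moreover from this have "quat (cnj a) (- b) \<in> carrier SU2" by (simp add: quat_in_SU2)
  ultimately show "inv\<^bsub>SU2\<^esub> p = adj p"
    using quat_adj_mult[of a b]
    by (intro group.inv_equality[OF group_SU2]) (simp_all add: adj_quat m one quat_in_SU2)
qed (simp_all add: SU2_def matrix_mul_assoc)

section \<open>Calibrated factors\<close>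

text \<open>The determinant is contracted over the row indices instead of the column indices;
  \<open>eps_det_transpose\<close> shows that the number is the same.\<close>

lemma eps_orthogonal':
  assumes I: "finite I"
    and A: "\<And>x z. x \<in> I \<Longrightarrow> z \<in> I \<Longrightarrow> (\<Sum>y\<in>I. A y x * A y z) = (if x = z then 1 else 0)"
  shows "(\<Sum>xs\<in>tuples I (card I). eps xs * pr A xs (sorted_list_of_set I)) ^ 2 = 1"
proof -
  let ?T = "tuples I (card I)" and ?s = "sorted_list_of_set I"
  have s: "?s \<in> ?T" using I by (simp add: tuples_def)
  define c where "c = (\<Sum>xs\<in>?T. eps xs * pr A xs ?s)"
  have "(\<Sum>xs\<in>?T. eps xs * pr A xs ys) = c * eps ys" if "ys \<in> ?T" for ys
    unfolding c_def
    using skew_on_top[OF I skew_on_contract[where A = "\<lambda>x y. A y x", OF I skew_on_eps] that]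
    by (simp only: pr_transpose[of A])
  from eps_det_transpose[OF I this s] have "(\<Sum>xs\<in>?T. eps xs * pr A ?s xs) = c" by (simp add: eps_sorted)
  then show ?thesis using eps_orthogonal[OF I A] by (simp add: c_def)
qed

lemma wedge_1_zero: "(\<And>v. v \<in> set vs \<Longrightarrow> \<alpha> [v] = 0) \<Longrightarrow> wedge 1 \<alpha> \<beta> vs = 0"
  by (induction vs arbitrary: \<beta>) (simp_all add: wedge_1_Cons)

lemma coframe_wedge_zero:
  assumes "i \<in> set is" "\<And>v. v \<in> set vs \<Longrightarrow> f i [v] = 0"
  shows "coframe_wedge f is vs = 0"
  using assms
proof (induction "is" arbitrary: vs)
  case (Cons j "is")
  show ?case
  proof (cases "i = j")
    case True
    then show ?thesis using Cons.prems by (simp add: wedge_1_zero)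
  next
    case False
    have "wedge 1 (f j) (coframe_wedge f is) vs = wedge 1 (f j) (\<lambda>_. 0) vs"
      by (rule wedge_1_cong, rule Cons.IH) (use Cons.prems False in auto)
    then show ?thesis by (simp add: wedge_def)
  qed
qed simp

context coframed
begin

text \<open>The span of the vectors \<open>F j\<close> with j in \<open>K\<close>, described by
  equations as in \<open>adapted_to_product\<close> and not by generators.\<close>

definition sub :: "nat set \<Rightarrow> 'a set" where
  "sub K = {v \<in> V. \<forall>i\<in>{1..7} - K. f i [v] = 0}"

lemma dim_sub:
  assumes K: "K \<subseteq> {1..7}"
  shows "dim (sub K) = card K"
proof -
  have fK: "finite K" using K finite_subset by blast
  have coeff: "f i [\<Sum>j\<in>K. c j *\<^sub>R F j] = (if i \<in> K then c i else 0)" if "i \<in> {1..7}" for c i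
  proof -
    have "f i [\<Sum>j\<in>K. c j *\<^sub>R F j] = (\<Sum>j\<in>K. c j * f i [F j])"
      using that fK by (intro linear_sum) auto
    also have "\<dots> = (\<Sum>j\<in>K. if j = i then c j else 0)"
      using that by (intro sum.cong refl) (simp add: dual)
    finally show ?thesis using fK by (simp add: sum.delta)
  qed
  have inj: "inj_on F K"
  proof (rule inj_onI)
    fix i j assume "i \<in> K" "j \<in> K" "F i = F j"
    then show "i = j" using dual[of i i] dual[of i j] K by (auto split: if_splits)
  qed
  have "independent (F ` K)"
  proof (rule independent_if_scalars_zero)
    show "finite (F ` K)" using fK by simp
    fix g x assume s: "(\<Sum>x\<in>F ` K. g x *\<^sub>R x) = 0" and "x \<in> F ` K"
    then obtain i where i: "i \<in> K" "x = F i" by blast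
    have "(\<Sum>j\<in>K. g (F j) *\<^sub>R F j) = 0" using s inj by (simp add: sum.reindex)
    then have "f i [\<Sum>j\<in>K. g (F j) *\<^sub>R F j] = 0" using zero i K by auto
    then show "g x = 0" using coeff[of i "\<lambda>j. g (F j)"] i K by auto
  qed
  moreover have "sub K \<subseteq> span (F ` K)"
  proof
    fix v assume v: "v \<in> sub K"
    then have "v = (\<Sum>j\<in>{1..7}. f j [v] *\<^sub>R F j)" by (intro expand) (simp add: sub_def)
    also have "\<dots> = (\<Sum>j\<in>K. f j [v] *\<^sub>R F j)"
      using K v by (intro sum.mono_neutral_right) (auto simp: sub_def)
    also have "\<dots> \<in> span (F ` K)" by (intro span_sum span_scale span_base) auto
    finally show "v \<in> span (F ` K)" .
  qed
  moreover have "F ` K \<subseteq> sub K" using K by (auto simp: sub_def dual)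
  ultimately have "dim (sub K) = card (F ` K)"
    using dim_unique[of "F ` K" "sub K" "card (F ` K)"] by simp
  then show ?thesis using card_image[OF inj] by simp
qed

text \<open>The coordinates outside \<open>K\<close> vanish, so the value is the determinant of the
  square matrix of coordinates in \<open>K\<close>. This matrix is orthogonal, and its determinant
  is 1 or -1.\<close>

lemma sub_wedge_orthonormal:
  assumes K: "K \<subseteq> {1..7}" and vs: "vs \<in> tuples (sub K) (card K)" and on: "orthonormal_list (coframe_metric f) vs"
  shows "\<bar>coframe_wedge f (sorted_list_of_set K) vs\<bar> = 1"
proof -
  let ?s = "sorted_list_of_set K" and ?k = "card K"
  have fK: "finite K" using K finite_subset by blast
  have ls: "length ?s = ?k" "set ?s = K" "distinct ?s" "sorted ?s" using fK by simp_all
  \<comment> \<open>The vectors are reindexed by the elements of \<open>K\<close>, so that rows and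
    columns of the coordinate matrix have the same index set, as \<open>eps_orthogonal'\<close>
    requires.\<close>
  define v where "v i = vs ! (THE r. r < ?k \<and> ?s ! r = i)" for i
  have v: "v (?s ! r) = vs ! r" if "r < ?k" for r
  proof -
    have "(THE r'. r' < ?k \<and> ?s ! r' = ?s ! r) = r"
      using that ls nth_eq_iff_index_eq[OF ls(3)] by (intro the_equality) auto
    then show ?thesis by (simp add: v_def)
  qed
  have vs_eq: "vs = map v ?s" using vs v ls by (intro nth_equalityI) (auto simp: tuples_def)
  have vin: "v i \<in> sub K" if "i \<in> K" for i
  proof -
    have "v i \<in> set vs" using vs_eq ls that by auto
    then show ?thesis using vs by (auto simp: tuples_def)
  qed
  define A where "A y x = f y [v x]" for y x
  have orth: "(\<Sum>y\<in>K. A y x * A y z) = (if x = z then 1 else 0)" if "x \<in> K" "z \<in> K" for x z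
  proof -
    have "x \<in> set ?s" "z \<in> set ?s" using that fK by simp_all
    then obtain r r' where r: "r < ?k" "?s ! r = x" "r' < ?k" "?s ! r' = z"
      using ls(1) unfolding in_set_conv_nth by auto
    have "(\<Sum>y\<in>K. A y x * A y z) = (\<Sum>y\<in>{1..7}. A y x * A y z)"
      using K vin[OF that(1)] by (intro sum.mono_neutral_left) (auto simp: A_def sub_def)
    also have "\<dots> = coframe_metric f (vs ! r) (vs ! r')"
      using v[OF r(1)] v[OF r(3)] r by (simp add: coframe_metric_def A_def)
    also have "\<dots> = (if r = r' then 1 else 0)"
      using on r vs unfolding orthonormal_list_def by (simp add: tuples_def)
    also have "\<dots> = (if x = z then 1 else 0)"
      using r nth_eq_iff_index_eq[OF ls(3)] ls(1) by auto
    finally show ?thesis .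
  qed
  have m: "multilin_on V ?k (coframe_wedge f ?s)"
    using multilin_coframe_wedge[of ?s] K ls by simp
  have "vs \<in> tuples V ?k" using vs by (auto simp: tuples_def sub_def)
  from multilin_on_expand[OF m this]
  have "coframe_wedge f ?s vs = (\<Sum>is\<in>tuples {1..7} ?k. pr (\<lambda>i v. f i [v]) is vs * coframe_wedge f ?s (map F is))" .
  also have "\<dots> = (\<Sum>is\<in>tuples {1..7} ?k. pr A is ?s * cw ?s is)"
  proof (intro sum.cong refl arg_cong2[where f = "(*)"])
    fix "is" :: "nat list" assume i: "is \<in> tuples {1..7} ?k"
    then show "coframe_wedge f ?s (map F is) = cw ?s is"
      by (intro coframe_wedge_comp i) (use K ls in simp_all)
    show "pr (\<lambda>i v. f i [v]) is vs = pr A is ?s"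
      unfolding vs_eq pr_map_right A_def[abs_def] ..
  qed
  also have "\<dots> = (\<Sum>is\<in>tuples K ?k. pr A is ?s * cw ?s is)"
  proof (rule sum.mono_neutral_right)
    show "tuples K ?k \<subseteq> tuples {1..7} ?k" using K by (auto simp: tuples_def)
    show "\<forall>is\<in>tuples {1..7} ?k - tuples K ?k. pr A is ?s * cw ?s is = 0"
    proof
      fix "is" :: "nat list" assume i: "is \<in> tuples {1..7} ?k - tuples K ?k"
      have "sort is \<noteq> ?s"
      proof
        assume "sort is = ?s"
        then have "set is = K" using ls(2) by (metis set_sort)
        then show False using i by (simp add: tuples_def)
      qed
      then show "pr A is ?s * cw ?s is = 0" by (simp add: cw_def)
    qed
  qed simp
  also have "\<dots> = (\<Sum>is\<in>tuples K ?k. eps is * pr A is ?s)"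
  proof (intro sum.cong refl)
    fix "is" assume i: "is \<in> tuples K ?k"
    have "sort is = ?s" if "distinct is"
    proof -
      have "set is = K" using that i by (intro card_subset_eq[OF fK]) (auto simp: tuples_def distinct_card)
      then have "?s = sort (remdups is)" using sorted_list_of_set_sort_remdups[of "is"] by simp
      then show ?thesis using that by (simp only: distinct_remdups_id)
    qed
    then show "pr A is ?s * cw ?s is = eps is * pr A is ?s"
      by (cases "distinct is") (auto simp: cw_def eps_not_distinct)
  qed
  finally have "(coframe_wedge f ?s vs)\<^sup>2 = 1" using eps_orthogonal'[OF fK orth] by simp
  then show ?thesis by (simp add: power2_eq_1_iff abs_if) linarith
qed

end

lemma alternating_on_mono:
  assumes "alternating_on V k \<omega>" "W \<subseteq> V"
  shows "alternating_on W k \<omega>"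
proof -
  have "tuples W k \<subseteq> tuples V k" using assms(2) by (auto simp: tuples_def)
  with assms show ?thesis unfolding alternating_on_def by (intro conjI ballI allI impI) (simp_all add: subset_iff)
qed

section \<open>Volumes\<close>

text \<open>The map lives on the whole space, so that derivatives at the boundary of the box are
  ordinary ones and all velocities are tangent to \<open>S\<close>. One point with injective
  derivative suffices to make the volume positive.\<close>

definition good_param :: "(real^'k::finite \<Rightarrow> 'b::real_normed_vector) \<Rightarrow> (real^'k \<Rightarrow> real^'k \<Rightarrow> 'b) \<Rightarrow>
    real^'k \<Rightarrow> real^'k \<Rightarrow> 'b set \<Rightarrow> bool" where
  "good_param F F' l u S \<longleftrightarrow>
     (\<forall>x. (F has_derivative F' x) (at x)) \<and> (\<forall>h. continuous_on UNIV (\<lambda>x. F' x h)) \<and>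
     (\<forall>x. F x \<in> S) \<and> F ` cbox l u = S \<and> inj_on F (box l u) \<and> box l u \<noteq> {} \<and>
     (\<exists>x\<in>cbox l u. \<forall>h. F' x h = 0 \<longrightarrow> h = 0)"

lemma good_param_tangent:
  assumes "good_param F F' l u S"
  shows "F' x h \<in> tangent_space S (F x)"
proof -
  have d: "(F has_derivative F' x) (at x)" and S: "\<forall>x. F x \<in> S" using assms by (auto simp: good_param_def)
  have "((\<lambda>s. F (x + s *\<^sub>R h)) has_derivative (\<lambda>t. F' x (t *\<^sub>R h))) (at 0)"
  proof (rule has_derivative_compose[of "\<lambda>s. x + s *\<^sub>R h" "\<lambda>t. t *\<^sub>R h" 0 UNIV F "F' x"])
    show "((\<lambda>s. x + s *\<^sub>R h) has_derivative (\<lambda>t. t *\<^sub>R h)) (at 0)" by (auto intro!: derivative_eq_intros)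
  qed (use d in simp)
  then have "((\<lambda>s. F (x + s *\<^sub>R h)) has_vector_derivative F' x h) (at 0)"
    using has_derivative_linear[OF d] by (simp add: has_vector_derivative_def linear_scale)
  then show ?thesis using S by (auto simp: tangent_space_def intro!: exI[of _ "\<lambda>s. F (x + s *\<^sub>R h)"])
qed

context lie_frame
begin

text \<open>\<open>e i\<close> is controlled only on tangent vectors. A linear extension to the
  ambient Euclidean space is continuous, which yields continuity of the integrand in
  \<open>riemannian_volume\<close>.\<close>

lemma e_linear_extension:
  assumes i: "i \<in> {1..7}"
  obtains L :: "'a \<Rightarrow> real" where "linear L" "\<And>v. v \<in> T \<one>\<^bsub>G\<^esub> \<Longrightarrow> L v = e i \<one>\<^bsub>G\<^esub> [v]"
proof -
  interpret coframed "T \<one>\<^bsub>G\<^esub>" "\<lambda>i. e i \<one>\<^bsub>G\<^esub>" using coframed_at by simp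
  obtain B where B: "B \<subseteq> T \<one>\<^bsub>G\<^esub>" "independent B" "T \<one>\<^bsub>G\<^esub> \<subseteq> span B" "card B = dim (T \<one>\<^bsub>G\<^esub>)"
    using basis_exists by blast
  obtain L :: "'a \<Rightarrow> real" where L: "linear L" "\<forall>x\<in>B. L x = e i \<one>\<^bsub>G\<^esub> [x]"
    using linear_independent_extend[OF B(2), of "\<lambda>x. e i \<one>\<^bsub>G\<^esub> [x]"] by blast
  let ?W = "{v \<in> T \<one>\<^bsub>G\<^esub>. L v = e i \<one>\<^bsub>G\<^esub> [v]}"
  have "subspace ?W"
  proof (rule subspaceI)
    show "0 \<in> ?W" using subspace_0[OF subspace] zero[OF i] linear_0[OF L(1)] by simp
    show "x + y \<in> ?W" if "x \<in> ?W" "y \<in> ?W" for x y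
      using that linear[OF i, of x y 1 1] linear_add[OF L(1)] subspace_add[OF subspace] by simp
    show "r *\<^sub>R x \<in> ?W" if "x \<in> ?W" for r x
      using that linear[OF i, of x x r 0] linear_scale[OF L(1)] subspace_scale[OF subspace] by simp
  qed
  moreover have "B \<subseteq> ?W" using B(1) L(2) by blast
  ultimately have "span B \<subseteq> ?W" by (rule span_minimal[rotated])
  then show ?thesis using that[OF L(1)] B(3) by blast
qed

text \<open>Let \<open>A\<close> hold the coordinates of the partial derivatives. The Gram matrix is
  \<open>r\<close> times A transposed times A, so the root of its determinant is r^(n/2) |det A| in
  dimension n. The integral V of |det A| therefore serves all translations \<open>q\<close>, metrics
  \<open>g\<close> and factors \<open>r\<close>; it is positive because det A is nonzero at one
  point.\<close>

lemma riemannian_volume: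
  fixes F :: "real^'k::finite \<Rightarrow> 'a"
  assumes P: "good_param F F' l u S" and S: "S \<subseteq> carrier G"
    and K: "K \<subseteq> {1..7}" "card K = CARD('k)"
    and vanish: "\<And>x h i. i \<in> {1..7} - K \<Longrightarrow> e i (F x) [F' x h] = 0"
  shows "\<exists>V>0. \<forall>q\<in>carrier G. \<forall>g r. r > 0 \<and>
     (\<forall>x h h'. g (q \<otimes>\<^bsub>G\<^esub> F x) (q \<otimes>\<^bsub>G\<^esub> F' x h) (q \<otimes>\<^bsub>G\<^esub> F' x h') = r * (\<Sum>i\<in>K. e i (F x) [F' x h] * e i (F x) [F' x h'])) \<longrightarrow>
     has_riemannian_volume TYPE('k) ((\<lambda>p. q \<otimes>\<^bsub>G\<^esub> p) ` S) g (sqrt (r ^ CARD('k)) * V)"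
proof -
  have d: "\<And>x. (F has_derivative F' x) (at x)" and c: "\<And>h. continuous_on UNIV (\<lambda>x. F' x h)"
    and FS: "\<And>x. F x \<in> S" and im: "F ` cbox l u = S" and inj: "inj_on F (box l u)" and ne: "box l u \<noteq> {}"
    using P by (auto simp: good_param_def)
  obtain x0 where x0: "x0 \<in> cbox l u" "\<And>h. F' x0 h = 0 \<Longrightarrow> h = 0" using P by (auto simp: good_param_def)
  have FG: "F x \<in> carrier G" for x using FS S by blast
  have FT: "F' x h \<in> T (F x)" for x h
  proof -
    have "tangent_space S (F x) \<subseteq> T (F x)" using S unfolding tangent_space_def by blast
    then show ?thesis using good_param_tangent[OF P] by blast
  qed
  obtain b :: "'k \<Rightarrow> nat" where b: "bij_betw b UNIV K"
    using finite_same_card_bij[OF finite_class.finite_UNIV finite_subset[OF K(1) finite_atLeastAtMost] K(2)[symmetric]] by blast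
  then have bK: "b k \<in> K" for k by (auto simp: bij_betw_def)
  define A :: "real^'k \<Rightarrow> real^'k^'k" where "A x = (\<chi> k j. e (b k) (F x) [F' x (axis j 1)])" for x
  have contA: "continuous_on UNIV (\<lambda>x. A x $ k $ j)" for k j
  proof -
    obtain L :: "'a \<Rightarrow> real" where L: "linear L" "\<And>v. v \<in> T \<one>\<^bsub>G\<^esub> \<Longrightarrow> L v = e (b k) \<one>\<^bsub>G\<^esub> [v]"
      using e_linear_extension[of "b k"] bK[of k] K(1) by blast
    \<comment> \<open>The covectors are moved to the identity by left-invariance and
      \<open>J\<close> replaces the inverse, so that only continuous maps remain.\<close>
    have "A x $ k $ j = L (J (F x) \<otimes>\<^bsub>G\<^esub> F' x (axis j 1))" for x
    proof -
      have "e (b k) (inv\<^bsub>G\<^esub> F x \<otimes>\<^bsub>G\<^esub> F x) [inv\<^bsub>G\<^esub> F x \<otimes>\<^bsub>G\<^esub> F' x (axis j 1)] = e (b k) (F x) [F' x (axis j 1)]"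
        using bK[of k] K(1) FG[of x] FT by (intro e_left) auto
      then have "e (b k) \<one>\<^bsub>G\<^esub> [inv\<^bsub>G\<^esub> F x \<otimes>\<^bsub>G\<^esub> F' x (axis j 1)] = e (b k) (F x) [F' x (axis j 1)]"
        by (simp only: group.l_inv[OF group FG])
      then have "L (inv\<^bsub>G\<^esub> F x \<otimes>\<^bsub>G\<^esub> F' x (axis j 1)) = e (b k) (F x) [F' x (axis j 1)]"
        using L(2)[OF tangent_inv[OF FG FT]] by (rule trans[rotated])
      then show ?thesis unfolding inv_J[OF FG] by (simp add: A_def)
    qed
    moreover have "continuous_on UNIV (\<lambda>x. L (J (F x) \<otimes>\<^bsub>G\<^esub> F' x (axis j 1)))"
    proof -
      have F: "continuous_on UNIV F" using d has_derivative_continuous_on by blast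
      have "continuous_on UNIV (\<lambda>x. J (F x))"
        by (rule bounded_linear.continuous_on[OF linear_conv_bounded_linear[THEN iffD1, OF linear_J] F])
      from bounded_bilinear.continuous_on[OF bilinear this c]
      show ?thesis
        by (rule bounded_linear.continuous_on[OF linear_conv_bounded_linear[THEN iffD1, OF L(1)]])
    qed
    ultimately show ?thesis by simp
  qed
  have contD: "continuous_on UNIV (\<lambda>x. \<bar>det (A x)\<bar>)"
    unfolding det_def by (intro continuous_intros contA)
  \<comment> \<open>A vector in the kernel of \<open>A x0\<close> has an image under
    \<open>F' x0\<close> that is annihilated by the covectors in \<open>K\<close> and, through
    \<open>vanish\<close>, by the others; so the image is 0, and the vector too.\<close>
  have "det (A x0) \<noteq> 0"
  proof -
    have "y = 0" if "A x0 *v y = 0" for y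
    proof -
      have y: "F' x0 y = (\<Sum>j\<in>UNIV. y $ j *\<^sub>R F' x0 (axis j 1))"
      proof -
        have "(\<Sum>j\<in>UNIV. y $ j *\<^sub>R axis j 1) = y" using basis_expansion[of y] by (simp only: scalar_mult_eq_scaleR)
        then have "F' x0 y = F' x0 (\<Sum>j\<in>UNIV. y $ j *\<^sub>R axis j 1)" by (rule arg_cong[OF sym])
        then show ?thesis using has_derivative_linear[OF d[of x0]] by (simp add: linear_sum linear_scale)
      qed
      interpret coframed "T (F x0)" "\<lambda>i. e i (F x0)" using coframed_at FG by blast
      have K0: "e (b k) (F x0) [F' x0 y] = 0" for k
      proof -
        have "e (b k) (F x0) [F' x0 y] = (\<Sum>j\<in>UNIV. y $ j * e (b k) (F x0) [F' x0 (axis j 1)])"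
          unfolding y by (rule linear_sum) (use bK[of k] K(1) FT[of x0] in auto)
        also have "\<dots> = (A x0 *v y) $ k" by (simp add: matrix_vector_mult_def A_def mult.commute)
        finally show ?thesis using that by simp
      qed
      have "e i (F x0) [F' x0 y] = 0" if "i \<in> {1..7}" for i
      proof (cases "i \<in> K")
        case True
        then obtain k where "i = b k" using b by (auto simp: bij_betw_def)
        then show ?thesis using K0 by simp
      qed (use vanish that in blast)
      then have "F' x0 y = 0" by (intro eqI FT subspace_0[OF subspace]) (simp add: zero)
      then show ?thesis by (rule x0(2))
    qed
    then have "\<exists>B. B ** A x0 = mat 1" unfolding matrix_left_invertible_ker by simp
    then obtain B where "B ** A x0 = mat 1" ..
    then have "det B * det (A x0) = 1" unfolding det_mul[symmetric] by simp
    then show ?thesis by auto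
  qed
  define V where "V = integral (cbox l u) (\<lambda>x. \<bar>det (A x)\<bar>)"
  have int: "(\<lambda>x. \<bar>det (A x)\<bar>) integrable_on cbox l u"
    by (rule integrable_continuous[OF continuous_on_subset[OF contD]]) simp
  have "V \<noteq> 0"
  proof
    assume "V = 0"
    then have "\<forall>x\<in>cbox l u. \<bar>det (A x)\<bar> = 0"
      unfolding V_def using integral_cbox_eq_0_iff[OF continuous_on_subset[OF contD subset_UNIV] ne] by simp
    then show False using x0(1) \<open>det (A x0) \<noteq> 0\<close> by simp
  qed
  moreover have "V \<ge> 0" unfolding V_def by (intro integral_nonneg int) simp
  ultimately have "V > 0" by simp
  moreover have "has_riemannian_volume TYPE('k) ((\<lambda>p. q \<otimes>\<^bsub>G\<^esub> p) ` S) g (sqrt (r ^ CARD('k)) * V)"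
    if q: "q \<in> carrier G" and r: "r > 0"
      and g: "\<forall>x h h'. g (q \<otimes>\<^bsub>G\<^esub> F x) (q \<otimes>\<^bsub>G\<^esub> F' x h) (q \<otimes>\<^bsub>G\<^esub> F' x h') = r * (\<Sum>i\<in>K. e i (F x) [F' x h] * e i (F x) [F' x h'])" for q g r
    unfolding has_riemannian_volume_def
  proof (intro exI conjI ballI allI)
    show "open (UNIV :: (real^'k) set)" "cbox l u \<subseteq> UNIV" "cbox l u \<in> sets lebesgue" by simp_all
    have bl: "bounded_linear (\<lambda>x. q \<otimes>\<^bsub>G\<^esub> x)" by (rule bounded_bilinear.bounded_linear_right[OF bilinear])
    show "((\<lambda>x. q \<otimes>\<^bsub>G\<^esub> F x) has_derivative (\<lambda>h. q \<otimes>\<^bsub>G\<^esub> F' x h)) (at x)" for x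
      by (rule bounded_linear.has_derivative[OF bl d])
    show "continuous_on UNIV (\<lambda>x. q \<otimes>\<^bsub>G\<^esub> F' x h)" for h
      by (rule bounded_linear.continuous_on[OF bl c])
    show "(\<lambda>x. q \<otimes>\<^bsub>G\<^esub> F x) ` cbox l u = (\<lambda>p. q \<otimes>\<^bsub>G\<^esub> p) ` S" unfolding im[symmetric] image_image ..
    show "negligible (cbox l u - box l u)" by (rule negligible_frontier_interval)
    show "inj_on (\<lambda>x. q \<otimes>\<^bsub>G\<^esub> F x) (cbox l u - (cbox l u - box l u))"
    proof (rule inj_onI)
      fix x y assume xy: "x \<in> cbox l u - (cbox l u - box l u)" "y \<in> cbox l u - (cbox l u - box l u)" "q \<otimes>\<^bsub>G\<^esub> F x = q \<otimes>\<^bsub>G\<^esub> F y"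
      then have "inv\<^bsub>G\<^esub> q \<otimes>\<^bsub>G\<^esub> (q \<otimes>\<^bsub>G\<^esub> F x) = inv\<^bsub>G\<^esub> q \<otimes>\<^bsub>G\<^esub> (q \<otimes>\<^bsub>G\<^esub> F y)" by simp
      then have "F x = F y" unfolding cancel(1)[OF q] .
      then show "x = y" using inj xy by (auto dest: inj_onD)
    qed
    have "sqrt (det (\<chi> i j. g (q \<otimes>\<^bsub>G\<^esub> F x) (q \<otimes>\<^bsub>G\<^esub> F' x (axis i 1)) (q \<otimes>\<^bsub>G\<^esub> F' x (axis j 1)))) = sqrt (r ^ CARD('k)) * \<bar>det (A x)\<bar>" for x
    proof -
      have "(\<Sum>i\<in>K. e i (F x) [F' x h] * e i (F x) [F' x h']) = (\<Sum>k\<in>UNIV. e (b k) (F x) [F' x h] * e (b k) (F x) [F' x h'])" for h h'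
        using sum.reindex_bij_betw[OF b, of "\<lambda>i. e i (F x) [F' x h] * e i (F x) [F' x h']"] by simp
      then have "(\<chi> i j. g (q \<otimes>\<^bsub>G\<^esub> F x) (q \<otimes>\<^bsub>G\<^esub> F' x (axis i 1)) (q \<otimes>\<^bsub>G\<^esub> F' x (axis j 1))) = (\<chi> i. r *s (transpose (A x) ** A x) $ i)"
        using g by (simp add: vec_eq_iff matrix_matrix_mult_def transpose_def A_def)
      then have "det (\<chi> i j. g (q \<otimes>\<^bsub>G\<^esub> F x) (q \<otimes>\<^bsub>G\<^esub> F' x (axis i 1)) (q \<otimes>\<^bsub>G\<^esub> F' x (axis j 1))) = r ^ CARD('k) * (det (A x))\<^sup>2"
        using det_rows_mul[of "\<lambda>_. r" "\<lambda>i. (transpose (A x) ** A x) $ i"]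
        by (simp add: det_mul power2_eq_square)
      then show ?thesis by (simp add: real_sqrt_mult)
    qed
    then show "((\<lambda>x. sqrt (det (\<chi> i j. g (q \<otimes>\<^bsub>G\<^esub> F x) (q \<otimes>\<^bsub>G\<^esub> F' x (axis i 1)) (q \<otimes>\<^bsub>G\<^esub> F' x (axis j 1))))) has_integral sqrt (r ^ CARD('k)) * V) (cbox l u)"
      using has_integral_mult_right[OF integrable_integral[OF int], of "sqrt (r ^ CARD('k))"] by (simp add: V_def)
  qed
  ultimately show ?thesis by blast
qed

end

section \<open>Parametrisations of the factors\<close>

lemma cis_nth_derivative:
  "((\<lambda>u::real^'n::finite. cis (u $ i)) has_derivative (\<lambda>h. h $ i *\<^sub>R (\<i> * cis (x $ i)))) (at x)"
proof -
  have "((\<lambda>t. Complex (cos t) (sin t)) has_vector_derivative Complex (- sin (x $ i)) (cos (x $ i))) (at (x $ i))"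
    unfolding has_vector_derivative_complex_iff by (auto intro!: derivative_eq_intros)
  moreover have "Complex (- sin (x $ i)) (cos (x $ i)) = \<i> * cis (x $ i)" by (simp add: complex_eq_iff)
  ultimately have "(cis has_derivative (\<lambda>h. h *\<^sub>R (\<i> * cis (x $ i)))) (at (x $ i))"
    by (simp add: has_vector_derivative_def cis.ctr[abs_def])
  from has_derivative_compose[OF bounded_linear_imp_has_derivative[OF bounded_linear_vec_nth[of i]] this]
  show ?thesis .
qed

lemma cis_nth_continuous: "continuous_on S (\<lambda>u::real^'n::finite. cis (u $ i))"
  by (rule has_derivative_continuous_on[OF has_derivative_at_withinI[OF cis_nth_derivative]])

lemma bounded_linear_quat: "bounded_linear (\<lambda>p. quat (fst p) (snd p))"
  unfolding linear_conv_bounded_linear[symmetric] by (intro linearI) (simp_all add: quat_lin)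

text \<open>Hopf coordinates on the 3-sphere: the angle \<open>u $ i\<close> distributes the norm
  between the two complex coordinates, and \<open>u $ j\<close>, \<open>u $ k\<close> are their
  phases. The indices are parameters because the map is used in dimensions 3 and 4.\<close>

definition hopf :: "real^'n::finite \<Rightarrow> 'n \<Rightarrow> 'n \<Rightarrow> 'n \<Rightarrow> complex^2^2" where
  "hopf u i j k = quat (cos (u $ i) *\<^sub>R cis (u $ j)) (sin (u $ i) *\<^sub>R cis (u $ k))"

definition hopf' :: "real^'n::finite \<Rightarrow> real^'n \<Rightarrow> 'n \<Rightarrow> 'n \<Rightarrow> 'n \<Rightarrow> complex^2^2" where
  "hopf' u h i j k = quat (cos (u $ i) *\<^sub>R (h $ j *\<^sub>R (\<i> * cis (u $ j))) + (- sin (u $ i) * h $ i) *\<^sub>R cis (u $ j))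
     (sin (u $ i) *\<^sub>R (h $ k *\<^sub>R (\<i> * cis (u $ k))) + (cos (u $ i) * h $ i) *\<^sub>R cis (u $ k))"

lemma hopf_derivative: "((\<lambda>u. hopf u i j k) has_derivative (\<lambda>h. hopf' x h i j k)) (at x)"
proof -
  note nth = bounded_linear_imp_has_derivative[OF bounded_linear_vec_nth[of i]]
  have c: "((\<lambda>u. cos (u $ i)) has_derivative (\<lambda>h. - sin (x $ i) * h $ i)) (at x)"
    by (rule has_derivative_compose[OF nth DERIV_cos[unfolded has_field_derivative_def]])
  have s: "((\<lambda>u. sin (u $ i)) has_derivative (\<lambda>h. cos (x $ i) * h $ i)) (at x)"
    by (rule has_derivative_compose[OF nth DERIV_sin[unfolded has_field_derivative_def]])
  have "((\<lambda>u. (cos (u $ i) *\<^sub>R cis (u $ j), sin (u $ i) *\<^sub>R cis (u $ k))) has_derivative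
     (\<lambda>h. (cos (x $ i) *\<^sub>R (h $ j *\<^sub>R (\<i> * cis (x $ j))) + (- sin (x $ i) * h $ i) *\<^sub>R cis (x $ j),
       sin (x $ i) *\<^sub>R (h $ k *\<^sub>R (\<i> * cis (x $ k))) + (cos (x $ i) * h $ i) *\<^sub>R cis (x $ k)))) (at x)"
    by (intro has_derivative_Pair has_derivative_scaleR c s cis_nth_derivative)
  from bounded_linear.has_derivative[OF bounded_linear_quat this]
  show ?thesis by (simp only: hopf_def hopf'_def fst_conv snd_conv)
qed

lemma hopf'_continuous: "continuous_on S (\<lambda>x. hopf' x h i j k)"
proof -
  have "continuous_on S (\<lambda>u. (cos (u $ i) *\<^sub>R (h $ j *\<^sub>R (\<i> * cis (u $ j))) + (- sin (u $ i) * h $ i) *\<^sub>R cis (u $ j),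
       sin (u $ i) *\<^sub>R (h $ k *\<^sub>R (\<i> * cis (u $ k))) + (cos (u $ i) * h $ i) *\<^sub>R cis (u $ k)))"
    by (intro continuous_on_Pair continuous_on_add continuous_on_scaleR continuous_on_mult continuous_on_const
        continuous_on_minus continuous_on_cos continuous_on_sin continuous_on_component continuous_on_id cis_nth_continuous)
  from bounded_linear.continuous_on[OF bounded_linear_quat this]
  show ?thesis by (simp only: hopf'_def fst_conv snd_conv)
qed

lemma hopf_in: "hopf u i j k \<in> carrier SU2"
  unfolding hopf_def by (rule quat_in_SU2) (simp add: power_mult_distrib)

lemma cis_inj:
  assumes "cis x = cis y" "0 < x" "x < 2 * pi" "0 < y" "y < 2 * pi"
  shows "x = y"
proof -
  have "Arg2pi (cis z) = z" if "0 < z" "z < 2 * pi" for z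
    by (rule Arg2pi_unique[of 1]) (use that in \<open>simp_all add: cis_conv_exp\<close>)
  then show ?thesis using assms by metis
qed

lemma cis_surj:
  obtains t where "0 \<le> t" "t \<le> 2 * pi" "z = norm z *\<^sub>R cis t"
proof
  show "0 \<le> Arg2pi z" by (rule Arg2pi_ge_0)
  show "Arg2pi z \<le> 2 * pi" using Arg2pi_lt_2pi[of z] by simp
  show "z = norm z *\<^sub>R cis (Arg2pi z)"
    using Arg2pi_eq[of z] by (simp add: cis_conv_exp scaleR_conv_of_real)
qed

lemma hopf_inj:
  assumes "hopf u i j k = hopf v i j k"
    and "0 < u $ i" "u $ i < pi / 2" "0 < v $ i" "v $ i < pi / 2"
    and "0 < u $ j" "u $ j < 2 * pi" "0 < v $ j" "v $ j < 2 * pi"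
    and "0 < u $ k" "u $ k < 2 * pi" "0 < v $ k" "v $ k < 2 * pi"
  shows "u $ i = v $ i" "u $ j = v $ j" "u $ k = v $ k"
proof -
  have a: "cos (u $ i) *\<^sub>R cis (u $ j) = cos (v $ i) *\<^sub>R cis (v $ j)" and b: "sin (u $ i) *\<^sub>R cis (u $ k) = sin (v $ i) *\<^sub>R cis (v $ k)"
    using arg_cong[OF assms(1), of "\<lambda>A. A $ 1 $ 1"] arg_cong[OF assms(1), of "\<lambda>A. A $ 1 $ 2"]
    by (simp_all only: hopf_def quat_nth)
  have pos: "cos (u $ i) > 0" "cos (v $ i) > 0" "sin (u $ i) > 0" "sin (v $ i) > 0"
    using assms by (auto intro!: cos_gt_zero_pi sin_gt_zero)
  have c: "cos (u $ i) = cos (v $ i)" using arg_cong[OF a, of norm] pos by simp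
  show i: "u $ i = v $ i" by (rule cos_inj_pi[OF _ _ _ _ c]) (use assms(2-5) pi_gt_zero in linarith)+
  have "cis (u $ j) = cis (v $ j)" using a pos(2) unfolding i by simp
  then show "u $ j = v $ j" by (rule cis_inj[OF _ assms(6-9)])
  have "cis (u $ k) = cis (v $ k)" using b pos(4) unfolding i by simp
  then show "u $ k = v $ k" by (rule cis_inj[OF _ assms(10-13)])
qed

lemma hopf_surj:
  assumes "A \<in> carrier SU2"
  obtains t1 t2 t3 where "0 \<le> t1" "t1 \<le> pi / 2" "0 \<le> t2" "t2 \<le> 2 * pi" "0 \<le> t3" "t3 \<le> 2 * pi"
    "A = quat (cos t1 *\<^sub>R cis t2) (sin t1 *\<^sub>R cis t3)"
proof -
  obtain a b where A: "A = quat a b" "(cmod a)\<^sup>2 + (cmod b)\<^sup>2 = 1" using assms by (auto simp: carrier_SU2)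
  have "(cmod a)\<^sup>2 \<le> 1" using A(2) zero_le_power2[of "cmod b"] by linarith
  then have a1: "cmod a \<le> 1" by (simp add: power_le_one_iff)
  have c: "cos (arccos (cmod a)) = cmod a" using a1 by (intro cos_arccos) (auto intro: order_trans[OF _ norm_ge_zero])
  have "sin (arccos (cmod a)) = sqrt (1 - (cmod a)\<^sup>2)"
    using a1 by (intro sin_arccos) (auto intro: order_trans[OF _ norm_ge_zero])
  also have "1 - (cmod a)\<^sup>2 = (cmod b)\<^sup>2" using A(2) by simp
  finally have s: "sin (arccos (cmod a)) = cmod b" by simp
  obtain t2 where t2: "0 \<le> t2" "t2 \<le> 2 * pi" "a = norm a *\<^sub>R cis t2" by (rule cis_surj)
  obtain t3 where t3: "0 \<le> t3" "t3 \<le> 2 * pi" "b = norm b *\<^sub>R cis t3" by (rule cis_surj)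
  have "0 \<le> arccos (cmod a)" using a1 by (intro arccos_lbound) (auto intro: order_trans[OF _ norm_ge_zero])
  moreover have "arccos (cmod a) \<le> pi / 2" using a1 by (intro arccos_le_pi2) auto
  moreover have "A = quat (cos (arccos (cmod a)) *\<^sub>R cis t2) (sin (arccos (cmod a)) *\<^sub>R cis t3)"
    unfolding c s A(1) using t2(3) t3(3) by simp
  ultimately show ?thesis using that t2 t3 by blast
qed

text \<open>At the angle pi/4 sine and cosine are both nonzero, so neither phase degenerates; this
  supplies the point with injective derivative required by \<open>good_param\<close>.\<close>

lemma hopf'_inj:
  assumes "hopf' x h i j k = 0" "x $ i = pi / 4" "x $ j = 0" "x $ k = 0"
  shows "h $ i = 0" "h $ j = 0" "h $ k = 0"
proof -
  have "cos (x $ i) *\<^sub>R (h $ j *\<^sub>R (\<i> * cis (x $ j))) + (- sin (x $ i) * h $ i) *\<^sub>R cis (x $ j) = 0"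
    "sin (x $ i) *\<^sub>R (h $ k *\<^sub>R (\<i> * cis (x $ k))) + (cos (x $ i) * h $ i) *\<^sub>R cis (x $ k) = 0"
    using arg_cong[OF assms(1), of "\<lambda>A. A $ 1 $ 1"] arg_cong[OF assms(1), of "\<lambda>A. A $ 1 $ 2"]
    by (simp_all only: hopf'_def quat_nth zero_index)
  then show "h $ i = 0" "h $ j = 0" "h $ k = 0"
    using assms(2-) by (simp_all add: complex_eq_iff cos_45 sin_45)
qed

lemma ex_vec3: "\<exists>x::real^3. x $ 1 = a \<and> x $ 2 = b \<and> x $ 3 = c"
  by (rule exI[of _ "\<chi> i. if i = 1 then a else if i = 2 then b else c"]) simp

lemma ex_vec4: "\<exists>x::real^4. x $ 1 = a \<and> x $ 2 = b \<and> x $ 3 = c \<and> x $ 4 = d"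
  by (rule exI[of _ "\<chi> i. if i = 1 then a else if i = 2 then b else if i = 3 then c else d"]) simp

lemma good_paramI:
  assumes "\<And>x. (F has_derivative F' x) (at x)" "\<And>h. continuous_on UNIV (\<lambda>x. F' x h)" "\<And>x. F x \<in> S"
    "\<And>y. y \<in> S \<Longrightarrow> \<exists>x\<in>cbox l u. F x = y"
    "\<And>x y. x \<in> box l u \<Longrightarrow> y \<in> box l u \<Longrightarrow> F x = F y \<Longrightarrow> x = y" "\<And>i. l $ i < u $ i"
    "x0 \<in> cbox l u" "\<And>h. F' x0 h = 0 \<Longrightarrow> h = 0"
  shows "good_param F F' l u S"
proof -
  have "box l u \<noteq> {}" unfolding interval_ne_empty_cart using assms(6) by blast
  moreover have "F ` cbox l u = S" using assms(3,4) by (auto simp: image_iff)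
  ultimately show ?thesis
    unfolding good_param_def using assms(1-3,7,8) by (auto intro!: inj_onI assms(5))
qed

lemma ex_good_param_torus:
  "\<exists>(F :: real^3 \<Rightarrow> complex \<times> complex \<times> complex) F' l u. good_param F F' l u (carrier (U1 \<times>\<times> (U1 \<times>\<times> U1)))"
proof -
  obtain u :: "real^3" where u: "u $ 1 = 2 * pi" "u $ 2 = 2 * pi" "u $ 3 = 2 * pi" using ex_vec3 by blast
  have "good_param (\<lambda>x. (cis (x $ 1), cis (x $ 2), cis (x $ 3)))
     (\<lambda>x h. (h $ 1 *\<^sub>R (\<i> * cis (x $ 1)), h $ 2 *\<^sub>R (\<i> * cis (x $ 2)), h $ 3 *\<^sub>R (\<i> * cis (x $ 3)))) 0 u
     (carrier (U1 \<times>\<times> (U1 \<times>\<times> U1)))"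
  proof (rule good_paramI)
    show "((\<lambda>x. (cis (x $ 1), cis (x $ 2), cis (x $ 3))) has_derivative (\<lambda>h. (h $ 1 *\<^sub>R (\<i> * cis (x $ 1)), h $ 2 *\<^sub>R (\<i> * cis (x $ 2)), h $ 3 *\<^sub>R (\<i> * cis (x $ 3))))) (at x)"
      for x :: "real^3"
      by (intro has_derivative_Pair cis_nth_derivative)
    show "continuous_on UNIV (\<lambda>x::real^3. (h $ 1 *\<^sub>R (\<i> * cis (x $ 1)), h $ 2 *\<^sub>R (\<i> * cis (x $ 2)), h $ 3 *\<^sub>R (\<i> * cis (x $ 3))))"
      for h :: "real^3"
      by (intro continuous_on_Pair continuous_on_scaleR continuous_on_mult continuous_on_const cis_nth_continuous)
    show "(cis (x $ 1), cis (x $ 2), cis (x $ 3)) \<in> carrier (U1 \<times>\<times> (U1 \<times>\<times> U1))" for x :: "real^3"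
      by (simp add: DirProd_def U1_def)
    show "\<exists>x\<in>cbox 0 u. (cis (x $ 1), cis (x $ 2), cis (x $ 3)) = y" if y: "y \<in> carrier (U1 \<times>\<times> (U1 \<times>\<times> U1))" for y
    proof -
      obtain a b c where y: "y = (a, b, c)" "norm a = 1" "norm b = 1" "norm c = 1"
        using y by (auto simp: DirProd_def U1_def)
      obtain t1 where 1: "0 \<le> t1" "t1 \<le> 2 * pi" "a = norm a *\<^sub>R cis t1" by (rule cis_surj)
      obtain t2 where 2: "0 \<le> t2" "t2 \<le> 2 * pi" "b = norm b *\<^sub>R cis t2" by (rule cis_surj)
      obtain t3 where 3: "0 \<le> t3" "t3 \<le> 2 * pi" "c = norm c *\<^sub>R cis t3" by (rule cis_surj)
      obtain x :: "real^3" where "x $ 1 = t1 \<and> x $ 2 = t2 \<and> x $ 3 = t3" using ex_vec3 by blast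
      then show ?thesis using 1 2 3 y u by (intro bexI[of _ x]) (simp_all add: mem_box_cart forall_3)
    qed
    show "x = z" if "x \<in> box 0 u" "z \<in> box 0 u" "(cis (x $ 1), cis (x $ 2), cis (x $ 3)) = (cis (z $ 1), cis (z $ 2), cis (z $ 3))" for x z :: "real^3"
      using that u unfolding vec_eq_iff forall_3 mem_box_cart by (auto intro: cis_inj)
    have "\<forall>i. (0::real^3) $ i < u $ i" using u by (simp add: forall_3)
    then show "(0::real^3) $ i < u $ i" for i by blast
    show "(0::real^3) \<in> cbox 0 u" using u by (simp add: mem_box_cart forall_3)
    show "h = 0" if "(h $ 1 *\<^sub>R (\<i> * cis ((0::real^3) $ 1)), h $ 2 *\<^sub>R (\<i> * cis ((0::real^3) $ 2)), h $ 3 *\<^sub>R (\<i> * cis ((0::real^3) $ 3))) = 0" for h :: "real^3"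
      using that by (simp add: vec_eq_iff forall_3 zero_prod_def)
  qed
  then show ?thesis by blast
qed

lemma ex_good_param_SU2: "\<exists>(F :: real^3 \<Rightarrow> complex^2^2) F' l u. good_param F F' l u (carrier SU2)"
proof -
  obtain u :: "real^3" where u: "u $ 1 = pi / 2" "u $ 2 = 2 * pi" "u $ 3 = 2 * pi" using ex_vec3 by blast
  obtain x0 :: "real^3" where x0: "x0 $ 1 = pi / 4" "x0 $ 2 = 0" "x0 $ 3 = 0" using ex_vec3 by blast
  have "good_param (\<lambda>x::real^3. hopf x 1 2 3) (\<lambda>x h. hopf' x h 1 2 3) 0 u (carrier SU2)"
  proof (rule good_paramI)
    show "((\<lambda>x. hopf x 1 2 3) has_derivative (\<lambda>h. hopf' x h 1 2 3)) (at x)" for x :: "real^3" by (rule hopf_derivative)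
    show "continuous_on UNIV (\<lambda>x::real^3. hopf' x h 1 2 3)" for h by (rule hopf'_continuous)
    show "hopf x 1 2 3 \<in> carrier SU2" for x :: "real^3" by (rule hopf_in)
    show "\<exists>x\<in>cbox 0 u. hopf x 1 2 3 = y" if y: "y \<in> carrier SU2" for y
    proof -
      obtain t1 t2 t3 where t: "0 \<le> t1" "t1 \<le> pi / 2" "0 \<le> t2" "t2 \<le> 2 * pi" "0 \<le> t3" "t3 \<le> 2 * pi"
        "y = quat (cos t1 *\<^sub>R cis t2) (sin t1 *\<^sub>R cis t3)" using y by (rule hopf_surj)
      obtain x :: "real^3" where "x $ 1 = t1 \<and> x $ 2 = t2 \<and> x $ 3 = t3" using ex_vec3 by blast
      then show ?thesis using t u by (intro bexI[of _ x]) (simp_all add: mem_box_cart forall_3 hopf_def)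
    qed
    show "x = z" if "x \<in> box 0 u" "z \<in> box 0 u" "hopf x 1 2 3 = hopf z 1 2 3" for x z
    proof -
      have b: "0 < x $ 1" "x $ 1 < pi / 2" "0 < z $ 1" "z $ 1 < pi / 2" "0 < x $ 2" "x $ 2 < 2 * pi" "0 < z $ 2" "z $ 2 < 2 * pi"
        "0 < x $ 3" "x $ 3 < 2 * pi" "0 < z $ 3" "z $ 3 < 2 * pi"
        using that(1,2) unfolding mem_box_cart forall_3 u by simp_all
      show ?thesis unfolding vec_eq_iff forall_3 using hopf_inj[OF that(3) b] by simp
    qed
    have "\<forall>i. (0::real^3) $ i < u $ i" unfolding forall_3 u by simp
    then show "(0::real^3) $ i < u $ i" for i by blast
    show "x0 \<in> cbox 0 u" unfolding mem_box_cart forall_3 u x0 by simp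
    show "h = 0" if "hopf' x0 h 1 2 3 = 0" for h
      using hopf'_inj[OF that x0] by (simp add: vec_eq_iff forall_3)
  qed
  then show ?thesis by blast
qed

lemma ex_good_param_SU2_U1:
  "\<exists>(F :: real^4 \<Rightarrow> (complex^2^2) \<times> complex) F' l u. good_param F F' l u (carrier (SU2 \<times>\<times> U1))"
proof -
  obtain u :: "real^4" where u: "u $ 1 = pi / 2" "u $ 2 = 2 * pi" "u $ 3 = 2 * pi" "u $ 4 = 2 * pi" using ex_vec4 by blast
  obtain x0 :: "real^4" where x0: "x0 $ 1 = pi / 4" "x0 $ 2 = 0" "x0 $ 3 = 0" "x0 $ 4 = 0" using ex_vec4 by blast
  have "good_param (\<lambda>x::real^4. (hopf x 1 2 3, cis (x $ 4))) (\<lambda>x h. (hopf' x h 1 2 3, h $ 4 *\<^sub>R (\<i> * cis (x $ 4)))) 0 u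
     (carrier (SU2 \<times>\<times> U1))"
  proof (rule good_paramI)
    show "((\<lambda>x. (hopf x 1 2 3, cis (x $ 4))) has_derivative (\<lambda>h. (hopf' x h 1 2 3, h $ 4 *\<^sub>R (\<i> * cis (x $ 4))))) (at x)" for x :: "real^4"
      by (intro has_derivative_Pair hopf_derivative cis_nth_derivative)
    show "continuous_on UNIV (\<lambda>x::real^4. (hopf' x h 1 2 3, h $ 4 *\<^sub>R (\<i> * cis (x $ 4))))" for h
      by (intro continuous_on_Pair hopf'_continuous continuous_on_scaleR continuous_on_mult continuous_on_const cis_nth_continuous)
    show "(hopf x 1 2 3, cis (x $ 4)) \<in> carrier (SU2 \<times>\<times> U1)" for x :: "real^4"
      using hopf_in[of x] by (simp add: DirProd_def U1_def)
    show "\<exists>x\<in>cbox 0 u. (hopf x 1 2 3, cis (x $ 4)) = y" if y: "y \<in> carrier (SU2 \<times>\<times> U1)" for y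
    proof -
      obtain A c where y: "y = (A, c)" "A \<in> carrier SU2" "norm c = 1"
        using y by (auto simp: DirProd_def U1_def)
      obtain t1 t2 t3 where t: "0 \<le> t1" "t1 \<le> pi / 2" "0 \<le> t2" "t2 \<le> 2 * pi" "0 \<le> t3" "t3 \<le> 2 * pi"
        "A = quat (cos t1 *\<^sub>R cis t2) (sin t1 *\<^sub>R cis t3)" using y(2) by (rule hopf_surj)
      obtain t4 where 4: "0 \<le> t4" "t4 \<le> 2 * pi" "c = norm c *\<^sub>R cis t4" by (rule cis_surj)
      obtain x :: "real^4" where "x $ 1 = t1 \<and> x $ 2 = t2 \<and> x $ 3 = t3 \<and> x $ 4 = t4" using ex_vec4 by blast
      then show ?thesis using t 4 y u by (intro bexI[of _ x]) (simp_all add: mem_box_cart forall_4 hopf_def)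
    qed
    show "x = z" if "x \<in> box 0 u" "z \<in> box 0 u" "(hopf x 1 2 3, cis (x $ 4)) = (hopf z 1 2 3, cis (z $ 4))" for x z
    proof -
      have h: "hopf x 1 2 3 = hopf z 1 2 3" and c: "cis (x $ 4) = cis (z $ 4)" using that(3) by simp_all
      have b: "0 < x $ 1" "x $ 1 < pi / 2" "0 < z $ 1" "z $ 1 < pi / 2" "0 < x $ 2" "x $ 2 < 2 * pi" "0 < z $ 2" "z $ 2 < 2 * pi"
        "0 < x $ 3" "x $ 3 < 2 * pi" "0 < z $ 3" "z $ 3 < 2 * pi"
        and b': "0 < x $ 4" "x $ 4 < 2 * pi" "0 < z $ 4" "z $ 4 < 2 * pi"
        using that(1,2) unfolding mem_box_cart forall_4 u by simp_all
      show ?thesis unfolding vec_eq_iff forall_4 using hopf_inj[OF h b] cis_inj[OF c b'] by simp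
    qed
    have "\<forall>i. (0::real^4) $ i < u $ i" unfolding forall_4 u by simp
    then show "(0::real^4) $ i < u $ i" for i by blast
    show "x0 \<in> cbox 0 u" unfolding mem_box_cart forall_4 u x0 by simp
    show "h = 0" if "(hopf' x0 h 1 2 3, h $ 4 *\<^sub>R (\<i> * cis (x0 $ 4))) = 0" for h
    proof -
      have h: "hopf' x0 h 1 2 3 = 0" and c: "h $ 4 = 0" using that by (simp_all add: zero_prod_def)
      show ?thesis using hopf'_inj[OF h x0(1-3)] c by (simp add: vec_eq_iff forall_4)
    qed
  qed
  then show ?thesis by blast
qed

lemma good_param_left:
  assumes "good_param F F' l u A"
  shows "good_param (\<lambda>x. (F x, c)) (\<lambda>x h. (F' x h, 0)) l u (A \<times> {c})"
proof -
  have "(\<lambda>x. (F x, c)) ` cbox l u = A \<times> {c}" using assms by (auto simp: good_param_def)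
  then show ?thesis using assms unfolding good_param_def
    by (auto intro!: has_derivative_Pair has_derivative_const continuous_on_Pair continuous_on_const simp: inj_on_def zero_prod_def)
qed

lemma good_param_right:
  assumes "good_param F F' l u A"
  shows "good_param (\<lambda>x. (c, F x)) (\<lambda>x h. (0, F' x h)) l u ({c} \<times> A)"
proof -
  have "(\<lambda>x. (c, F x)) ` cbox l u = {c} \<times> A" using assms by (auto simp: good_param_def)
  then show ?thesis using assms unfolding good_param_def
    by (auto intro!: has_derivative_Pair has_derivative_const continuous_on_Pair continuous_on_const simp: inj_on_def zero_prod_def)
qed

section \<open>The flow\<close>

context lie_frame
begin

text \<open>On the overlap of \<open>N\<close> and \<open>I\<close> this is
  \<open>coflow_unique\<close>. An interval \<open>N\<close> that leaves \<open>I\<close> contains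
  the endpoint \<open>c\<close>; there \<open>psi_norm\<close> would have to be positive, by
  definiteness, and 0, by continuity of \<psi>.\<close>

lemma ansatz_unique:
  assumes str: "structure_constants (str k)"
    and a: "\<And>t. t \<in> I \<Longrightarrow> a t > 0 \<and> (a has_real_derivative (a t + k\<^sup>2)) (at t)" and a0: "a 0 = 1" "0 \<in> I"
    and I: "I = UNIV \<or> (\<exists>c<0. I = {c<..} \<and> isCont a c \<and> a c = 0)"
    and N: "is_interval N" "0 \<in> N" and flow: "left_invariant_laplacian_coflow G (ew_vol e) N \<psi>"
    and init: "form_eq (carrier G) 4 (\<psi> 0) (ansatz e 1)"
  shows "N \<subseteq> I" and "\<And>t. t \<in> N \<Longrightarrow> form_eq (carrier G) 4 (\<psi> t) (ansatz e (a t))"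
proof -
  have flowI: "left_invariant_laplacian_coflow G (ew_vol e) I (\<lambda>t. ansatz e (a t))"
    by (rule ansatz_coflow[OF str]) (rule a)
  have cJ: "convex N" "convex I" using N(1) I by (auto simp: is_interval_convex_1)
  have eq: "form_eq (carrier G) 4 (\<psi> t) (ansatz e (a t))" if t: "t \<in> N" "t \<in> I" for t
  proof -
    have "closed_segment 0 t \<subseteq> N \<inter> I"
      using closed_segment_subset[OF N(2) t(1) cJ(1)] closed_segment_subset[OF a0(2) t(2) cJ(2)] by blast
    moreover have "form_eq (carrier G) 4 (\<psi> 0) (ansatz e (a 0))" using init a0(1) by simp
    ultimately show ?thesis using coflow_unique[OF str flow flowI] by simp
  qed
  show JI: "N \<subseteq> I"
  proof (rule ccontr)
    assume "\<not> N \<subseteq> I"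
    then obtain T' c where T': "T' \<in> N" "T' \<notin> I" and c: "c < 0" "I = {c<..}" "isCont a c" "a c = 0" using I by auto
    have cin: "x \<in> N" if "x \<in> {c..0}" for x
      using T' c that by (intro mem_is_interval_1_I[OF N(1) T'(1) N(2)]) auto
    have cJ: "c \<in> N" using cin c(1) by simp
    have conta: "continuous_on {c..0} a"
    proof (intro continuous_at_imp_continuous_on ballI)
      fix x assume "x \<in> {c..0}"
      then consider "x = c" | "x \<in> I" using c(2) by force
      then show "isCont a x" using c(3) a DERIV_isCont by cases blast+
    qed
    define w where "w js = \<psi> c \<one>\<^bsub>G\<^esub> (map (E \<one>\<^bsub>G\<^esub>) js)" for js
    interpret o: coframed "T \<one>\<^bsub>G\<^esub>" "\<lambda>i. e i \<one>\<^bsub>G\<^esub>" by (rule coframed_at[OF one_closed])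
    have w: "w js = cw [4,5,6,7] js" if js: "js \<in> tuples {1..7} 4" for js
    proof -
      have vs: "map (E \<one>\<^bsub>G\<^esub>) js \<in> tuples (T \<one>\<^bsub>G\<^esub>) 4" using js o.dual_in by (auto simp: tuples_def)
      \<comment> \<open>\<open>h\<close> compares the solution with the ansatz: it vanishes on the
        open interval by uniqueness, hence at \<open>c\<close> by continuity.\<close>
      define h where "h t = \<psi> t \<one>\<^bsub>G\<^esub> (map (E \<one>\<^bsub>G\<^esub>) js) - (cw [4,5,6,7] js + a t * (psi0 js - cw [4,5,6,7] js))" for t
      have "continuous_on {c..0} h"
        unfolding h_def
        by (intro continuous_intros conta continuous_on_subset[OF coflow_continuous[OF flow one_closed vs]] subsetI cin)
      moreover have cl: "closure {c<..<0} = {c..0}" using c(1) by (rule closure_greaterThanLessThan)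
      moreover have "h t = 0" if "t \<in> {c<..<0}" for t
      proof -
        have "form_eq (carrier G) 4 (\<psi> t) (ansatz e (a t))" using that cin[of t] c(2) by (intro eq) auto
        then show ?thesis
          using vs has_compD(2)[OF has_comp_ansatz one_closed js] unfolding form_eq_def h_def by simp
      qed
      ultimately have "h c = 0" using c(1) continuous_constant_on_closure[of "{c<..<0}" h 0 c] by simp
      then show ?thesis by (simp add: h_def w_def c(4))
    qed
    have def: "left_invariant_form G 4 (\<psi> c)" "definite_4form G (ew_vol e) (\<psi> c)"
      using flow cJ by (auto simp: left_invariant_laplacian_coflow_def)
    have hc: "has_comp 4 (\<psi> c) w" unfolding w_def[abs_def] by (rule left_invariant_has_comp[OF def(1)])
    have "psi_norm w > 0" by (rule has_comp_star_gen(1)[OF hc def(2) hc, of 3]) simp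
    moreover have "psi_norm w = psi_norm (cw [4,5,6,7])" by (rule psi_norm_cong[OF w])
    ultimately show False by (simp add: psi_norm_degenerate)
  qed
  show "form_eq (carrier G) 4 (\<psi> t) (ansatz e (a t))" if "t \<in> N" for t using eq that JI by blast
qed

end

lemma mult_eq_sgn:
  fixes c x :: real
  assumes "c > 0" "\<bar>c * x\<bar> = 1"
  shows "c * x = sgn x"
proof -
  have "c * x = \<bar>c * x\<bar> * sgn (c * x)" by (simp only: abs_mult_sgn)
  also have "\<dots> = sgn x" unfolding assms(2) sgn_mult using assms(1) by simp
  finally show ?thesis .
qed

context lie_frame
begin

text \<open>On a list that is orthonormal for the scaled coframe the scaled monomial has absolute
  value 1 (\<open>sub_wedge_orthonormal\<close>); the scaling factor is positive, so only the sign
  of e^L remains.\<close>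

lemma calibrated_value:
  assumes str: "structure_constants (str k)" and s: "s > 0" and p: "p \<in> carrier G"
    and L: "sorted L" "distinct L" "set L \<subseteq> {1..7}"
    and vs: "vs \<in> tuples (coframed.sub (T p) (\<lambda>i. e i p) (set L)) (length L)"
    and on: "orthonormal_list (metric_psi G (ew_vol e) (ansatz e s) p) vs"
  shows "ew e L p vs \<noteq> 0"
    "sqrt s ^ length (filter (\<lambda>i. i \<le> 3) L) * ew e L p vs = sgn (ew e L p vs)"
proof -
  interpret f: lie_frame G J "scaled (sqrt s) e" by (rule lie_frame_scaled) (use s in simp)
  interpret c: coframed "T p" "\<lambda>i. scaled (sqrt s) e i p" by (rule f.coframed_at[OF p])
  interpret c0: coframed "T p" "\<lambda>i. e i p" by (rule coframed_at[OF p])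
  have sub: "c0.sub (set L) = c.sub (set L)" using s by (auto simp: c0.sub_def c.sub_def scaled_def)
  have card: "card (set L) = length L" using L(2) by (rule distinct_card)
  have vsT: "set vs \<subseteq> T p" using vs by (auto simp: tuples_def c0.sub_def)
  have "orthonormal_list (coframe_metric (\<lambda>i. scaled (sqrt s) e i p)) vs"
    unfolding orthonormal_list_def
  proof (intro allI impI)
    fix i j assume ij: "i < length vs" "j < length vs"
    then have "vs ! i \<in> T p" "vs ! j \<in> T p" using vsT nth_mem by blast+
    then have "metric_psi G (ew_vol e) (ansatz e s) p (vs ! i) (vs ! j) = coframe_metric (\<lambda>i. scaled (sqrt s) e i p) (vs ! i) (vs ! j)"
      unfolding metric_psi_def
      by (intro psi_metric_eq[OF subspace_tangent[OF p] alternating_vol[OF p] ansatz_adapted[OF str s p]])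
    then show "coframe_metric (\<lambda>i. scaled (sqrt s) e i p) (vs ! i) (vs ! j) = (if i = j then 1 else 0)"
      using on ij unfolding orthonormal_list_def by simp
  qed
  from c.sub_wedge_orthonormal[OF L(3) vs[unfolded sub, folded card] this]
  have "\<bar>coframe_wedge (\<lambda>i. scaled (sqrt s) e i p) L vs\<bar> = 1"
    using sorted_list_of_set.idem_if_sorted_distinct[OF L(1,2)] by simp
  then have 1: "\<bar>sqrt s ^ length (filter (\<lambda>i. i \<le> 3) L) * ew e L p vs\<bar> = 1"
    using ew_scaled[of "sqrt s" e L p vs] by (simp add: ew_def)
  have "sqrt s ^ length (filter (\<lambda>i. i \<le> 3) L) > 0" using s by simp
  moreover from 1 show "ew e L p vs \<noteq> 0" by auto
  ultimately show "sqrt s ^ length (filter (\<lambda>i. i \<le> 3) L) * ew e L p vs = sgn (ew e L p vs)"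
    using 1 mult_eq_sgn by blast
qed

lemma metric_translate:
  assumes str: "structure_constants (str k)" and s: "s > 0" and q: "q \<in> carrier G" and p: "p \<in> carrier G"
    and v: "v \<in> T p" "w \<in> T p"
  shows "metric_psi G (ew_vol e) (ansatz e s) (q \<otimes>\<^bsub>G\<^esub> p) (q \<otimes>\<^bsub>G\<^esub> v) (q \<otimes>\<^bsub>G\<^esub> w)
    = s * (\<Sum>i\<in>{1..3}. e i p [v] * e i p [w]) + (\<Sum>i\<in>{4..7}. e i p [v] * e i p [w])"
proof -
  have "e i (q \<otimes>\<^bsub>G\<^esub> p) [q \<otimes>\<^bsub>G\<^esub> x] = e i p [x]" if "i \<in> {1..3} \<or> i \<in> {4..7}" "x \<in> T p" for i x
    using that by (intro e_left q p) auto
  then show ?thesis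
    unfolding ansatz_metric[OF str s m_closed[OF q p] tangent_mult[OF q v(1)] tangent_mult[OF q v(2)]]
    using v by simp
qed

end

lemma index_set_1: "set [1,2,3::nat] = {1..3}"
  by ((auto; arith) | (rule set_eqI; simp; arith) | (simp add: numeral_eq_Suc One_nat_def; force))

lemma index_set_2: "set [4,5,6,7::nat] = {4..7}"
  by ((auto; arith) | (rule set_eqI; simp; arith) | (simp add: numeral_eq_Suc One_nat_def; force))

lemma index_set_3: "{1..7} - set [1,2,3::nat] = {4..7}"
  by ((auto; arith) | (rule set_eqI; simp; arith) | (simp add: numeral_eq_Suc One_nat_def; force))

lemma index_set_4: "{1..7} - set [4,5,6,7::nat] = {1..3}"
  by ((auto; arith) | (rule set_eqI; simp; arith) | (simp add: numeral_eq_Suc One_nat_def; force))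

lemma index_set_5: "{1..7} - {1..3::nat} = {4..7}"
  by ((auto; arith) | (rule set_eqI; simp; arith) | (simp add: numeral_eq_Suc One_nat_def; force))

lemma index_set_6: "{1..7} - {4..7::nat} = {1..3}"
  by ((auto; arith) | (rule set_eqI; simp; arith) | (simp add: numeral_eq_Suc One_nat_def; force))

lemmas index_sets = index_set_1 index_set_2 index_set_3 index_set_4 index_set_5 index_set_6

declare carrier_DirProd [simp del]

section \<open>Coframes on the product of two groups\<close>

locale product_frame =
  Y: lin_group Y JY + X: lin_group X JX + lie_frame "Y \<times>\<times> X" "map_prod JY JX" e
  for Y :: "'y::euclidean_space monoid" and JY and X :: "'x::euclidean_space monoid" and JX and e +
  fixes k :: real
  assumes str: "structure_constants (str k)"
begin

lemma carrier_prod: "p \<in> carrier (Y \<times>\<times> X) \<longleftrightarrow> fst p \<in> carrier Y \<and> snd p \<in> carrier X"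
  by (cases p) (simp add: DirProd_def)

lemma T_pair: "T (y, x) = tangent Y y \<times> tangent X x"
  unfolding tangent_space_Times[symmetric] by (simp add: DirProd_def)

lemma zero_in: "y \<in> carrier Y \<Longrightarrow> 0 \<in> tangent Y y" "x \<in> carrier X \<Longrightarrow> 0 \<in> tangent X x"
  using subspace_0[OF Y.subspace_tangent] subspace_0[OF X.subspace_tangent] by blast+

context
  assumes ad: "adapted_to_product Y X e"
begin

lemma tangent_factor:
  assumes "y \<in> carrier Y" "x \<in> carrier X"
  shows "tangent_space (carrier Y \<times> {x}) (y, x) = coframed.sub (T (y, x)) (\<lambda>i. e i (y, x)) (set [1,2,3])"
    and "tangent_space ({y} \<times> carrier X) (y, x) = coframed.sub (T (y, x)) (\<lambda>i. e i (y, x)) (set [4,5,6,7])"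
proof -
  interpret coframed "T (y, x)" "\<lambda>i. e i (y, x)" by (rule coframed_at) (use assms in \<open>simp add: carrier_prod\<close>)
  show "tangent_space (carrier Y \<times> {x}) (y, x) = sub (set [1,2,3])"
    using ad assms unfolding adapted_to_product_def sub_def index_sets by blast
  show "tangent_space ({y} \<times> carrier X) (y, x) = sub (set [4,5,6,7])"
    using ad assms unfolding adapted_to_product_def sub_def index_sets by blast
qed

lemma e_zero:
  assumes p: "y \<in> carrier Y" "x \<in> carrier X"
  shows "v \<in> tangent Y y \<Longrightarrow> i \<in> {4..7} \<Longrightarrow> e i (y, x) [(v, 0)] = 0"
    and "w \<in> tangent X x \<Longrightarrow> i \<in> {1..3} \<Longrightarrow> e i (y, x) [(0, w)] = 0"
proof -
  have "tangent_space (carrier Y \<times> {x}) (y, x) = tangent Y y \<times> {0}" "tangent_space ({y} \<times> carrier X) (y, x) = {0} \<times> tangent X x"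
    by (simp_all add: tangent_space_Times tangent_space_singleton)
  then have "tangent Y y \<times> {0} = {v \<in> T (y, x). \<forall>i\<in>{4..7}. e i (y, x) [v] = 0}"
    "{0} \<times> tangent X x = {v \<in> T (y, x). \<forall>i\<in>{1..3}. e i (y, x) [v] = 0}"
    using ad p unfolding adapted_to_product_def by simp_all
  then show "v \<in> tangent Y y \<Longrightarrow> i \<in> {4..7} \<Longrightarrow> e i (y, x) [(v, 0)] = 0"
    "w \<in> tangent X x \<Longrightarrow> i \<in> {1..3} \<Longrightarrow> e i (y, x) [(0, w)] = 0" by blast+
qed

text \<open>Left translation by an element of one factor does not move the other component, so
  left-invariance removes the dependence on that factor; adaptedness kills the remaining component
  of the vector.\<close>

lemma e_factor:
  assumes p: "y \<in> carrier Y" "x \<in> carrier X" and v: "v \<in> tangent Y y" "w \<in> tangent X x"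
  shows "i \<in> {1..3} \<Longrightarrow> e i (y, x) [(v, w)] = e i (y, \<one>\<^bsub>X\<^esub>) [(v, 0)]"
    and "i \<in> {4..7} \<Longrightarrow> e i (y, x) [(v, w)] = e i (\<one>\<^bsub>Y\<^esub>, x) [(0, w)]"
proof -
  interpret coframed "T (y, x)" "\<lambda>i. e i (y, x)" by (rule coframed_at) (use p in \<open>simp add: carrier_prod\<close>)
  have in_T: "(v, 0) \<in> T (y, x)" "(0, w) \<in> T (y, x)" using v zero_in p by (simp_all add: T_pair)
  have split: "e i (y, x) [(v, w)] = e i (y, x) [(v, 0)] + e i (y, x) [(0, w)]" if "i \<in> {1..7}" for i
    using linear[OF that in_T, of 1 1] by simp
  have v1: "e i (y, x) [(v, 0)] = e i (y, \<one>\<^bsub>X\<^esub>) [(v, 0)]" if i: "i \<in> {1..7}" for i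
    using e_left[OF i, of "(\<one>\<^bsub>Y\<^esub>, x)" "(y, \<one>\<^bsub>X\<^esub>)" "(v, 0)"] p v zero_in
    by (simp add: carrier_prod T_pair Y.one X.one bounded_bilinear.zero_right[OF X.bilinear])
  have w1: "e i (y, x) [(0, w)] = e i (\<one>\<^bsub>Y\<^esub>, x) [(0, w)]" if i: "i \<in> {1..7}" for i
    using e_left[OF i, of "(y, \<one>\<^bsub>X\<^esub>)" "(\<one>\<^bsub>Y\<^esub>, x)" "(0, w)"] p v zero_in
    by (simp add: carrier_prod T_pair Y.one X.one bounded_bilinear.zero_right[OF Y.bilinear])
  show "e i (y, x) [(v, w)] = e i (y, \<one>\<^bsub>X\<^esub>) [(v, 0)]" if "i \<in> {1..3}"
    using split[of i] v1[of i] e_zero(2)[OF p v(2) that] that by simp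
  show "e i (y, x) [(v, w)] = e i (\<one>\<^bsub>Y\<^esub>, x) [(0, w)]" if "i \<in> {4..7}"
    using split[of i] w1[of i] e_zero(1)[OF p v(1) that] that by simp
qed

lemma riemannian_product_ansatz:
  assumes s: "s > 0"
  shows "riemannian_product Y X (metric_psi (Y \<times>\<times> X) (ew_vol e) (ansatz e s))"
  unfolding riemannian_product_def
proof (intro ballI)
  fix y x v v' w w' assume p: "y \<in> carrier Y" "x \<in> carrier X"
    and v: "v \<in> tangent Y y" "v' \<in> tangent Y y" and w: "w \<in> tangent X x" "w' \<in> tangent X x"
  let ?g = "metric_psi (Y \<times>\<times> X) (ew_vol e) (ansatz e s)"
  note one = Y.one_closed X.one_closed
  note z = zero_in(1)[OF p(1)] zero_in(2)[OF p(2)] zero_in(1)[OF one(1)] zero_in(2)[OF one(2)]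
  have 1: "?g (y, x) (v, w) (v', w') = s * (\<Sum>i\<in>{1..3}. e i (y, x) [(v, w)] * e i (y, x) [(v', w')])
      + (\<Sum>i\<in>{4..7}. e i (y, x) [(v, w)] * e i (y, x) [(v', w')])"
    by (rule ansatz_metric[OF str s]) (use p v w in \<open>simp_all add: carrier_prod T_pair\<close>)
  have 2: "?g (y, \<one>\<^bsub>X\<^esub>) (v, 0) (v', 0) = s * (\<Sum>i\<in>{1..3}. e i (y, \<one>\<^bsub>X\<^esub>) [(v, 0)] * e i (y, \<one>\<^bsub>X\<^esub>) [(v', 0)])
      + (\<Sum>i\<in>{4..7}. e i (y, \<one>\<^bsub>X\<^esub>) [(v, 0)] * e i (y, \<one>\<^bsub>X\<^esub>) [(v', 0)])"
    by (rule ansatz_metric[OF str s]) (use p v z one in \<open>simp_all add: carrier_prod T_pair\<close>)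
  have 3: "?g (\<one>\<^bsub>Y\<^esub>, x) (0, w) (0, w') = s * (\<Sum>i\<in>{1..3}. e i (\<one>\<^bsub>Y\<^esub>, x) [(0, w)] * e i (\<one>\<^bsub>Y\<^esub>, x) [(0, w')])
      + (\<Sum>i\<in>{4..7}. e i (\<one>\<^bsub>Y\<^esub>, x) [(0, w)] * e i (\<one>\<^bsub>Y\<^esub>, x) [(0, w')])"
    by (rule ansatz_metric[OF str s]) (use p w z one in \<open>simp_all add: carrier_prod T_pair\<close>)
  show "?g (y, x) (v, w) (v', w') = ?g (y, \<one>\<^bsub>X\<^esub>) (v, 0) (v', 0) + ?g (\<one>\<^bsub>Y\<^esub>, x) (0, w) (0, w')"
    unfolding 1 2 3
    using e_factor(1)[OF p v(1) w(1)] e_factor(1)[OF p v(2) w(2)] e_factor(2)[OF p v(1) w(1)] e_factor(2)[OF p v(2) w(2)]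
      e_zero(1)[OF p(1) one(2) v(1)] e_zero(2)[OF one(1) p(2) w(1)]
    by simp
qed

text \<open>Apart from e^123 every monomial of \<phi> contains a covector among e^4, ..., e^7, which
  vanishes along \<open>Y\<close>; apart from e^4567 every monomial of \<psi> contains one among
  e^1, e^2, e^3, which vanishes along \<open>X\<close>. The remaining monomial is handled by
  \<open>calibrated_value\<close>.\<close>

lemma calibrated_ansatz:
  assumes s: "s > 0"
  shows "x \<in> carrier X \<Longrightarrow> calibrated 3 (carrier Y \<times> {x}) (ew e [1,2,3]) (metric_psi (Y \<times>\<times> X) (ew_vol e) (ansatz e s))
      (star_psi (Y \<times>\<times> X) (ew_vol e) (ansatz e s) 4 (ansatz e s))"
    and "y \<in> carrier Y \<Longrightarrow> calibrated 4 ({y} \<times> carrier X) (ew e [4,5,6,7]) (metric_psi (Y \<times>\<times> X) (ew_vol e) (ansatz e s))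
      (ansatz e s)"
proof -
  let ?\<phi> = "star_psi (Y \<times>\<times> X) (ew_vol e) (ansatz e s) 4 (ansatz e s)"
  let ?g = "metric_psi (Y \<times>\<times> X) (ew_vol e) (ansatz e s)"
  interpret f: lie_frame "Y \<times>\<times> X" "map_prod JY JX" "scaled (sqrt s) e" by (rule lie_frame_scaled) (use s in simp)
  have main: "alternating_on (coframed.sub (T p) (\<lambda>i. e i p) (set [1,2,3])) 3 (?\<phi> p) \<and>
      dim (coframed.sub (T p) (\<lambda>i. e i p) (set [1,2,3])) = 3 \<and>
      (\<forall>vs\<in>tuples (coframed.sub (T p) (\<lambda>i. e i p) (set [1,2,3])) 3. orthonormal_list (?g p) vs \<longrightarrow>
        ew e [1,2,3] p vs \<noteq> 0 \<and> ?\<phi> p vs = sgn (ew e [1,2,3] p vs))"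
    "alternating_on (coframed.sub (T p) (\<lambda>i. e i p) (set [4,5,6,7])) 4 (ansatz e s p) \<and>
      dim (coframed.sub (T p) (\<lambda>i. e i p) (set [4,5,6,7])) = 4 \<and>
      (\<forall>vs\<in>tuples (coframed.sub (T p) (\<lambda>i. e i p) (set [4,5,6,7])) 4. orthonormal_list (?g p) vs \<longrightarrow>
        ew e [4,5,6,7] p vs \<noteq> 0 \<and> ansatz e s p vs = sgn (ew e [4,5,6,7] p vs))"
    if p: "p \<in> carrier (Y \<times>\<times> X)" for p
  proof -
    interpret c: coframed "T p" "\<lambda>i. e i p" by (rule coframed_at[OF p])
    have sT: "c.sub K \<subseteq> T p" for K by (auto simp: c.sub_def)
    have z: "ew e' L p vs = 0"
      if "e' = e \<or> e' = scaled (sqrt s) e" "vs \<in> tuples (c.sub K) n" "i \<in> set L" "i \<in> {1..7} - K" for e' L vs K n i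
      unfolding ew_def by (rule coframe_wedge_zero[OF that(3)]) (use that in \<open>auto simp: tuples_def c.sub_def scaled_def\<close>)
    have d: "dim (c.sub (set [1,2,3])) = 3" "dim (c.sub (set [4,5,6,7])) = 4"
      using c.dim_sub[of "set [1,2,3]"] c.dim_sub[of "set [4,5,6,7]"] by simp_all
    have len: "length [1,2,3::nat] = 3" "length [4,5,6,7::nat] = 4" "length (filter (\<lambda>i. i \<le> 3) [1,2,3::nat]) = 3"
      "length (filter (\<lambda>i. i \<le> 3) [4,5,6,7::nat]) = 0" by simp_all
    have 3: "?\<phi> p vs = sqrt s ^ 3 * ew e [1,2,3] p vs" if vs: "vs \<in> tuples (c.sub (set [1,2,3])) 3" for vs
    proof -
      have "vs \<in> tuples (T p) 3" using vs sT unfolding tuples_def by blast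
      then have "?\<phi> p vs = standard_phi (\<lambda>i. scaled (sqrt s) e i p) vs"
        using ansatz_star_eq[OF str s] p unfolding form_eq_def by blast
      also have "\<dots> = ew (scaled (sqrt s) e) [1,2,3] p vs"
        using z[of "scaled (sqrt s) e", OF _ vs, of 4 "[1,4,5]"] z[of "scaled (sqrt s) e", OF _ vs, of 6 "[1,6,7]"]
          z[of "scaled (sqrt s) e", OF _ vs, of 4 "[2,4,6]"] z[of "scaled (sqrt s) e", OF _ vs, of 5 "[2,5,7]"]
          z[of "scaled (sqrt s) e", OF _ vs, of 4 "[3,4,7]"] z[of "scaled (sqrt s) e", OF _ vs, of 5 "[3,5,6]"]
        unfolding standard_phi_def ew_def index_sets by simp
      also have "\<dots> = sqrt s ^ 3 * ew e [1,2,3] p vs" by (simp only: ew_scaled len)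
      finally show ?thesis .
    qed
    have 4: "ansatz e s p vs = ew e [4,5,6,7] p vs" if vs: "vs \<in> tuples (c.sub (set [4,5,6,7])) 4" for vs
      using z[of e, OF _ vs, of 2 "[2,3,4,5]"] z[of e, OF _ vs, of 2 "[2,3,6,7]"] z[of e, OF _ vs, of 1 "[1,3,4,6]"]
        z[of e, OF _ vs, of 1 "[1,3,5,7]"] z[of e, OF _ vs, of 1 "[1,2,4,7]"] z[of e, OF _ vs, of 1 "[1,2,5,6]"]
      unfolding ansatz_def index_sets by simp
    have v3: "ew e [1,2,3] p vs \<noteq> 0 \<and> ?\<phi> p vs = sgn (ew e [1,2,3] p vs)"
      if vs: "vs \<in> tuples (c.sub (set [1,2,3])) 3" "orthonormal_list (?g p) vs" for vs
    proof
      have vs': "vs \<in> tuples (c.sub (set [1,2,3])) (length [1,2,3::nat])" using vs(1) by (simp only: len)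
      show "ew e [1,2,3] p vs \<noteq> 0" by (rule calibrated_value(1)[OF str s p _ _ _ vs' vs(2)]) simp_all
      have "sqrt s ^ length (filter (\<lambda>i. i \<le> 3) [1,2,3::nat]) * ew e [1,2,3] p vs = sgn (ew e [1,2,3] p vs)"
        by (rule calibrated_value(2)[OF str s p _ _ _ vs' vs(2)]) simp_all
      then show "?\<phi> p vs = sgn (ew e [1,2,3] p vs)" unfolding 3[OF vs(1)] len .
    qed
    have v4: "ew e [4,5,6,7] p vs \<noteq> 0 \<and> ansatz e s p vs = sgn (ew e [4,5,6,7] p vs)"
      if vs: "vs \<in> tuples (c.sub (set [4,5,6,7])) 4" "orthonormal_list (?g p) vs" for vs
    proof
      have vs': "vs \<in> tuples (c.sub (set [4,5,6,7])) (length [4,5,6,7::nat])" using vs(1) by (simp only: len)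
      show "ew e [4,5,6,7] p vs \<noteq> 0" by (rule calibrated_value(1)[OF str s p _ _ _ vs' vs(2)]) simp_all
      have "sqrt s ^ length (filter (\<lambda>i. i \<le> 3) [4,5,6,7::nat]) * ew e [4,5,6,7] p vs = sgn (ew e [4,5,6,7] p vs)"
        by (rule calibrated_value(2)[OF str s p _ _ _ vs' vs(2)]) simp_all
      then show "ansatz e s p vs = sgn (ew e [4,5,6,7] p vs)" unfolding 4[OF vs(1)] len by simp
    qed
    have a3: "alternating_on (c.sub (set [1,2,3])) 3 (?\<phi> p)"
      by (rule alternating_on_mono[OF f.has_compD(1)[OF ansatz_star[OF str s] p] sT])
    have a4: "alternating_on (c.sub (set [4,5,6,7])) 4 (ansatz e s p)"
      by (rule alternating_on_mono[OF has_compD(1)[OF has_comp_ansatz p] sT])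
    show "alternating_on (c.sub (set [1,2,3])) 3 (?\<phi> p) \<and> dim (c.sub (set [1,2,3])) = 3 \<and>
      (\<forall>vs\<in>tuples (c.sub (set [1,2,3])) 3. orthonormal_list (?g p) vs \<longrightarrow>
        ew e [1,2,3] p vs \<noteq> 0 \<and> ?\<phi> p vs = sgn (ew e [1,2,3] p vs))"
      by (intro conjI[OF a3] conjI[OF d(1)] ballI impI v3)
    show "alternating_on (c.sub (set [4,5,6,7])) 4 (ansatz e s p) \<and> dim (c.sub (set [4,5,6,7])) = 4 \<and>
      (\<forall>vs\<in>tuples (c.sub (set [4,5,6,7])) 4. orthonormal_list (?g p) vs \<longrightarrow>
        ew e [4,5,6,7] p vs \<noteq> 0 \<and> ansatz e s p vs = sgn (ew e [4,5,6,7] p vs))"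
      by (intro conjI[OF a4] conjI[OF d(2)] ballI impI v4)
  qed
  show "calibrated 3 (carrier Y \<times> {x}) (ew e [1,2,3]) ?g ?\<phi>" if x: "x \<in> carrier X"
  proof -
    have "alternating_on (tangent_space (carrier Y \<times> {x}) p) 3 (?\<phi> p) \<and> dim (tangent_space (carrier Y \<times> {x}) p) = 3 \<and>
      (\<forall>vs\<in>tuples (tangent_space (carrier Y \<times> {x}) p) 3. orthonormal_list (?g p) vs \<longrightarrow>
        ew e [1,2,3] p vs \<noteq> 0 \<and> ?\<phi> p vs = sgn (ew e [1,2,3] p vs))" if pin: "p \<in> carrier Y \<times> {x}" for p
    proof -
      obtain y where y: "p = (y, x)" "y \<in> carrier Y" using pin by blast
      show ?thesis unfolding y(1) tangent_factor(1)[OF y(2) x]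
        by (rule main(1)) (use y x in \<open>simp add: carrier_prod\<close>)
    qed
    then show ?thesis unfolding calibrated_def is_form_def by blast
  qed
  show "calibrated 4 ({y} \<times> carrier X) (ew e [4,5,6,7]) ?g (ansatz e s)" if y: "y \<in> carrier Y"
  proof -
    have "alternating_on (tangent_space ({y} \<times> carrier X) p) 4 (ansatz e s p) \<and> dim (tangent_space ({y} \<times> carrier X) p) = 4 \<and>
      (\<forall>vs\<in>tuples (tangent_space ({y} \<times> carrier X) p) 4. orthonormal_list (?g p) vs \<longrightarrow>
        ew e [4,5,6,7] p vs \<noteq> 0 \<and> ansatz e s p vs = sgn (ew e [4,5,6,7] p vs))" if pin: "p \<in> {y} \<times> carrier X" for p
    proof -
      obtain x where x: "p = (y, x)" "x \<in> carrier X" using pin by blast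
      show ?thesis unfolding x(1) tangent_factor(2)[OF y x(2)]
        by (rule main(2)) (use y x in \<open>simp add: carrier_prod\<close>)
    qed
    then show ?thesis unfolding calibrated_def is_form_def by blast
  qed
qed

text \<open>The slice over the identity of \<open>X\<close> is parametrised, and the other slices
  are its left translates. Along \<open>Y\<close> the metric is \<open>s\<close> times that of
  \<open>e\<close>, whence the factor s^(3/2) in dimension 3.\<close>

lemma volume_Y:
  fixes F :: "real^3 \<Rightarrow> 'y"
  assumes P: "good_param F F' l u (carrier Y)"
  shows "\<exists>V>0. \<forall>s>0. \<forall>x\<in>carrier X.
    has_riemannian_volume TYPE(3) (carrier Y \<times> {x}) (metric_psi (Y \<times>\<times> X) (ew_vol e) (ansatz e s)) (sqrt (s ^ 3) * V)"
proof -
  note P1 = good_param_left[OF P, of "\<one>\<^bsub>X\<^esub>"]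
  have FY: "F x \<in> carrier Y" "F' x h \<in> tangent Y (F x)" for x h
    using P good_param_tangent[OF P] by (auto simp: good_param_def)
  have S: "carrier Y \<times> {\<one>\<^bsub>X\<^esub>} \<subseteq> carrier (Y \<times>\<times> X)" using X.one_closed by (auto simp: carrier_prod)
  have K: "set [1,2,3] \<subseteq> {1..7::nat}" "card (set [1,2,3::nat]) = CARD(3)" by simp_all
  have van: "e i (F x, \<one>\<^bsub>X\<^esub>) [(F' x h, 0)] = 0" if "i \<in> {4..7}" for x h i
    by (rule e_zero(1)[OF FY(1) X.one_closed FY(2) that])
  obtain V where V0: "V > 0" and V: "\<forall>q\<in>carrier (Y \<times>\<times> X). \<forall>g r. r > 0 \<and>
     (\<forall>x h h'. g (q \<otimes>\<^bsub>Y \<times>\<times> X\<^esub> (F x, \<one>\<^bsub>X\<^esub>)) (q \<otimes>\<^bsub>Y \<times>\<times> X\<^esub> (F' x h, 0)) (q \<otimes>\<^bsub>Y \<times>\<times> X\<^esub> (F' x h', 0))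
        = r * (\<Sum>i\<in>set [1,2,3]. e i (F x, \<one>\<^bsub>X\<^esub>) [(F' x h, 0)] * e i (F x, \<one>\<^bsub>X\<^esub>) [(F' x h', 0)])) \<longrightarrow>
     has_riemannian_volume TYPE(3) ((\<lambda>p. q \<otimes>\<^bsub>Y \<times>\<times> X\<^esub> p) ` (carrier Y \<times> {\<one>\<^bsub>X\<^esub>})) g (sqrt (r ^ CARD(3)) * V)"
    by (rule exE[OF riemannian_volume[OF P1 S K]], rule van[folded index_sets(3)], assumption, elim conjE, rule that)
  have "has_riemannian_volume TYPE(3) (carrier Y \<times> {x}) (metric_psi (Y \<times>\<times> X) (ew_vol e) (ansatz e s)) (sqrt (s ^ 3) * V)"
    if s: "s > 0" and x: "x \<in> carrier X" for s x
  proof -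
    have q: "(\<one>\<^bsub>Y\<^esub>, x) \<in> carrier (Y \<times>\<times> X)" using x Y.one_closed by (simp add: carrier_prod)
    have "(\<lambda>p. (\<one>\<^bsub>Y\<^esub>, x) \<otimes>\<^bsub>Y \<times>\<times> X\<^esub> p) ` (carrier Y \<times> {\<one>\<^bsub>X\<^esub>}) = (\<lambda>p. (fst p, x)) ` (carrier Y \<times> {\<one>\<^bsub>X\<^esub>})"
      by (rule image_cong) (auto simp: Y.one X.one)
    also have "\<dots> = carrier Y \<times> {x}" by force
    finally have im: "(\<lambda>p. (\<one>\<^bsub>Y\<^esub>, x) \<otimes>\<^bsub>Y \<times>\<times> X\<^esub> p) ` (carrier Y \<times> {\<one>\<^bsub>X\<^esub>}) = carrier Y \<times> {x}" .
    have c: "\<forall>z h h'. metric_psi (Y \<times>\<times> X) (ew_vol e) (ansatz e s) ((\<one>\<^bsub>Y\<^esub>, x) \<otimes>\<^bsub>Y \<times>\<times> X\<^esub> (F z, \<one>\<^bsub>X\<^esub>)) ((\<one>\<^bsub>Y\<^esub>, x) \<otimes>\<^bsub>Y \<times>\<times> X\<^esub> (F' z h, 0)) ((\<one>\<^bsub>Y\<^esub>, x) \<otimes>\<^bsub>Y \<times>\<times> X\<^esub> (F' z h', 0))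
        = s * (\<Sum>i\<in>set [1,2,3]. e i (F z, \<one>\<^bsub>X\<^esub>) [(F' z h, 0)] * e i (F z, \<one>\<^bsub>X\<^esub>) [(F' z h', 0)])"
    proof (intro allI)
      fix z h h'
      have "(F z, \<one>\<^bsub>X\<^esub>) \<in> carrier (Y \<times>\<times> X)" "(F' z h, 0) \<in> T (F z, \<one>\<^bsub>X\<^esub>)" "(F' z h', 0) \<in> T (F z, \<one>\<^bsub>X\<^esub>)"
        using FY X.one_closed zero_in(2)[OF X.one_closed] by (simp_all add: carrier_prod T_pair)
      from metric_translate[OF str s q this]
      show "metric_psi (Y \<times>\<times> X) (ew_vol e) (ansatz e s) ((\<one>\<^bsub>Y\<^esub>, x) \<otimes>\<^bsub>Y \<times>\<times> X\<^esub> (F z, \<one>\<^bsub>X\<^esub>)) ((\<one>\<^bsub>Y\<^esub>, x) \<otimes>\<^bsub>Y \<times>\<times> X\<^esub> (F' z h, 0)) ((\<one>\<^bsub>Y\<^esub>, x) \<otimes>\<^bsub>Y \<times>\<times> X\<^esub> (F' z h', 0))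
        = s * (\<Sum>i\<in>set [1,2,3]. e i (F z, \<one>\<^bsub>X\<^esub>) [(F' z h, 0)] * e i (F z, \<one>\<^bsub>X\<^esub>) [(F' z h', 0)])"
        unfolding index_sets using van by simp
    qed
    have "has_riemannian_volume TYPE(3) ((\<lambda>p. (\<one>\<^bsub>Y\<^esub>, x) \<otimes>\<^bsub>Y \<times>\<times> X\<^esub> p) ` (carrier Y \<times> {\<one>\<^bsub>X\<^esub>}))
        (metric_psi (Y \<times>\<times> X) (ew_vol e) (ansatz e s)) (sqrt (s ^ CARD(3)) * V)"
    by (rule mp[OF spec[OF spec[OF bspec[OF V q], where x = "metric_psi (Y \<times>\<times> X) (ew_vol e) (ansatz e s)"], where x = s] conjI[OF s c]])
    then show ?thesis unfolding im by simp
  qed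
  with V0 show ?thesis by blast
qed

text \<open>Along \<open>X\<close> the metric of the ansatz is that of \<open>e\<close> for every
  \<open>s\<close>, so \<open>riemannian_volume\<close> is applied with r = 1 and the volume stays
  constant.\<close>

lemma volume_X:
  fixes F :: "real^4 \<Rightarrow> 'x"
  assumes P: "good_param F F' l u (carrier X)"
  shows "\<exists>V. \<forall>s>0. \<forall>y\<in>carrier Y.
    has_riemannian_volume TYPE(4) ({y} \<times> carrier X) (metric_psi (Y \<times>\<times> X) (ew_vol e) (ansatz e s)) V"
proof -
  note P1 = good_param_right[OF P, of "\<one>\<^bsub>Y\<^esub>"]
  have FX: "F x \<in> carrier X" "F' x h \<in> tangent X (F x)" for x h
    using P good_param_tangent[OF P] by (auto simp: good_param_def)
  have S: "{\<one>\<^bsub>Y\<^esub>} \<times> carrier X \<subseteq> carrier (Y \<times>\<times> X)" using Y.one_closed by (auto simp: carrier_prod)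
  have K: "set [4,5,6,7] \<subseteq> {1..7::nat}" "card (set [4,5,6,7::nat]) = CARD(4)" by simp_all
  have van: "e i (\<one>\<^bsub>Y\<^esub>, F x) [(0, F' x h)] = 0" if "i \<in> {1..3}" for x h i
    by (rule e_zero(2)[OF Y.one_closed FX(1) FX(2) that])
  obtain V where V0: "V > 0" and V: "\<forall>q\<in>carrier (Y \<times>\<times> X). \<forall>g r. r > 0 \<and>
     (\<forall>x h h'. g (q \<otimes>\<^bsub>Y \<times>\<times> X\<^esub> (\<one>\<^bsub>Y\<^esub>, F x)) (q \<otimes>\<^bsub>Y \<times>\<times> X\<^esub> (0, F' x h)) (q \<otimes>\<^bsub>Y \<times>\<times> X\<^esub> (0, F' x h'))
        = r * (\<Sum>i\<in>set [4,5,6,7]. e i (\<one>\<^bsub>Y\<^esub>, F x) [(0, F' x h)] * e i (\<one>\<^bsub>Y\<^esub>, F x) [(0, F' x h')])) \<longrightarrow>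
     has_riemannian_volume TYPE(4) ((\<lambda>p. q \<otimes>\<^bsub>Y \<times>\<times> X\<^esub> p) ` ({\<one>\<^bsub>Y\<^esub>} \<times> carrier X)) g (sqrt (r ^ CARD(4)) * V)"
    by (rule exE[OF riemannian_volume[OF P1 S K]], rule van[folded index_sets(4)], assumption, elim conjE, rule that)
  have "has_riemannian_volume TYPE(4) ({y} \<times> carrier X) (metric_psi (Y \<times>\<times> X) (ew_vol e) (ansatz e s)) V"
    if s: "s > 0" and y: "y \<in> carrier Y" for s y
  proof -
    have q: "(y, \<one>\<^bsub>X\<^esub>) \<in> carrier (Y \<times>\<times> X)" using y X.one_closed by (simp add: carrier_prod)
    have "(\<lambda>p. (y, \<one>\<^bsub>X\<^esub>) \<otimes>\<^bsub>Y \<times>\<times> X\<^esub> p) ` ({\<one>\<^bsub>Y\<^esub>} \<times> carrier X) = (\<lambda>p. (y, snd p)) ` ({\<one>\<^bsub>Y\<^esub>} \<times> carrier X)"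
      by (rule image_cong) (auto simp: Y.one X.one)
    also have "\<dots> = {y} \<times> carrier X" by force
    finally have im: "(\<lambda>p. (y, \<one>\<^bsub>X\<^esub>) \<otimes>\<^bsub>Y \<times>\<times> X\<^esub> p) ` ({\<one>\<^bsub>Y\<^esub>} \<times> carrier X) = {y} \<times> carrier X" .
    have c: "\<forall>x h h'. metric_psi (Y \<times>\<times> X) (ew_vol e) (ansatz e s) ((y, \<one>\<^bsub>X\<^esub>) \<otimes>\<^bsub>Y \<times>\<times> X\<^esub> (\<one>\<^bsub>Y\<^esub>, F x)) ((y, \<one>\<^bsub>X\<^esub>) \<otimes>\<^bsub>Y \<times>\<times> X\<^esub> (0, F' x h)) ((y, \<one>\<^bsub>X\<^esub>) \<otimes>\<^bsub>Y \<times>\<times> X\<^esub> (0, F' x h'))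
        = 1 * (\<Sum>i\<in>set [4,5,6,7]. e i (\<one>\<^bsub>Y\<^esub>, F x) [(0, F' x h)] * e i (\<one>\<^bsub>Y\<^esub>, F x) [(0, F' x h')])"
    proof (intro allI)
      fix z h h'
      have "(\<one>\<^bsub>Y\<^esub>, F z) \<in> carrier (Y \<times>\<times> X)" "(0, F' z h) \<in> T (\<one>\<^bsub>Y\<^esub>, F z)" "(0, F' z h') \<in> T (\<one>\<^bsub>Y\<^esub>, F z)"
        using FX Y.one_closed zero_in(1)[OF Y.one_closed] by (simp_all add: carrier_prod T_pair)
      from metric_translate[OF str s q this]
      show "metric_psi (Y \<times>\<times> X) (ew_vol e) (ansatz e s) ((y, \<one>\<^bsub>X\<^esub>) \<otimes>\<^bsub>Y \<times>\<times> X\<^esub> (\<one>\<^bsub>Y\<^esub>, F z)) ((y, \<one>\<^bsub>X\<^esub>) \<otimes>\<^bsub>Y \<times>\<times> X\<^esub> (0, F' z h)) ((y, \<one>\<^bsub>X\<^esub>) \<otimes>\<^bsub>Y \<times>\<times> X\<^esub> (0, F' z h'))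
        = 1 * (\<Sum>i\<in>set [4,5,6,7]. e i (\<one>\<^bsub>Y\<^esub>, F z) [(0, F' z h)] * e i (\<one>\<^bsub>Y\<^esub>, F z) [(0, F' z h')])"
        unfolding index_sets using van by simp
    qed
    have "has_riemannian_volume TYPE(4) ((\<lambda>p. (y, \<one>\<^bsub>X\<^esub>) \<otimes>\<^bsub>Y \<times>\<times> X\<^esub> p) ` ({\<one>\<^bsub>Y\<^esub>} \<times> carrier X))
        (metric_psi (Y \<times>\<times> X) (ew_vol e) (ansatz e s)) (sqrt (1 ^ CARD(4)) * V)"
    by (rule mp[OF spec[OF spec[OF bspec[OF V q], where x = "metric_psi (Y \<times>\<times> X) (ew_vol e) (ansatz e s)"], where x = 1] conjI[OF zero_less_one c]])
    then show ?thesis unfolding im by simp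
  qed
  then show ?thesis by blast
qed

end

text \<open>Both groups are treated together: they differ in the constant \<open>k\<close>, the
  solution \<open>a\<close> of a' = a + k^2, its interval and the parametrisations. The condition on
  \<open>I\<close> says that the ansatz lives for all times or begins where \<open>a\<close> is
  0.\<close>

theorem coflow:
  assumes a: "\<And>t. t \<in> I \<Longrightarrow> a t > 0 \<and> (a has_real_derivative (a t + k\<^sup>2)) (at t)" and a0: "a 0 = 1" "0 \<in> I"
    and I: "I = UNIV \<or> (\<exists>c<0. I = {c<..} \<and> isCont a c \<and> a c = 0)"
    and mono: "strict_mono_on I a"
    and PY: "\<exists>(F :: real^3 \<Rightarrow> 'y) F' l u. good_param F F' l u (carrier Y)"
    and PX: "\<exists>(F :: real^4 \<Rightarrow> 'x) F' l u. good_param F F' l u (carrier X)"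
  shows "left_invariant_laplacian_coflow (Y \<times>\<times> X) (ew_vol e) I (\<lambda>t. ansatz e (a t)) \<and>
    form_eq (carrier (Y \<times>\<times> X)) 4 (ansatz e (a 0)) (ansatz e 1) \<and>
    (\<forall>J \<psi>'. is_interval J \<and> 0 \<in> J \<and> left_invariant_laplacian_coflow (Y \<times>\<times> X) (ew_vol e) J \<psi>' \<and>
        form_eq (carrier (Y \<times>\<times> X)) 4 (\<psi>' 0) (ansatz e 1) \<longrightarrow>
        J \<subseteq> I \<and> (\<forall>t\<in>J. form_eq (carrier (Y \<times>\<times> X)) 4 (\<psi>' t) (ansatz e (a t)))) \<and>
    {0<..} \<subseteq> I \<and>
    (\<forall>t\<in>I. strong_G2T (Y \<times>\<times> X) (star_psi (Y \<times>\<times> X) (ew_vol e) (ansatz e (a t)) 4 (ansatz e (a t)))) \<and>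
    (adapted_to_product Y X e \<longrightarrow>
      (\<forall>t\<in>I. riemannian_product Y X (metric_psi (Y \<times>\<times> X) (ew_vol e) (ansatz e (a t))) \<and>
         (\<forall>x\<in>carrier X. calibrated 3 (carrier Y \<times> {x}) (ew e [1,2,3]) (metric_psi (Y \<times>\<times> X) (ew_vol e) (ansatz e (a t)))
            (star_psi (Y \<times>\<times> X) (ew_vol e) (ansatz e (a t)) 4 (ansatz e (a t)))) \<and>
         (\<forall>y\<in>carrier Y. calibrated 4 ({y} \<times> carrier X) (ew e [4,5,6,7]) (metric_psi (Y \<times>\<times> X) (ew_vol e) (ansatz e (a t)))
            (ansatz e (a t)))) \<and>
      (\<exists>volY. strict_mono_on I volY \<and>
         (\<forall>t\<in>I. \<forall>x\<in>carrier X.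
            has_riemannian_volume TYPE(3) (carrier Y \<times> {x}) (metric_psi (Y \<times>\<times> X) (ew_vol e) (ansatz e (a t))) (volY t))) \<and>
      (\<exists>volX. \<forall>t\<in>I. \<forall>y\<in>carrier Y.
            has_riemannian_volume TYPE(4) ({y} \<times> carrier X) (metric_psi (Y \<times>\<times> X) (ew_vol e) (ansatz e (a t))) volX))"
proof -
  have pos: "a t > 0" if "t \<in> I" for t using a that by blast
  have 1: "left_invariant_laplacian_coflow (Y \<times>\<times> X) (ew_vol e) I (\<lambda>t. ansatz e (a t))" by (rule ansatz_coflow[OF str]) (rule a)
  have 2: "form_eq (carrier (Y \<times>\<times> X)) 4 (ansatz e (a 0)) (ansatz e 1)" by (simp add: a0 form_eq_def)
  have 3: "J \<subseteq> I \<and> (\<forall>t\<in>J. form_eq (carrier (Y \<times>\<times> X)) 4 (\<psi>' t) (ansatz e (a t)))"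
    if "is_interval J \<and> 0 \<in> J \<and> left_invariant_laplacian_coflow (Y \<times>\<times> X) (ew_vol e) J \<psi>' \<and>
        form_eq (carrier (Y \<times>\<times> X)) 4 (\<psi>' 0) (ansatz e 1)" for J \<psi>'
  proof -
    from that have h: "is_interval J" "0 \<in> J" "left_invariant_laplacian_coflow (Y \<times>\<times> X) (ew_vol e) J \<psi>'"
      "form_eq (carrier (Y \<times>\<times> X)) 4 (\<psi>' 0) (ansatz e 1)" by simp_all
    show ?thesis
    proof (intro conjI ballI)
      show "J \<subseteq> I" by (rule ansatz_unique(1)[OF str _ a0 I h]) (rule a)
      show "form_eq (carrier (Y \<times>\<times> X)) 4 (\<psi>' t) (ansatz e (a t))" if t: "t \<in> J" for t
        by (rule ansatz_unique(2)[OF str _ a0 I h t]) (rule a)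
    qed
  qed
  have 4: "{0<..} \<subseteq> I" using I by auto
  have 5: "strong_G2T (Y \<times>\<times> X) (star_psi (Y \<times>\<times> X) (ew_vol e) (ansatz e (a t)) 4 (ansatz e (a t)))" if "t \<in> I" for t
    by (rule ansatz_strong[OF str pos[OF that]])
  have 7: "\<exists>volY. strict_mono_on I volY \<and>
         (\<forall>t\<in>I. \<forall>x\<in>carrier X.
            has_riemannian_volume TYPE(3) (carrier Y \<times> {x}) (metric_psi (Y \<times>\<times> X) (ew_vol e) (ansatz e (a t))) (volY t))"
    if ad: "adapted_to_product Y X e"
  proof -
    obtain F :: "real^3 \<Rightarrow> 'y" and F' l u where P: "good_param F F' l u (carrier Y)" using PY by blast
    obtain V where V: "V > 0" "\<And>s x. s > 0 \<Longrightarrow> x \<in> carrier X \<Longrightarrow>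
        has_riemannian_volume TYPE(3) (carrier Y \<times> {x}) (metric_psi (Y \<times>\<times> X) (ew_vol e) (ansatz e s)) (sqrt (s ^ 3) * V)"
      using volume_Y[OF ad P] by blast
    have "strict_mono_on I (\<lambda>t. sqrt (a t ^ 3) * V)"
    proof (rule strict_mono_onI)
      fix r s assume rs: "r \<in> I" "s \<in> I" "r < s"
      have "a r < a s" by (rule strict_mono_onD[OF mono rs])
      then have "a r ^ 3 < a s ^ 3" using pos[OF rs(1)] by (intro power_strict_mono) simp_all
      then show "sqrt (a r ^ 3) * V < sqrt (a s ^ 3) * V" using V(1) by simp
    qed
    moreover have "\<forall>t\<in>I. \<forall>x\<in>carrier X.
        has_riemannian_volume TYPE(3) (carrier Y \<times> {x}) (metric_psi (Y \<times>\<times> X) (ew_vol e) (ansatz e (a t))) (sqrt (a t ^ 3) * V)"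
      by (intro ballI V(2) pos)
    ultimately show ?thesis by (intro exI[of _ "\<lambda>t. sqrt (a t ^ 3) * V"] conjI)
  qed
  have 8: "\<exists>volX. \<forall>t\<in>I. \<forall>y\<in>carrier Y.
            has_riemannian_volume TYPE(4) ({y} \<times> carrier X) (metric_psi (Y \<times>\<times> X) (ew_vol e) (ansatz e (a t))) volX"
    if ad: "adapted_to_product Y X e"
  proof -
    obtain F :: "real^4 \<Rightarrow> 'x" and F' l u where P: "good_param F F' l u (carrier X)" using PX by blast
    show ?thesis using volume_X[OF ad P] pos by blast
  qed
  have 3: "(\<forall>J \<psi>'. is_interval J \<and> 0 \<in> J \<and> left_invariant_laplacian_coflow (Y \<times>\<times> X) (ew_vol e) J \<psi>' \<and>
        form_eq (carrier (Y \<times>\<times> X)) 4 (\<psi>' 0) (ansatz e 1) \<longrightarrow>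
        J \<subseteq> I \<and> (\<forall>t\<in>J. form_eq (carrier (Y \<times>\<times> X)) 4 (\<psi>' t) (ansatz e (a t))))"
    by (intro allI impI 3)
  show ?thesis
  proof (rule conjI[OF 1 conjI[OF 2 conjI[OF 3 conjI[OF 4 conjI]]]])
    show "\<forall>t\<in>I. strong_G2T (Y \<times>\<times> X) (star_psi (Y \<times>\<times> X) (ew_vol e) (ansatz e (a t)) 4 (ansatz e (a t)))"
      by (intro ballI 5)
  qed (intro impI conjI ballI 7 8 riemannian_product_ansatz calibrated_ansatz pos; assumption)
qed

end

section \<open>The two groups of the theorem\<close>

lemma ansatz_fold:
  "(\<lambda>p vs. ew e [4,5,6,7] p vs
      + s * (ew e [2,3,4,5] p vs + ew e [2,3,6,7] p vs - ew e [1,3,4,6] p vs + ew e [1,3,5,7] p vs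
             - ew e [1,2,4,7] p vs - ew e [1,2,5,6] p vs)) = ansatz e s"
  "(\<lambda>p vs. ew e [4,5,6,7] p vs + ew e [2,3,4,5] p vs + ew e [2,3,6,7] p vs - ew e [1,3,4,6] p vs + ew e [1,3,5,7] p vs
      - ew e [1,2,4,7] p vs - ew e [1,2,5,6] p vs) = ansatz e 1"
  by (intro ext; simp add: ansatz_def)+

lemmas lin_group_X = lin_group_DirProd[OF lin_group_SU2 lin_group_U1]
lemmas lin_group_torus = lin_group_DirProd[OF lin_group_U1 lin_group_DirProd[OF lin_group_U1 lin_group_U1]]

theorem mainTheorem12:
  shows
   "(\<forall>e :: nat \<Rightarrow> ((complex \<times> complex \<times> complex) \<times> ((complex^2^2) \<times> complex)) form.
      let Y = U1 \<times>\<times> (U1 \<times>\<times> U1);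
          X = SU2 \<times>\<times> U1;
          G = Y \<times>\<times> X;
          d = ext_deriv G;
          vol = ew e [1,2,3,4,5,6,7];
          a = (\<lambda>t::real. exp t);
          I = UNIV;
          \<psi>\<^sub>0 = (\<lambda>p vs. ew e [4,5,6,7] p vs + ew e [2,3,4,5] p vs + ew e [2,3,6,7] p vs
                  - ew e [1,3,4,6] p vs + ew e [1,3,5,7] p vs
                  - ew e [1,2,4,7] p vs - ew e [1,2,5,6] p vs);
          \<psi> = (\<lambda>t p vs. ew e [4,5,6,7] p vs
                  + a t * (ew e [2,3,4,5] p vs + ew e [2,3,6,7] p vs
                           - ew e [1,3,4,6] p vs + ew e [1,3,5,7] p vs
                           - ew e [1,2,4,7] p vs - ew e [1,2,5,6] p vs));
          \<phi> = (\<lambda>t. star_psi G vol (\<psi> t) 4 (\<psi> t));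
          g = (\<lambda>t. metric_psi G vol (\<psi> t))
      in
        left_invariant_coframe G e \<and>
        (\<forall>i\<in>{1,2,3}. form_eq (carrier G) 2 (d 1 (e i)) (\<lambda>p vs. 0)) \<and>
        form_eq (carrier G) 2 (d 1 (e 4)) (ew e [5,6]) \<and>
        form_eq (carrier G) 2 (d 1 (e 5)) (\<lambda>p vs. - ew e [4,6] p vs) \<and>
        form_eq (carrier G) 2 (d 1 (e 6)) (ew e [4,5]) \<and>
        form_eq (carrier G) 2 (d 1 (e 7)) (\<lambda>p vs. 0)
        \<longrightarrow>
        left_invariant_laplacian_coflow G vol I \<psi> \<and>
        form_eq (carrier G) 4 (\<psi> 0) \<psi>\<^sub>0 \<and>
        (\<forall>J \<psi>'. is_interval J \<and> 0 \<in> J \<and>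
            left_invariant_laplacian_coflow G vol J \<psi>' \<and>
            form_eq (carrier G) 4 (\<psi>' 0) \<psi>\<^sub>0 \<longrightarrow>
            J \<subseteq> I \<and> (\<forall>t\<in>J. form_eq (carrier G) 4 (\<psi>' t) (\<psi> t))) \<and>
        {0<..} \<subseteq> I \<and>
        (\<forall>t\<in>I. strong_G2T G (\<phi> t)) \<and>
        (adapted_to_product Y X e \<longrightarrow>
          (\<forall>t\<in>I. riemannian_product Y X (g t) \<and>
             (\<forall>x\<in>carrier X. calibrated 3 (carrier Y \<times> {x}) (ew e [1,2,3]) (g t) (\<phi> t)) \<and>
             (\<forall>y\<in>carrier Y. calibrated 4 ({y} \<times> carrier X) (ew e [4,5,6,7]) (g t) (\<psi> t))) \<and>
          (\<exists>volY. strict_mono_on I volY \<and>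
             (\<forall>t\<in>I. \<forall>x\<in>carrier X.
                has_riemannian_volume TYPE(3) (carrier Y \<times> {x}) (g t) (volY t))) \<and>
          (\<exists>volX. \<forall>t\<in>I. \<forall>y\<in>carrier Y.
                has_riemannian_volume TYPE(4) ({y} \<times> carrier X) (g t) volX)))
    \<and>
    (\<forall>e :: nat \<Rightarrow> ((complex^2^2) \<times> ((complex^2^2) \<times> complex)) form.
      let Y = SU2;
          X = SU2 \<times>\<times> U1;
          G = Y \<times>\<times> X;
          d = ext_deriv G;
          vol = ew e [1,2,3,4,5,6,7];
          a = (\<lambda>t::real. 2 * exp t - 1);
          I = {- ln 2<..};
          \<psi>\<^sub>0 = (\<lambda>p vs. ew e [4,5,6,7] p vs + ew e [2,3,4,5] p vs + ew e [2,3,6,7] p vs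
                  - ew e [1,3,4,6] p vs + ew e [1,3,5,7] p vs
                  - ew e [1,2,4,7] p vs - ew e [1,2,5,6] p vs);
          \<psi> = (\<lambda>t p vs. ew e [4,5,6,7] p vs
                  + a t * (ew e [2,3,4,5] p vs + ew e [2,3,6,7] p vs
                           - ew e [1,3,4,6] p vs + ew e [1,3,5,7] p vs
                           - ew e [1,2,4,7] p vs - ew e [1,2,5,6] p vs));
          \<phi> = (\<lambda>t. star_psi G vol (\<psi> t) 4 (\<psi> t));
          g = (\<lambda>t. metric_psi G vol (\<psi> t))
      in
        left_invariant_coframe G e \<and>
        form_eq (carrier G) 2 (d 1 (e 1)) (ew e [2,3]) \<and>
        form_eq (carrier G) 2 (d 1 (e 2)) (\<lambda>p vs. - ew e [1,3] p vs) \<and>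
        form_eq (carrier G) 2 (d 1 (e 3)) (ew e [1,2]) \<and>
        form_eq (carrier G) 2 (d 1 (e 4)) (ew e [5,6]) \<and>
        form_eq (carrier G) 2 (d 1 (e 5)) (\<lambda>p vs. - ew e [4,6] p vs) \<and>
        form_eq (carrier G) 2 (d 1 (e 6)) (ew e [4,5]) \<and>
        form_eq (carrier G) 2 (d 1 (e 7)) (\<lambda>p vs. 0)
        \<longrightarrow>
        left_invariant_laplacian_coflow G vol I \<psi> \<and>
        form_eq (carrier G) 4 (\<psi> 0) \<psi>\<^sub>0 \<and>
        (\<forall>J \<psi>'. is_interval J \<and> 0 \<in> J \<and>
            left_invariant_laplacian_coflow G vol J \<psi>' \<and>
            form_eq (carrier G) 4 (\<psi>' 0) \<psi>\<^sub>0 \<longrightarrow>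
            J \<subseteq> I \<and> (\<forall>t\<in>J. form_eq (carrier G) 4 (\<psi>' t) (\<psi> t))) \<and>
        {0<..} \<subseteq> I \<and>
        (\<forall>t\<in>I. strong_G2T G (\<phi> t)) \<and>
        (adapted_to_product Y X e \<longrightarrow>
          (\<forall>t\<in>I. riemannian_product Y X (g t) \<and>
             (\<forall>x\<in>carrier X. calibrated 3 (carrier Y \<times> {x}) (ew e [1,2,3]) (g t) (\<phi> t)) \<and>
             (\<forall>y\<in>carrier Y. calibrated 4 ({y} \<times> carrier X) (ew e [4,5,6,7]) (g t) (\<psi> t))) \<and>
          (\<exists>volY. strict_mono_on I volY \<and>
             (\<forall>t\<in>I. \<forall>x\<in>carrier X.
                has_riemannian_volume TYPE(3) (carrier Y \<times> {x}) (g t) (volY t))) \<and>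
          (\<exists>volX. \<forall>t\<in>I. \<forall>y\<in>carrier Y.
                has_riemannian_volume TYPE(4) ({y} \<times> carrier X) (g t) volX)))"
  unfolding Let_def ansatz_fold
proof ((rule conjI; rule allI; rule impI; elim conjE), goal_cases)
  case (1 e)
  note h = 1
  have li: "left_invariant_coframe ((U1 \<times>\<times> (U1 \<times>\<times> U1)) \<times>\<times> (SU2 \<times>\<times> U1)) e" by (rule h)
  have lf: "lie_frame ((U1 \<times>\<times> (U1 \<times>\<times> U1)) \<times>\<times> (SU2 \<times>\<times> U1)) (map_prod (map_prod cnj (map_prod cnj cnj)) (map_prod adj cnj)) e"
    by (intro lie_frame.intro lie_frame_axioms.intro lin_group_DirProd lin_group_U1 lin_group_SU2 li)
  \<comment> \<open>The torus is the case k = 0, in which the structure equations of the first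
    factor have right-hand side 0.\<close>
  have pf: "product_frame (U1 \<times>\<times> (U1 \<times>\<times> U1)) (map_prod cnj (map_prod cnj cnj)) (SU2 \<times>\<times> U1) (map_prod adj cnj) e 0"
    by (intro product_frame.intro product_frame_axioms.intro lin_group_torus lin_group_X lf lie_frame.structure_constants_str[OF lf];
        (simp only: minus_zero mult_zero_left)?; (rule h | (rule bspec[OF h(2)], simp)))
  have a: "exp t > 0 \<and> (exp has_real_derivative (exp t + 0\<^sup>2)) (at t)" for t :: real
    by (auto intro!: derivative_eq_intros)
  have I: "UNIV = (UNIV :: real set) \<or> (\<exists>c<0. UNIV = {c<..} \<and> isCont exp c \<and> exp c = (0 :: real))" by simp
  have mono: "strict_mono_on UNIV (exp :: real \<Rightarrow> real)" by (rule strict_mono_onI) simp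
  have a0: "exp 0 = (1 :: real)" "0 \<in> (UNIV :: real set)" by simp_all
  show ?case by (rule product_frame.coflow[OF pf a a0 I mono ex_good_param_torus ex_good_param_SU2_U1])
next
  case (2 e)
  note h = 2
  have li: "left_invariant_coframe (SU2 \<times>\<times> (SU2 \<times>\<times> U1)) e" by (rule h)
  have lf: "lie_frame (SU2 \<times>\<times> (SU2 \<times>\<times> U1)) (map_prod adj (map_prod adj cnj)) e"
    by (intro lie_frame.intro lie_frame_axioms.intro lin_group_DirProd lin_group_U1 lin_group_SU2 li)
  have pf: "product_frame SU2 adj (SU2 \<times>\<times> U1) (map_prod adj cnj) e 1"
    by (intro product_frame.intro product_frame_axioms.intro lin_group_SU2 lin_group_X lf lie_frame.structure_constants_str[OF lf];
        (simp only: mult_1_left mult_minus1)?; rule h)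
  let ?a = "\<lambda>t::real. 2 * exp t - 1"
  \<comment> \<open>The time -ln 2 is the zero of 2 exp t - 1, so it is the endpoint where the
    solution of a' = a + 1 with a(0) = 1 degenerates.\<close>
  have ln2: "exp (- ln 2) = (1 / 2 :: real)" by (simp add: exp_minus)
  have a: "?a t > 0 \<and> (?a has_real_derivative (?a t + 1\<^sup>2)) (at t)" if "t \<in> {- ln 2<..}" for t
  proof
    have "exp (- ln 2) < exp t" using that by simp
    then show "?a t > 0" unfolding ln2 by simp
    show "(?a has_real_derivative (?a t + 1\<^sup>2)) (at t)" by (auto intro!: derivative_eq_intros)
  qed
  have I: "{- ln 2<..} = UNIV \<or> (\<exists>c<0. {- ln 2<..} = {c<..} \<and> isCont ?a c \<and> ?a c = 0)"
  proof (intro disjI2 exI[of _ "- ln 2"] conjI)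
    show "?a (- ln 2) = 0" unfolding ln2 by simp
    show "isCont ?a (- ln 2)" by (intro continuous_intros)
  qed simp_all
  have mono: "strict_mono_on {- ln 2<..} ?a" by (rule strict_mono_onI) simp
  have a0: "?a 0 = 1" "0 \<in> {- ln (2::real)<..}" by simp_all
  show ?case by (rule product_frame.coflow[OF pf a a0 I mono ex_good_param_SU2 ex_good_param_SU2_U1])
qed

end
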